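(* Let $W$ be the number of triangles in the Erdős–Rényi random graph $G(n,p)$, where $p=p_n$, and suppose $n^\alpha p\to c>0$ as $n\to\infty$ with $1/2\le\alpha<1$. Let $M_2\sim NB(r,\bar p)*\mathcal P(\lambda)$ with $$r=\frac{4\Gamma_2(W)^3}{\Gamma_3(W)^2},\qquad \bar p=\frac{2\Gamma_2(W)}{2\Gamma_2(W)+\Gamma_3(W)},\qquad \lambda={\rm E}W-\frac{r(1-\bar p)}{\bar p},$$ and $Y^d=Y^d({\rm E}W,\operatorname{Var}W)$. Then there is a constant $C$, not depending on $n$, such that $$d_{\mathrm{TV}}(W,M_2)\le Cn^{-1-\alpha},\qquad d_{\mathrm{TV}}(W,Y^d)\le Cn^{-3/2+3\alpha/2},$$ $$d_{\rm loc}(W,M_2)\le Cn^{-2+\alpha},\qquad d_{\rm loc}(W,Y^d)\le Cn^{-3+3\alpha}.$$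
   Context: $G(n,p)$ is the random graph on $n$ vertices in which each edge appears with probability $p$, independently of all other edges. Factorial cumulants: with $m_j={\rm E}W^j$, $\Gamma_1(W)=m_1$, $\Gamma_2(W)=m_2-m_1^2-m_1$, $\Gamma_3(W)=m_3-3m_1m_2-3m_2+2m_1^3+3m_1^2+2m_1$. $*$ denotes convolution, $\mathcal P(\lambda)$ the Poisson law, $NB(r,\bar p)$ the negative binomial law with probability generating function $(\bar p/(1-(1-\bar p)z))^r$; thus $M_2$ has probability generating function $(\bar p/(1-(1-\bar p)z))^r\exp\{\lambda(z-1)\}$. $Y^d(\mu,\sigma^2)$ is the discretized normal random variable: ${\rm P}(Y^d=k)=\int_{k-0.5}^{k+0.5}\frac1{\sqrt{2\pi\sigma^2}}\exp\big[-\frac{(x-\mu)^2}{2\sigma^2}\big]dx$, $k\in\mathbb Z$. $d_{\mathrm{TV}}(U,V)=\sup_{A\subseteq\mathbb Z}|{\rm P}(U\in A)-{\rm P}(V\in A)|$ and $d_{\rm loc}(U,V)=\sup_{a\in\mathbb Z}|{\rm P}(U=a)-{\rm P}(V=a)|$. *)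

theory Defs
  imports "HOL-Probability.Probability"
begin

text \<open>A graph on the vertex set \<open>{..<n}\<close> is identified with its edge set, a subset of
  \<open>pairs {..<n}\<close>.\<close>

definition pairs :: "nat set \<Rightarrow> nat set set" where
  "pairs V = {e. e \<subseteq> V \<and> card e = 2}"

definition gnp_pmf :: "nat \<Rightarrow> real \<Rightarrow> nat set set pmf" where
  "gnp_pmf n p =
     map_pmf (\<lambda>f. {e \<in> pairs {..<n}. f e})
       (Pi_pmf (pairs {..<n}) False (\<lambda>_. bernoulli_pmf p))"

definition triangles :: "nat \<Rightarrow> nat set set \<Rightarrow> nat set set" where
  "triangles n E = {T. T \<subseteq> {..<n} \<and> card T = 3 \<and> pairs T \<subseteq> E}"

definition triangle_count_pmf :: "nat \<Rightarrow> real \<Rightarrow> nat pmf" where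
  "triangle_count_pmf n p = map_pmf (\<lambda>E. card (triangles n E)) (gnp_pmf n p)"

definition moment :: "nat pmf \<Rightarrow> nat \<Rightarrow> real" where
  "moment W j = measure_pmf.expectation W (\<lambda>k. real k ^ j)"

definition mean :: "nat pmf \<Rightarrow> real" where
  "mean W = measure_pmf.expectation W real"

definition var :: "nat pmf \<Rightarrow> real" where
  "var W = measure_pmf.variance W real"

definition Gamma2 :: "nat pmf \<Rightarrow> real" where
  "Gamma2 W = moment W 2 - (moment W 1)\<^sup>2 - moment W 1"

definition Gamma3 :: "nat pmf \<Rightarrow> real" where
  "Gamma3 W = moment W 3 - 3 * moment W 1 * moment W 2 - 3 * moment W 2
     + 2 * moment W 1 ^ 3 + 3 * (moment W 1)\<^sup>2 + 2 * moment W 1"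

text \<open>The library's \<^const>\<open>neg_binomial_pmf\<close> has a shape parameter of type \<^typ>\<open>nat\<close>.
  The definition below is meaningful for \<open>0 < r\<close> and \<open>0 < q < 1\<close>; its probability generating
  function is computed in \<open>negbin_pgf\<close>.\<close>

definition negbin_pmf :: "real \<Rightarrow> real \<Rightarrow> nat pmf" where
  "negbin_pmf r q =
     embed_pmf (\<lambda>k. ((r + real k - 1) gchoose k) * q powr r * (1 - q) ^ k)"

lemma negbin_series:
  fixes r q z :: real
  assumes "0 < r" "0 < q" "q < 1" "0 \<le> z" "z \<le> 1"
  shows "(\<lambda>k. ((r + real k - 1) gchoose k) * q powr r * (1 - q) ^ k * z ^ k) sums
           ((q / (1 - (1 - q) * z)) powr r)"
proof -
  let ?x = "- ((1 - q) * z)"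
  have le: "(1 - q) * z \<le> 1 - q"
    using assms by (simp add: mult_left_le)
  have nn: "0 \<le> (1 - q) * z" using assms by simp
  have lt: "\<bar>?x\<bar> < 1" and pos: "1 - (1 - q) * z > 0" using le nn assms by linarith+
  have "(\<lambda>k. ((- r) gchoose k) * ?x ^ k) sums (1 + ?x) powr (- r)"
    by (rule gen_binomial_real) (use lt in simp)
  moreover have "((- r) gchoose k) * ?x ^ k = ((r + real k - 1) gchoose k) * (1 - q) ^ k * z ^ k" for k
  proof -
    have x: "?x ^ k = (-1) ^ k * ((1 - q) ^ k * z ^ k)"
      unfolding power_minus [of "(1 - q) * z"] power_mult_distrib ..
    have m: "(-1 :: real) ^ k * (-1) ^ k = 1"
      unfolding power_mult_distrib [symmetric] by simp
    have "((- r) gchoose k) * ?x ^ k =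
        ((-1) ^ k * (-1) ^ k) * (((r + real k - 1) gchoose k) * (1 - q) ^ k * z ^ k)"
      unfolding gbinomial_minus x by (simp only: mult_ac)
    then show ?thesis by (simp only: m mult_1_left)
  qed
  ultimately have "(\<lambda>k. ((r + real k - 1) gchoose k) * (1 - q) ^ k * z ^ k) sums (1 + ?x) powr (- r)"
    by simp
  then have "(\<lambda>k. q powr r * (((r + real k - 1) gchoose k) * (1 - q) ^ k * z ^ k)) sums
               (q powr r * (1 + ?x) powr (- r))"
    by (rule sums_mult)
  moreover have "q powr r * (1 + ?x) powr (- r) = (q / (1 - (1 - q) * z)) powr r"
    using pos assms by (simp add: powr_divide powr_minus divide_simps)
  ultimately show ?thesis by (simp add: mult_ac)
qed

lemma gbinomial_shift_nonneg:
  fixes r :: real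
  assumes "0 < r"
  shows "0 \<le> ((r + real k - 1) gchoose k)"
proof -
  have "((r + real k - 1) gchoose k) = pochhammer r k / fact k"
    unfolding gbinomial_pochhammer' by (simp add: algebra_simps)
  then show ?thesis using pochhammer_pos[OF assms, of k] by simp
qed

lemma pmf_negbin:
  assumes "0 < r" "0 < q" "q < 1"
  shows "pmf (negbin_pmf r q) k = ((r + real k - 1) gchoose k) * q powr r * (1 - q) ^ k"
  unfolding negbin_pmf_def
proof (rule pmf_embed_pmf)
  let ?f = "\<lambda>k. ((r + real k - 1) gchoose k) * q powr r * (1 - q) ^ k"
  show nn: "0 \<le> ?f k" for k
    using assms by (intro mult_nonneg_nonneg gbinomial_shift_nonneg) auto
  have s: "?f sums 1"
    using negbin_series[OF assms, of 1] assms(2)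
    by (simp only: power_one mult_1_right zero_le_one order_refl simp_thms) simp
  have "(\<integral>\<^sup>+ k. ennreal (?f k) \<partial>count_space UNIV) = (\<Sum>k. ennreal (?f k))"
    by (rule nn_integral_count_space_nat)
  also have "\<dots> = ennreal (\<Sum>k. ?f k)"
    by (rule suminf_ennreal2[OF nn sums_summable[OF s]])
  also have "\<dots> = 1" by (simp only: sums_unique[OF s, symmetric] ennreal_1)
  finally show "(\<integral>\<^sup>+ k. ennreal (?f k) \<partial>count_space UNIV) = 1" .
qed

lemma negbin_pgf:
  assumes "0 < r" "0 < q" "q < 1" "0 \<le> z" "z \<le> 1"
  shows "(\<lambda>k. pmf (negbin_pmf r q) k * z ^ k) sums ((q / (1 - (1 - q) * z)) powr r)"
  using negbin_series[OF assms] unfolding pmf_negbin[OF assms(1-3)] .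

definition convolve_pmf :: "nat pmf \<Rightarrow> nat pmf \<Rightarrow> nat pmf" where
  "convolve_pmf P Q = map_pmf (\<lambda>(x, y). x + y) (pair_pmf P Q)"

definition M2_r :: "nat pmf \<Rightarrow> real" where
  "M2_r W = 4 * Gamma2 W ^ 3 / (Gamma3 W)\<^sup>2"

definition M2_p :: "nat pmf \<Rightarrow> real" where
  "M2_p W = 2 * Gamma2 W / (2 * Gamma2 W + Gamma3 W)"

definition M2_lambda :: "nat pmf \<Rightarrow> real" where
  "M2_lambda W = mean W - M2_r W * (1 - M2_p W) / M2_p W"

text \<open>The parameters are admissible only if they define laws; for the triangle counts this
  can fail for small \<open>n\<close> (for instance, for \<open>n = 3\<close> the second factorial cumulant is
  nonpositive).  The library's \<^const>\<open>poisson_pmf\<close> is specified for positive rates.\<close>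

definition M2_admissible :: "nat pmf \<Rightarrow> bool" where
  "M2_admissible W \<longleftrightarrow> 0 < M2_r W \<and> 0 < M2_p W \<and> M2_p W < 1 \<and> 0 < M2_lambda W"

definition M2_pmf :: "nat pmf \<Rightarrow> nat pmf" where
  "M2_pmf W = convolve_pmf (negbin_pmf (M2_r W) (M2_p W)) (poisson_pmf (M2_lambda W))"

text \<open>The second parameter is the variance; the library's \<^const>\<open>normal_density\<close> takes the
  standard deviation.\<close>

definition discretized_normal_pmf :: "real \<Rightarrow> real \<Rightarrow> int pmf" where
  "discretized_normal_pmf \<mu> v =
     embed_pmf (\<lambda>k. LBINT x:{real_of_int k - 1/2..real_of_int k + 1/2}. normal_density \<mu> (sqrt v) x)"

lemma pmf_discretized_normal:
  assumes "0 < v"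
  shows "pmf (discretized_normal_pmf \<mu> v) k =
    (LBINT x:{real_of_int k - 1/2..real_of_int k + 1/2}.
       1 / sqrt (2 * pi * v) * exp (- ((x - \<mu>)\<^sup>2 / (2 * v))))"
proof -
  let ?d = "normal_density \<mu> (sqrt v)"
  let ?f = "\<lambda>k::int. LBINT x:{real_of_int k - 1/2..real_of_int k + 1/2}. ?d x"
  let ?I = "\<lambda>k::int. {real_of_int k - 1/2..real_of_int k + 1/2}"
  let ?J = "\<lambda>k::int. {real_of_int k - 1/2..<real_of_int k + 1/2}"
  let ?N = "density lborel ?d"
  have sv: "0 < sqrt v" using assms by simp
  have nn: "0 \<le> ?f k" for k
    by (simp add: set_lebesgue_integral_def)
  have f_eq: "ennreal (?f k) = emeasure ?N (?J k)" for k
  proof -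
    have "AE x in lborel. x \<noteq> real_of_int k + 1/2" by (rule AE_lborel_singleton)
    then have ae: "AE x in lborel. ennreal (?d x) * indicator (?I k) x = ennreal (?d x) * indicator (?J k) x"
      by eventually_elim (auto simp: indicator_def)
    have int: "integrable lborel (\<lambda>x. indicator (?I k) x *\<^sub>R ?d x)"
      using sv by (intro integrable_mult_indicator) auto
    have "ennreal (?f k) = (\<integral>\<^sup>+x. ennreal (indicator (?I k) x *\<^sub>R ?d x) \<partial>lborel)"
      unfolding set_lebesgue_integral_def
      by (rule nn_integral_eq_integral[symmetric, OF int]) simp
    also have "\<dots> = (\<integral>\<^sup>+x. ennreal (?d x) * indicator (?I k) x \<partial>lborel)"
      by (intro nn_integral_cong) (auto simp: indicator_def)
    also have "\<dots> = (\<integral>\<^sup>+x. ennreal (?d x) * indicator (?J k) x \<partial>lborel)"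
      by (rule nn_integral_cong_AE[OF ae])
    also have "\<dots> = emeasure ?N (?J k)"
      by (simp add: emeasure_density)
    finally show ?thesis .
  qed
  have disj: "disjoint_family ?J"
  proof (unfold disjoint_family_on_def, intro ballI impI)
    fix m n :: int assume "m \<noteq> n"
    then consider "real_of_int m + 1 \<le> real_of_int n" | "real_of_int n + 1 \<le> real_of_int m"
      by linarith
    then show "?J m \<inter> ?J n = {}" by cases auto
  qed
  have cover: "(\<Union>k. ?J k) = UNIV"
  proof -
    have "x \<in> ?J \<lfloor>x + 1/2\<rfloor>" for x :: real
      by (simp add: algebra_simps) linarith
    then show ?thesis by blast
  qed
  interpret prob_space ?N using sv by (rule prob_space_normal_density)
  have "(\<integral>\<^sup>+ k. ennreal (?f k) \<partial>count_space UNIV) = (\<integral>\<^sup>+ k. emeasure ?N (?J k) \<partial>count_space UNIV)"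
    by (simp add: f_eq)
  also have "\<dots> = emeasure ?N (\<Union>k. ?J k)"
    by (rule emeasure_UN_countable[symmetric]) (use disj in auto)
  also have "\<dots> = 1" using cover emeasure_space_1 by simp
  finally have "(\<integral>\<^sup>+ k. ennreal (?f k) \<partial>count_space UNIV) = 1" .
  then have "pmf (discretized_normal_pmf \<mu> v) k = ?f k"
    unfolding discretized_normal_pmf_def by (intro pmf_embed_pmf nn)
  then show ?thesis using assms by (simp add: normal_density_def)
qed

text \<open>Both suprema are over nonempty families bounded by 1, so the real supremum is genuine.\<close>

definition dTV :: "int pmf \<Rightarrow> int pmf \<Rightarrow> real" where
  "dTV P Q = (SUP A. \<bar>measure_pmf.prob P A - measure_pmf.prob Q A\<bar>)"

definition dloc :: "int pmf \<Rightarrow> int pmf \<Rightarrow> real" where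
  "dloc P Q = (SUP a. \<bar>pmf P a - pmf Q a\<bar>)"

end

theory Submission imports Defs begin

text \<open>Write \<open>x = n p\<^sup>2\<close>, which stays bounded, and \<open>X = (n p)\<^sup>3\<close>, the order of the mean.
  Forcing a triangle, and then successively the triangles sharing an edge with what has been forced,
  gives a size-bias expansion
  \<open>E W f(W - 1) = \<mu> E f(W) + \<Gamma>\<^sub>2 E (\<Delta> f)(W) + (\<Gamma>\<^sub>3 / 2) E (\<Delta>\<^sup>2 f)(W) + \<dots>\<close>
  with a remainder of order \<open>X x\<^sup>2\<close> times third differences averaged over the graph.  Those are small
  because \<open>G(n, p)\<close> is a half-thinning of \<open>G(n, 2p)\<close>: given the latter, each of its isolated triangles,
  of which there are about \<open>X\<close> by the Efron-Stein inequality, survives independently with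
  probability \<open>1/8\<close>.  The laws of \<open>M\<^sub>2\<close> and \<open>W\<close> are joined by thinning \<open>W\<close> with probability \<open>s\<close> and
  adding the complementary part of \<open>M\<^sub>2\<close>.  The parameters of \<open>M\<^sub>2\<close> match three factorial cumulants,
  so only fourth powers of \<open>z - 1\<close> survive in the derivative in \<open>s\<close> of the generating function, and
  the total variation distance is of order \<open>x\<^sup>2 / X = p / n\<close>.  Since the exponent \<open>-1 - \<alpha>\<close> is at most
  \<open>-2 + \<alpha>\<close>, the same bound serves for the local distance.  Finally \<open>M\<^sub>2\<close> is compared with the normal
  density by Fourier inversion, integrating by parts twice to gain the factor
  \<open>1 / (\<sigma>\<^sup>2 + (k - \<mu>)\<^sup>2)\<close>, which is summable in \<open>k\<close>.\<close>

section \<open>Finite products of Bernoulli variables\<close>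

text \<open>Two obstacles shape the proof. First, the number of isolated triangles is controlled
  only by Chebyshev's inequality: it is too small with probability of order 1/X, and on that event
  the graph gives no smoothing. There the Poisson component of rate \<open>l * (1 - s)\<close> takes
  over. It bounds the norm of a fourth power of z - 1 by a multiple of (1 + l (1 - s))^-2, whose
  integral over s is at most 1/l, again of order 1/X. On the complementary event the thinned count
  gives s^-2 X^-2, and three differences supply s^3, so nothing blows up at s = 0. Both events thus
  contribute X^-2, against coefficients of order X x^2. Second, \<lambda> must be of the order of
  the mean. The Poisson part is also the only source of decay used for the characteristic function.
  With \<Gamma>_2 close to 3 x \<mu> and \<Gamma>_3 / 2 close to (9/2 + 6) x^2 \<mu>, the negative
  binomial part has mean about 9/10.5 = 6/7 of \<mu>, which leaves 1/7. The margin is thin, and the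
  explicit lower bound for \<Gamma>_3 is there to secure it.\<close>

definition bern :: "'a set \<Rightarrow> real \<Rightarrow> ('a set \<Rightarrow> real) \<Rightarrow> real" where
  "bern P p g = (\<Sum>E\<in>Pow P. p ^ card E * (1 - p) ^ card (P - E) * g E)"

lemma bern_empty [simp]: "bern {} p g = g {}"
  by (simp add: bern_def)

text \<open>Conditioning on one element. Since \<open>bern\<close> is a plain finite sum, most of
  the identities below are inductions on \<open>P\<close> through this recursion; the inequalities
  are where \<open>p\<close> has to be a probability.\<close>

lemma bern_insert:
  assumes "finite P" "e \<notin> P"
  shows "bern (insert e P) p g = p * bern P p (\<lambda>E. g (insert e E)) + (1 - p) * bern P p g"
proof -
  have inj: "inj_on (insert e) (Pow P)"
    using assms(2) by (auto simp: inj_on_def)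
  have disj: "Pow P \<inter> insert e ` Pow P = {}" using assms(2) by auto
  let ?w = "\<lambda>E. p ^ card E * (1 - p) ^ card (insert e P - E) * g E"
  have "bern (insert e P) p g = sum ?w (Pow P) + sum ?w (insert e ` Pow P)"
    unfolding bern_def Pow_insert by (rule sum.union_disjoint) (use assms disj in auto)
  moreover have "sum ?w (insert e ` Pow P) = p * bern P p (\<lambda>E. g (insert e E))"
    unfolding sum.reindex[OF inj] bern_def sum_distrib_left o_def
  proof (rule sum.cong[OF refl])
    fix E assume E: "E \<in> Pow P"
    then have "card (insert e E) = Suc (card E)" 
      using assms by (meson PowD card_insert_disjoint finite_subset subsetD)
    moreover have "insert e P - insert e E = P - E" using assms E by auto
    ultimately show "?w (insert e E) = p * (p ^ card E * (1 - p) ^ card (P - E) * g (insert e E))"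
      by simp
  qed
  moreover have "sum ?w (Pow P) = (1 - p) * bern P p g"
    unfolding bern_def sum_distrib_left
  proof (rule sum.cong[OF refl])
    fix E assume E: "E \<in> Pow P"
    then have "insert e P - E = insert e (P - E)" using assms by auto
    then have "card (insert e P - E) = Suc (card (P - E))" using assms by simp
    then show "?w E = (1 - p) * (p ^ card E * (1 - p) ^ card (P - E) * g E)" by simp
  qed
  ultimately show ?thesis by simp
qed

lemma bern_cong:
  assumes "\<And>E. E \<subseteq> P \<Longrightarrow> f E = g E"
  shows "bern P p f = bern P p g"
  unfolding bern_def using assms by (intro sum.cong) auto

lemma bern_add: "bern P p (\<lambda>E. f E + g E) = bern P p f + bern P p g"
  by (simp add: bern_def distrib_left sum.distrib)

lemma bern_diff: "bern P p (\<lambda>E. f E - g E) = bern P p f - bern P p g"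
  by (simp add: bern_def right_diff_distrib sum_subtractf)

lemma bern_cmult: "bern P p (\<lambda>E. c * f E) = c * bern P p f"
  by (simp add: bern_def sum_distrib_left mult_ac)

lemma bern_sum: "bern P p (\<lambda>E. \<Sum>i\<in>I. f i E) = (\<Sum>i\<in>I. bern P p (f i))"
  unfolding bern_def sum_distrib_left by (rule sum.swap)

lemma bern_const:
  assumes "finite P" shows "bern P p (\<lambda>_. c) = c"
  using assms by (induction P rule: finite_induct) (auto simp: bern_insert algebra_simps)

lemma bern_mono:
  assumes "0 \<le> p" "p \<le> 1" "\<And>E. E \<subseteq> P \<Longrightarrow> f E \<le> g E"
  shows "bern P p f \<le> bern P p g"
  unfolding bern_def using assms by (intro sum_mono mult_left_mono) auto

lemma bern_nonneg:
  assumes "0 \<le> p" "p \<le> 1" "\<And>E. E \<subseteq> P \<Longrightarrow> 0 \<le> f E"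
  shows "0 \<le> bern P p f"
  unfolding bern_def using assms by (intro sum_nonneg mult_nonneg_nonneg) auto

lemma bern_abs_le:
  assumes "0 \<le> p" "p \<le> 1" 
  shows "\<bar>bern P p f\<bar> \<le> bern P p (\<lambda>E. \<bar>f E\<bar>)"
  unfolding bern_def by (rule order_trans[OF sum_abs]) (use assms in \<open>simp add: abs_mult\<close>)

lemma bern_union:
  assumes "finite A" "finite B" "A \<inter> B = {}"
  shows "bern (A \<union> B) p g = bern A p (\<lambda>E. bern B p (\<lambda>F. g (E \<union> F)))"
  using assms
proof (induction A arbitrary: g rule: finite_induct)
  case (insert a A)
  have "bern (insert a A \<union> B) p g = bern (insert a (A \<union> B)) p g" by simp
  also have "\<dots> = p * bern (A \<union> B) p (\<lambda>E. g (insert a E)) + (1 - p) * bern (A \<union> B) p g"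
    by (rule bern_insert) (use insert in auto)
  also have "\<dots> = p * bern A p (\<lambda>E. bern B p (\<lambda>F. g (insert a E \<union> F))) + (1 - p) * bern A p (\<lambda>E. bern B p (\<lambda>F. g (E \<union> F)))"
    using insert by simp
  finally show ?case using insert by (simp add: bern_insert)
qed simp

text \<open>Sampling in two stages: the inner mean runs over subsets of the random outer set
  \<open>B\<close>. With \<open>q = 1/2\<close> this realizes G(n, p) inside G(n, 2p).\<close>

lemma bern_thin:
  assumes "finite P"
  shows "bern P (p * q) g = bern P p (\<lambda>B. bern B q g)"
  using assms
proof (induction P arbitrary: g rule: finite_induct)
  case (insert e P)
  have *: "bern P p (\<lambda>E. bern (insert e E) q g) = bern P p (\<lambda>E. q * bern E q (\<lambda>F. g (insert e F)) + (1 - q) * bern E q g)"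
    by (rule bern_cong) (use insert in \<open>auto intro!: bern_insert dest: finite_subset\<close>)
  show ?case
    by (simp add: bern_insert insert * bern_add bern_cmult) (simp add: algebra_simps)
qed simp

lemma bern_remove:
  assumes "finite P" "e \<in> P"
  shows "bern P p g = p * bern (P - {e}) p (\<lambda>E. g (insert e E)) + (1 - p) * bern (P - {e}) p g"
  using bern_insert[of "P - {e}" e p g] assms by (simp add: insert_absorb)

text \<open>Conditioning without division: given that the elements of \<open>S\<close> are present,
  the rest of \<open>E\<close> is unaffected, so the event can be traded for adding \<open>S\<close>
  by hand. For edge sets this is what forcing a triangle means.\<close>

lemma bern_cond:
  assumes "finite P" "S \<subseteq> P"
  shows "bern P p (\<lambda>E. if S \<subseteq> E then g E else 0) = p ^ card S * bern P p (\<lambda>E. g (E \<union> S))"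
proof -
  have "finite S" using assms finite_subset by blast
  then show ?thesis using assms(2)
  proof (induction S arbitrary: g rule: finite_induct)
    case (insert e S)
    have e: "e \<in> P" using insert by auto
    have "bern P p (\<lambda>E. if insert e S \<subseteq> E then g E else 0) = 
      bern P p (\<lambda>E. if S \<subseteq> E then (if e \<in> E then g E else 0) else 0)"
      by (rule bern_cong) auto
    also have "\<dots> = p ^ card S * bern P p (\<lambda>E. if e \<in> E \<union> S then g (E \<union> S) else 0)"
      using insert by auto
    also have "bern P p (\<lambda>E. if e \<in> E \<union> S then g (E \<union> S) else 0) 
       = p * bern (P - {e}) p (\<lambda>E. g (insert e E \<union> S)) + 
         (1 - p) * bern (P - {e}) p (\<lambda>E. if e \<in> E \<union> S then g (E \<union> S) else 0)"
      by (subst bern_remove[OF assms(1) e]) simp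
    also have "bern (P - {e}) p (\<lambda>E. if e \<in> E \<union> S then g (E \<union> S) else 0) = bern (P - {e}) p (\<lambda>E. 0)"
      by (rule bern_cong) (use insert in auto)
    also have "\<dots> = 0" using bern_const[of "P - {e}"] assms(1) by simp
    also have "bern (P - {e}) p (\<lambda>E. g (insert e E \<union> S)) = bern P p (\<lambda>E. g (E \<union> insert e S))"
      by (subst bern_remove[OF assms(1) e]) (simp add: algebra_simps)
    finally show ?case using insert by (simp add: mult_ac)
  qed simp
qed

lemma bern_subset:
  assumes "finite P" "S \<subseteq> P"
  shows "bern P p (\<lambda>E. if S \<subseteq> E then 1 else 0) = p ^ card S"
  using bern_cond[OF assms, of p "\<lambda>_. 1"] bern_const[OF assms(1)] by simp

lemma bern_superset:
  assumes "finite P" "A \<subseteq> P"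
  shows "bern P p (\<lambda>E. f (E \<inter> A)) = bern A p f"
proof -
  have "bern P p (\<lambda>E. f (E \<inter> A)) = bern (A \<union> (P - A)) p (\<lambda>E. f (E \<inter> A))"
    using assms by (simp add: Un_absorb1)
  also have "\<dots> = bern A p (\<lambda>E. bern (P - A) p (\<lambda>F. f ((E \<union> F) \<inter> A)))"
    by (rule bern_union) (use assms finite_subset in auto)
  also have "\<dots> = bern A p (\<lambda>E. bern (P - A) p (\<lambda>F. f E))"
    by (intro bern_cong arg_cong[where f=f]) auto
  also have "\<dots> = bern A p f" using assms by (simp add: bern_const)
  finally show ?thesis .
qed

lemma bern_indep:
  assumes "finite P" "A \<subseteq> P" "B \<subseteq> P" "A \<inter> B = {}"
  shows "bern P p (\<lambda>E. f (E \<inter> A) * g (E \<inter> B)) = bern A p f * bern B p g"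
proof -
  have fin: "finite A" "finite B" using assms(1-3) by (auto intro: finite_subset)
  have "bern P p (\<lambda>E. f (E \<inter> A) * g (E \<inter> B)) = bern P p (\<lambda>E. (\<lambda>E. f (E \<inter> A) * g (E \<inter> B)) (E \<inter> (A \<union> B)))"
    by (rule bern_cong) (simp add: Int_assoc inf_sup_absorb Un_Int_distrib)
  also have "\<dots> = bern (A \<union> B) p (\<lambda>E. f (E \<inter> A) * g (E \<inter> B))"
    by (rule bern_superset) (use assms in auto)
  also have "\<dots> = bern A p (\<lambda>E. bern B p (\<lambda>F. f ((E \<union> F) \<inter> A) * g ((E \<union> F) \<inter> B)))"
    by (rule bern_union) (use assms fin in auto)
  also have "\<dots> = bern A p (\<lambda>E. bern B p (\<lambda>F. f E * g F))"
  proof (intro bern_cong)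
    fix E F assume "E \<subseteq> A" "F \<subseteq> B"
    then have "(E \<union> F) \<inter> A = E" "(E \<union> F) \<inter> B = F" using assms(4) by auto
    then show "f ((E \<union> F) \<inter> A) * g ((E \<union> F) \<inter> B) = f E * g F" by simp
  qed
  also have "\<dots> = bern A p f * bern B p g"
    by (simp add: bern_cmult) (simp add: bern_cmult mult.commute[of _ "bern B p g"])
  finally show ?thesis .
qed

lemma bern_prod:
  assumes "finite P" "finite I" "\<And>i. i \<in> I \<Longrightarrow> A i \<subseteq> P" "disjoint_family_on A I"
  shows "bern P p (\<lambda>E. \<Prod>i\<in>I. f i (E \<inter> A i)) = (\<Prod>i\<in>I. bern (A i) p (f i))"
  using assms(2,3,4)
proof (induction I rule: finite_induct)
  case (insert i I)
  let ?B = "\<Union>j\<in>I. A j"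
  have dis: "A i \<inter> ?B = {}"
    using insert by (force simp: disjoint_family_on_def)
  have "bern P p (\<lambda>E. \<Prod>j\<in>insert i I. f j (E \<inter> A j)) = 
     bern P p (\<lambda>E. f i (E \<inter> A i) * (\<lambda>E. \<Prod>j\<in>I. f j (E \<inter> A j)) (E \<inter> ?B))"
    using insert by (intro bern_cong) (auto intro!: prod.cong arg_cong2[where f="(*)"] arg_cong2[where f=f])
  also have "\<dots> = bern (A i) p (f i) * bern ?B p (\<lambda>E. \<Prod>j\<in>I. f j (E \<inter> A j))"
    by (rule bern_indep) (use assms(1) insert dis in auto)
  also have "bern ?B p (\<lambda>E. \<Prod>j\<in>I. f j (E \<inter> A j)) = bern P p (\<lambda>E. (\<lambda>E. \<Prod>j\<in>I. f j (E \<inter> A j)) (E \<inter> ?B))"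
    by (rule bern_superset[symmetric]) (use assms(1) insert in auto)
  also have "\<dots> = bern P p (\<lambda>E. \<Prod>j\<in>I. f j (E \<inter> A j))"
    by (intro bern_cong) (auto intro!: prod.cong arg_cong2[where f=f])
  also have "\<dots> = (\<Prod>j\<in>I. bern (A j) p (f j))"
    using insert by (auto simp: disjoint_family_on_def)
  finally show ?case using insert by simp
qed (use assms(1) bern_const in auto)

section \<open>Variance inequalities\<close>

lemma bern_square_le:
  assumes "0 \<le> p" "p \<le> 1" "finite P"
  shows "(bern P p f)\<^sup>2 \<le> bern P p (\<lambda>E. (f E)\<^sup>2)"
proof -
  let ?m = "bern P p f"
  have "0 \<le> bern P p (\<lambda>E. (f E - ?m)\<^sup>2)" by (rule bern_nonneg) (use assms in auto)
  also have "\<dots> = bern P p (\<lambda>E. (f E)\<^sup>2 - (2 * ?m) * f E + ?m\<^sup>2)"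
    by (rule bern_cong) (simp add: power2_eq_square algebra_simps)
  also have "\<dots> = bern P p (\<lambda>E. (f E)\<^sup>2) - 2 * ?m * ?m + ?m\<^sup>2"
    unfolding bern_add bern_diff bern_cmult using assms by (simp add: bern_const)
  finally show ?thesis by (simp add: power2_eq_square)
qed

text \<open>Induction on the coordinates. By the law of total variance, one coordinate splits the
  variance into the averaged conditional variances and p (1 - p) times the squared difference of the
  conditional means; Jensen's inequality bounds that square by the mean squared effect of the
  coordinate.\<close>

lemma efron_stein:
  assumes "0 \<le> p" "p \<le> 1" "finite P"
  shows "bern P p (\<lambda>E. (f E)\<^sup>2) - (bern P p f)\<^sup>2 \<le>
     p * (1 - p) * (\<Sum>e\<in>P. bern P p (\<lambda>E. (f (insert e E) - f (E - {e}))\<^sup>2))"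
  using assms(3)
proof (induction P arbitrary: f rule: finite_induct)
  case (insert a P)
  let ?D = "\<lambda>e f E. (f (insert e E) - f (E - {e}))\<^sup>2"
  let ?f1 = "\<lambda>E. f (insert a E)"
  let ?x = "bern P p ?f1" and ?y = "bern P p f"
  let ?s = "\<lambda>f. bern P p (\<lambda>E. (f E)\<^sup>2)"
  have q: "0 \<le> p * (1 - p)" using assms by simp
  have id: "bern (insert a P) p (\<lambda>E. (f E)\<^sup>2) - (bern (insert a P) p f)\<^sup>2 =
     p * (?s ?f1 - ?x\<^sup>2) + (1 - p) * (?s f - ?y\<^sup>2) + p * (1 - p) * (?x - ?y)\<^sup>2"
    by (simp add: bern_insert insert power2_eq_square algebra_simps)
  have "(?x - ?y)\<^sup>2 = (bern P p (\<lambda>E. ?f1 E - f E))\<^sup>2" by (simp add: bern_diff)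
  also have "\<dots> \<le> bern P p (\<lambda>E. (?f1 E - f E)\<^sup>2)" by (rule bern_square_le) (use assms insert in auto)
  also have "\<dots> = bern (insert a P) p (?D a f)"
  proof -
    have "bern P p (\<lambda>E. ?D a f (insert a E)) = bern P p (\<lambda>E. (?f1 E - f E)\<^sup>2)"
      by (rule bern_cong) (use insert in \<open>auto simp: subset_iff intro!: arg_cong[where f="\<lambda>x. (_ - f x)\<^sup>2"]\<close>)
    moreover have "bern P p (\<lambda>E. ?D a f E) = bern P p (\<lambda>E. (?f1 E - f E)\<^sup>2)"
      by (rule bern_cong) (use insert in \<open>auto simp: subset_iff intro!: arg_cong[where f="\<lambda>x. (_ - f x)\<^sup>2"]\<close>)
    ultimately show ?thesis by (simp add: bern_insert insert algebra_simps)
  qed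
  finally have xy: "(?x - ?y)\<^sup>2 \<le> bern (insert a P) p (?D a f)" .
  have e: "p * bern P p (?D e ?f1) + (1 - p) * bern P p (?D e f) = bern (insert a P) p (?D e f)" if "e \<in> P" for e
  proof -
    have ae: "a \<noteq> e" using that insert by auto
    have "?D e ?f1 = (\<lambda>E. ?D e f (insert a E))"
      using ae by (auto simp: fun_eq_iff insert_commute insert_Diff_if)
    then show ?thesis using insert by (simp add: bern_insert)
  qed
  have "p * (?s ?f1 - ?x\<^sup>2) + (1 - p) * (?s f - ?y\<^sup>2) \<le> 
     p * (p * (1 - p) * (\<Sum>e\<in>P. bern P p (?D e ?f1))) + (1 - p) * (p * (1 - p) * (\<Sum>e\<in>P. bern P p (?D e f)))"
    using assms by (intro add_mono mult_left_mono insert.IH) auto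
  also have "\<dots> = p * (1 - p) * (\<Sum>e\<in>P. p * bern P p (?D e ?f1) + (1 - p) * bern P p (?D e f))"
    unfolding sum.distrib sum_distrib_left[symmetric] by (simp only: distrib_left mult_ac)
  also have "\<dots> = p * (1 - p) * (\<Sum>e\<in>P. bern (insert a P) p (?D e f))"
    using e by simp
  finally have "bern (insert a P) p (\<lambda>E. (f E)\<^sup>2) - (bern (insert a P) p f)\<^sup>2 \<le>
     p * (1 - p) * (\<Sum>e\<in>P. bern (insert a P) p (?D e f)) + p * (1 - p) * bern (insert a P) p (?D a f)"
    unfolding id using mult_left_mono[OF xy q] by linarith
  also have "\<dots> = p * (1 - p) * (\<Sum>e\<in>insert a P. bern (insert a P) p (?D e f))"
    using insert by (simp add: algebra_simps)
  finally show ?case .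
qed simp

lemma bern_chebyshev:
  assumes "0 \<le> p" "p \<le> 1" "finite P" "0 < t" "m + t \<le> bern P p f"
    and v: "bern P p (\<lambda>E. (f E)\<^sup>2) - (bern P p f)\<^sup>2 \<le> v"
  shows "bern P p (\<lambda>E. if f E < m then 1 else 0) \<le> v / t\<^sup>2"
proof -
  let ?m = "bern P p f"
  have "t\<^sup>2 * bern P p (\<lambda>E. if f E < m then 1 else 0) = bern P p (\<lambda>E. t\<^sup>2 * (if f E < m then 1 else 0))"
    by (simp add: bern_cmult)
  also have "\<dots> \<le> bern P p (\<lambda>E. (f E - ?m)\<^sup>2)"
  proof (rule bern_mono)
    fix E
    show "t\<^sup>2 * (if f E < m then 1 else 0) \<le> (f E - ?m)\<^sup>2"
    proof (cases "f E < m")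
      case True
      then have "t \<le> \<bar>f E - ?m\<bar>" using assms by linarith
      then have "t\<^sup>2 \<le> \<bar>f E - ?m\<bar>\<^sup>2" using assms by (intro power_mono) auto
      then show ?thesis using True by simp
    qed simp
  qed (use assms in auto)
  also have "\<dots> = bern P p (\<lambda>E. (f E)\<^sup>2 - (2 * ?m) * f E + ?m\<^sup>2)"
    by (rule bern_cong) (simp add: power2_eq_square algebra_simps)
  also have "\<dots> = bern P p (\<lambda>E. (f E)\<^sup>2) - 2 * ?m * ?m + ?m\<^sup>2"
    unfolding bern_add bern_diff bern_cmult using assms by (simp add: bern_const)
  also have "\<dots> \<le> v" using v by (simp add: power2_eq_square)
  finally show ?thesis using assms by (simp add: field_simps)
qed

section \<open>Expansion by forced triangles\<close>

lemma finite_pairs: "finite V \<Longrightarrow> finite (pairs V)"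
  unfolding pairs_def by simp

lemma card_pairs: "finite V \<Longrightarrow> card (pairs V) = card V choose 2"
  unfolding pairs_def by (rule n_subsets)

lemma pairs_mono: "A \<subseteq> B \<Longrightarrow> pairs A \<subseteq> pairs B"
  unfolding pairs_def by auto

lemma pairs_Int: "pairs A \<inter> pairs B = pairs (A \<inter> B)"
  unfolding pairs_def by auto

lemma pairs_eq_empty: "finite V \<Longrightarrow> card V \<le> 1 \<Longrightarrow> pairs V = {}"
  using card_pairs[of V] finite_pairs[of V] by (simp add: binomial_eq_0)

lemma doubleton_in_pairs [simp]: "{a, b} \<in> pairs V \<longleftrightarrow> a \<in> V \<and> b \<in> V \<and> a \<noteq> b"
  unfolding pairs_def by (auto simp: card_insert_if)

definition triples :: "nat \<Rightarrow> nat set set" where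
  "triples n = {S. S \<subseteq> {..<n} \<and> card S = 3}"

lemma finite_triples [simp]: "finite (triples n)"
  unfolding triples_def by simp

lemma card_triples: "card (triples n) = n choose 3"
  unfolding triples_def using n_subsets[of "{..<n}" 3] by simp

lemma tripleD: "S \<in> triples n \<Longrightarrow> finite S \<and> card S = 3 \<and> S \<subseteq> {..<n}"
  unfolding triples_def by (auto intro: finite_subset)

lemma card_pairs_triple: "S \<in> triples n \<Longrightarrow> card (pairs S) = 3"
  using card_pairs[of S] tripleD[of S n] by (simp add: choose_two)

text \<open>The family \<open>\<S>\<close> is a parameter because a triangle that has been forced is
  no longer counted.\<close>

definition copies :: "nat set set \<Rightarrow> nat set set \<Rightarrow> nat" where
  "copies \<S> E = card {S \<in> \<S>. pairs S \<subseteq> E}"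

definition forced_mean :: "nat \<Rightarrow> real \<Rightarrow> nat set set \<Rightarrow> nat set set \<Rightarrow> (nat \<Rightarrow> real) \<Rightarrow> real" where
  "forced_mean n p H \<S> f = bern (pairs {..<n}) p (\<lambda>E. f (copies \<S> (E \<union> H)))"

definition fwd_diff :: "(nat \<Rightarrow> real) \<Rightarrow> nat \<Rightarrow> real" where
  "fwd_diff f k = f (Suc k) - f k"

lemma copies_remove:
  assumes "finite \<S>" "S \<in> \<S>"
  shows "copies \<S> E = copies (\<S> - {S}) E + (if pairs S \<subseteq> E then 1 else 0)"
proof (cases "pairs S \<subseteq> E")
  case True
  then have "{T \<in> \<S>. pairs T \<subseteq> E} = insert S {T \<in> \<S> - {S}. pairs T \<subseteq> E}" using assms by auto
  then show ?thesis using True assms by (simp add: copies_def)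
next
  case False
  then have "{T \<in> \<S>. pairs T \<subseteq> E} = {T \<in> \<S> - {S}. pairs T \<subseteq> E}" by auto
  then show ?thesis using False by (simp add: copies_def)
qed

text \<open>Split according to whether \<open>S\<close> is present. Only its edges outside
  \<open>H\<close> are random, whence the exponent. On that event the count over the other triangles
  goes up by one, which produces the forward difference, and the edges of \<open>S\<close> join the
  forced set.\<close>

lemma forced_mean_remove:
  assumes "\<S> \<subseteq> triples n" "S \<in> \<S>"
  shows "forced_mean n p H \<S> f = forced_mean n p H (\<S> - {S}) f +
    p ^ card (pairs S - H) * forced_mean n p (H \<union> pairs S) (\<S> - {S}) (fwd_diff f)"
proof -
  have fin: "finite \<S>" using assms finite_subset by (metis finite_triples)
  have S: "S \<subseteq> {..<n}" using assms tripleD by blast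
  have "forced_mean n p H \<S> f = bern (pairs {..<n}) p (\<lambda>E. f (copies (\<S> - {S}) (E \<union> H)) + 
     (if pairs S - H \<subseteq> E then fwd_diff f (copies (\<S> - {S}) (E \<union> H)) else 0))"
    unfolding forced_mean_def
  proof (rule bern_cong)
    fix E
    have "pairs S \<subseteq> E \<union> H \<longleftrightarrow> pairs S - H \<subseteq> E" by auto
    then show "f (copies \<S> (E \<union> H)) = f (copies (\<S> - {S}) (E \<union> H)) + 
     (if pairs S - H \<subseteq> E then fwd_diff f (copies (\<S> - {S}) (E \<union> H)) else 0)"
      using copies_remove[OF fin assms(2), of "E \<union> H"] by (auto simp: fwd_diff_def)
  qed
  also have "\<dots> = forced_mean n p H (\<S> - {S}) f + p ^ card (pairs S - H) * 
     bern (pairs {..<n}) p (\<lambda>E. fwd_diff f (copies (\<S> - {S}) (E \<union> (pairs S - H) \<union> H)))"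
    unfolding bern_add forced_mean_def 
    by (subst bern_cond) (use pairs_mono[OF S] in \<open>auto intro: finite_pairs\<close>)
  also have "(\<lambda>E. fwd_diff f (copies (\<S> - {S}) (E \<union> (pairs S - H) \<union> H))) = (\<lambda>E. fwd_diff f (copies (\<S> - {S}) (E \<union> (H \<union> pairs S))))"
    by (intro ext arg_cong[where f="fwd_diff f"] arg_cong[where f="copies _"]) auto
  finally show ?thesis by (simp add: forced_mean_def)
qed

text \<open>Triangles are removed one at a time, so the term of index \<open>j\<close> has lost the
  first \<open>j + 1\<close> of them. The order is arbitrary but must be fixed, which is the purpose
  of \<open>enum\<close>.\<close>

lemma forced_mean_remove_list:
  assumes "\<S> \<subseteq> triples n" "distinct xs" "set xs \<subseteq> \<S>"
  shows "forced_mean n p H \<S> f = forced_mean n p H (\<S> - set xs) f +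
    (\<Sum>j<length xs. p ^ card (pairs (xs ! j) - H) *
       forced_mean n p (H \<union> pairs (xs ! j)) (\<S> - set (take (Suc j) xs)) (fwd_diff f))"
  using assms(2,3)
proof (induction xs rule: rev_induct)
  case (snoc x xs)
  have "forced_mean n p H (\<S> - set xs) f = forced_mean n p H (\<S> - set xs - {x}) f + 
    p ^ card (pairs x - H) * forced_mean n p (H \<union> pairs x) (\<S> - set xs - {x}) (fwd_diff f)"
    by (rule forced_mean_remove) (use snoc assms in auto)
  moreover have "\<S> - set xs - {x} = \<S> - set (xs @ [x])" by auto
  ultimately show ?case using snoc by (simp add: nth_append)
qed simp

definition enum :: "'a set \<Rightarrow> 'a list" where
  "enum A = (SOME xs. distinct xs \<and> set xs = A)"

lemma enum: "finite A \<Longrightarrow> distinct (enum A)" "finite A \<Longrightarrow> set (enum A) = A"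
  using someI_ex[OF finite_distinct_list[of A, unfolded conj_commute[of "set _ = _"]]]
  unfolding enum_def by auto

lemma length_enum: "finite A \<Longrightarrow> length (enum A) = card A"
  using enum[of A] distinct_card by metis

lemma sum_enum: "finite A \<Longrightarrow> (\<Sum>j<length (enum A). g (enum A ! j)) = sum g A"
  using sum.reindex_bij_betw[OF bij_betw_nth[OF enum(1) refl], of A "A" g]
  by (metis atLeast0LessThan bij_betw_nth enum(1) enum(2) sum.reindex_bij_betw)

text \<open>A triangle with at most one vertex in \<open>U\<close> has no edge inside
  \<open>U\<close>, so forced edges from \<open>pairs U\<close> do not touch it. The near triangles
  are those that can be affected.\<close>

definition near :: "nat set \<Rightarrow> nat set set \<Rightarrow> nat set set" where
  "near U \<S> = {S \<in> \<S>. 2 \<le> card (S \<inter> U)}"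

text \<open>One step of the expansion: a functional of the states \<open>(U, H, \<S>)\<close> is summed over the
  states obtained by forcing the triangles with at least two vertices in \<open>U\<close>, in turn, first
  those of \<open>\<S>\<close> in the presence of \<open>H\<close> and then, with negative sign, all of them.\<close>
definition expand ::
  "nat \<Rightarrow> real \<Rightarrow> (nat set \<Rightarrow> nat set set \<Rightarrow> nat set set \<Rightarrow> real) \<Rightarrow>
     nat set \<Rightarrow> nat set set \<Rightarrow> nat set set \<Rightarrow> real" where
  "expand n p \<Phi> U H \<S> =
    (let xs = enum (near U \<S>); ys = enum (near U (triples n)) in
     (\<Sum>j<length xs. p ^ card (pairs (xs ! j) - H) *
        \<Phi> (U \<union> xs ! j) (H \<union> pairs (xs ! j)) (\<S> - set (take (Suc j) xs))) -
     (\<Sum>j<length ys. p ^ 3 *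
        \<Phi> (U \<union> ys ! j) (pairs (ys ! j)) (triples n - set (take (Suc j) ys))))"

text \<open>The last condition says that every triangle not yet removed from consideration and meeting \<open>U\<close>
  in at most one vertex, hence unaffected by \<open>H\<close>, is still available.\<close>
definition valid_state :: "nat \<Rightarrow> nat set \<Rightarrow> nat set set \<Rightarrow> nat set set \<Rightarrow> bool" where
  "valid_state n U H \<S> \<longleftrightarrow> U \<subseteq> {..<n} \<and> H \<subseteq> pairs U \<and> \<S> \<subseteq> triples n \<and> triples n - \<S> \<subseteq> near U (triples n)"

lemma finite_near [simp]: "finite \<S> \<Longrightarrow> finite (near U \<S>)"
  unfolding near_def by simp

lemma valid_stateD: "valid_state n U H \<S> \<Longrightarrow> finite U \<and> finite \<S> \<and> U \<subseteq> {..<n} \<and> H \<subseteq> pairs U \<and> \<S> \<subseteq> triples n"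
  unfolding valid_state_def by (auto intro: finite_subset)

lemma near_mono:
  assumes "U \<subseteq> U'" "\<S> \<subseteq> \<S>'" "finite U'"
  shows "near U \<S> \<subseteq> near U' \<S>'"
proof
  fix S assume "S \<in> near U \<S>"
  then have "S \<in> \<S>" "2 \<le> card (S \<inter> U)" by (auto simp: near_def)
  moreover have "card (S \<inter> U) \<le> card (S \<inter> U')" using assms by (intro card_mono) auto
  ultimately show "S \<in> near U' \<S>'" using assms by (auto simp: near_def)
qed

lemma near_self:
  assumes "S \<in> near U (triples n)" shows "S \<in> triples n" "card (U \<union> S) \<le> Suc (card U)"
proof -
  show S: "S \<in> triples n" using assms by (auto simp: near_def)
  show "card (U \<union> S) \<le> Suc (card U)"
  proof (cases "finite U")
    case True
    have "card (U \<union> S) + card (U \<inter> S) = card U + card S"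
      using card_Un_Int[of U S] True tripleD[OF S] by simp
    then show ?thesis using assms tripleD[OF S] by (simp add: near_def Int_commute)
  qed auto
qed

text \<open>A near triangle has at most one vertex outside \<open>U\<close>, so a step of the
  expansion adds at most one vertex. Three steps from a triangle therefore stay within six vertices,
  the bound that recurs below.\<close>

lemma valid_state_child:
  assumes "valid_state n U H \<S>" "j < length (enum (near U \<S>))"
  defines "x \<equiv> enum (near U \<S>) ! j"
  shows "valid_state n (U \<union> x) (H \<union> pairs x) (\<S> - set (take (Suc j) (enum (near U \<S>))))"
    "card (U \<union> x) \<le> Suc (card U)" "x \<in> near U \<S>" "x \<in> near U (triples n)"
proof -
  note v = valid_stateD[OF assms(1)]
  have e: "set (enum (near U \<S>)) = near U \<S>" using v by (simp add: enum)
  show x: "x \<in> near U \<S>" using e assms(2) unfolding x_def by (metis nth_mem)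
  show x': "x \<in> near U (triples n)" using x v by (auto simp: near_def)
  then show "card (U \<union> x) \<le> Suc (card U)" by (rule near_self)
  have xn: "x \<subseteq> {..<n}" using near_self(1)[OF x'] tripleD by auto
  have "set (take (Suc j) (enum (near U \<S>))) \<subseteq> near U (triples n)" 
    using e set_take_subset v by (fastforce simp: near_def)
  moreover have "near U (triples n) \<subseteq> near (U \<union> x) (triples n)"
    by (rule near_mono) (use v xn finite_subset in \<open>auto dest: finite_subset\<close>)
  moreover have "pairs U \<subseteq> pairs (U \<union> x)" "pairs x \<subseteq> pairs (U \<union> x)" by (simp_all add: pairs_mono)
  ultimately show "valid_state n (U \<union> x) (H \<union> pairs x) (\<S> - set (take (Suc j) (enum (near U \<S>))))"
    using assms(1) xn unfolding valid_state_def by blast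
qed

lemma valid_state_triples: "U \<subseteq> {..<n} \<Longrightarrow> valid_state n U {} (triples n)"
  unfolding valid_state_def by auto

lemma valid_state_child':
  assumes "U \<subseteq> {..<n}" "j < length (enum (near U (triples n)))"
  defines "x \<equiv> enum (near U (triples n)) ! j"
  shows "valid_state n (U \<union> x) (pairs x) (triples n - set (take (Suc j) (enum (near U (triples n)))))"
    "card (U \<union> x) \<le> Suc (card U)" "x \<in> near U (triples n)"
  using valid_state_child[OF valid_state_triples[OF assms(1)] assms(2)] unfolding x_def by auto

lemma forced_mean_far:
  assumes "U \<subseteq> {..<n}" "H \<subseteq> pairs U" "\<S> \<subseteq> triples n" "near U \<S> = {}"
  shows "forced_mean n p H \<S> f = forced_mean n p {} \<S> f"
proof -
  have "{S \<in> \<S>. pairs S \<subseteq> E \<union> H} = {S \<in> \<S>. pairs S \<subseteq> E \<union> {}}" for E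
  proof -
    have "pairs S \<inter> H = {}" if "S \<in> \<S>" for S
    proof -
      have "card (S \<inter> U) \<le> 1" using assms(4) that by (force simp: near_def)
      moreover have "finite (S \<inter> U)" using assms finite_subset by blast
      ultimately have "pairs (S \<inter> U) = {}" by (rule pairs_eq_empty[rotated])
      then show ?thesis using assms(2) pairs_Int[of S U] by auto
    qed
    then show ?thesis by auto
  qed
  then show ?thesis unfolding forced_mean_def copies_def by simp
qed

text \<open>Remove the near triangles from the count both with and without forcing. The remaining
  families coincide by the last clause of \<open>valid_state\<close>, and the forced edges have no
  effect on them, so the two remaining means cancel. The difference of the two telescoping sums is
  \<open>expand\<close>.\<close>

lemma forced_mean_expand:
  assumes "valid_state n U H \<S>"
  shows "forced_mean n p H \<S> f = forced_mean n p {} (triples n) f + expand n p (\<lambda>U H \<S>. forced_mean n p H \<S> (fwd_diff f)) U H \<S>"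
proof -
  note v = valid_stateD[OF assms]
  let ?xs = "enum (near U \<S>)" and ?ys = "enum (near U (triples n))"
  have e: "set ?xs = near U \<S>" "set ?ys = near U (triples n)" "distinct ?xs" "distinct ?ys"
    using v by (simp_all add: enum)
  have eq: "\<S> - near U \<S> = triples n - near U (triples n)"
    using assms unfolding valid_state_def near_def by auto
  have far: "forced_mean n p H (\<S> - near U \<S>) f = forced_mean n p {} (\<S> - near U \<S>) f"
    by (rule forced_mean_far[of U]) (use v in \<open>auto simp: near_def\<close>)
  have 1: "forced_mean n p H \<S> f = forced_mean n p H (\<S> - set ?xs) f +
    (\<Sum>j<length ?xs. p ^ card (pairs (?xs ! j) - H) *
       forced_mean n p (H \<union> pairs (?xs ! j)) (\<S> - set (take (Suc j) ?xs)) (fwd_diff f))"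
    by (rule forced_mean_remove_list) (use e v in \<open>auto simp: near_def\<close>)
  have "forced_mean n p {} (triples n) f = forced_mean n p {} (triples n - set ?ys) f +
    (\<Sum>j<length ?ys. p ^ card (pairs (?ys ! j) - {}) *
       forced_mean n p ({} \<union> pairs (?ys ! j)) (triples n - set (take (Suc j) ?ys)) (fwd_diff f))"
    by (rule forced_mean_remove_list) (use e v in \<open>auto simp: near_def\<close>)
  also have "(\<Sum>j<length ?ys. p ^ card (pairs (?ys ! j) - {}) *
       forced_mean n p ({} \<union> pairs (?ys ! j)) (triples n - set (take (Suc j) ?ys)) (fwd_diff f)) =
     (\<Sum>j<length ?ys. p ^ 3 * forced_mean n p (pairs (?ys ! j)) (triples n - set (take (Suc j) ?ys)) (fwd_diff f))"
  proof (rule sum.cong[OF refl])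
    fix j assume "j \<in> {..<length ?ys}"
    then have "?ys ! j \<in> triples n" using e(2) nth_mem[of j ?ys] by (auto simp: near_def)
    then show "p ^ card (pairs (?ys ! j) - {}) *
       forced_mean n p ({} \<union> pairs (?ys ! j)) (triples n - set (take (Suc j) ?ys)) (fwd_diff f) =
       p ^ 3 * forced_mean n p (pairs (?ys ! j)) (triples n - set (take (Suc j) ?ys)) (fwd_diff f)"
      by (simp add: card_pairs_triple)
  qed
  finally show ?thesis using 1 e far eq by (simp add: expand_def Let_def)
qed

lemma expand_cong:
  assumes "valid_state n U H \<S>" "\<And>U' H' \<S>'. valid_state n U' H' \<S>' \<Longrightarrow> card U' \<le> Suc (card U) \<Longrightarrow> \<Phi> U' H' \<S>' = \<Psi> U' H' \<S>'"
  shows "expand n p \<Phi> U H \<S> = expand n p \<Psi> U H \<S>"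
proof -
  have U: "U \<subseteq> {..<n}" using valid_stateD[OF assms(1)] by auto
  let ?xs = "enum (near U \<S>)" and ?ys = "enum (near U (triples n))"
  have "\<Phi> (U \<union> ?xs ! j) (H \<union> pairs (?xs ! j)) (\<S> - set (take (Suc j) ?xs)) =
    \<Psi> (U \<union> ?xs ! j) (H \<union> pairs (?xs ! j)) (\<S> - set (take (Suc j) ?xs))" if "j < length ?xs" for j
    using valid_state_child(1,2)[OF assms(1) that] by (rule assms(2))
  moreover have "\<Phi> (U \<union> ?ys ! j) (pairs (?ys ! j)) (triples n - set (take (Suc j) ?ys)) =
    \<Psi> (U \<union> ?ys ! j) (pairs (?ys ! j)) (triples n - set (take (Suc j) ?ys))" if "j < length ?ys" for j
    using valid_state_child'(1,2)[OF U that] by (rule assms(2))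
  ultimately show ?thesis unfolding expand_def Let_def by simp
qed

lemma expand_add: "expand n p (\<lambda>U H \<S>. \<Phi> U H \<S> + \<Psi> U H \<S>) U H \<S> = expand n p \<Phi> U H \<S> + expand n p \<Psi> U H \<S>"
  unfolding expand_def Let_def by (simp add: distrib_left sum.distrib)

lemma expand_cmult: "expand n p (\<lambda>U H \<S>. \<Phi> U H \<S> * c) U H \<S> = expand n p \<Phi> U H \<S> * c"
  unfolding expand_def Let_def by (simp only: sum_distrib_right left_diff_distrib mult.assoc)

lemma forced_mean_expand2:
  assumes "valid_state n U H \<S>"
  defines "one \<equiv> (\<lambda>_ _ _. 1)"
  shows "forced_mean n p H \<S> f = forced_mean n p {} (triples n) f + expand n p one U H \<S> * forced_mean n p {} (triples n) (fwd_diff f) +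
     expand n p (expand n p (\<lambda>U H \<S>. forced_mean n p H \<S> (fwd_diff (fwd_diff f)))) U H \<S>"
proof -
  have "expand n p (\<lambda>U H \<S>. forced_mean n p H \<S> (fwd_diff f)) U H \<S> = 
     expand n p (\<lambda>U H \<S>. one U H \<S> * forced_mean n p {} (triples n) (fwd_diff f) + expand n p (\<lambda>U H \<S>. forced_mean n p H \<S> (fwd_diff (fwd_diff f))) U H \<S>) U H \<S>"
    by (rule expand_cong[OF assms(1)]) (simp add: one_def forced_mean_expand[of n])
  then show ?thesis using forced_mean_expand[OF assms(1), of p f] by (simp add: expand_add expand_cmult)
qed

text \<open>The expansion is substituted into its own children once more. The coefficients do not
  depend on \<open>f\<close>, so they can later be identified as cumulants by testing on
  polynomials.\<close>

lemma forced_mean_expand3: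
  assumes "valid_state n U H \<S>"
  defines "one \<equiv> (\<lambda>_ _ _. 1)"
  shows "forced_mean n p H \<S> f = forced_mean n p {} (triples n) f + expand n p one U H \<S> * forced_mean n p {} (triples n) (fwd_diff f) +
     expand n p (expand n p one) U H \<S> * forced_mean n p {} (triples n) (fwd_diff (fwd_diff f)) +
     expand n p (expand n p (expand n p (\<lambda>U H \<S>. forced_mean n p H \<S> (fwd_diff (fwd_diff (fwd_diff f)))))) U H \<S>"
proof -
  have "expand n p (\<lambda>U H \<S>. forced_mean n p H \<S> (fwd_diff f)) U H \<S> = 
     expand n p (\<lambda>U H \<S>. one U H \<S> * forced_mean n p {} (triples n) (fwd_diff f) + 
      (expand n p one U H \<S> * forced_mean n p {} (triples n) (fwd_diff (fwd_diff f)) + 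
       expand n p (expand n p (\<lambda>U H \<S>. forced_mean n p H \<S> (fwd_diff (fwd_diff (fwd_diff f))))) U H \<S>)) U H \<S>"
    by (rule expand_cong[OF assms(1)]) (subst forced_mean_expand2, auto simp: one_def)
  then show ?thesis using forced_mean_expand[OF assms(1), of p f] by (simp add: expand_add expand_cmult)
qed

text \<open>w f(w - 1) is the sum, over the triangles present, of f of the number of the others;
  each summand is then evaluated by forcing its triangle.\<close>

lemma size_bias:
  "bern (pairs {..<n}) p (\<lambda>E. real (copies (triples n) E) * f (copies (triples n) E - 1)) =
   (\<Sum>S\<in>triples n. p ^ 3 * forced_mean n p (pairs S) (triples n - {S}) f)"
proof -
  let ?P = "pairs {..<n}" and ?A = "triples n"
  have "bern ?P p (\<lambda>E. real (copies ?A E) * f (copies ?A E - 1)) =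
     bern ?P p (\<lambda>E. \<Sum>S\<in>?A. if pairs S \<subseteq> E then f (copies (?A - {S}) E) else 0)"
  proof (rule bern_cong)
    fix E
    have "(\<Sum>S\<in>?A. if pairs S \<subseteq> E then f (copies (?A - {S}) E) else 0) = 
       (\<Sum>S\<in>{S\<in>?A. pairs S \<subseteq> E}. f (copies (?A - {S}) E))"
      by (simp add: sum.inter_filter)
    also have "\<dots> = (\<Sum>S\<in>{S\<in>?A. pairs S \<subseteq> E}. f (copies ?A E - 1))"
      by (rule sum.cong) (use copies_remove[of ?A] in auto)
    finally show "real (copies ?A E) * f (copies ?A E - 1) = (\<Sum>S\<in>?A. if pairs S \<subseteq> E then f (copies (?A - {S}) E) else 0)"
      by (simp add: copies_def)
  qed
  also have "\<dots> = (\<Sum>S\<in>?A. p ^ 3 * forced_mean n p (pairs S) (?A - {S}) f)"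
    unfolding bern_sum
  proof (rule sum.cong[OF refl])
    fix S assume S: "S \<in> ?A"
    then have "pairs S \<subseteq> ?P" by (intro pairs_mono) (auto simp: triples_def)
    then show "bern ?P p (\<lambda>E. if pairs S \<subseteq> E then f (copies (?A - {S}) E) else 0) = p ^ 3 * forced_mean n p (pairs S) (?A - {S}) f"
      using S by (simp add: bern_cond finite_pairs card_pairs_triple forced_mean_def)
  qed
  finally show ?thesis .
qed

section \<open>Weights of the triangles near a vertex set\<close>

lemma inj_insert_outside:
  assumes "\<And>e. e \<in> A \<Longrightarrow> e \<subseteq> U" "B \<inter> U = {}"
  shows "inj_on (\<lambda>(e, v). insert v e) (A \<times> B)"
proof (rule inj_onI, clarsimp)
  fix e v e' v' assume *: "e \<in> A" "v \<in> B" "e' \<in> A" "v' \<in> B" "insert v e = insert v' e'"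
  have **: "v \<notin> U" "v' \<notin> U" "e \<subseteq> U" "e' \<subseteq> U" using assms * by auto
  then have "e = insert v e \<inter> U" "e' = insert v' e' \<inter> U" by auto
  then have "e = e'" using *(5) by simp
  then show "e = e' \<and> v = v'" using ** *(5) by auto
qed

lemma near2_eq:
  assumes "U \<subseteq> {..<n}"
  shows "{S \<in> triples n. card (S \<inter> U) = 2} = (\<lambda>(e, v). insert v e) ` (pairs U \<times> ({..<n} - U))"
proof (intro set_eqI iffI)
  fix S assume S: "S \<in> {S \<in> triples n. card (S \<inter> U) = 2}"
  then have "card (S - U) = 1" using tripleD[of S n] card_Diff_subset_Int[of S U] by auto
  then obtain v where v: "S - U = {v}" by (auto simp: card_1_singleton_iff)
  have "S = insert v (S \<inter> U)" using v by auto
  moreover have "S \<inter> U \<in> pairs U" using S by (auto simp: pairs_def)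
  moreover have "v \<in> {..<n} - U" using v S tripleD[of S n] by auto
  ultimately show "S \<in> (\<lambda>(e, v). insert v e) ` (pairs U \<times> ({..<n} - U))" by (intro image_eqI[of _ _ "(S \<inter> U, v)"]) auto
next
  fix S assume "S \<in> (\<lambda>(e, v). insert v e) ` (pairs U \<times> ({..<n} - U))"
  then obtain e v where ev: "S = insert v e" "e \<subseteq> U" "card e = 2" "v < n" "v \<notin> U" by (auto simp: pairs_def)
  have "finite e" using ev(3) card.infinite by fastforce
  moreover have "insert v e \<inter> U = e" "v \<notin> e" using ev by auto
  ultimately show "S \<in> {S \<in> triples n. card (S \<inter> U) = 2}" using ev assms by (auto simp: triples_def)
qed

lemma card_near2:
  assumes "U \<subseteq> {..<n}"
  shows "card {S \<in> triples n. card (S \<inter> U) = 2} = (card U choose 2) * (n - card U)"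
proof -
  have fin: "finite U" using assms finite_subset by blast
  have "card {S \<in> triples n. card (S \<inter> U) = 2} = card (pairs U \<times> ({..<n} - U))"
    unfolding near2_eq[OF assms] by (rule card_image, rule inj_insert_outside[of _ U]) (auto simp: pairs_def)
  also have "\<dots> = (card U choose 2) * (n - card U)"
    using assms fin by (simp add: card_cartesian_product card_pairs card_Diff_subset)
  finally show ?thesis .
qed

lemma near3_eq: "U \<subseteq> {..<n} \<Longrightarrow> {S \<in> triples n. card (S \<inter> U) = 3} = {S. S \<subseteq> U \<and> card S = 3}"
proof (intro set_eqI iffI)
  fix S assume S: "S \<in> {S \<in> triples n. card (S \<inter> U) = 3}"
  then have "finite S" "card S = 3" "card (S \<inter> U) = 3" using tripleD[of S n] by auto
  then have "S \<inter> U = S" by (metis Int_lower1 card_subset_eq)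
  then show "S \<in> {S. S \<subseteq> U \<and> card S = 3}" using S by (auto simp: triples_def)
qed (auto simp: triples_def Int_absorb2)

lemma card_near3: "U \<subseteq> {..<n} \<Longrightarrow> card {S \<in> triples n. card (S \<inter> U) = 3} = card U choose 3"
  by (simp add: near3_eq) (metis n_subsets finite_lessThan finite_subset)

lemma near_split:
  "near U (triples n) = {S \<in> triples n. card (S \<inter> U) = 2} \<union> {S \<in> triples n. card (S \<inter> U) = 3}"
proof -
  have "card (S \<inter> U) \<le> 3" if "S \<in> triples n" for S
    using tripleD[OF that] card_mono[of S "S \<inter> U"] by auto
  then show ?thesis by (force simp: near_def)
qed

lemma card_near:
  assumes "U \<subseteq> {..<n}"
  shows "card (near U (triples n)) = (card U choose 2) * (n - card U) + (card U choose 3)"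
  unfolding near_split 
  by (subst card_Un_disjoint) (use assms card_near2 card_near3 in auto)

text \<open>Two vertices in \<open>U\<close> span only one edge that can already be forced, so
  completing the triangle costs a factor of at most \<open>p\<^sup>2\<close>.\<close>

lemma card_pairs_diff_near2:
  assumes "S \<in> triples n" "card (S \<inter> U) = 2" "H \<subseteq> pairs U"
  shows "2 \<le> card (pairs S - H)"
proof -
  have fin: "finite S" using tripleD[OF assms(1)] by simp
  have "card (pairs S \<inter> H) \<le> card (pairs S \<inter> pairs U)"
    using assms fin by (intro card_mono) (auto intro: finite_pairs)
  also have "\<dots> = 1" using fin assms(2) by (simp add: pairs_Int card_pairs choose_two)
  finally show ?thesis using card_Diff_subset_Int[of "pairs S" H] card_pairs_triple[OF assms(1)] fin
    by (simp add: finite_pairs)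
qed

definition ext_weight :: "real \<Rightarrow> nat set \<Rightarrow> nat set set \<Rightarrow> nat set set \<Rightarrow> real" where
  "ext_weight p U H \<S> = (\<Sum>S\<in>near U \<S>. p ^ card (pairs S - H))"

lemma expand_one:
  assumes "valid_state n U H \<S>"
  shows "expand n p (\<lambda>_ _ _. 1) U H \<S> = ext_weight p U H \<S> - real (card (near U (triples n))) * p ^ 3"
proof -
  have fin: "finite (near U \<S>)" using valid_stateD[OF assms] by simp
  show ?thesis unfolding expand_def Let_def ext_weight_def mult_1_right sum_enum[OF fin, where g="\<lambda>S. p ^ card (pairs S - H)"]
    by (simp add: length_enum)
qed

text \<open>\<open>\<theta>\<close> bounds the weights of the forced triangles with all vertices in \<open>U\<close>.\<close>
lemma ext_weight_le:
  fixes p \<theta> :: real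
  assumes "0 \<le> p" "p \<le> 1" "valid_state n U H \<S>" 
    and "\<And>S. S \<in> \<S> \<Longrightarrow> S \<subseteq> U \<Longrightarrow> p ^ card (pairs S - H) \<le> \<theta>" "0 \<le> \<theta>"
  shows "ext_weight p U H \<S> \<le> real (card U choose 2) * real n * p\<^sup>2 + real (card U choose 3) * \<theta>"
proof -
  note v = valid_stateD[OF assms(3)]
  let ?A = "{S \<in> triples n. card (S \<inter> U) = 2} \<inter> \<S>" and ?B = "{S \<in> triples n. card (S \<inter> U) = 3} \<inter> \<S>"
  have near: "near U \<S> = ?A \<union> ?B"
    using v near_split[of U n] by (auto simp: near_def set_eq_iff)
  have "ext_weight p U H \<S> = (\<Sum>S\<in>?A. p ^ card (pairs S - H)) + (\<Sum>S\<in>?B. p ^ card (pairs S - H))"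
    unfolding ext_weight_def near by (rule sum.union_disjoint) auto
  also have "(\<Sum>S\<in>?A. p ^ card (pairs S - H)) \<le> real (card ?A) * p\<^sup>2"
    by (rule sum_bounded_above) (use v card_pairs_diff_near2 assms in \<open>auto intro!: power_decreasing\<close>)
  also have "(\<Sum>S\<in>?B. p ^ card (pairs S - H)) \<le> real (card ?B) * \<theta>"
    by (rule sum_bounded_above) (use v near3_eq[of U n] assms in auto)
  also have "real (card ?A) * p\<^sup>2 \<le> real (card U choose 2) * real n * p\<^sup>2"
  proof (rule mult_right_mono)
    have "card ?A \<le> card {S \<in> triples n. card (S \<inter> U) = 2}" by (intro card_mono) auto
    also have "\<dots> \<le> (card U choose 2) * n" using v by (subst card_near2) auto
    finally show "real (card ?A) \<le> real (card U choose 2) * real n" by (metis of_nat_le_iff of_nat_mult)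
  qed simp
  also have "real (card ?B) * \<theta> \<le> real (card U choose 3) * \<theta>"
  proof (rule mult_right_mono)
    have "card ?B \<le> card {S \<in> triples n. card (S \<inter> U) = 3}" by (intro card_mono) auto
    also have "\<dots> = card U choose 3" using v by (subst card_near3) auto
    finally have "card ?B \<le> card U choose 3" .
    then show "real (card ?B) \<le> (card U choose 3)" by simp
  qed (use assms in auto)
  finally show ?thesis by simp
qed

text \<open>The two sums get separate bounds: \<open>B\<close> can exploit the structure of the
  children that keep \<open>H\<close>, whereas each term of the subtracted sum carries
  \<open>p ^ 3\<close>, so that a crude uniform \<open>B'\<close> is enough.\<close>

lemma expand_abs_le:
  fixes p B B' :: real
  assumes "0 \<le> p" "valid_state n U H \<S>"
    and \<Phi>: "\<And>j. j < length (enum (near U \<S>)) \<Longrightarrow> 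
     \<bar>\<Phi> (U \<union> enum (near U \<S>) ! j) (H \<union> pairs (enum (near U \<S>) ! j)) (\<S> - set (take (Suc j) (enum (near U \<S>))))\<bar> \<le> B"
    "\<And>U' H' \<S>'. valid_state n U' H' \<S>' \<Longrightarrow> card U' \<le> Suc (card U) \<Longrightarrow> \<bar>\<Phi> U' H' \<S>'\<bar> \<le> B'"
  shows "\<bar>expand n p \<Phi> U H \<S>\<bar> \<le> ext_weight p U H \<S> * B + card (near U (triples n)) * p ^ 3 * B'"
proof -
  note v = valid_stateD[OF assms(2)]
  have U: "U \<subseteq> {..<n}" using v by auto
  let ?xs = "enum (near U \<S>)" and ?ys = "enum (near U (triples n))"
  let ?X = "\<lambda>j. \<Phi> (U \<union> ?xs ! j) (H \<union> pairs (?xs ! j)) (\<S> - set (take (Suc j) ?xs))"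
  let ?Y = "\<lambda>j. \<Phi> (U \<union> ?ys ! j) (pairs (?ys ! j)) (triples n - set (take (Suc j) ?ys))"
  have "\<bar>expand n p \<Phi> U H \<S>\<bar> \<le> \<bar>\<Sum>j<length ?xs. p ^ card (pairs (?xs ! j) - H) * ?X j\<bar> + \<bar>\<Sum>j<length ?ys. p ^ 3 * ?Y j\<bar>"
    unfolding expand_def Let_def by (rule abs_triangle_ineq4)
  also have "\<bar>\<Sum>j<length ?xs. p ^ card (pairs (?xs ! j) - H) * ?X j\<bar> \<le> (\<Sum>j<length ?xs. p ^ card (pairs (?xs ! j) - H) * B)"
    using \<Phi>(1) assms(1) by (intro order_trans[OF sum_abs] sum_mono) (auto simp: abs_mult intro!: mult_left_mono)
  also have "\<dots> = ext_weight p U H \<S> * B"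
    unfolding ext_weight_def sum_distrib_right
    by (rule sum_enum[where g="\<lambda>S. p ^ card (pairs S - H) * B"]) (use v in simp)
  also have "\<bar>\<Sum>j<length ?ys. p ^ 3 * ?Y j\<bar> \<le> (\<Sum>j<length ?ys. p ^ 3 * B')"
    using \<Phi>(2) valid_state_child'(1,2)[OF U] assms(1)
    by (intro order_trans[OF sum_abs] sum_mono) (auto simp: abs_mult intro!: mult_left_mono)
  also have "\<dots> = card (near U (triples n)) * p ^ 3 * B'"
    by (simp add: length_enum)
  finally show ?thesis by simp
qed

lemma choose_small: "k \<le> 5 \<Longrightarrow> k choose 2 \<le> 10 \<and> k choose 3 \<le> 10"
proof -
  assume "k \<le> 5"
  then consider "k = 0" | "k = 1" | "k = 2" | "k = 3" | "k = 4" | "k = 5" by linarith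
  then show ?thesis by cases (simp_all add: eval_nat_numeral)
qed

lemma card_near_le:
  assumes "U \<subseteq> {..<n}" "card U \<le> 5"
  shows "real (card (near U (triples n))) \<le> 10 * n + 10"
proof -
  have "card (near U (triples n)) \<le> 10 * n + 10"
    unfolding card_near[OF assms(1)] using choose_small[OF assms(2)] by (intro add_mono mult_mono) auto
  then have "real (card (near U (triples n))) \<le> real (10 * n + 10)" by (rule of_nat_mono)
  then show ?thesis by simp
qed

text \<open>For states about which nothing is known: the at most ten triples inside \<open>U\<close>
  may already be fully forced and weigh up to 1, hence the summand 1 beside n p^2.\<close>

lemma expand_abs_le_crude:
  fixes p B :: real
  assumes p: "0 \<le> p" "p \<le> 1" and v: "valid_state n U H \<S>" and k: "card U \<le> 5"
    and \<Phi>: "\<And>U' H' \<S>'. valid_state n U' H' \<S>' \<Longrightarrow> card U' \<le> Suc (card U) \<Longrightarrow> \<bar>\<Phi> U' H' \<S>'\<bar> \<le> B"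
  shows "\<bar>expand n p \<Phi> U H \<S>\<bar> \<le> 20 * (n * p\<^sup>2 + 1) * B"
proof -
  have U: "U \<subseteq> {..<n}" using valid_stateD[OF v] by auto
  have B: "0 \<le> B" using \<Phi>[OF v] by linarith
  have "\<bar>expand n p \<Phi> U H \<S>\<bar> \<le> ext_weight p U H \<S> * B + card (near U (triples n)) * p ^ 3 * B"
    by (rule expand_abs_le[OF p(1) v]) (use \<Phi> valid_state_child[OF v] in auto)
  also have "\<dots> = (ext_weight p U H \<S> + card (near U (triples n)) * p ^ 3) * B" by (simp add: algebra_simps)
  also have "ext_weight p U H \<S> \<le> real (card U choose 2) * real n * p\<^sup>2 + real (card U choose 3) * 1"
    by (rule ext_weight_le) (use p v in \<open>auto intro: power_le_one\<close>)
  also have "\<dots> \<le> 10 * n * p\<^sup>2 + 10"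
  proof -
    have "real (card U choose 2) \<le> 10" "real (card U choose 3) \<le> 10" using choose_small[OF k] by simp_all
    then have "real (card U choose 2) * (real n * p\<^sup>2) \<le> 10 * (real n * p\<^sup>2)" "real (card U choose 3) \<le> 10"
      by (auto intro!: mult_right_mono)
    then show ?thesis by (simp add: mult.assoc)
  qed
  also have "card (near U (triples n)) * p ^ 3 \<le> (10 * n + 10) * p ^ 3"
    using card_near_le[OF U k] p by (intro mult_right_mono) auto
  also have "\<dots> \<le> 10 * n * p\<^sup>2 + 10"
  proof -
    have "p ^ 3 \<le> p\<^sup>2" "p ^ 3 \<le> 1" using p by (auto intro: power_decreasing power_le_one)
    then have "10 * n * p ^ 3 \<le> 10 * n * p\<^sup>2" by (intro mult_left_mono) auto
    then show ?thesis using \<open>p ^ 3 \<le> 1\<close> by (simp add: algebra_simps)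
  qed
  finally show ?thesis using B by (simp add: algebra_simps mult_right_mono)
qed

section \<open>The first two steps of the expansion from one triangle\<close>

context
  fixes n :: nat and p :: real and T :: "nat set"
  assumes p: "0 \<le> p" "p \<le> 1" and T: "T \<in> triples n"
begin

lemma T_facts: "finite T" "card T = 3" "T \<subseteq> {..<n}" "3 \<le> n"
proof -
  show *: "finite T" "card T = 3" "T \<subseteq> {..<n}" using tripleD[OF T] by auto
  show "3 \<le> n" using card_mono[of "{..<n}" T] * by simp
qed

lemma T_valid_state: "valid_state n T (pairs T) (triples n - {T})"
  using T T_facts unfolding valid_state_def near_def by auto

lemma near_T: "near T (triples n - {T}) = {S \<in> triples n. card (S \<inter> T) = 2}"
proof -
  have ne: "card (S \<inter> T) \<noteq> 3" if "S \<in> triples n" "S \<noteq> T" for S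
  proof
    assume "card (S \<inter> T) = 3"
    then have "S \<subseteq> T" "card S = 3" using near3_eq[OF T_facts(3)] that by blast+
    then show False using that T_facts card_subset_eq by metis
  qed
  have "near T (triples n - {T}) = near T (triples n) - {T}" by (auto simp: near_def)
  also have "\<dots> = {S \<in> triples n. card (S \<inter> T) = 2}"
    unfolding near_split using ne T_facts by (auto simp del: One_nat_def)
  finally show ?thesis .
qed

text \<open>Each of the three edges of \<open>T\<close> can be completed by \<open>n - 3\<close>
  outside vertices. If \<open>T\<close> itself has not been removed it is near itself, hence the
  extra 1.\<close>

lemma card_near_T: "card (near T (triples n - {T})) = 3 * (n - 3)" "card (near T (triples n)) = 3 * (n - 3) + 1"
  unfolding near_T card_near2[OF T_facts(3)] card_near[OF T_facts(3)] using T_facts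
  by (simp_all add: choose_two)

lemma card_pairs_near_T: "S \<in> near T (triples n - {T}) \<Longrightarrow> card (pairs S - pairs T) = 2"
proof -
  assume "S \<in> near T (triples n - {T})"
  then have S: "S \<in> triples n" "card (S \<inter> T) = 2" by (auto simp: near_T)
  have fin: "finite S" using tripleD[OF S(1)] by simp
  have "card (pairs S \<inter> pairs T) = 1" using fin S by (simp add: pairs_Int card_pairs choose_two)
  then show ?thesis using card_Diff_subset_Int[of "pairs S" "pairs T"] card_pairs_triple[OF S(1)] fin
    by (simp add: finite_pairs)
qed

lemma ext_weight_T: "ext_weight p T (pairs T) (triples n - {T}) = 3 * (real n - 3) * p\<^sup>2"
proof -
  have "ext_weight p T (pairs T) (triples n - {T}) = (\<Sum>S\<in>near T (triples n - {T}). p\<^sup>2)"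
    unfolding ext_weight_def by (rule sum.cong) (use card_pairs_near_T in auto)
  then show ?thesis using card_near_T T_facts by (simp add: of_nat_diff)
qed

lemma expand_one_T: "expand n p (\<lambda>_ _ _. 1) T (pairs T) (triples n - {T}) = 3 * (real n - 3) * (p\<^sup>2 - p ^ 3) - p ^ 3"
  unfolding expand_one[OF T_valid_state] ext_weight_T card_near_T using T_facts by (simp add: of_nat_diff algebra_simps)

private abbreviation (input) "xs \<equiv> enum (near T (triples n - {T}))"

context
  fixes j :: nat
  assumes j: "j < 3 * (n - 3)"
begin

private abbreviation (input) "U1 \<equiv> T \<union> xs ! j"
private abbreviation (input) "H1 \<equiv> pairs T \<union> pairs (xs ! j)"
private abbreviation (input) "\<S>1 \<equiv> triples n - {T} - set (take (Suc j) xs)"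

lemma len: "length xs = 3 * (n - 3)" "distinct xs" "set xs = near T (triples n - {T})"
  using card_near_T by (simp_all add: length_enum enum)

lemma x_facts: "xs ! j \<in> triples n" "card (xs ! j \<inter> T) = 2" "card U1 = 4" "finite (xs ! j)" "card (xs ! j) = 3" "xs ! j \<subseteq> {..<n}"
proof -
  have "xs ! j \<in> near T (triples n - {T})" using len j nth_mem by metis
  then show x: "xs ! j \<in> triples n" "card (xs ! j \<inter> T) = 2" by (auto simp: near_T)
  show x2: "finite (xs ! j)" "card (xs ! j) = 3" "xs ! j \<subseteq> {..<n}" using tripleD[OF x(1)] by auto
  show "card U1 = 4" using card_Un_Int[of T "xs ! j"] x x2 T_facts by (simp add: Int_commute)
qed

lemma child_valid_state: "valid_state n U1 H1 \<S>1"
  using valid_state_child(1)[OF T_valid_state] j len by simp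

text \<open>The gain over the crude bound: \<open>T\<close> and \<open>xs ! j\<close> are no longer
  counted, and every other triple within their four vertices uses the one missing edge, so it weighs
  at most \<open>p\<close> instead of 1. The coefficients 6 and 4 are 4 choose 2 and 4 choose
  3.\<close>

lemma ext_weight_child_le: "ext_weight p U1 H1 \<S>1 \<le> 6 * n * p\<^sup>2 + 4 * p"
proof -
  have "ext_weight p U1 H1 \<S>1 \<le> real (card U1 choose 2) * real n * p\<^sup>2 + real (card U1 choose 3) * p"
  proof (rule ext_weight_le[where \<theta> = p, OF p child_valid_state _ p(1)])
    fix S assume S: "S \<in> \<S>1" "S \<subseteq> U1"
    then have S3: "S \<in> triples n" "S \<noteq> T" by auto
    have "xs ! j \<in> set (take (Suc j) xs)" using j len by (auto simp: take_Suc_conv_app_nth)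
    then have Sx: "S \<noteq> xs ! j" using S by auto
    \<comment> \<open>\<open>S\<close> has a vertex outside \<open>T\<close> and a vertex outside
      \<open>xs ! j\<close>; the edge between these two lies in neither triangle.\<close>
    obtain v where v: "v \<in> S" "v \<notin> T" using S3 T_facts tripleD[OF S3(1)] card_subset_eq[of T S] by auto
    obtain w where w: "w \<in> S" "w \<notin> xs ! j" using S3 Sx x_facts tripleD[OF S3(1)] card_subset_eq[of "xs ! j" S] by auto
    have "v \<noteq> w" using v w S by auto
    then have "{v, w} \<in> pairs S - H1" using v w by simp
    moreover have "finite (pairs S - H1)" using tripleD[OF S3(1)] by (simp add: finite_pairs)
    ultimately have "1 \<le> card (pairs S - H1)" by (metis One_nat_def Suc_leI card_gt_0_iff empty_iff)
    then have "p ^ card (pairs S - H1) \<le> p ^ 1" using p by (intro power_decreasing) auto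
    then show "p ^ card (pairs S - H1) \<le> p" by simp
  qed
  then show ?thesis using x_facts by (simp add: eval_nat_numeral)
qed

text \<open>Two disjoint supplies of near triangles of weight at least \<open>p\<^sup>2\<close>:
  those sharing an edge with \<open>T\<close> that come later in the list than
  \<open>xs ! j\<close>, and those joining one of the two new edges of \<open>xs ! j\<close> to a
  fifth vertex.\<close>

lemma ext_weight_child_ge: "(real (3 * (n - 3)) - j - 1 + 2 * (real n - 4)) * p\<^sup>2 \<le> ext_weight p U1 H1 \<S>1"
proof -
  let ?x = "xs ! j"
  obtain v where v: "v \<in> ?x" "v \<notin> T"
    using x_facts T_facts card_subset_eq[of T ?x] by (metis Int_absorb2 numeral_eq_iff semiring_norm(88) subsetI verit_eq_simplify(14))
  obtain a b where ab: "?x \<inter> T = {a, b}" "a \<noteq> b" using x_facts(2) by (auto simp: card_2_iff)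
  let ?A1 = "set (drop (Suc j) xs)"
  let ?E = "{{v, a}, {v, b}}"
  let ?A2 = "(\<lambda>(e, w). insert w e) ` (?E \<times> ({..<n} - U1))"
  have U1: "U1 \<subseteq> {..<n}" "finite U1" using x_facts T_facts by auto
  have EU: "?E \<subseteq> pairs U1" "?E \<subseteq> pairs ?x" using v ab by auto
  have A2n: "?A2 \<subseteq> {S \<in> triples n. card (S \<inter> U1) = 2}"
    unfolding near2_eq[OF U1(1)] using EU by (intro image_mono) auto
  have A2T: "card (S \<inter> T) = 1" if "S \<in> ?A2" for S
  proof -
    have "S \<inter> T = {a} \<or> S \<inter> T = {b}" using that v ab by auto
    then show ?thesis by auto
  qed
  have A1n: "?A1 \<subseteq> near T (triples n - {T})" using len set_drop_subset by metis
  then have A1T: "S \<in> triples n" "card (S \<inter> T) = 2" "S \<noteq> T" if "S \<in> ?A1" for S 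
  proof -
    have "S \<in> near T (triples n - {T})" using that A1n by blast
    then show "S \<in> triples n" "card (S \<inter> T) = 2" "S \<noteq> T" unfolding near_T using T_facts by auto
  qed
  have disj: "?A1 \<inter> ?A2 = {}"
  proof (rule equals0I)
    fix S assume "S \<in> ?A1 \<inter> ?A2"
    then have "card (S \<inter> T) = 2" "card (S \<inter> T) = 1" using A1T(2)[of S] A2T[of S] by blast+
    then show False by simp
  qed
  have dt: "set (take (Suc j) xs) \<inter> ?A1 = {}" using len(2) by (metis append_take_drop_id distinct_append)
  have tk: "set (take (Suc j) xs) \<subseteq> near T (triples n - {T})" using len set_take_subset by metis
  have sub1: "?A1 \<subseteq> near U1 \<S>1"
  proof
    fix S assume S: "S \<in> ?A1"
    then have "S \<in> \<S>1" using dt A1T(1,3)[OF S] by blast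
    moreover have "card (S \<inter> T) \<le> card (S \<inter> U1)" using U1 by (intro card_mono) auto
    ultimately show "S \<in> near U1 \<S>1" using A1T(2)[OF S] by (simp add: near_def)
  qed
  have sub2: "?A2 \<subseteq> near U1 \<S>1"
  proof
    fix S assume S: "S \<in> ?A2"
    then have S': "S \<in> triples n" "card (S \<inter> U1) = 2" using A2n by blast+
    have "S \<notin> near T (triples n - {T})" using A2T[OF S] by (auto simp: near_def)
    moreover have "S \<noteq> T" using A2T[OF S] T_facts by auto
    ultimately have "S \<in> \<S>1" using S' tk by blast
    then show "S \<in> near U1 \<S>1" using S' by (simp add: near_def)
  qed
  have c1: "card ?A1 = 3 * (n - 3) - Suc j" using len by (simp add: distinct_card)
  have c2: "card ?A2 = 2 * (n - 4)"
  proof -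
    have "card ?A2 = card (?E \<times> ({..<n} - U1))"
      by (rule card_image, rule inj_insert_outside[of _ U1]) (use EU in \<open>auto simp: pairs_def\<close>)
    also have "card ?E = 2" using ab v by (auto simp: doubleton_eq_iff)
    ultimately show ?thesis using U1 x_facts(3) by (simp add: card_cartesian_product card_Diff_subset)
  qed
  have "real (card (?A1 \<union> ?A2)) * p\<^sup>2 = (\<Sum>S\<in>?A1 \<union> ?A2. p\<^sup>2)" by simp
  also have "\<dots> \<le> (\<Sum>S\<in>?A1 \<union> ?A2. p ^ card (pairs S - H1))"
  proof (rule sum_mono)
    fix S assume S: "S \<in> ?A1 \<union> ?A2"
    then have S3: "S \<in> triples n" using A1T(1)[of S] A2n by blast
    have fin: "finite (pairs S)" using tripleD[OF S3] by (simp add: finite_pairs)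
    have "card (pairs S - H1) \<le> 2"
    proof (cases "S \<in> ?A1")
      case True
      have "card (pairs S - H1) \<le> card (pairs S - pairs T)" using fin by (intro card_mono) auto
      then show ?thesis using card_pairs_near_T[OF subsetD[OF A1n True]] by simp
    next
      case False
      then obtain e w where ew: "S = insert w e" "e \<in> ?E" using S by auto
      have e: "e \<in> pairs S" "e \<in> H1" using ew EU by (auto simp: pairs_def)
      have "card (pairs S - H1) \<le> card (pairs S - {e})" using fin e by (intro card_mono) auto
      then show ?thesis using e fin card_pairs_triple[OF S3] by simp
    qed
    then show "p\<^sup>2 \<le> p ^ card (pairs S - H1)" using p by (intro power_decreasing)
  qed
  also have "\<dots> \<le> ext_weight p U1 H1 \<S>1" unfolding ext_weight_def
    by (rule sum_mono2) (use sub1 sub2 p in auto)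
  finally have *: "real (card (?A1 \<union> ?A2)) * p\<^sup>2 \<le> ext_weight p U1 H1 \<S>1" .
  have "card (?A1 \<union> ?A2) = 3 * (n - 3) - Suc j + 2 * (n - 4)"
    using card_Un_disjoint[OF _ _ disj] c1 c2 by simp
  \<comment> \<open>The four vertices of \<open>U1\<close> guarantee that the natural subtraction
    \<open>n - 4\<close> is not truncated.\<close>
  moreover have "4 \<le> n" using card_mono[of "{..<n}" U1] U1 x_facts by simp
  ultimately have "real (card (?A1 \<union> ?A2)) = real (3 * (n - 3)) - j - 1 + 2 * (real n - 4)"
    using j by (simp add: of_nat_diff)
  then show ?thesis using * by metis
qed

lemma expand_child_ge: "(real (3 * (n - 3)) - j - 1 + 2 * (real n - 4)) * p\<^sup>2 - (10 * n + 10) * p ^ 3 \<le> expand n p (\<lambda>_ _ _. 1) U1 H1 \<S>1"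
proof -
  have "real (card (near U1 (triples n))) * p ^ 3 \<le> (10 * n + 10) * p ^ 3"
    by (intro mult_right_mono card_near_le) (use x_facts T_facts p in auto)
  then show ?thesis unfolding expand_one[OF child_valid_state] using ext_weight_child_ge by linarith
qed

lemma expand_child_le:
  assumes "\<And>U' H' \<S>'. valid_state n U' H' \<S>' \<Longrightarrow> card U' \<le> 5 \<Longrightarrow> \<bar>\<Phi> U' H' \<S>'\<bar> \<le> B"
  shows "\<bar>expand n p \<Phi> U1 H1 \<S>1\<bar> \<le> (20 * n * p\<^sup>2 + 20 * p) * B"
proof -
  have B: "0 \<le> B" using assms[OF T_valid_state] T_facts by (metis abs_ge_zero numeral_le_iff order_trans semiring_norm(68) semiring_norm(72) semiring_norm(73))
  have "\<bar>expand n p \<Phi> U1 H1 \<S>1\<bar> \<le> ext_weight p U1 H1 \<S>1 * B + card (near U1 (triples n)) * p ^ 3 * B"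
    by (rule expand_abs_le[OF p(1) child_valid_state]) (use assms valid_state_child[OF child_valid_state] x_facts(3) in auto)
  also have "\<dots> = (ext_weight p U1 H1 \<S>1 + card (near U1 (triples n)) * p ^ 3) * B" by (simp add: algebra_simps)
  also have "\<dots> \<le> ((6 * n * p\<^sup>2 + 4 * p) + (10 * n * p\<^sup>2 + 10 * p)) * B"
  proof (intro mult_right_mono add_mono B ext_weight_child_le)
    have "card (near U1 (triples n)) * p ^ 3 \<le> (10 * n + 10) * p ^ 3"
      by (intro mult_right_mono card_near_le) (use x_facts T_facts p in auto)
    also have "\<dots> \<le> 10 * n * p\<^sup>2 + 10 * p"
    proof -
      have "p ^ 3 \<le> p\<^sup>2" "p ^ 3 \<le> p ^ 1" using p by (intro power_decreasing; simp)+
      then have "10 * n * p ^ 3 \<le> 10 * n * p\<^sup>2" "p ^ 3 \<le> p" by (simp_all add: mult_left_mono)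
      then show ?thesis by (simp add: algebra_simps)
    qed
    finally show "card (near U1 (triples n)) * p ^ 3 \<le> 10 * n * p\<^sup>2 + 10 * p" .
  qed
  also have "\<dots> \<le> (20 * n * p\<^sup>2 + 20 * p) * B" using p by (intro mult_right_mono B) (auto simp: algebra_simps)
  finally show ?thesis .
qed

end

lemma expand_expand_T_le:
  assumes "\<And>U' H' \<S>'. valid_state n U' H' \<S>' \<Longrightarrow> card U' \<le> 5 \<Longrightarrow> \<bar>\<Phi> U' H' \<S>'\<bar> \<le> B"
  shows "\<bar>expand n p (expand n p \<Phi>) T (pairs T) (triples n - {T})\<bar> \<le>
    (3 * n * p\<^sup>2 * (20 * n * p\<^sup>2 + 20 * p) + 80 * n * p ^ 3 * (n * p\<^sup>2 + 1)) * B"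
proof -
  have B: "0 \<le> B" using assms[OF T_valid_state] T_facts by (metis abs_ge_zero numeral_le_iff order_trans semiring_norm(68) semiring_norm(72) semiring_norm(73))
  have "\<bar>expand n p (expand n p \<Phi>) T (pairs T) (triples n - {T})\<bar> \<le>
     ext_weight p T (pairs T) (triples n - {T}) * ((20 * n * p\<^sup>2 + 20 * p) * B) + card (near T (triples n)) * p ^ 3 * (20 * (n * p\<^sup>2 + 1) * B)"
  proof (rule expand_abs_le[OF p(1) T_valid_state])
    fix j assume "j < length xs"
    then have "j < 3 * (n - 3)" using card_near_T by (simp add: length_enum)
    then show "\<bar>expand n p \<Phi> (T \<union> xs ! j) (pairs T \<union> pairs (xs ! j)) (triples n - {T} - set (take (Suc j) xs))\<bar>
         \<le> (20 * n * p\<^sup>2 + 20 * p) * B"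
      using expand_child_le assms by blast
  next
    fix U' H' \<S>' assume "valid_state n U' H' \<S>'" "card U' \<le> Suc (card T)"
    then show "\<bar>expand n p \<Phi> U' H' \<S>'\<bar> \<le> 20 * (n * p\<^sup>2 + 1) * B"
      using T_facts by (intro expand_abs_le_crude[OF p]) (auto intro: assms)
  qed
  also have "\<dots> \<le> (3 * n * p\<^sup>2) * ((20 * n * p\<^sup>2 + 20 * p) * B) + (4 * n) * p ^ 3 * (20 * (n * p\<^sup>2 + 1) * B)"
    unfolding ext_weight_T card_near_T
    by (intro add_mono mult_right_mono) (use B p T_facts in \<open>auto simp: of_nat_diff\<close>)
  also have "\<dots> = (3 * n * p\<^sup>2 * (20 * n * p\<^sup>2 + 20 * p) + 80 * n * p ^ 3 * (n * p\<^sup>2 + 1)) * B"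
    by (simp add: algebra_simps)
  finally show ?thesis .
qed

text \<open>With m = 3 (n - 3), summing over \<open>j\<close> yields m (m - 1) / 2 from the later
  triangles on \<open>T\<close> and 2 (n - 4) m from the new edges, together 9/2 + 6 times n^2 to
  leading order. What counts later is that this exceeds 9, the square of the leading constant 3 in
  \<Gamma>_2 / \<mu>.\<close>

lemma expand_expand_one_T_ge:
  "expand n p (expand n p (\<lambda>_ _ _. 1)) T (pairs T) (triples n - {T}) \<ge> 
    p ^ 4 * (3 * (real n - 3) * (3 * (real n - 3) - 1) / 2 + 6 * (real n - 3) * (real n - 4)) 
    - 3 * n * p\<^sup>2 * ((10 * n + 10) * p ^ 3) - 80 * n * p ^ 3 * (n * p\<^sup>2 + 1)"
proof -
  let ?one = "\<lambda>_ _ _. 1::real"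
  let ?ys = "enum (near T (triples n))"
  let ?X = "\<lambda>j. expand n p ?one (T \<union> xs ! j) (pairs T \<union> pairs (xs ! j)) (triples n - {T} - set (take (Suc j) xs))"
  let ?Y = "\<lambda>j. expand n p ?one (T \<union> ?ys ! j) (pairs (?ys ! j)) (triples n - set (take (Suc j) ?ys))"
  let ?m = "3 * (n - 3)"
  have l: "length xs = ?m" using card_near_T by (simp add: length_enum)
  have pw: "p ^ card (pairs (xs ! j) - pairs T) = p\<^sup>2" if "j < ?m" for j
    using that l card_pairs_near_T[of "xs ! j"] nth_mem[of j xs] by (simp add: enum)
  have "(\<Sum>j<length ?ys. p ^ 3 * ?Y j) \<le> (\<Sum>j<length ?ys. p ^ 3 * (20 * (n * p\<^sup>2 + 1) * 1))"
  proof (intro sum_mono mult_left_mono)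
    fix j assume "j \<in> {..<length ?ys}"
    then have "valid_state n (T \<union> ?ys ! j) (pairs (?ys ! j)) (triples n - set (take (Suc j) ?ys))" "card (T \<union> ?ys ! j) \<le> Suc (card T)"
      using valid_state_child'[OF T_facts(3)] by auto
    then have "\<bar>?Y j\<bar> \<le> 20 * (n * p\<^sup>2 + 1) * 1"
      using T_facts by (intro expand_abs_le_crude[OF p]) auto
    then show "?Y j \<le> 20 * (n * p\<^sup>2 + 1) * 1" by linarith
  qed (use p in auto)
  also have "\<dots> = real (?m + 1) * p ^ 3 * (20 * (n * p\<^sup>2 + 1))" using card_near_T by (simp add: length_enum)
  also have "\<dots> \<le> (4 * n) * p ^ 3 * (20 * (n * p\<^sup>2 + 1))"
    by (intro mult_right_mono) (use p T_facts in auto)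
  finally have Y: "(\<Sum>j<length ?ys. p ^ 3 * ?Y j) \<le> 80 * n * p ^ 3 * (n * p\<^sup>2 + 1)" by (simp add: algebra_simps)
  have "(\<Sum>j<?m. p\<^sup>2 * ((real ?m - j - 1 + 2 * (real n - 4)) * p\<^sup>2 - (10 * n + 10) * p ^ 3)) \<le> 
     (\<Sum>j<?m. p ^ card (pairs (xs ! j) - pairs T) * ?X j)"
  proof (intro sum_mono)
    fix j assume j: "j \<in> {..<?m}"
    then show "p\<^sup>2 * ((real ?m - j - 1 + 2 * (real n - 4)) * p\<^sup>2 - (10 * n + 10) * p ^ 3) \<le> p ^ card (pairs (xs ! j) - pairs T) * ?X j"
      using expand_child_ge[of j] pw[of j] p by (simp only: lessThan_iff) (intro mult_left_mono, auto)
  qed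
  moreover have "(\<Sum>j<?m. p\<^sup>2 * ((real ?m - j - 1 + 2 * (real n - 4)) * p\<^sup>2 - (10 * n + 10) * p ^ 3)) = 
     p ^ 4 * (\<Sum>j<?m. real ?m - real j - 1) + p ^ 4 * (?m * (2 * (real n - 4))) - ?m * p\<^sup>2 * ((10 * n + 10) * p ^ 3)"
  proof -
    have "(\<Sum>j<?m. p\<^sup>2 * ((real ?m - j - 1 + 2 * (real n - 4)) * p\<^sup>2 - (10 * n + 10) * p ^ 3)) = 
      (\<Sum>j<?m. p ^ 4 * (real ?m - real j - 1) + (p ^ 4 * (2 * (real n - 4)) - p\<^sup>2 * ((10 * n + 10) * p ^ 3)))"
      by (rule sum.cong) (simp_all add: algebra_simps power2_eq_square power4_eq_xxxx)
    also have "\<dots> = p ^ 4 * (\<Sum>j<?m. real ?m - real j - 1) + ?m * (p ^ 4 * (2 * (real n - 4)) - p\<^sup>2 * ((10 * n + 10) * p ^ 3))"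
      unfolding sum.distrib sum_distrib_left[symmetric] by simp
    finally show ?thesis by (simp add: right_diff_distrib mult_ac)
  qed
  moreover have sums: "(\<Sum>j<m. real m - real j - 1) = real m * (real m - 1) / 2" for m :: nat
  proof -
    have "(\<Sum>j<m. real j) = real m * (real m - 1) / 2"
      by (induction m) (auto simp: field_simps)
    moreover have "(\<Sum>j<m. real m - real j - 1) = real m * real m - (\<Sum>j<m. real j) - real m"
      by (simp add: sum_subtractf)
    ultimately show ?thesis by (simp add: field_simps)
  qed
  moreover have "?m * p\<^sup>2 * ((10 * n + 10) * p ^ 3) \<le> (3 * n) * p\<^sup>2 * ((10 * n + 10) * p ^ 3)"
    by (intro mult_right_mono) (use p in auto)
  moreover have rm: "real ?m = 3 * (real n - 3)" using T_facts by (simp add: of_nat_diff)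
  moreover have "p ^ 4 * (\<Sum>j<?m. real ?m - real j - 1) + p ^ 4 * (?m * (2 * (real n - 4))) =
    p ^ 4 * (3 * (real n - 3) * (3 * (real n - 3) - 1) / 2 + 6 * (real n - 3) * (real n - 4))"
    unfolding sums[of ?m] unfolding rm by (simp add: algebra_simps)
  ultimately have "p ^ 4 * (3 * (real n - 3) * (3 * (real n - 3) - 1) / 2 + 6 * (real n - 3) * (real n - 4)) 
    - 3 * n * p\<^sup>2 * ((10 * n + 10) * p ^ 3) \<le> (\<Sum>j<?m. p ^ card (pairs (xs ! j) - pairs T) * ?X j)"
    by linarith
  moreover have "expand n p (expand n p ?one) T (pairs T) (triples n - {T}) = 
     (\<Sum>j<?m. p ^ card (pairs (xs ! j) - pairs T) * ?X j) - (\<Sum>j<length ?ys. p ^ 3 * ?Y j)"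
    unfolding expand_def[of n p "expand n p ?one"] Let_def l ..
  ultimately show ?thesis using Y by linarith
qed

end

lemma forced_mean_const_fun: "forced_mean n p H \<S> (\<lambda>_. c) = c"
  unfolding forced_mean_def by (simp add: bern_const finite_pairs)

section \<open>Factorial cumulants of the triangle count\<close>

definition wmean :: "nat \<Rightarrow> real \<Rightarrow> (nat \<Rightarrow> real) \<Rightarrow> real" where
  "wmean n p f = bern (pairs {..<n}) p (\<lambda>E. f (copies (triples n) E))"

lemma wmean_eq_forced_mean: "wmean n p f = forced_mean n p {} (triples n) f"
  unfolding wmean_def forced_mean_def by simp

lemma expectation_bernoulli_set:
  assumes "finite A" "0 \<le> p" "p \<le> 1"
  shows "measure_pmf.expectation (Pi_pmf A False (\<lambda>_. bernoulli_pmf p)) (\<lambda>f. g {e \<in> A. f e}) = bern A p g"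
proof -
  let ?M = "Pi_pmf A False (\<lambda>_. bernoulli_pmf p)"
  let ?h = "\<lambda>E x. x \<in> E"
  have inj: "inj_on ?h (Pow A)" by (auto simp: inj_on_def fun_eq_iff)
  have "measure_pmf.expectation ?M (\<lambda>f. g {e \<in> A. f e}) = (\<Sum>f\<in>?h ` Pow A. pmf ?M f *\<^sub>R g {e \<in> A. f e})"
  proof (rule integral_measure_pmf)
    fix f assume "f \<in> set_pmf ?M"
    then have "\<forall>x. x \<notin> A \<longrightarrow> \<not> f x" using set_Pi_pmf_subset[OF assms(1)] by fastforce
    then have "f = ?h {x. f x}" "{x. f x} \<in> Pow A" by auto
    then show "f \<in> ?h ` Pow A" by blast
  qed (use assms in auto)
  also have "\<dots> = (\<Sum>E\<in>Pow A. pmf ?M (?h E) * g {e \<in> A. ?h E e})"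
    by (simp add: sum.reindex[OF inj])
  also have "\<dots> = bern A p g" unfolding bern_def
  proof (rule sum.cong[OF refl])
    fix E assume E: "E \<in> Pow A"
    have "pmf ?M (?h E) = (\<Prod>x\<in>A. pmf (bernoulli_pmf p) (x \<in> E))"
      using assms E by (subst pmf_Pi') auto
    also have "\<dots> = (\<Prod>x\<in>E. p) * (\<Prod>x\<in>A - E. 1 - p)"
      using assms E by (subst prod.subset_diff[of E A]) (auto simp: mult.commute)
    finally have "pmf ?M (?h E) = p ^ card E * (1 - p) ^ card (A - E)" by simp
    moreover have "{e \<in> A. ?h E e} = E" using E by auto
    ultimately show "pmf ?M (?h E) * g {e \<in> A. ?h E e} = p ^ card E * (1 - p) ^ card (A - E) * g E" by simp
  qed
  finally show ?thesis .
qed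

lemma expectation_triangle_count:
  assumes "0 \<le> p" "p \<le> 1"
  shows "measure_pmf.expectation (triangle_count_pmf n p) f = wmean n p f"
proof -
  have tr: "card (triangles n E) = copies (triples n) E" for E
    unfolding triangles_def copies_def triples_def by (rule arg_cong[where f=card]) auto
  show ?thesis
    unfolding triangle_count_pmf_def gnp_pmf_def wmean_def integral_map_pmf tr
    by (rule expectation_bernoulli_set) (use assms in \<open>auto intro: finite_pairs\<close>)
qed

lemma wmean_add: "wmean n p (\<lambda>w. f w + g w) = wmean n p f + wmean n p g"
  and wmean_diff: "wmean n p (\<lambda>w. f w - g w) = wmean n p f - wmean n p g"
  and wmean_cmult: "wmean n p (\<lambda>w. c * f w) = c * wmean n p f"
  and wmean_const: "wmean n p (\<lambda>w. c) = c"
  unfolding wmean_def bern_add bern_diff bern_cmult by (auto simp: bern_const finite_pairs)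

text \<open>\<open>coeff1\<close> is \<Gamma>_2 and \<open>coeff2\<close> is \<Gamma>_3 / 2, as
  \<open>Gamma2_W\<close> and \<open>Gamma3_W\<close> show.\<close>

definition coeff1 :: "nat \<Rightarrow> real \<Rightarrow> real" where
  "coeff1 n p = (\<Sum>T\<in>triples n. p ^ 3 * expand n p (\<lambda>_ _ _. 1) T (pairs T) (triples n - {T}))"

definition coeff2 :: "nat \<Rightarrow> real \<Rightarrow> real" where
  "coeff2 n p = (\<Sum>T\<in>triples n. p ^ 3 * expand n p (expand n p (\<lambda>_ _ _. 1)) T (pairs T) (triples n - {T}))"

text \<open>The bound obtained in \<open>expand_expand_T_le\<close>. With x = n p^2 it equals 60 x^2
  + 60 x p + 80 x p (x + 1), so it is of order x^2 for bounded x as soon as p is at most of order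
  x.\<close>

definition excess :: "nat \<Rightarrow> real \<Rightarrow> real" where
  "excess n p = 3 * n * p\<^sup>2 * (20 * n * p\<^sup>2 + 20 * p) + 80 * n * p ^ 3 * (n * p\<^sup>2 + 1)"

text \<open>The first two steps contribute \<open>excess\<close>, of order x^2; the third only adds
  a bounded factor from the crude bound, which is enough. The third differences must be small in
  every state on up to six vertices, not just for the original graph.\<close>

lemma wmean_expansion:
  assumes p: "0 \<le> p" "p \<le> 1"
    and B: "\<And>U H \<S>. valid_state n U H \<S> \<Longrightarrow> card U \<le> 6 \<Longrightarrow> \<bar>forced_mean n p H \<S> (fwd_diff (fwd_diff (fwd_diff f)))\<bar> \<le> B"
  shows "\<bar>wmean n p (\<lambda>w. real w * f (w - 1)) - real (n choose 3) * p ^ 3 * wmean n p f 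
     - coeff1 n p * wmean n p (fwd_diff f) - coeff2 n p * wmean n p (fwd_diff (fwd_diff f))\<bar> \<le>
     real (n choose 3) * p ^ 3 * (excess n p * (20 * (n * p\<^sup>2 + 1) * B))"
proof -
  let ?one = "\<lambda>_ _ _. 1::real"
  let ?R = "\<lambda>T. expand n p (expand n p (expand n p (\<lambda>U H \<S>. forced_mean n p H \<S> (fwd_diff (fwd_diff (fwd_diff f)))))) T (pairs T) (triples n - {T})"
  have "wmean n p (\<lambda>w. real w * f (w - 1)) = 
    (\<Sum>T\<in>triples n. p ^ 3 * (wmean n p f + expand n p ?one T (pairs T) (triples n - {T}) * wmean n p (fwd_diff f)
       + expand n p (expand n p ?one) T (pairs T) (triples n - {T}) * wmean n p (fwd_diff (fwd_diff f)) + ?R T))"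
    unfolding wmean_def[of n p "\<lambda>w. real w * f (w - 1)"] size_bias wmean_eq_forced_mean[symmetric]
    unfolding wmean_eq_forced_mean
    by (intro sum.cong refl arg_cong2[where f="(*)"] forced_mean_expand3 T_valid_state[OF p])
  also have "\<dots> = (\<Sum>T\<in>triples n. p ^ 3 * wmean n p f + p ^ 3 * expand n p ?one T (pairs T) (triples n - {T}) * wmean n p (fwd_diff f)
       + p ^ 3 * expand n p (expand n p ?one) T (pairs T) (triples n - {T}) * wmean n p (fwd_diff (fwd_diff f)) + p ^ 3 * ?R T)"
    by (simp add: distrib_left mult.assoc)
  also have "\<dots> = real (n choose 3) * p ^ 3 * wmean n p f + coeff1 n p * wmean n p (fwd_diff f) + coeff2 n p * wmean n p (fwd_diff (fwd_diff f))
     + (\<Sum>T\<in>triples n. p ^ 3 * ?R T)"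
    unfolding sum.distrib coeff1_def coeff2_def sum_distrib_right by (simp add: card_triples)
  finally have "\<bar>wmean n p (\<lambda>w. real w * f (w - 1)) - real (n choose 3) * p ^ 3 * wmean n p f 
     - coeff1 n p * wmean n p (fwd_diff f) - coeff2 n p * wmean n p (fwd_diff (fwd_diff f))\<bar> = \<bar>\<Sum>T\<in>triples n. p ^ 3 * ?R T\<bar>"
    by simp
  also have "\<dots> \<le> (\<Sum>T\<in>triples n. p ^ 3 * (excess n p * (20 * (n * p\<^sup>2 + 1) * B)))"
  proof (rule order_trans[OF sum_abs], rule sum_mono)
    fix T assume T: "T \<in> triples n"
    have "\<bar>expand n p (\<lambda>U H \<S>. forced_mean n p H \<S> (fwd_diff (fwd_diff (fwd_diff f)))) U H \<S>\<bar> \<le> 20 * (n * p\<^sup>2 + 1) * B"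
      if "valid_state n U H \<S>" "card U \<le> 5" for U H \<S>
      using that by (intro expand_abs_le_crude[OF p]) (auto intro: B)
    from expand_expand_T_le[OF p T this] have "\<bar>?R T\<bar> \<le> excess n p * (20 * (n * p\<^sup>2 + 1) * B)"
      by (simp add: excess_def)
    then show "\<bar>p ^ 3 * ?R T\<bar> \<le> p ^ 3 * (excess n p * (20 * (n * p\<^sup>2 + 1) * B))"
      using p by (auto simp: abs_mult intro!: mult_left_mono)
  qed
  also have "\<dots> = real (n choose 3) * p ^ 3 * (excess n p * (20 * (n * p\<^sup>2 + 1) * B))"
    by (simp add: card_triples)
  finally show ?thesis .
qed

text \<open>For polynomials of degree at most two the remainder vanishes, as \<open>B = 0\<close> is
  allowed; the resulting identity reads off the cumulants.\<close>

lemma wmean_expansion_exact: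
  assumes p: "0 \<le> p" "p \<le> 1" and "fwd_diff (fwd_diff (fwd_diff f)) = (\<lambda>_. 0)"
  shows "wmean n p (\<lambda>w. real w * f (w - 1)) = real (n choose 3) * p ^ 3 * wmean n p f 
     + coeff1 n p * wmean n p (fwd_diff f) + coeff2 n p * wmean n p (fwd_diff (fwd_diff f))"
  using wmean_expansion[OF p, of n f 0] assms(3) by (simp add: forced_mean_const_fun)

context
  fixes n :: nat and p :: real and W :: "nat pmf"
  assumes p: "0 \<le> p" "p \<le> 1" 
  defines "W \<equiv> triangle_count_pmf n p"
begin

lemma mean_W: "mean W = real (n choose 3) * p ^ 3" "moment W 1 = mean W"
proof -
  show "moment W 1 = mean W" by (simp add: moment_def mean_def)
  have f: "fwd_diff (\<lambda>_. 1) = (\<lambda>_. 0)" "fwd_diff (\<lambda>_. 0) = (\<lambda>_. 0)" by (auto simp: fwd_diff_def fun_eq_iff)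
  have "wmean n p (\<lambda>w. real w * 1) = real (n choose 3) * p ^ 3 * wmean n p (\<lambda>_. 1) 
     + coeff1 n p * wmean n p (\<lambda>_. 0) + coeff2 n p * wmean n p (\<lambda>_. 0)"
    using wmean_expansion_exact[OF p, of "\<lambda>_. 1" n] by (simp only: f)
  then
  show "mean W = real (n choose 3) * p ^ 3"
    unfolding mean_def W_def expectation_triangle_count[OF p] by (simp add: wmean_const)
qed

lemma moment_W: "moment W j = wmean n p (\<lambda>w. real w ^ j)"
  unfolding moment_def W_def expectation_triangle_count[OF p] ..

text \<open>The exact expansion with test function w; \<open>Gamma3_W\<close> uses w^2 in the same
  way. The truncation in \<open>w - 1\<close> is harmless because of the factor w.\<close>

lemma Gamma2_W: "Gamma2 W = coeff1 n p"
proof -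
  have f: "fwd_diff (\<lambda>w. real w) = (\<lambda>_. 1)" "fwd_diff (\<lambda>_. 1) = (\<lambda>_. 0)" "fwd_diff (\<lambda>_. 0) = (\<lambda>_. 0)"
    by (auto simp: fwd_diff_def fun_eq_iff)
  have "wmean n p (\<lambda>w. real w * real (w - 1)) = mean W * wmean n p real + coeff1 n p"
    using wmean_expansion_exact[OF p, of real n] by (simp add: f wmean_const mean_W)
  moreover have "(\<lambda>w::nat. real w * real (w - 1)) = (\<lambda>w. real w ^ 2 - real w ^ 1)"
  proof
    fix w show "real w * real (w - 1) = real w ^ 2 - real w ^ 1" by (cases w) (auto simp: power2_eq_square algebra_simps)
  qed
  ultimately have "moment W 2 - moment W 1 = mean W * moment W 1 + coeff1 n p"
    by (simp add: wmean_diff moment_W)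
  then show ?thesis unfolding Gamma2_def mean_W(2) by (simp add: power2_eq_square)
qed

lemma Gamma3_W: "Gamma3 W = 2 * coeff2 n p"
proof -
  have f: "fwd_diff (\<lambda>w. real w ^ 2) = (\<lambda>w. 2 * real w + 1)" "fwd_diff (\<lambda>w. 2 * real w + 1) = (\<lambda>_. 2)" "fwd_diff (\<lambda>_. 2) = (\<lambda>_. 0)"
    by (auto simp: fwd_diff_def fun_eq_iff power2_eq_square algebra_simps)
  have "wmean n p (\<lambda>w. real w * real (w - 1) ^ 2) = mean W * wmean n p (\<lambda>w. real w ^ 2) 
    + coeff1 n p * wmean n p (\<lambda>w. 2 * real w + 1) + coeff2 n p * 2"
    using wmean_expansion_exact[OF p, of "\<lambda>w. real w ^ 2" n] by (simp only: f wmean_const mean_W)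
  moreover have "(\<lambda>w::nat. real w * real (w - 1) ^ 2) = (\<lambda>w. real w ^ 3 - 2 * real w ^ 2 + real w ^ 1)"
  proof
    fix w show "real w * real (w - 1) ^ 2 = real w ^ 3 - 2 * real w ^ 2 + real w ^ 1" 
      by (cases w) (auto simp: power2_eq_square power3_eq_cube algebra_simps)
  qed
  moreover have "wmean n p (\<lambda>w. 2 * real w + 1) = 2 * moment W 1 + 1"
    unfolding wmean_add wmean_cmult wmean_const moment_W by simp
  ultimately have "moment W 3 - 2 * moment W 2 + moment W 1 = mean W * moment W 2 + coeff1 n p * (2 * mean W + 1) + coeff2 n p * 2"
    by (simp only: wmean_add wmean_diff wmean_cmult moment_W mean_W(2)[symmetric])
  moreover have "coeff1 n p = moment W 2 - (mean W)\<^sup>2 - mean W" 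
    using Gamma2_W by (simp only: Gamma2_def mean_W(2))
  ultimately show ?thesis unfolding Gamma3_def mean_W(2)
    by (simp only: power2_eq_square power3_eq_cube) (simp add: algebra_simps)
qed

lemma var_W: "var W = mean W + Gamma2 W"
proof -
  have "finite (set_pmf (Pi_pmf (pairs {..<n}) False (\<lambda>_. bernoulli_pmf p)))"
    by (rule finite_subset[OF set_Pi_pmf_subset']) (auto intro!: finite_PiE_dflt simp: finite_pairs)
  then have "finite (set_pmf W)" unfolding W_def triangle_count_pmf_def gnp_pmf_def by simp
  then have "integrable (measure_pmf W) f" for f :: "nat \<Rightarrow> real" by (rule integrable_measure_pmf_finite)
  then have "var W = moment W 2 - (mean W)\<^sup>2"
    unfolding var_def moment_def mean_def by (subst measure_pmf.variance_eq) auto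
  then show ?thesis by (simp only: Gamma2_def mean_W(2))
qed

lemma Gamma2_W_eq: 
  assumes "3 \<le> n"
  shows "Gamma2 W = mean W * (3 * (real n - 3) * (p\<^sup>2 - p ^ 3) - p ^ 3)"
  unfolding Gamma2_W coeff1_def mean_W(1) using expand_one_T[OF p] by (simp add: card_triples)

lemma Gamma3_W_ge:
  "Gamma3 W \<ge> 2 * mean W * (p ^ 4 * (3 * (real n - 3) * (3 * (real n - 3) - 1) / 2 + 6 * (real n - 3) * (real n - 4)) 
    - 3 * n * p\<^sup>2 * ((10 * n + 10) * p ^ 3) - 80 * n * p ^ 3 * (n * p\<^sup>2 + 1))" (is "_ \<ge> 2 * mean W * ?b")
proof -
  have "mean W * ?b = (\<Sum>T\<in>triples n. p ^ 3 * ?b)" by (simp add: mean_W card_triples)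
  also have "\<dots> \<le> coeff2 n p" unfolding coeff2_def
    using expand_expand_one_T_ge[OF p] p by (intro sum_mono mult_left_mono) auto
  finally show ?thesis by (simp add: Gamma3_W)
qed

lemma Gamma3_W_le: "\<bar>Gamma3 W\<bar> \<le> 2 * mean W * excess n p"
proof -
  have "\<bar>coeff2 n p\<bar> \<le> (\<Sum>T\<in>triples n. p ^ 3 * (excess n p * 1))" unfolding coeff2_def
  proof (rule order_trans[OF sum_abs], rule sum_mono)
    fix T assume T: "T \<in> triples n"
    show "\<bar>p ^ 3 * expand n p (expand n p (\<lambda>_ _ _. 1)) T (pairs T) (triples n - {T})\<bar> \<le> p ^ 3 * (excess n p * 1)"
      using expand_expand_T_le[OF p T, of "\<lambda>_ _ _. 1" 1] p unfolding excess_def by (auto simp: abs_mult intro!: mult_left_mono)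
  qed
  then show ?thesis by (simp add: Gamma3_W mean_W card_triples)
qed

end

section \<open>Smoothing by isolated triangles\<close>

text \<open>The edges of a triangle of \<open>B\<close> that is isolated in this sense lie in no other triangle of \<open>B\<close>,
  so under a thinning of \<open>B\<close> the surviving isolated triangles are independent of the rest of the
  count.\<close>
definition isolated :: "nat \<Rightarrow> nat set \<Rightarrow> nat set set \<Rightarrow> nat set set" where
  "isolated n U B = {T \<in> triples n. T \<inter> U = {} \<and> pairs T \<subseteq> B \<and>
     (\<forall>v\<in>{..<n} - T. card {a \<in> T. {v, a} \<in> B} \<le> 1)}"

lemma finite_isolated [simp]: "finite (isolated n U B)"
  unfolding isolated_def by simp

text \<open>A triangle sharing the edge {a, b} with \<open>T\<close> has an apex outside
  \<open>T\<close> joined to both a and b, which isolation forbids. Those two edges cannot come from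
  \<open>H\<close>, because \<open>T\<close> avoids \<open>U\<close>.\<close>

lemma isolated_edge_disjoint:
  assumes T: "T \<in> isolated n U B" and H: "H \<subseteq> pairs U" and S: "S \<in> triples n" "pairs S \<subseteq> B \<union> H" "S \<noteq> T"
  shows "pairs S \<inter> pairs T = {}"
proof (rule ccontr)
  assume "pairs S \<inter> pairs T \<noteq> {}"
  then obtain e where e: "e \<in> pairs S" "e \<in> pairs T" by auto
  then obtain a b where ab: "e = {a, b}" "a \<noteq> b" by (auto simp: pairs_def card_2_iff)
  have abST: "a \<in> S" "b \<in> S" "a \<in> T" "b \<in> T" using e ab by auto
  have T': "T \<in> triples n" "T \<inter> U = {}" using T by (auto simp: isolated_def)
  have "\<not> S \<subseteq> T" using S tripleD[OF S(1)] tripleD[OF T'(1)] card_subset_eq[of T S] by auto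
  then obtain v where v: "v \<in> S" "v \<notin> T" by auto
  have vn: "v \<in> {..<n} - T" using v tripleD[OF S(1)] by auto
  have "{v, a} \<in> pairs S" "{v, b} \<in> pairs S" using v abST by auto
  moreover have "{v, a} \<notin> H" "{v, b} \<notin> H" using H T'(2) abST by (auto simp: pairs_def)
  ultimately have "{v, a} \<in> B" "{v, b} \<in> B" using S(2) by blast+
  then have "{a, b} \<subseteq> {a \<in> T. {v, a} \<in> B}" using abST by auto
  moreover have "finite T" using tripleD[OF T'(1)] by simp
  ultimately have "card {a, b} \<le> card {a \<in> T. {v, a} \<in> B}" by (intro card_mono) auto
  moreover have "card {a \<in> T. {v, a} \<in> B} \<le> 1" using T vn by (auto simp: isolated_def)
  ultimately show False using ab by simp
qed

lemma isolated_disjoint: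
  assumes "S \<in> isolated n U B" "T \<in> isolated n U B" "S \<noteq> T"
  shows "pairs S \<inter> pairs T = {}"
  by (rule isolated_edge_disjoint[OF assms(2), of "{}"]) (use assms in \<open>auto simp: isolated_def\<close>)

text \<open>Disjoint blocks survive whole independently of each other. For the three edges of a
  triangle and \<open>q = 1/2\<close> this gives the 1/8 used throughout.\<close>

lemma bern_blocks:
  assumes "finite I" "disjoint_family_on A I" "\<And>i. i \<in> I \<Longrightarrow> finite (A i) \<and> card (A i) = k"
  shows "bern (\<Union>i\<in>I. A i) q (\<lambda>F. g {i \<in> I. A i \<subseteq> F}) = bern I (q ^ k) g"
  using assms
proof (induction I arbitrary: g rule: finite_induct)
  case (insert i I)
  let ?D = "\<Union>j\<in>I. A j"
  have dis: "A i \<inter> ?D = {}" using insert by (force simp: disjoint_family_on_def)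
  have fin: "finite (A i)" "finite ?D" using insert by auto
  have dI: "disjoint_family_on A I" using insert by (auto simp: disjoint_family_on_def)
  let ?X = "bern I (q ^ k) (\<lambda>J. g (insert i J))" and ?Y = "bern I (q ^ k) g"
  have "bern (\<Union>j\<in>insert i I. A j) q (\<lambda>F. g {j \<in> insert i I. A j \<subseteq> F}) = 
     bern (A i) q (\<lambda>E. bern ?D q (\<lambda>F. g {j \<in> insert i I. A j \<subseteq> E \<union> F}))"
    using bern_union[OF fin dis] by simp
  also have "\<dots> = bern (A i) q (\<lambda>E. ?Y + (?X - ?Y) * (if A i \<subseteq> E then 1 else 0))"
  proof (rule bern_cong)
    fix E assume E: "E \<subseteq> A i"
    have sub: "A j \<subseteq> E \<union> F \<longleftrightarrow> A j \<subseteq> F" if "j \<in> I" for j F using that E dis by auto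
    have "bern ?D q (\<lambda>F. g {j \<in> insert i I. A j \<subseteq> E \<union> F}) = 
       bern ?D q (\<lambda>F. (\<lambda>J. if A i \<subseteq> E then g (insert i J) else g J) {j \<in> I. A j \<subseteq> F})"
    proof (rule bern_cong)
      fix F assume F: "F \<subseteq> ?D"
      have i: "A i \<subseteq> E \<union> F \<longleftrightarrow> A i \<subseteq> E" using dis F by blast
      show "g {j \<in> insert i I. A j \<subseteq> E \<union> F} = (\<lambda>J. if A i \<subseteq> E then g (insert i J) else g J) {j \<in> I. A j \<subseteq> F}"
      proof (cases "A i \<subseteq> E")
        case True
        then have "{j \<in> insert i I. A j \<subseteq> E \<union> F} = insert i {j \<in> I. A j \<subseteq> F}" using sub i by auto
        then show ?thesis using True by simp
      next
        case False
        then have "{j \<in> insert i I. A j \<subseteq> E \<union> F} = {j \<in> I. A j \<subseteq> F}" using sub i by auto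
        then show ?thesis using False by simp
      qed
    qed
    also have "\<dots> = bern I (q ^ k) (\<lambda>J. if A i \<subseteq> E then g (insert i J) else g J)"
      by (rule insert.IH) (use insert dI in auto)
    finally show "bern ?D q (\<lambda>F. g {j \<in> insert i I. A j \<subseteq> E \<union> F}) = ?Y + (?X - ?Y) * (if A i \<subseteq> E then 1 else 0)"
      by simp
  qed
  also have "\<dots> = ?Y + (?X - ?Y) * q ^ k"
    unfolding bern_add bern_cmult using fin insert by (simp add: bern_const bern_subset)
  finally show ?case using insert by (simp add: bern_insert algebra_simps)
qed simp

text \<open>Condition on what survives outside the isolated triangles. The count is then a constant
  plus the number of surviving isolated triangles, each kept independently with probability 1/8. The
  constant is the unknown shift \<open>r\<close>, over which the hypothesis is uniform.\<close>

lemma bern_half_le: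
  assumes v: "valid_state n U H \<S>" and B: "B \<subseteq> pairs {..<n}"
    and M: "\<And>r. \<bar>bern (isolated n U B) (1/8) (\<lambda>J. f (r + card J))\<bar> \<le> M"
  shows "\<bar>bern B (1/2) (\<lambda>E. f (copies \<S> (E \<union> H)))\<bar> \<le> M"
proof -
  note v' = valid_stateD[OF v]
  let ?I = "isolated n U B"
  let ?D = "\<Union>T\<in>?I. pairs T"
  have DB: "?D \<subseteq> B" by (auto simp: isolated_def)
  have finB: "finite B" using B finite_subset finite_pairs by (metis finite_lessThan)
  \<comment> \<open>Triples missing from \<open>\<S>\<close> are near \<open>U\<close>, whereas
    isolated triangles avoid \<open>U\<close>; so all of the latter are still counted.\<close>
  have IS: "?I \<subseteq> \<S>"
  proof
    fix T assume "T \<in> ?I"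
    then have "T \<in> triples n" "T \<inter> U = {}" by (auto simp: isolated_def)
    then show "T \<in> \<S>" using v by (auto simp: valid_state_def near_def)
  qed
  have cnt_eq: "copies \<S> ((E \<union> F) \<union> H) = copies (\<S> - ?I) (E \<union> H) + card {T \<in> ?I. pairs T \<subseteq> F}"
    if "E \<subseteq> B - ?D" "F \<subseteq> ?D" for E F
  proof -
    have 1: "pairs T \<subseteq> (E \<union> F) \<union> H \<longleftrightarrow> pairs T \<subseteq> F" if "T \<in> ?I" for T
    proof -
      have "pairs T \<inter> E = {}" using that(1) \<open>E \<subseteq> B - ?D\<close> by auto
      moreover have "T \<inter> U = {}" using that by (auto simp: isolated_def)
      then have "pairs T \<inter> pairs U = {}" by (simp add: pairs_Int pairs_eq_empty)
      ultimately show ?thesis using v' by blast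
    qed
    have 2: "pairs S \<subseteq> (E \<union> F) \<union> H \<longleftrightarrow> pairs S \<subseteq> E \<union> H" if "S \<in> \<S> - ?I" for S
    proof
      assume "pairs S \<subseteq> (E \<union> F) \<union> H"
      moreover from this have "pairs S \<subseteq> B \<union> H" using \<open>E \<subseteq> B - ?D\<close> \<open>F \<subseteq> ?D\<close> DB by blast
      then have "pairs S \<inter> pairs T = {}" if "T \<in> ?I" for T
        using isolated_edge_disjoint[OF that, of H S] v' \<open>S \<in> \<S> - ?I\<close> that by blast
      ultimately show "pairs S \<subseteq> E \<union> H" using \<open>F \<subseteq> ?D\<close> by blast
    qed auto
    have "{S \<in> \<S>. pairs S \<subseteq> (E \<union> F) \<union> H} = {S \<in> \<S> - ?I. pairs S \<subseteq> E \<union> H} \<union> {T \<in> ?I. pairs T \<subseteq> F}"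
      using 1 2 IS by blast
    then show ?thesis unfolding copies_def using v' by (subst card_Un_disjoint[symmetric]) auto
  qed
  have "bern B (1/2) (\<lambda>E. f (copies \<S> (E \<union> H))) = bern ((B - ?D) \<union> ?D) (1/2) (\<lambda>E. f (copies \<S> (E \<union> H)))"
    using DB by (simp add: Un_absorb2)
  also have "\<dots> = bern (B - ?D) (1/2) (\<lambda>E. bern ?D (1/2) (\<lambda>F. f (copies \<S> ((E \<union> F) \<union> H))))"
    by (rule bern_union) (use finB finite_subset[OF DB finB] in auto)
  also have "\<dots> = bern (B - ?D) (1/2) (\<lambda>E. bern ?D (1/2) (\<lambda>F. (\<lambda>J. f (copies (\<S> - ?I) (E \<union> H) + card J)) {T \<in> ?I. pairs T \<subseteq> F}))"
    by (intro bern_cong) (simp add: cnt_eq)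
  also have "\<dots> = bern (B - ?D) (1/2) (\<lambda>E. bern ?I ((1/2) ^ 3) (\<lambda>J. f (copies (\<S> - ?I) (E \<union> H) + card J)))"
  proof (intro bern_cong bern_blocks)
    show "disjoint_family_on pairs ?I" using isolated_disjoint by (auto simp: disjoint_family_on_def)
    fix T assume "T \<in> ?I"
    then have "T \<in> triples n" by (auto simp: isolated_def)
    then show "finite (pairs T) \<and> card (pairs T) = 3" using card_pairs_triple tripleD finite_pairs by blast
  qed simp
  finally have eq: "bern B (1/2) (\<lambda>E. f (copies \<S> (E \<union> H))) = bern (B - ?D) (1/2) (\<lambda>E. bern ?I (1/8) (\<lambda>J. f (copies (\<S> - ?I) (E \<union> H) + card J)))"
    by (simp add: power3_eq_cube)
  have "\<bar>bern (B - ?D) (1/2) (\<lambda>E. bern ?I (1/8) (\<lambda>J. f (copies (\<S> - ?I) (E \<union> H) + card J)))\<bar> \<le> 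
    bern (B - ?D) (1/2) (\<lambda>E. \<bar>bern ?I (1/8) (\<lambda>J. f (copies (\<S> - ?I) (E \<union> H) + card J))\<bar>)"
    by (rule bern_abs_le) auto
  also have "\<dots> \<le> bern (B - ?D) (1/2) (\<lambda>_. M)"
    by (rule bern_mono) (use M in auto)
  also have "\<dots> = M" using finB by (simp add: bern_const)
  finally show ?thesis unfolding eq .
qed

section \<open>Mean and variance of the number of isolated triangles\<close>

lemma isolated_insert_diff_card:
  fixes a b n :: nat and B :: "nat set set"
  assumes ab: "a \<noteq> b" "a < n" "b < n" and B: "{a, b} \<notin> B"
  defines "C \<equiv> {v \<in> {..<n}. {v, a} \<in> B \<and> {v, b} \<in> B}"
  shows "\<bar>real (card (isolated n U (insert {a, b} B))) - real (card (isolated n U B))\<bar> \<le> 2 * real (card C)"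
proof -
  let ?e = "{a, b}"
  let ?I1 = "isolated n U (insert ?e B)" and ?I0 = "isolated n U B"
  have finC: "finite C" by (simp add: C_def)
  \<comment> \<open>A triangle gained must contain the new edge, since an additional edge elsewhere
    can only spoil isolation. Its apex is a common neighbour of \<open>a\<close> and
    \<open>b\<close>.\<close>
  have "?I1 - ?I0 \<subseteq> (\<lambda>v. {a, b, v}) ` C"
  proof
    fix T assume T: "T \<in> ?I1 - ?I0"
    have T0: "T \<in> ?I1" "T \<notin> ?I0" using T by blast+
    have T3: "T \<in> triples n" "pairs T \<subseteq> insert ?e B" "T \<inter> U = {}" using T0(1) by (simp_all add: isolated_def)
    have fT: "finite T" "card T = 3" "T \<subseteq> {..<n}" using tripleD[OF T3(1)] by auto
    have "?e \<in> pairs T"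
    proof (rule ccontr)
      assume "?e \<notin> pairs T"
      then have "pairs T \<subseteq> B" using T3(2) by blast
      moreover have "card {x \<in> T. {v, x} \<in> B} \<le> 1" if "v \<in> {..<n} - T" for v
      proof -
        have "card {x \<in> T. {v, x} \<in> B} \<le> card {x \<in> T. {v, x} \<in> insert ?e B}"
          using fT by (intro card_mono) auto
        also have "\<dots> \<le> 1" using T0(1) that by (simp add: isolated_def)
        finally show ?thesis .
      qed
      ultimately have "T \<in> ?I0" using T3 by (simp add: isolated_def)
      then show False using T0(2) by simp
    qed
    then have abT: "a \<in> T" "b \<in> T" by auto
    have "card (T - ?e) = 1" using fT abT ab by (simp add: card_Diff_subset)
    then obtain v where "T - ?e = {v}" by (auto simp: card_1_singleton_iff)
    then have v: "T = {a, b, v}" "v \<noteq> a" "v \<noteq> b" using abT by auto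
    have "{v, a} \<in> pairs T" "{v, b} \<in> pairs T" using v by auto
    then have "{v, a} \<in> insert ?e B" "{v, b} \<in> insert ?e B" using T3(2) by blast+
    moreover have "{v, a} \<noteq> ?e" "{v, b} \<noteq> ?e" using v(2,3) by (auto simp: doubleton_eq_iff)
    moreover have "v < n" using v(1) fT(3) by auto
    ultimately have "v \<in> C" by (simp add: C_def)
    then show "T \<in> (\<lambda>v. {a, b, v}) ` C" using v(1) by blast
  qed
  then have 1: "card (?I1 - ?I0) \<le> card C" using surj_card_le[OF finC] by blast
  \<comment> \<open>A triangle that is lost contains one end y of the new edge and another vertex x
    adjacent to both ends. Isolated triangles share no edge, so {x, y} determines the triangle, and
    each end accounts for at most \<open>card C\<close> losses.\<close>
  let ?X = "\<lambda>y. {T \<in> ?I0. \<exists>x\<in>C. {x, y} \<in> pairs T}"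
  have X: "card (?X y) \<le> card C" for y
  proof -
    have "\<forall>T\<in>?X y. \<exists>x. x \<in> C \<and> {x, y} \<in> pairs T" by blast
    then obtain f where f: "\<forall>T\<in>?X y. f T \<in> C \<and> {f T, y} \<in> pairs T" by (rule bchoice[THEN exE])
    have "inj_on f (?X y)"
    proof (rule inj_onI)
      fix S T assume *: "S \<in> ?X y" "T \<in> ?X y" "f S = f T"
      have "{f S, y} \<in> pairs S" using f *(1) by blast
      moreover have "{f S, y} \<in> pairs T" using f *(2) unfolding *(3) by blast
      ultimately have "pairs S \<inter> pairs T \<noteq> {}" by blast
      moreover have "S \<in> ?I0" "T \<in> ?I0" using * by blast+
      ultimately show "S = T" using isolated_disjoint[of S n U B T] by blast
    qed
    moreover have "f ` ?X y \<subseteq> C" using f by blast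
    ultimately show ?thesis using finC by (rule card_inj_on_le)
  qed
  have "?I0 - ?I1 \<subseteq> ?X a \<union> ?X b"
  proof
    fix T assume T: "T \<in> ?I0 - ?I1"
    have T0: "T \<in> ?I0" "T \<notin> ?I1" using T by blast+
    have T3: "T \<in> triples n" "pairs T \<subseteq> B" "T \<inter> U = {}" using T0(1) by (simp_all add: isolated_def)
    have fT: "finite T" "card T = 3" "T \<subseteq> {..<n}" using tripleD[OF T3(1)] by auto
    have "\<not> (\<forall>v\<in>{..<n} - T. card {x \<in> T. {v, x} \<in> insert ?e B} \<le> 1)"
    proof
      assume "\<forall>v\<in>{..<n} - T. card {x \<in> T. {v, x} \<in> insert ?e B} \<le> 1"
      moreover have "pairs T \<subseteq> insert ?e B" using T3(2) by blast
      ultimately have "T \<in> ?I1" using T3(1,3) unfolding isolated_def by simp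
      then show False using T0(2) by simp
    qed
    then obtain v where v: "v \<in> {..<n} - T" "\<not> card {x \<in> T. {v, x} \<in> insert ?e B} \<le> 1"
      by blast
    have c0: "card {x \<in> T. {v, x} \<in> B} \<le> 1" using T0(1) v(1) by (simp add: isolated_def)
    have "\<exists>y\<in>T. {v, y} = ?e"
    proof (rule ccontr)
      assume "\<not> (\<exists>y\<in>T. {v, y} = ?e)"
      then have "{x \<in> T. {v, x} \<in> insert ?e B} = {x \<in> T. {v, x} \<in> B}" by auto
      then show False using v c0 by simp
    qed
    then obtain y where y: "y \<in> T" "{v, y} = ?e" by blast
    have "\<not> {x \<in> T. {v, x} \<in> insert ?e B} \<subseteq> {y}"
      using v(2) card_mono[of "{y}" "{x \<in> T. {v, x} \<in> insert ?e B}"] by auto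
    then obtain x where x: "x \<in> T" "{v, x} \<in> insert ?e B" "x \<noteq> y" by auto
    have "{v, x} \<noteq> ?e" using y(2) x(3) by (metis doubleton_eq_iff)
    then have vx: "{v, x} \<in> B" using x by simp
    have xyT: "{x, y} \<in> pairs T" using x y by simp
    then have "{x, y} \<in> B" using T3 by blast
    then have "x \<in> C" using vx y(2) x(1) fT unfolding C_def
      by (auto simp: doubleton_eq_iff insert_commute)
    then have "T \<in> ?X y" using xyT T by auto
    moreover have "y = a \<or> y = b" using y(2) by (auto simp: doubleton_eq_iff)
    ultimately show "T \<in> ?X a \<union> ?X b" by auto
  qed
  then have "card (?I0 - ?I1) \<le> card (?X a \<union> ?X b)" by (intro card_mono) auto
  also have "\<dots> \<le> card (?X a) + card (?X b)" by (rule card_Un_le)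
  also have "\<dots> \<le> 2 * card C" using X[of a] X[of b] by linarith
  finally have 2: "card (?I0 - ?I1) \<le> 2 * card C" .
  have "card ?I1 \<le> card (?I0 \<union> (?I1 - ?I0))" by (intro card_mono) auto
  also have "\<dots> \<le> card ?I0 + card (?I1 - ?I0)" by (rule card_Un_le)
  finally have 3: "card ?I1 \<le> card ?I0 + card (?I1 - ?I0)" .
  have "card ?I0 \<le> card (?I1 \<union> (?I0 - ?I1))" by (intro card_mono) auto
  also have "\<dots> \<le> card ?I1 + card (?I0 - ?I1)" by (rule card_Un_le)
  finally have 4: "card ?I0 \<le> card ?I1 + card (?I0 - ?I1)" .
  show ?thesis using 1 2 3 4 by linarith
qed

text \<open>Square the sum over common neighbours: the diagonal gives at most n q^2, and two
  distinct vertices use four distinct edges, giving at most (n q^2)^2.\<close>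

lemma codegree_second_moment:
  assumes q: "0 \<le> q" "q \<le> 1" and ab: "a \<noteq> b" "a < n" "b < n"
  shows "bern (pairs {..<n}) q (\<lambda>B. (real (card {v \<in> {..<n}. {v, a} \<in> B \<and> {v, b} \<in> B}))\<^sup>2) \<le> 
    n * q\<^sup>2 + (n * q\<^sup>2)\<^sup>2"
proof -
  let ?P = "pairs {..<n}" and ?V = "{..<n} - {a, b}"
  let ?A = "\<lambda>v. {{v, a}, {v, b}}"
  have A: "?A v \<subseteq> ?P" "card (?A v) = 2" if "v \<in> ?V" for v using that ab by (auto simp: doubleton_eq_iff)
  have AA: "card (?A v \<union> ?A w) = 4" if "v \<in> ?V" "w \<in> ?V" "v \<noteq> w" for v w
  proof -
    have "?A v \<inter> ?A w = {}" using that ab by (auto simp: doubleton_eq_iff)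
    then show ?thesis using A[OF that(1)] A[OF that(2)] by (subst card_Un_disjoint) auto
  qed
  have eq: "(real (card {v \<in> {..<n}. {v, a} \<in> B \<and> {v, b} \<in> B}))\<^sup>2 = 
     (\<Sum>v\<in>?V. \<Sum>w\<in>?V. if ?A v \<union> ?A w \<subseteq> B then 1 else 0)" if B: "B \<subseteq> ?P" for B
  proof -
    have "{a} \<notin> B" "{b} \<notin> B" using B by (auto simp: pairs_def)
    then have "{v \<in> {..<n}. {v, a} \<in> B \<and> {v, b} \<in> B} = {v \<in> ?V. ?A v \<subseteq> B}" by auto
    then have "real (card {v \<in> {..<n}. {v, a} \<in> B \<and> {v, b} \<in> B}) = (\<Sum>v\<in>?V. if ?A v \<subseteq> B then 1 else 0)"
      by (simp add: sum.If_cases Int_def)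
    then have "(real (card {v \<in> {..<n}. {v, a} \<in> B \<and> {v, b} \<in> B}))\<^sup>2 = 
       (\<Sum>v\<in>?V. \<Sum>w\<in>?V. (if ?A v \<subseteq> B then 1 else 0) * (if ?A w \<subseteq> B then 1 else 0))"
      by (simp add: power2_eq_square sum_product)
    also have "\<dots> = (\<Sum>v\<in>?V. \<Sum>w\<in>?V. if ?A v \<union> ?A w \<subseteq> B then 1 else 0)"
      by (intro sum.cong) auto
    finally show ?thesis .
  qed
  have "bern ?P q (\<lambda>B. (real (card {v \<in> {..<n}. {v, a} \<in> B \<and> {v, b} \<in> B}))\<^sup>2) = 
    (\<Sum>v\<in>?V. \<Sum>w\<in>?V. bern ?P q (\<lambda>B. if ?A v \<union> ?A w \<subseteq> B then 1 else 0))"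
    unfolding bern_sum[symmetric] by (rule bern_cong) (rule eq)
  also have "\<dots> \<le> (\<Sum>v\<in>?V. \<Sum>w\<in>?V. (if v = w then q\<^sup>2 else 0) + q ^ 4)"
  proof (intro sum_mono)
    fix v w assume vw: "v \<in> ?V" "w \<in> ?V"
    have "bern ?P q (\<lambda>B. if ?A v \<union> ?A w \<subseteq> B then 1 else 0) = q ^ card (?A v \<union> ?A w)"
      using A[OF vw(1)] A[OF vw(2)] by (intro bern_subset) (auto intro: finite_pairs)
    also have "\<dots> \<le> (if v = w then q\<^sup>2 else 0) + q ^ 4"
      using AA[OF vw] A[OF vw(1)] q by (cases "v = w") auto
    finally show "bern ?P q (\<lambda>B. if ?A v \<union> ?A w \<subseteq> B then 1 else 0) \<le> (if v = w then q\<^sup>2 else 0) + q ^ 4" .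
  qed
  also have "\<dots> = real (card ?V) * q\<^sup>2 + real (card ?V) * (real (card ?V) * q ^ 4)"
    by (simp add: sum.distrib distrib_left)
  also have "\<dots> \<le> n * q\<^sup>2 + n * (n * q ^ 4)"
  proof -
    have "card ?V \<le> card {..<n}" by (intro card_mono) auto
    then have "real (card ?V) \<le> n" by simp
    then show ?thesis using q by (intro add_mono mult_mono) auto
  qed
  also have "\<dots> = n * q\<^sup>2 + (n * q\<^sup>2)\<^sup>2" by (simp add: power2_eq_square power4_eq_xxxx)
  finally show ?thesis .
qed

text \<open>Efron-Stein: toggling an edge changes the number by at most twice the codegree of its
  ends, and there are at most n^2 edges. For bounded n q^2 the variance is thus at most of order (n
  q)^3, like the mean.\<close>

lemma isolated_variance:
  fixes n :: nat and q :: real and U :: "nat set"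
  assumes q: "0 \<le> q" "q \<le> 1"
  defines "G \<equiv> \<lambda>B. real (card (isolated n U B))"
  shows "bern (pairs {..<n}) q (\<lambda>B. (G B)\<^sup>2) - (bern (pairs {..<n}) q G)\<^sup>2 \<le> 4 * real n ^ 3 * q ^ 3 * (1 + n * q\<^sup>2)"
proof -
  let ?P = "pairs {..<n}"
  have fin: "finite ?P" by (simp add: finite_pairs)
  have D: "bern ?P q (\<lambda>B. (G (insert e B) - G (B - {e}))\<^sup>2) \<le> 4 * (n * q\<^sup>2 + (n * q\<^sup>2)\<^sup>2)" if e: "e \<in> ?P" for e
  proof -
    obtain a b where ab: "e = {a, b}" "a \<noteq> b" "a < n" "b < n" using e by (auto simp: pairs_def card_2_iff)
    let ?C = "\<lambda>B. {v \<in> {..<n}. {v, a} \<in> B \<and> {v, b} \<in> B}"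
    have "bern ?P q (\<lambda>B. (G (insert e B) - G (B - {e}))\<^sup>2) \<le> bern ?P q (\<lambda>B. 4 * (real (card (?C B)))\<^sup>2)"
    proof (rule bern_mono[OF q])
      fix B assume "B \<subseteq> ?P"
      have "insert e B = insert {a, b} (B - {e})" using ab by auto
      then have "\<bar>G (insert e B) - G (B - {e})\<bar> \<le> 2 * real (card (?C (B - {e})))"
        unfolding G_def using isolated_insert_diff_card[OF ab(2-4), of "B - {e}" U] ab(1) by simp
      also have "\<dots> \<le> 2 * real (card (?C B))" by (intro mult_left_mono of_nat_mono card_mono) auto
      finally have "\<bar>G (insert e B) - G (B - {e})\<bar>\<^sup>2 \<le> (2 * real (card (?C B)))\<^sup>2" by (intro power_mono) auto
      then show "(G (insert e B) - G (B - {e}))\<^sup>2 \<le> 4 * (real (card (?C B)))\<^sup>2" by (simp add: power_mult_distrib)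
    qed
    also have "\<dots> \<le> 4 * (n * q\<^sup>2 + (n * q\<^sup>2)\<^sup>2)"
      unfolding bern_cmult by (intro mult_left_mono codegree_second_moment q ab) auto
    finally show ?thesis .
  qed
  have "bern ?P q (\<lambda>B. (G B)\<^sup>2) - (bern ?P q G)\<^sup>2 \<le> q * (1 - q) * (\<Sum>e\<in>?P. bern ?P q (\<lambda>B. (G (insert e B) - G (B - {e}))\<^sup>2))"
    by (rule efron_stein[OF q fin])
  also have "\<dots> \<le> q * 1 * (\<Sum>e\<in>?P. 4 * (n * q\<^sup>2 + (n * q\<^sup>2)\<^sup>2))"
    using q D by (intro mult_mono sum_mono sum_nonneg bern_nonneg) auto
  also have "\<dots> = q * (real (card ?P) * (4 * (n * q\<^sup>2 + (n * q\<^sup>2)\<^sup>2)))" by simp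
  also have "\<dots> \<le> q * (real n ^ 2 * (4 * (n * q\<^sup>2 + (n * q\<^sup>2)\<^sup>2)))"
  proof -
    have "card ?P \<le> n * n" by (simp add: card_pairs choose_two div_le_dividend order_trans[OF div_le_dividend])
    then have "real (card ?P) \<le> real (n * n)" by (rule of_nat_mono)
    then show ?thesis using q by (intro mult_left_mono mult_right_mono) (auto simp: power2_eq_square)
  qed
  also have "\<dots> = 4 * real n ^ 3 * q ^ 3 * (1 + n * q\<^sup>2)"
    by (simp add: power2_eq_square power3_eq_cube algebra_simps)
  finally show ?thesis .
qed

text \<open>Edges from different outside vertices to \<open>T\<close> are disjoint from each other
  and from the edges of \<open>T\<close>, so the conditions are independent. One vertex violates its
  condition with probability at most 3 q^2, by a union bound over the edges of
  \<open>T\<close>.\<close>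

lemma isolated_prob:
  assumes q: "0 \<le> q" "q \<le> 1" "3 * q\<^sup>2 \<le> 1" and T: "T \<in> triples n" "T \<inter> U = {}"
  shows "q ^ 3 * (1 - 3 * q\<^sup>2) ^ n \<le> bern (pairs {..<n}) q (\<lambda>B. if T \<in> isolated n U B then 1 else 0)"
proof -
  let ?P = "pairs {..<n}" and ?V = "{..<n} - T"
  let ?A = "\<lambda>v. (\<lambda>a. {v, a}) ` T"
  let ?g = "\<lambda>v E. if card {a \<in> T. {v, a} \<in> E} \<le> 1 then 1 else (0::real)"
  let ?f = "\<lambda>E. if pairs T \<subseteq> E then 1 else (0::real)"
  let ?D = "\<Union>v\<in>?V. ?A v"
  have fin: "finite ?P" by (simp add: finite_pairs)
  have fT: "finite T" "card T = 3" "T \<subseteq> {..<n}" using tripleD[OF T(1)] by auto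
  have A: "?A v \<subseteq> ?P" if "v \<in> ?V" for v using that fT by auto
  have dis: "disjoint_family_on ?A ?V" by (auto simp: disjoint_family_on_def doubleton_eq_iff)
  have dis2: "pairs T \<inter> ?D = {}" by auto
  have gA: "?g v (E \<inter> F) = ?g v E" if "?A v \<subseteq> F" for v E F
  proof -
    have "{a \<in> T. {v, a} \<in> E \<inter> F} = {a \<in> T. {v, a} \<in> E}" using that by auto
    then show ?thesis by simp
  qed
  have "bern ?P q (\<lambda>B. if T \<in> isolated n U B then 1 else 0) = bern ?P q (\<lambda>B. ?f (B \<inter> pairs T) * (\<lambda>F. \<Prod>v\<in>?V. ?g v (F \<inter> ?A v)) (B \<inter> ?D))"
  proof (rule bern_cong)
    fix B assume "B \<subseteq> ?P"
    have "(\<Prod>v\<in>?V. ?g v (B \<inter> ?D \<inter> ?A v)) = (\<Prod>v\<in>?V. ?g v B)"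
    proof (rule prod.cong[OF refl])
      fix v assume "v \<in> ?V"
      then have "?A v \<subseteq> ?D \<inter> ?A v" by auto
      from gA[OF this, of B] show "?g v (B \<inter> ?D \<inter> ?A v) = ?g v B" by (simp add: Int_assoc)
    qed
    also have "\<dots> = (if \<forall>v\<in>?V. card {a \<in> T. {v, a} \<in> B} \<le> 1 then 1 else 0)"
      by (auto intro!: prod.neutral prod_zero)
    finally have "(\<Prod>v\<in>?V. ?g v (B \<inter> ?D \<inter> ?A v)) = (if \<forall>v\<in>?V. card {a \<in> T. {v, a} \<in> B} \<le> 1 then 1 else 0)" .
    then show "(if T \<in> isolated n U B then 1 else 0) = ?f (B \<inter> pairs T) * (\<lambda>F. \<Prod>v\<in>?V. ?g v (F \<inter> ?A v)) (B \<inter> ?D)"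
      using T by (simp add: isolated_def)
  qed
  also have "\<dots> = bern (pairs T) q ?f * bern ?D q (\<lambda>F. \<Prod>v\<in>?V. ?g v (F \<inter> ?A v))"
    by (rule bern_indep) (use fin A dis2 pairs_mono[OF fT(3)] in auto)
  also have "bern (pairs T) q ?f = q ^ 3"
    using fT by (simp add: bern_subset finite_pairs card_pairs_triple[OF T(1)])
  also have "bern ?D q (\<lambda>F. \<Prod>v\<in>?V. ?g v (F \<inter> ?A v)) = (\<Prod>v\<in>?V. bern (?A v) q (?g v))"
    by (rule bern_prod) (use dis fT in auto)
  finally have eq: "bern ?P q (\<lambda>B. if T \<in> isolated n U B then 1 else 0) = q ^ 3 * (\<Prod>v\<in>?V. bern (?A v) q (?g v))" .
  have gv: "1 - 3 * q\<^sup>2 \<le> bern (?A v) q (?g v)" if "v \<in> ?V" for v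
  proof -
    have fA: "finite (?A v)" using fT by simp
    have inj: "inj_on (\<lambda>a. {v, a}) T" by (auto simp: inj_on_def doubleton_eq_iff)
    have "1 - 3 * q\<^sup>2 = 1 - (\<Sum>e\<in>pairs T. bern (?A v) q (\<lambda>E. if (\<lambda>a. {v, a}) ` e \<subseteq> E then 1 else 0))"
    proof -
      have "bern (?A v) q (\<lambda>E. if (\<lambda>a. {v, a}) ` e \<subseteq> E then 1 else 0) = q\<^sup>2" if e: "e \<in> pairs T" for e
      proof -
        have "e \<subseteq> T" "card e = 2" using e by (auto simp: pairs_def)
        then have "card ((\<lambda>a. {v, a}) ` e) = 2" using card_image[OF inj_on_subset[OF inj]] by auto
        then show ?thesis using bern_subset[OF fA, of "(\<lambda>a. {v, a}) ` e" q] \<open>e \<subseteq> T\<close> by (simp add: image_mono)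
      qed
      then show ?thesis using card_pairs_triple[OF T(1)] by simp
    qed
    also have "\<dots> = bern (?A v) q (\<lambda>E. 1 - (\<Sum>e\<in>pairs T. if (\<lambda>a. {v, a}) ` e \<subseteq> E then 1 else 0))"
      unfolding bern_diff bern_sum using fA by (simp add: bern_const)
    also have "\<dots> \<le> bern (?A v) q (?g v)"
    proof (rule bern_mono[OF q(1,2)])
      fix E
      show "1 - (\<Sum>e\<in>pairs T. if (\<lambda>a. {v, a}) ` e \<subseteq> E then 1 else 0) \<le> ?g v E"
      proof (cases "card {a \<in> T. {v, a} \<in> E} \<le> 1")
        case False
        then have "2 \<le> card {a \<in> T. {v, a} \<in> E}" by simp
        then obtain e where e: "e \<subseteq> {a \<in> T. {v, a} \<in> E}" "card e = 2" "finite e" by (rule obtain_subset_with_card_n)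
        then have "e \<in> pairs T" "(\<lambda>a. {v, a}) ` e \<subseteq> E" by (auto simp: pairs_def)
        then have "1 \<le> (\<Sum>e\<in>pairs T. if (\<lambda>a. {v, a}) ` e \<subseteq> E then 1 else (0::real))"
          using member_le_sum[of e "pairs T" "\<lambda>e. if (\<lambda>a. {v, a}) ` e \<subseteq> E then 1 else (0::real)"] fT by (auto simp: finite_pairs)
        then show ?thesis using False by simp
      qed (simp add: sum_nonneg)
    qed
    finally show ?thesis .
  qed
  have "(1 - 3 * q\<^sup>2) ^ n \<le> (1 - 3 * q\<^sup>2) ^ card ?V"
    using q card_mono[of "{..<n}" ?V] by (intro power_decreasing) auto
  also have "\<dots> = (\<Prod>v\<in>?V. 1 - 3 * q\<^sup>2)" by simp
  also have "\<dots> \<le> (\<Prod>v\<in>?V. bern (?A v) q (?g v))" using gv q by (intro prod_mono) auto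
  finally show ?thesis unfolding eq using q by (intro mult_left_mono) auto
qed

lemma isolated_mean:
  assumes q: "0 \<le> q" "q \<le> 1" "3 * q\<^sup>2 \<le> 1" and U: "U \<subseteq> {..<n}" "card U \<le> 6"
  shows "real ((n - 6) choose 3) * q ^ 3 * (1 - 3 * q\<^sup>2) ^ n \<le> bern (pairs {..<n}) q (\<lambda>B. real (card (isolated n U B)))"
proof -
  let ?\<T> = "{T. T \<subseteq> {..<n} - U \<and> card T = 3}"
  have fin: "finite U" using U finite_subset by auto
  have "n - 6 \<le> card ({..<n} - U)" using U fin by (simp add: card_Diff_subset)
  then have "(n - 6) choose 3 \<le> card ?\<T>"
    by (subst n_subsets) (auto intro: binomial_right_mono)
  have "real ((n - 6) choose 3) * (q ^ 3 * (1 - 3 * q\<^sup>2) ^ n) \<le> real (card ?\<T>) * (q ^ 3 * (1 - 3 * q\<^sup>2) ^ n)"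
    using \<open>(n - 6) choose 3 \<le> card ?\<T>\<close> q by (intro mult_right_mono) auto
  also have "\<dots> = (\<Sum>T\<in>?\<T>. q ^ 3 * (1 - 3 * q\<^sup>2) ^ n)" by simp
  also have "\<dots> \<le> (\<Sum>T\<in>?\<T>. bern (pairs {..<n}) q (\<lambda>B. if T \<in> isolated n U B then 1 else 0))"
    by (intro sum_mono isolated_prob q) (auto simp: triples_def)
  also have "\<dots> = bern (pairs {..<n}) q (\<lambda>B. real (card (isolated n U B)))"
    unfolding bern_sum[symmetric]
  proof (rule bern_cong)
    fix B
    have "isolated n U B = {T \<in> ?\<T>. T \<in> isolated n U B}" by (auto simp: isolated_def triples_def)
    then show "(\<Sum>T\<in>?\<T>. if T \<in> isolated n U B then 1 else 0) = real (card (isolated n U B))"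
      by (simp add: sum.If_cases Int_def)
  qed
  finally show ?thesis by (simp add: mult.assoc)
qed

text \<open>Expose the graph of density 2p first. If it has at least \<open>L / 2\<close> isolated
  triangles, averaging over the thinning gives \<open>M1\<close>; otherwise only \<open>M2\<close>
  is available. \<open>L\<close> is a lower bound for the mean number, so Chebyshev with deviation
  \<open>L / 2\<close> bounds the probability of the second case.\<close>

lemma forced_mean_smooth:
  assumes q: "0 \<le> p" "2 * p \<le> 1" "12 * p\<^sup>2 \<le> 1" and v: "valid_state n U H \<S>" "card U \<le> 6"
    and L: "0 < L" "L \<le> real ((n - 6) choose 3) * (2 * p) ^ 3 * (1 - 12 * p\<^sup>2) ^ n"
    and M: "\<And>r I. finite I \<Longrightarrow> \<bar>bern (I :: nat set set) (1/8) (\<lambda>J. f (r + card J))\<bar> \<le> M2"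
      "\<And>r I. finite I \<Longrightarrow> L / 2 \<le> card I \<Longrightarrow> \<bar>bern (I :: nat set set) (1/8) (\<lambda>J. f (r + card J))\<bar> \<le> M1"
      "0 \<le> M1" "0 \<le> M2"
  shows "\<bar>forced_mean n p H \<S> f\<bar> \<le> M1 + M2 * (128 * real n ^ 3 * p ^ 3 * (1 + 4 * n * p\<^sup>2) / L\<^sup>2)"
proof -
  let ?P = "pairs {..<n}" and ?q = "2 * p"
  let ?G = "\<lambda>B. real (card (isolated n U B))"
  have q': "0 \<le> ?q" "?q \<le> 1" using q by auto
  have fin: "finite ?P" by (simp add: finite_pairs)
  have "forced_mean n p H \<S> f = bern ?P (?q * (1/2)) (\<lambda>E. f (copies \<S> (E \<union> H)))" by (simp add: forced_mean_def)
  also have "\<dots> = bern ?P ?q (\<lambda>B. bern B (1/2) (\<lambda>E. f (copies \<S> (E \<union> H))))" by (rule bern_thin[OF fin])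
  finally have "\<bar>forced_mean n p H \<S> f\<bar> \<le> bern ?P ?q (\<lambda>B. \<bar>bern B (1/2) (\<lambda>E. f (copies \<S> (E \<union> H)))\<bar>)"
    using bern_abs_le[OF q'] by simp
  also have "\<dots> \<le> bern ?P ?q (\<lambda>B. M1 + M2 * (if ?G B < L / 2 then 1 else 0))"
  proof (rule bern_mono[OF q'])
    fix B assume B: "B \<subseteq> ?P"
    show "\<bar>bern B (1/2) (\<lambda>E. f (copies \<S> (E \<union> H)))\<bar> \<le> M1 + M2 * (if ?G B < L / 2 then 1 else 0)"
    proof (rule bern_half_le[OF v(1) B])
      fix r show "\<bar>bern (isolated n U B) (1/8) (\<lambda>J. f (r + card J))\<bar> \<le> M1 + M2 * (if ?G B < L / 2 then 1 else 0)"
        using M(1)[of "isolated n U B" r] M(2)[of "isolated n U B" r] M(3,4) by auto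
    qed
  qed
  also have "\<dots> = M1 + M2 * bern ?P ?q (\<lambda>B. if ?G B < L / 2 then 1 else 0)"
    unfolding bern_add bern_cmult using fin by (simp add: bern_const)
  also have "bern ?P ?q (\<lambda>B. if ?G B < L / 2 then 1 else 0) \<le> (4 * real n ^ 3 * ?q ^ 3 * (1 + n * ?q\<^sup>2)) / (L / 2)\<^sup>2"
  proof (rule bern_chebyshev[OF q' fin])
    have "L \<le> real ((n - 6) choose 3) * ?q ^ 3 * (1 - 3 * ?q\<^sup>2) ^ n" using L by (simp add: power2_eq_square)
    also have "\<dots> \<le> bern ?P ?q ?G"
      by (rule isolated_mean) (use q q' v valid_stateD[OF v(1)] in \<open>auto simp: power2_eq_square\<close>)
    finally show "L / 2 + L / 2 \<le> bern ?P ?q ?G" by simp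
  qed (use L isolated_variance[OF q'] in auto)
  also have "\<dots> = 128 * real n ^ 3 * p ^ 3 * (1 + 4 * n * p\<^sup>2) / L\<^sup>2"
    by (simp add: power2_eq_square power3_eq_cube field_simps)
  finally show ?thesis using M(4) by (simp add: mult_left_mono)
qed

section \<open>Power series with summable coefficients\<close>

text \<open>A bound on the l1 norm of the coefficients in a form that carries its own summability.
  The norm is submultiplicative, so smoothing estimates can be made factor by factor on generating
  functions.\<close>

definition l1_bound :: "real fps \<Rightarrow> real \<Rightarrow> bool" where
  "l1_bound F B \<longleftrightarrow> (\<forall>n. (\<Sum>k<n. \<bar>fps_nth F k\<bar>) \<le> B)"

lemma l1_boundI: "(\<And>n. (\<Sum>k<n. \<bar>fps_nth F k\<bar>) \<le> B) \<Longrightarrow> l1_bound F B"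
  by (simp add: l1_bound_def)

lemma l1_boundD: "l1_bound F B \<Longrightarrow> (\<Sum>k<n. \<bar>fps_nth F k\<bar>) \<le> B"
  by (simp add: l1_bound_def)

lemma l1_bound_nonneg: "l1_bound F B \<Longrightarrow> 0 \<le> B"
  using l1_boundD[of F B 0] by simp

lemma l1_bound_mono: "l1_bound F A \<Longrightarrow> A \<le> B \<Longrightarrow> l1_bound F B"
  by (meson l1_bound_def order_trans)

lemma l1_bound_mult:
  assumes "l1_bound F A" "l1_bound G B"
  shows "l1_bound (F * G) (A * B)"
proof (rule l1_boundI)
  fix n
  let ?f = "\<lambda>k. \<bar>fps_nth F k\<bar>" and ?g = "\<lambda>k. \<bar>fps_nth G k\<bar>"
  have "(\<Sum>k<n. \<bar>fps_nth (F * G) k\<bar>) \<le> (\<Sum>k<n. \<Sum>i\<le>k. ?f i * ?g (k - i))"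
    unfolding fps_mult_nth atLeast0AtMost
    by (intro sum_mono order_trans[OF sum_abs]) (simp add: abs_mult)
  also have "\<dots> = (\<Sum>(i, j)\<in>{(i, j). i + j < n}. ?f i * ?g j)"
    by (rule sum.triangle_reindex[symmetric])
  also have "\<dots> \<le> (\<Sum>(i, j)\<in>{..<n} \<times> {..<n}. ?f i * ?g j)"
    by (rule sum_mono2) auto
  also have "\<dots> = (\<Sum>i<n. ?f i) * (\<Sum>j<n. ?g j)"
    by (simp add: sum_product sum.cartesian_product)
  also have "\<dots> \<le> A * B"
    using assms l1_bound_nonneg by (intro mult_mono l1_boundD sum_nonneg) auto
  finally show "(\<Sum>k<n. \<bar>fps_nth (F * G) k\<bar>) \<le> A * B" .
qed

lemma l1_bound_const: "l1_bound (fps_const c) \<bar>c\<bar>"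
proof (rule l1_boundI)
  fix n
  have "(\<Sum>k<n. \<bar>fps_nth (fps_const c) k\<bar>) = (\<Sum>k<n. if k = 0 then \<bar>c\<bar> else 0)"
    by (intro sum.cong) auto
  then show "(\<Sum>k<n. \<bar>fps_nth (fps_const c) k\<bar>) \<le> \<bar>c\<bar>" by simp
qed

lemma l1_bound_one: "l1_bound 1 1"
  using l1_bound_const[of 1] by simp

lemma l1_bound_X: "l1_bound fps_X 1"
proof (rule l1_boundI)
  fix n
  have "(\<Sum>k<n. \<bar>fps_nth fps_X k\<bar>) = (\<Sum>k<n. if k = 1 then 1 else (0::real))"
    by (intro sum.cong) (auto simp: fps_X_def)
  then show "(\<Sum>k<n. \<bar>fps_nth fps_X k\<bar>) \<le> (1::real)" by simp
qed

lemma l1_bound_add: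
  assumes "l1_bound F A" "l1_bound G B" shows "l1_bound (F + G) (A + B)"
proof (rule l1_boundI)
  fix n
  have "(\<Sum>k<n. \<bar>fps_nth (F + G) k\<bar>) \<le> (\<Sum>k<n. \<bar>fps_nth F k\<bar> + \<bar>fps_nth G k\<bar>)"
    by (intro sum_mono) (simp add: abs_triangle_ineq)
  then show "(\<Sum>k<n. \<bar>fps_nth (F + G) k\<bar>) \<le> A + B"
    using l1_boundD[OF assms(1), of n] l1_boundD[OF assms(2), of n] by (simp add: sum.distrib)
qed

lemma l1_bound_power: "l1_bound F A \<Longrightarrow> l1_bound (F ^ n) (A ^ n)"
  by (induction n) (auto intro: l1_bound_mult l1_bound_one)

lemma l1_bound_mult1: "l1_bound F A \<Longrightarrow> l1_bound G 1 \<Longrightarrow> l1_bound (F * G) A"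
  using l1_bound_mult[of F A G 1] by simp

lemma l1_bound_sum_set:
  assumes "l1_bound F B" "finite A" shows "\<bar>\<Sum>k\<in>A. fps_nth F k\<bar> \<le> B"
proof -
  obtain n where n: "A \<subseteq> {..<n}" using finite_nat_bounded[OF assms(2)] by auto
  have "\<bar>\<Sum>k\<in>A. fps_nth F k\<bar> \<le> (\<Sum>k\<in>A. \<bar>fps_nth F k\<bar>)" by (rule sum_abs)
  also have "\<dots> \<le> (\<Sum>k<n. \<bar>fps_nth F k\<bar>)" using n by (intro sum_mono2) auto
  finally show ?thesis using l1_boundD[OF assms(1), of n] by linarith
qed

text \<open>The power series are expanded in \<open>z\<close>; \<open>zx\<close> stands for \<open>z - 1\<close>.\<close>
abbreviation zx :: "real fps" where "zx \<equiv> fps_X - 1"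

lemma nth_x_mult: "fps_nth (zx * F) k = (if k = 0 then 0 else fps_nth F (k - 1)) - fps_nth F k"
  by (simp add: left_diff_distrib)

lemma l1_bound_x: "l1_bound zx 2"
proof -
  have "zx = fps_X + fps_const (- 1)" by (simp flip: fps_const_neg)
  then show ?thesis using l1_bound_add[OF l1_bound_X l1_bound_const[of "-1"]] by (metis abs_minus_cancel abs_one one_add_one)
qed

lemma sum_x_mult: "(\<Sum>k\<le>n. fps_nth (zx * F) k) = - fps_nth F n"
  by (induction n) (auto simp: nth_x_mult)

section \<open>Smoothing by binomial and Poisson laws\<close>

definition lin_fps :: "real \<Rightarrow> real fps" where
  "lin_fps t = 1 + fps_const t * zx"

lemma lin_fps_1: "lin_fps 1 = fps_X" and lin_0: "lin_fps 0 = 1"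
  by (simp_all add: lin_fps_def)

lemma lin_fps_alt: "lin_fps t = fps_const (1 - t) + fps_const t * fps_X"
  unfolding lin_fps_def by (simp add: algebra_simps fps_const_sub[symmetric] del: fps_const_sub)

lemma l1_bound_lin_fps: "0 \<le> t \<Longrightarrow> t \<le> 1 \<Longrightarrow> l1_bound (lin_fps t) 1"
  using l1_bound_add[OF l1_bound_const[of "1 - t"] l1_bound_mult[OF l1_bound_const[of t] l1_bound_X]] by (simp add: lin_fps_alt)

lemma l1_bound_lin_fps_power: "0 \<le> t \<Longrightarrow> t \<le> 1 \<Longrightarrow> l1_bound (lin_fps t ^ m) 1"
  using l1_bound_power[OF l1_bound_lin_fps, of t m] by simp

text \<open>The generating function of a binomial law; through Bernstein polynomials its mean and
  variance are available.\<close>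

lemma nth_lin_fps_power: "fps_nth (lin_fps t ^ m) k = Bernstein m k t"
proof (induction m arbitrary: k)
  case 0
  then show ?case by (cases k) (auto simp: Bernstein_def)
next
  case (Suc m)
  have e: "lin_fps t ^ Suc m = fps_const (1 - t) * lin_fps t ^ m + fps_const t * (fps_X * lin_fps t ^ m)"
    by (simp add: lin_fps_alt algebra_simps)
  show ?case
  proof (cases k)
    case 0
    then show ?thesis unfolding e by (simp add: Suc Bernstein_def)
  next
    case (Suc j)
    have "(1 - t) * Bernstein m (Suc j) t = (m choose Suc j) * t ^ Suc j * (1 - t) ^ (m - j)"
    proof (cases "Suc j \<le> m")
      case True
      then have "m - j = Suc (m - Suc j)" by simp
      then show ?thesis by (simp add: Bernstein_def)
    qed (simp add: Bernstein_def)
    moreover have "t * Bernstein m j t = (m choose j) * t ^ Suc j * (1 - t) ^ (m - j)"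
      by (simp add: Bernstein_def)
    ultimately show ?thesis unfolding e Suc by (simp add: Suc.IH Bernstein_def algebra_simps)
  qed
qed

lemma sqrt_average: "0 < v \<Longrightarrow> (v / sqrt v + sqrt v * 1) / 2 / v = 1 / sqrt v"
  by (simp add: real_div_sqrt) (simp add: field_simps)

text \<open>The k-th coefficient is the Bin(m + 1, t) probability of k times (k - mean) / variance.
  The norm is therefore the mean absolute deviation divided by the variance, at most the reciprocal
  of the standard deviation.\<close>

lemma l1_bound_x_lin_fps_power:
  assumes "0 < t" "t < 1"
  shows "l1_bound (zx * lin_fps t ^ m) (1 / sqrt (real (Suc m) * t * (1 - t)))"
proof -
  let ?M = "real (Suc m)" let ?v = "?M * t * (1 - t)" let ?s = "sqrt ?v"
  let ?b = "\<lambda>k. Bernstein (Suc m) k t"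
  have v: "0 < ?v" "0 < ?s" "?s * ?s = ?v" using assms by auto
  have b0: "0 \<le> ?b k" for k using assms by (simp add: Bernstein_def)
  have c: "fps_nth (zx * lin_fps t ^ m) k = ?b k * (real k - ?M * t) / ?v" for k
  proof -
    have 1: "(if k = 0 then 0 else Bernstein m (k - 1) t) * (?M * t) = ?b k * real k"
    proof (cases k)
      case (Suc j)
      have "real (Suc m choose Suc j) * real (Suc j) = real (Suc m) * real (m choose j)"
        using Suc_times_binomial_eq[of m j] by (metis of_nat_mult mult.commute)
      then show ?thesis using Suc by (simp add: Bernstein_def del: binomial_Suc_Suc of_nat_Suc)
    qed simp
    have 2: "Bernstein m k t * (?M * (1 - t)) = ?b k * (?M - real k)"
    proof (cases "k \<le> m")
      case True
      have "real (Suc m choose k) * real (Suc m - k) = real (Suc m) * real (m choose k)"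
        using binomial_absorb_comp[of "Suc m" k] by (metis of_nat_mult mult.commute diff_Suc_1)
      moreover have "real (Suc m - k) = ?M - real k" using True by (simp add: of_nat_diff)
      ultimately have *: "real (Suc m choose k) * (?M - real k) = ?M * real (m choose k)" by simp
      have "Suc m - k = Suc (m - k)" using True by simp
      then have "?b k * (?M - real k) = (real (Suc m choose k) * (?M - real k)) * t ^ k * ((1 - t) * (1 - t) ^ (m - k))"
        unfolding Bernstein_def by simp
      also have "\<dots> = Bernstein m k t * (?M * (1 - t))" unfolding * Bernstein_def by simp
      finally show ?thesis by simp
    next
      case False
      then have "k = Suc m \<or> Suc m < k" by linarith
      then show ?thesis by (auto simp add: Bernstein_def binomial_eq_0 simp del: binomial_Suc_Suc)
    qed
    have "fps_nth (zx * lin_fps t ^ m) k * ?v = (if k = 0 then 0 else Bernstein m (k - 1) t) * (?M * t) * (1 - t) - Bernstein m k t * (?M * (1 - t)) * t"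
      unfolding nth_x_mult nth_lin_fps_power by (simp add: algebra_simps)
    also have "\<dots> = ?b k * (real k - ?M * t)" unfolding 1 2 by (simp add: algebra_simps)
    finally show ?thesis using v by (simp add: field_simps)
  qed
  show ?thesis
  proof (rule l1_boundI)
    fix n
    have "(\<Sum>k<n. \<bar>fps_nth (zx * lin_fps t ^ m) k\<bar>) \<le> (\<Sum>k\<le>max n (Suc m). \<bar>fps_nth (zx * lin_fps t ^ m) k\<bar>)"
      by (intro sum_mono2) auto
    also have "\<dots> = (\<Sum>k\<le>Suc m. \<bar>fps_nth (zx * lin_fps t ^ m) k\<bar>)"
    proof (rule sum.mono_neutral_right)
      show "\<forall>i\<in>{..max n (Suc m)} - {..Suc m}. \<bar>fps_nth (zx * lin_fps t ^ m) i\<bar> = 0"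
        unfolding c by (auto simp: Bernstein_def)
    qed auto
    also have "\<dots> \<le> (\<Sum>k\<le>Suc m. (?b k * (real k - ?M * t)\<^sup>2 / ?s + ?s * ?b k) / 2 / ?v)"
    proof (rule sum_mono)
      fix k
      let ?y = "real k - ?M * t"
      \<comment> \<open>The inequality of arithmetic and geometric means replaces Cauchy-Schwarz:
        after summation both terms equal the standard deviation.\<close>
      have "0 \<le> (\<bar>?y\<bar> - ?s)\<^sup>2 / ?s" using v by simp
      then have "\<bar>?y\<bar> \<le> (?y\<^sup>2 / ?s + ?s) / 2" using v(2) by (simp add: power2_diff field_simps power2_eq_square)
      then have "?b k * \<bar>?y\<bar> \<le> ?b k * ((?y\<^sup>2 / ?s + ?s) / 2)" using b0 by (rule mult_left_mono)
      then have "?b k * \<bar>?y\<bar> / ?v \<le> ?b k * ((?y\<^sup>2 / ?s + ?s) / 2) / ?v" using v by (intro divide_right_mono) auto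
      moreover have "\<bar>fps_nth (zx * lin_fps t ^ m) k\<bar> = ?b k * \<bar>?y\<bar> / ?v"
        unfolding c abs_divide abs_mult[of "?b k"] abs_of_nonneg[OF b0] abs_of_pos[OF v(1)] ..
      moreover have "y * ((?y\<^sup>2 / ?s + ?s) / 2) = (y * ?y\<^sup>2 / ?s + ?s * y) / 2" for y by (simp only: times_divide_eq_right distrib_left mult.commute)
      ultimately show "\<bar>fps_nth (zx * lin_fps t ^ m) k\<bar> \<le> (?b k * (real k - ?M * t)\<^sup>2 / ?s + ?s * ?b k) / 2 / ?v" by metis
    qed
    also have "\<dots> = ((\<Sum>k\<le>Suc m. ?b k * (real k - ?M * t)\<^sup>2) / ?s + ?s * (\<Sum>k\<le>Suc m. ?b k)) / 2 / ?v"
      unfolding sum_divide_distrib[symmetric] sum.distrib sum_distrib_left[symmetric] ..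
    also have "(\<Sum>k\<le>Suc m. ?b k * (real k - ?M * t)\<^sup>2) = ?v"
    proof -
      have "(\<Sum>k\<le>Suc m. ?b k * (real k - ?M * t)\<^sup>2) = (\<Sum>k\<le>Suc m. real k * (real k - 1) * ?b k 
         + (1 - 2 * (?M * t)) * (real k * ?b k) + (?M * t)\<^sup>2 * ?b k)"
        by (rule sum.cong) (simp_all add: power2_eq_square algebra_simps)
      also have "\<dots> = ?M * (?M - 1) * t\<^sup>2 + (1 - 2 * (?M * t)) * (?M * t) + (?M * t)\<^sup>2 * 1"
        unfolding sum.distrib sum_distrib_left[symmetric] sum_k_Bernstein sum_kk_Bernstein sum_Bernstein ..
      also have "\<dots> = ?v" by (simp add: power2_eq_square algebra_simps)
      finally show ?thesis .
    qed
    also have "(?v / ?s + ?s * (\<Sum>k\<le>Suc m. ?b k)) / 2 / ?v = 1 / ?s"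
      unfolding sum_Bernstein by (rule sqrt_average[OF v(1)])
    finally show "(\<Sum>k<n. \<bar>fps_nth (zx * lin_fps t ^ m) k\<bar>) \<le> 1 / ?s" .
  qed
qed

text \<open>Split the power into four equal parts and a remainder, and give each part one factor z -
  1. The estimate m <= 4 (m div 4 + 1) yields the constant 16.\<close>

lemma l1_bound_x4_lin_fps_power:
  assumes "0 < t" "t < 1" "0 < m"
  shows "l1_bound (zx ^ 4 * lin_fps t ^ m) (16 / (real m * t * (1 - t))\<^sup>2)"
proof -
  let ?k = "m div 4"
  have m: "m = 4 * ?k + m mod 4" by simp
  have eq: "zx ^ 4 * lin_fps t ^ m = (zx * lin_fps t ^ ?k) ^ 4 * lin_fps t ^ (m mod 4)"
  proof -
    have "lin_fps t ^ m = (lin_fps t ^ ?k) ^ 4 * lin_fps t ^ (m mod 4)" by (metis m power_add power_mult mult.commute)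
    then show ?thesis by (simp add: power_mult_distrib mult.assoc)
  qed
  have b: "l1_bound ((zx * lin_fps t ^ ?k) ^ 4 * lin_fps t ^ (m mod 4)) ((1 / sqrt (real (Suc ?k) * t * (1 - t))) ^ 4)"
    by (intro l1_bound_mult1 l1_bound_power l1_bound_x_lin_fps_power l1_bound_lin_fps_power) (use assms in auto)
  have le: "(1 / sqrt (real (Suc ?k) * t * (1 - t))) ^ 4 \<le> 16 / (real m * t * (1 - t))\<^sup>2"
  proof -
    have tt: "0 < t * (1 - t)" using assms by simp
    have "(1 / sqrt (real (Suc ?k) * t * (1 - t))) ^ 4 = 1 / ((sqrt (real (Suc ?k) * t * (1 - t)))\<^sup>2)\<^sup>2"
      by (simp add: power_divide power_mult[symmetric])
    also have "\<dots> = 1 / (real (Suc ?k) * t * (1 - t))\<^sup>2" using assms by simp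
    also have "\<dots> = 16 / ((4 * real (Suc ?k)) * (t * (1 - t)))\<^sup>2"
    proof -
      have "1 / (y * t * (1 - t))\<^sup>2 = 16 / ((4 * y) * (t * (1 - t)))\<^sup>2" for y by (simp add: power_mult_distrib mult.assoc)
      then show ?thesis .
    qed
    also have "\<dots> \<le> 16 / (real m * (t * (1 - t)))\<^sup>2"
    proof -
      have "m \<le> 4 * Suc ?k" by presburger
      then have "real m \<le> 4 * real (Suc ?k)" by linarith
      then show ?thesis using assms tt by (intro divide_left_mono power_mono mult_right_mono mult_pos_pos zero_less_power) auto
    qed
    finally show ?thesis by (simp add: mult.assoc)
  qed
  show ?thesis unfolding eq by (rule l1_bound_mono[OF b le])
qed

definition pois_fps :: "real \<Rightarrow> real fps" where
  "pois_fps \<kappa> = Abs_fps (\<lambda>k. exp (- \<kappa>) * \<kappa> ^ k / fact k)"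

lemma pois_fps_0: "pois_fps 0 = 1"
  by (rule fps_ext) (auto simp: pois_fps_def)

lemma pois_fps_add: "pois_fps (a + b) = pois_fps a * pois_fps b"
proof -
  have p: "pois_fps \<kappa> = fps_const (exp (- \<kappa>)) * fps_exp \<kappa>" for \<kappa>
    by (rule fps_ext) (simp add: pois_fps_def)
  have "pois_fps (a + b) = fps_const (exp (- (a + b))) * (fps_exp a * fps_exp b)" by (simp only: p fps_exp_add_mult)
  also have "fps_const (exp (- (a + b))) = fps_const (exp (- a)) * fps_const (exp (- b))" by (simp add: exp_add[symmetric])
  finally show ?thesis unfolding p by (simp only: mult_ac)
qed

lemma pois_fps_sums:
  "(\<lambda>k. exp (- \<kappa>) * \<kappa> ^ k / fact k) sums (1::real)"
  "(\<lambda>k. exp (- \<kappa>) * \<kappa> ^ k / fact k * (real k - \<kappa>)\<^sup>2) sums \<kappa>"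
proof -
  let ?p = "\<lambda>k. exp (- \<kappa>) * \<kappa> ^ k / fact k"
  have e: "(\<lambda>k. \<kappa> ^ k / fact k) sums exp \<kappa>" using exp_converges[of \<kappa>] by (simp add: field_simps)
  then have "(\<lambda>k. exp (- \<kappa>) * (\<kappa> ^ k / fact k)) sums (exp (- \<kappa>) * exp \<kappa>)" by (rule sums_mult)
  then show 0: "?p sums 1" by (simp add: exp_minus_inverse mult.commute)
  have S: "real (Suc k) * ?p (Suc k) = \<kappa> * ?p k" for k
    by (simp add: field_simps del: of_nat_Suc)
  have 1: "(\<lambda>k. real k * ?p k) sums \<kappa>"
  proof -
    have "(\<lambda>k. real (Suc k) * ?p (Suc k)) sums (\<kappa> * 1)"
      unfolding S by (rule sums_mult[OF 0])
    then show ?thesis by (subst (asm) sums_Suc_iff) simp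
  qed
  have 2: "(\<lambda>k. real k * (real k - 1) * ?p k) sums \<kappa>\<^sup>2"
  proof -
    have "(\<lambda>k. real (Suc k) * (real (Suc k) - 1) * ?p (Suc k)) sums (\<kappa> * \<kappa>)"
    proof -
      have "real (Suc k) * (real (Suc k) - 1) * ?p (Suc k) = \<kappa> * (real k * ?p k)" for k
        using S[of k] by (metis add_diff_cancel_right' mult.assoc mult.left_commute of_nat_Suc add.commute)
      then show ?thesis by (simp only: sums_mult[OF 1, of \<kappa>])
    qed
    then show ?thesis by (subst (asm) sums_Suc_iff) (simp add: power2_eq_square)
  qed
  have "(\<lambda>k. real k * (real k - 1) * ?p k + (1 - 2 * \<kappa>) * (real k * ?p k) + \<kappa>\<^sup>2 * ?p k) sums (\<kappa>\<^sup>2 + (1 - 2 * \<kappa>) * \<kappa> + \<kappa>\<^sup>2 * 1)"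
    by (intro sums_add sums_mult 0 1 2)
  moreover have "(\<lambda>k. real k * (real k - 1) * ?p k + (1 - 2 * \<kappa>) * (real k * ?p k) + \<kappa>\<^sup>2 * ?p k) = (\<lambda>k. ?p k * (real k - \<kappa>)\<^sup>2)"
  proof
    fix k
    have "real k * (real k - 1) * y + (1 - 2 * \<kappa>) * (real k * y) + \<kappa>\<^sup>2 * y = y * (real k - \<kappa>)\<^sup>2" for y
      by (simp add: power2_eq_square algebra_simps)
    then show "real k * (real k - 1) * ?p k + (1 - 2 * \<kappa>) * (real k * ?p k) + \<kappa>\<^sup>2 * ?p k = ?p k * (real k - \<kappa>)\<^sup>2" .
  qed
  ultimately show "(\<lambda>k. ?p k * (real k - \<kappa>)\<^sup>2) sums \<kappa>" by (simp add: power2_eq_square algebra_simps)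
qed

lemma l1_bound_pois_fps: "0 \<le> \<kappa> \<Longrightarrow> l1_bound (pois_fps \<kappa>) 1"
proof (rule l1_boundI)
  fix n assume "0 \<le> \<kappa>"
  then show "(\<Sum>k<n. \<bar>fps_nth (pois_fps \<kappa>) k\<bar>) \<le> 1"
    using sum_le_suminf[OF sums_summable[OF pois_fps_sums(1)], of "{..<n}" \<kappa>] sums_unique[OF pois_fps_sums(1), of \<kappa>]
    by (simp add: pois_fps_def)
qed

text \<open>As in the binomial case, the coefficient is the Poisson probability of k times (k -
  \<kappa>) / \<kappa>.\<close>

lemma l1_bound_x_pois_fps:
  assumes "0 < \<kappa>"
  shows "l1_bound (zx * pois_fps \<kappa>) (1 / sqrt \<kappa>)"
proof (rule l1_boundI)
  fix n
  let ?p = "\<lambda>k. exp (- \<kappa>) * \<kappa> ^ k / fact k" and ?s = "sqrt \<kappa>"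
  have s: "0 < ?s" "?s * ?s = \<kappa>" using assms by auto
  have p0: "0 \<le> ?p k" for k using assms by simp
  have c: "fps_nth (zx * pois_fps \<kappa>) k = ?p k * (real k - \<kappa>) / \<kappa>" for k
    unfolding nth_x_mult using assms by (cases k) (simp_all add: pois_fps_def field_simps del: of_nat_Suc)
  have "(\<Sum>k<n. \<bar>fps_nth (zx * pois_fps \<kappa>) k\<bar>) \<le> (\<Sum>k<n. (?p k * (real k - \<kappa>)\<^sup>2 / ?s + ?s * ?p k) / 2 / \<kappa>)"
  proof (rule sum_mono)
    fix k
    let ?y = "real k - \<kappa>"
    have "0 \<le> (\<bar>?y\<bar> - ?s)\<^sup>2 / ?s" using s by simp
    then have "\<bar>?y\<bar> \<le> (?y\<^sup>2 / ?s + ?s) / 2" using s(1) by (simp add: power2_diff field_simps power2_eq_square)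
    then have "?p k * \<bar>?y\<bar> \<le> ?p k * ((?y\<^sup>2 / ?s + ?s) / 2)" using p0 by (rule mult_left_mono)
    then have "?p k * \<bar>?y\<bar> / \<kappa> \<le> ?p k * ((?y\<^sup>2 / ?s + ?s) / 2) / \<kappa>" using assms by (intro divide_right_mono) auto
    moreover have "\<bar>fps_nth (zx * pois_fps \<kappa>) k\<bar> = ?p k * \<bar>?y\<bar> / \<kappa>" unfolding c using p0[of k] assms by (simp add: abs_mult)
    moreover have "y * ((?y\<^sup>2 / ?s + ?s) / 2) = (y * ?y\<^sup>2 / ?s + ?s * y) / 2" for y by (simp add: algebra_simps)
    ultimately show "\<bar>fps_nth (zx * pois_fps \<kappa>) k\<bar> \<le> (?p k * (real k - \<kappa>)\<^sup>2 / ?s + ?s * ?p k) / 2 / \<kappa>" by metis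
  qed
  also have "\<dots> = ((\<Sum>k<n. ?p k * (real k - \<kappa>)\<^sup>2) / ?s + ?s * (\<Sum>k<n. ?p k)) / 2 / \<kappa>"
    unfolding sum_divide_distrib[symmetric] sum.distrib sum_distrib_left[symmetric] ..
  also have "\<dots> \<le> (\<kappa> / ?s + ?s * 1) / 2 / \<kappa>"
  proof -
    have "(\<Sum>k<n. ?p k * (real k - \<kappa>)\<^sup>2) \<le> \<kappa>"
      using sum_le_suminf[OF sums_summable[OF pois_fps_sums(2)], of "{..<n}" \<kappa>] sums_unique[OF pois_fps_sums(2), of \<kappa>] assms by simp
    moreover have "(\<Sum>k<n. ?p k) \<le> 1"
      using sum_le_suminf[OF sums_summable[OF pois_fps_sums(1)], of "{..<n}" \<kappa>] sums_unique[OF pois_fps_sums(1), of \<kappa>] p0 by simp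
    ultimately show ?thesis using s assms by (intro divide_right_mono add_mono mult_left_mono) auto
  qed
  also have "\<dots> = 1 / ?s" by (rule sqrt_average[OF assms])
  finally show "(\<Sum>k<n. \<bar>fps_nth (zx * pois_fps \<kappa>) k\<bar>) \<le> 1 / ?s" .
qed

text \<open>For \<kappa> <= 1 the trivial bound 2^4 suffices. Otherwise the law is a convolution of
  four Poisson laws of rate \<kappa> / 4, each absorbing one factor z - 1. The form (1 +
  \<kappa>)^-2 stays finite at 0 and is integrable in \<kappa>.\<close>

lemma l1_bound_x4_pois_fps:
  assumes "0 \<le> \<kappa>"
  shows "l1_bound (zx ^ 4 * pois_fps \<kappa>) (64 / (1 + \<kappa>)\<^sup>2)"
proof (cases "\<kappa> \<le> 1")
  case True
  have "l1_bound (zx ^ 4 * pois_fps \<kappa>) (2 ^ 4)" by (intro l1_bound_mult1 l1_bound_power l1_bound_x l1_bound_pois_fps assms)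
  moreover have "(2::real) ^ 4 \<le> 64 / (1 + \<kappa>)\<^sup>2"
  proof -
    have "(1 + \<kappa>)\<^sup>2 \<le> 2\<^sup>2" using True assms by (intro power_mono) auto
    then show ?thesis using assms by (simp add: field_simps)
  qed
  ultimately show ?thesis by (rule l1_bound_mono)
next
  case False
  let ?k = "\<kappa> / 4"
  have k: "0 < ?k" using False by simp
  have "pois_fps ?k ^ 4 = pois_fps (?k + ?k + ?k + ?k)" by (simp only: pois_fps_add power4_eq_xxxx)
  then have eq: "zx ^ 4 * pois_fps \<kappa> = (zx * pois_fps ?k) ^ 4" by (simp add: power_mult_distrib)
  have b: "l1_bound ((zx * pois_fps ?k) ^ 4) ((1 / sqrt ?k) ^ 4)" by (intro l1_bound_power l1_bound_x_pois_fps k)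
  have le: "(1 / sqrt ?k) ^ 4 \<le> 64 / (1 + \<kappa>)\<^sup>2"
  proof -
    have "(sqrt ?k) ^ 4 = ((sqrt ?k)\<^sup>2)\<^sup>2" by (simp only: power_mult[symmetric]) simp
    also have "\<dots> = \<kappa>\<^sup>2 / 16" using k by (simp add: power_divide)
    finally have "(1 / sqrt ?k) ^ 4 = 16 / \<kappa>\<^sup>2" by (simp only: power_one_over) (simp add: field_simps)
    also have "\<dots> = 64 / (2 * \<kappa>)\<^sup>2" by (simp add: power_mult_distrib)
    also have "\<dots> \<le> 64 / (1 + \<kappa>)\<^sup>2" using False by (intro divide_left_mono power_mono) auto
    finally show ?thesis .
  qed
  show ?thesis unfolding eq by (rule l1_bound_mono[OF b le])
qed

section \<open>The negative binomial factor as a power series\<close>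

fun ode_series :: "(nat \<Rightarrow> real) \<Rightarrow> real \<Rightarrow> nat \<Rightarrow> real" where
  "ode_series a y 0 = y"
| "ode_series a y (Suc k) = (\<Sum>j\<le>k. a j * ode_series a y (k - j)) / real (Suc k)"

lemma ode_series_nonneg:
  assumes "\<And>j. 0 \<le> a j" "0 \<le> y" shows "0 \<le> ode_series a y k"
proof (induction k rule: less_induct)
  case (less k)
  show ?case
  proof (cases k)
    case (Suc i)
    then show ?thesis using assms less by (auto intro!: divide_nonneg_nonneg sum_nonneg mult_nonneg_nonneg)
  qed (use assms in simp)
qed

text \<open>\<open>ode_series\<close> is the power series solution of F' = a F with F(0) =
  y.\<close>

lemma ode_series_deriv: "fps_deriv (Abs_fps (ode_series a y)) = Abs_fps a * Abs_fps (ode_series a y)"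
proof (rule fps_ext)
  fix k
  show "fps_nth (fps_deriv (Abs_fps (ode_series a y))) k = fps_nth (Abs_fps a * Abs_fps (ode_series a y)) k"
    unfolding fps_mult_nth fps_deriv_nth by (simp add: atLeast0AtMost)
qed

definition nb_ratio :: "real \<Rightarrow> real \<Rightarrow> real" where
  "nb_ratio \<theta> s = \<theta> * s / (1 + \<theta> * s)"

text \<open>\<open>nb_log_deriv\<close> is the logarithmic derivative in \<open>z\<close> of
  \<open>nb_fps = ((1 - \<theta> s (z - 1)) / (1 - \<theta> (z - 1)))\<^sup>r\<close>.  Defining \<open>nb_fps\<close> by the resulting recursion
  makes the nonnegativity of its coefficients evident.\<close>
definition nb_log_deriv :: "real \<Rightarrow> real \<Rightarrow> real \<Rightarrow> nat \<Rightarrow> real" where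
  "nb_log_deriv r \<theta> s j = r * (nb_ratio \<theta> 1 ^ Suc j - nb_ratio \<theta> s ^ Suc j)"

definition nb_fps :: "real \<Rightarrow> real \<Rightarrow> real \<Rightarrow> real fps" where
  "nb_fps r \<theta> s = Abs_fps (ode_series (nb_log_deriv r \<theta> s) (((1 + \<theta> * s) / (1 + \<theta>)) powr r))"

text \<open>The geometric law with generating function 1 / (1 - \<theta> s (z - 1)), see
  \<open>geo_fps_inverse\<close>. It appears when \<open>nb_fps\<close> is differentiated in
  \<open>s\<close>.\<close>

definition geo_fps :: "real \<Rightarrow> real \<Rightarrow> real fps" where
  "geo_fps \<theta> s = Abs_fps (\<lambda>k. nb_ratio \<theta> s ^ k / (1 + \<theta> * s))"

lemma nb_fps_deriv: "fps_deriv (nb_fps r \<theta> s) = Abs_fps (nb_log_deriv r \<theta> s) * nb_fps r \<theta> s"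
  unfolding nb_fps_def by (rule ode_series_deriv)

context
  fixes r \<theta> :: real
  assumes r: "0 < r" and \<theta>: "0 < \<theta>"
begin

lemma one_theta: "0 \<le> s \<Longrightarrow> 0 < 1 + \<theta> * s"
  using \<theta> by (simp add: add_pos_nonneg)

lemma nb_ratio_bounds: "0 \<le> s \<Longrightarrow> 0 \<le> nb_ratio \<theta> s" "0 \<le> s \<Longrightarrow> nb_ratio \<theta> s < 1" "0 \<le> s \<Longrightarrow> 1 - nb_ratio \<theta> s = 1 / (1 + \<theta> * s)"
  using \<theta> one_theta[of s] by (auto simp: nb_ratio_def field_simps)

lemma nb_ratio_le: "0 \<le> s \<Longrightarrow> s \<le> 1 \<Longrightarrow> nb_ratio \<theta> s \<le> nb_ratio \<theta> 1"
  using \<theta> one_theta[of s] by (auto simp: nb_ratio_def field_simps)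

lemma nb_log_deriv_nonneg: "0 \<le> s \<Longrightarrow> s \<le> 1 \<Longrightarrow> 0 \<le> nb_log_deriv r \<theta> s j"
  unfolding nb_log_deriv_def using r nb_ratio_le[of s] nb_ratio_bounds[of s] by (intro mult_nonneg_nonneg) (auto intro!: power_mono simp del: power_Suc)

lemma nb_fps_nonneg: "0 \<le> s \<Longrightarrow> s \<le> 1 \<Longrightarrow> 0 \<le> fps_nth (nb_fps r \<theta> s) k"
  unfolding nb_fps_def using nb_log_deriv_nonneg by (simp add: ode_series_nonneg)

lemma nb_fps_1: "nb_fps r \<theta> 1 = 1"
proof (rule fps_ext)
  fix k
  show "fps_nth (nb_fps r \<theta> 1) k = fps_nth 1 k"
    using \<theta> by (cases k) (auto simp: nb_fps_def nb_log_deriv_def)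
qed

lemma geo_fps_inverse: 
  assumes "0 \<le> s" shows "(1 - fps_const (\<theta> * s) * zx) * geo_fps \<theta> s = 1"
proof (rule fps_ext)
  fix k
  have e: "(1 - fps_const (\<theta> * s) * zx) * geo_fps \<theta> s = fps_const (1 + \<theta> * s) * geo_fps \<theta> s - fps_const (\<theta> * s) * (fps_X * geo_fps \<theta> s)"
    by (simp add: algebra_simps fps_const_add[symmetric] del: fps_const_add fps_const_mult)
  show "fps_nth ((1 - fps_const (\<theta> * s) * zx) * geo_fps \<theta> s) k = fps_nth 1 k"
  proof (cases k)
    case 0
    then show ?thesis unfolding e using one_theta[OF assms] by (simp add: geo_fps_def)
  next
    case (Suc i)
    have "fps_nth ((1 - fps_const (\<theta> * s) * zx) * geo_fps \<theta> s) k = 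
       (1 + \<theta> * s) * (nb_ratio \<theta> s * nb_ratio \<theta> s ^ i / (1 + \<theta> * s)) - \<theta> * s * (nb_ratio \<theta> s ^ i / (1 + \<theta> * s))"
      unfolding e Suc by (simp add: geo_fps_def)
    also have "\<dots> = nb_ratio \<theta> s ^ i * (nb_ratio \<theta> s - \<theta> * s / (1 + \<theta> * s))" using one_theta[OF assms] by (simp add: right_diff_distrib)
    also have "\<dots> = 0" by (simp add: nb_ratio_def)
    finally show ?thesis using Suc by simp
  qed
qed

lemma l1_bound_geo_fps: assumes "0 \<le> s" shows "l1_bound (geo_fps \<theta> s) 1"
proof (rule l1_boundI)
  fix n
  have q: "0 \<le> nb_ratio \<theta> s" "nb_ratio \<theta> s < 1" "1 - nb_ratio \<theta> s = 1 / (1 + \<theta> * s)" using nb_ratio_bounds assms by auto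
  have "(\<Sum>k<n. \<bar>fps_nth (geo_fps \<theta> s) k\<bar>) = (\<Sum>k<n. nb_ratio \<theta> s ^ k) * (1 / (1 + \<theta> * s))"
    unfolding sum_distrib_right using q one_theta[OF assms] by (intro sum.cong) (auto simp: geo_fps_def)
  also have "\<dots> = 1 - nb_ratio \<theta> s ^ n" using q unfolding q(3)[symmetric] by (simp add: one_diff_power_eq mult.commute)
  also have "\<dots> \<le> 1" using q by simp
  finally show "(\<Sum>k<n. \<bar>fps_nth (geo_fps \<theta> s) k\<bar>) \<le> 1" .
qed

lemma nb_ratio_deriv: "0 \<le> s \<Longrightarrow> (nb_ratio \<theta> has_real_derivative \<theta> / (1 + \<theta> * s)\<^sup>2) (at s)"
  unfolding nb_ratio_def using one_theta[of s]
  by (auto intro!: derivative_eq_intros simp: power2_eq_square field_simps)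

lemma nb_log_deriv_deriv:
  assumes "0 \<le> s"
  shows "((\<lambda>s. nb_log_deriv r \<theta> s j) has_real_derivative fps_nth (fps_deriv (- fps_const (r * \<theta>) * (zx * geo_fps \<theta> s))) j) (at s)"
proof -
  have e: "- fps_const (r * \<theta>) * (zx * geo_fps \<theta> s) = fps_const (- (r * \<theta>)) * (zx * geo_fps \<theta> s)" by (simp flip: fps_const_neg)
  have "((\<lambda>s. nb_log_deriv r \<theta> s j) has_real_derivative - r * (real (Suc j) * nb_ratio \<theta> s ^ j * (\<theta> / (1 + \<theta> * s)\<^sup>2))) (at s)"
    unfolding nb_log_deriv_def by (rule derivative_eq_intros nb_ratio_deriv assms refl | simp)+
  also have "- r * (real (Suc j) * nb_ratio \<theta> s ^ j * (\<theta> / (1 + \<theta> * s)\<^sup>2)) = 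
     - (r * \<theta>) * real (Suc j) * (nb_ratio \<theta> s ^ j * (1 / (1 + \<theta> * s)) / (1 + \<theta> * s))"
    by (simp add: power2_eq_square)
  also have "\<dots> = - (r * \<theta>) * real (Suc j) * (nb_ratio \<theta> s ^ j / (1 + \<theta> * s) - nb_ratio \<theta> s ^ Suc j / (1 + \<theta> * s))"
  proof -
    have "nb_ratio \<theta> s ^ j / (1 + \<theta> * s) - nb_ratio \<theta> s ^ Suc j / (1 + \<theta> * s) = nb_ratio \<theta> s ^ j * (1 - nb_ratio \<theta> s) / (1 + \<theta> * s)"
      by (simp add: diff_divide_distrib left_diff_distrib mult.commute)
    then show ?thesis by (simp only: nb_ratio_bounds(3)[OF assms])
  qed
  also have "\<dots> = fps_nth (fps_deriv (- fps_const (r * \<theta>) * (zx * geo_fps \<theta> s))) j"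
  proof -
    have "fps_nth (zx * geo_fps \<theta> s) (j + 1) = nb_ratio \<theta> s ^ j / (1 + \<theta> * s) - nb_ratio \<theta> s ^ Suc j / (1 + \<theta> * s)"
      unfolding nth_x_mult by (simp add: geo_fps_def)
    then show ?thesis unfolding e fps_deriv_nth fps_mult_left_const_nth by (simp add: mult_ac)
  qed
  finally show ?thesis .
qed

text \<open>Write N for the series, A for its logarithmic derivative in z and L = - r \<theta> (z -
  1) G. The derivative of A in \<open>s\<close> is L', so differentiating the recursion for the
  coefficients of N gives those of L' N + A L N = (L N)', and the induction closes.\<close>

lemma nb_fps_has_deriv:
  assumes s: "0 \<le> s"
  shows "((\<lambda>s. fps_nth (nb_fps r \<theta> s) k) has_real_derivative fps_nth (- fps_const (r * \<theta>) * (zx * geo_fps \<theta> s) * nb_fps r \<theta> s) k) (at s)"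
proof (induction k rule: less_induct)
  case (less k)
  let ?L = "- fps_const (r * \<theta>) * (zx * geo_fps \<theta> s)" and ?N = "nb_fps r \<theta> s" and ?A = "Abs_fps (nb_log_deriv r \<theta> s)"
  have e: "?L = fps_const (- (r * \<theta>)) * (zx * geo_fps \<theta> s)" by (simp flip: fps_const_neg)
  show ?case
  proof (cases k)
    case 0
    have L0: "fps_nth ?L 0 = r * \<theta> / (1 + \<theta> * s)" unfolding e by (simp add: geo_fps_def)
    have 1: "0 < (1 + \<theta> * s) / (1 + \<theta>)" using one_theta[OF s] \<theta> by (simp add: add_pos_pos)
    have "((\<lambda>s. ((1 + \<theta> * s) / (1 + \<theta>)) powr r) has_real_derivative 
      r * ((1 + \<theta> * s) / (1 + \<theta>)) powr (r - 1) * (\<theta> / (1 + \<theta>))) (at s)"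
      by (rule DERIV_fun_powr[where g = "\<lambda>s. (1 + \<theta> * s) / (1 + \<theta>)", THEN DERIV_cong])
         (use 1 in \<open>auto intro!: derivative_eq_intros\<close>)
    also have "r * ((1 + \<theta> * s) / (1 + \<theta>)) powr (r - 1) * (\<theta> / (1 + \<theta>)) = r * \<theta> / (1 + \<theta> * s) * ((1 + \<theta> * s) / (1 + \<theta>)) powr r"
    proof -
      have "r * (Y / (a / b)) * (\<theta> / b) = r * \<theta> / a * Y" if "0 < a" "0 < b" for Y a b :: real
        using that by (simp add: field_simps)
      then show ?thesis unfolding powr_diff using 1 one_theta[OF s] \<theta> by simp
    qed
    finally show ?thesis unfolding 0 fps_mult_nth_0[of ?L] L0 by (simp add: nb_fps_def)
  next
    case (Suc i)
    have N: "fps_nth (nb_fps r \<theta> s) (Suc i) = (\<Sum>j\<le>i. nb_log_deriv r \<theta> s j * fps_nth (nb_fps r \<theta> s) (i - j)) / real (Suc i)" for s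
      by (simp add: nb_fps_def)
    have "((\<lambda>s. \<Sum>j\<le>i. nb_log_deriv r \<theta> s j * fps_nth (nb_fps r \<theta> s) (i - j)) has_real_derivative
      (\<Sum>j\<le>i. fps_nth (fps_deriv ?L) j * fps_nth ?N (i - j) + nb_log_deriv r \<theta> s j * fps_nth (?L * ?N) (i - j))) (at s)"
    proof (rule DERIV_sum)
      fix j assume "j \<in> {..i}"
      then have "i - j < k" using Suc by simp
      from DERIV_mult[OF nb_log_deriv_deriv[OF s, of j] less[OF this]]
      show "((\<lambda>s. nb_log_deriv r \<theta> s j * fps_nth (nb_fps r \<theta> s) (i - j)) has_real_derivative
         (fps_nth (fps_deriv ?L) j * fps_nth ?N (i - j) + nb_log_deriv r \<theta> s j * fps_nth (?L * ?N) (i - j))) (at s)"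
        by (rule DERIV_cong) (simp only: mult.commute)
    qed
    moreover have "(\<Sum>j\<le>i. fps_nth (fps_deriv ?L) j * fps_nth ?N (i - j) + nb_log_deriv r \<theta> s j * fps_nth (?L * ?N) (i - j)) 
       = fps_nth (fps_deriv ?L * ?N + ?A * (?L * ?N)) i"
      unfolding fps_add_nth fps_mult_nth[of "fps_deriv ?L"] fps_mult_nth[of ?A] by (simp only: sum.distrib atLeast0AtMost fps_nth_Abs_fps)
    moreover have "fps_deriv ?L * ?N + ?A * (?L * ?N) = fps_deriv (?L * ?N)"
      by (simp only: fps_deriv_mult nb_fps_deriv) (simp only: mult_ac add_ac)
    ultimately have "((\<lambda>s. \<Sum>j\<le>i. nb_log_deriv r \<theta> s j * fps_nth (nb_fps r \<theta> s) (i - j)) has_real_derivative fps_nth (fps_deriv (?L * ?N)) i) (at s)"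
      by (simp only:)
    from DERIV_cdivide[OF this, of "real (Suc i)"]
    have "((\<lambda>s. fps_nth (nb_fps r \<theta> s) (Suc i)) has_real_derivative fps_nth (fps_deriv (?L * ?N)) i / real (Suc i)) (at s)"
      unfolding N .
    moreover have "fps_nth (fps_deriv F) i / real (Suc i) = fps_nth F (Suc i)" for F :: "real fps"
      by (simp add: fps_deriv_nth del: of_nat_Suc)
    ultimately show ?thesis unfolding Suc by (simp only:)
  qed
qed

text \<open>The partial sums are nondecreasing in \<open>s\<close>, because their derivative
  telescopes to r \<theta> times a nonnegative coefficient; at \<open>s = 1\<close> the series is
  1.\<close>

lemma l1_bound_nb_fps:
  assumes "0 \<le> s" "s \<le> 1" shows "l1_bound (nb_fps r \<theta> s) 1"
proof (rule l1_boundI)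
  fix n
  show "(\<Sum>k<n. \<bar>fps_nth (nb_fps r \<theta> s) k\<bar>) \<le> 1"
  proof (cases n)
    case (Suc m)
    let ?S = "\<lambda>s. \<Sum>k\<le>m. fps_nth (nb_fps r \<theta> s) k"
    have "?S s \<le> ?S 1"
    proof (rule DERIV_nonneg_imp_nondecreasing[OF assms(2)])
      fix t assume t: "s \<le> t" "t \<le> 1"
      then have t0: "0 \<le> t" using assms by simp
      let ?GN = "geo_fps \<theta> t * nb_fps r \<theta> t"
      have "(?S has_real_derivative (\<Sum>k\<le>m. fps_nth (- fps_const (r * \<theta>) * (zx * geo_fps \<theta> t) * nb_fps r \<theta> t) k)) (at t)"
        by (intro DERIV_sum nb_fps_has_deriv t0)
      moreover have "(\<Sum>k\<le>m. fps_nth (- fps_const (r * \<theta>) * (zx * geo_fps \<theta> t) * nb_fps r \<theta> t) k) \<ge> 0"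
      proof -
        have "- fps_const (r * \<theta>) * (zx * geo_fps \<theta> t) * nb_fps r \<theta> t = fps_const (- (r * \<theta>)) * (zx * ?GN)" 
          by (simp add: mult.assoc flip: fps_const_neg)
        then have "(\<Sum>k\<le>m. fps_nth (- fps_const (r * \<theta>) * (zx * geo_fps \<theta> t) * nb_fps r \<theta> t) k) = - (r * \<theta>) * (\<Sum>k\<le>m. fps_nth (zx * ?GN) k)"
          by (simp only: fps_mult_left_const_nth sum_distrib_left)
        also have "\<dots> = r * \<theta> * fps_nth ?GN m" by (simp add: sum_x_mult del: fps_mult_nth_0)
        also have "\<dots> \<ge> 0"
        proof -
          have "0 \<le> fps_nth ?GN m" unfolding fps_mult_nth
            using nb_fps_nonneg[OF t0 t(2)] nb_ratio_bounds(1)[OF t0] one_theta[OF t0]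
            by (intro sum_nonneg mult_nonneg_nonneg) (auto simp: geo_fps_def)
          then show ?thesis using r \<theta> by simp
        qed
        finally show ?thesis .
      qed
      ultimately show "\<exists>y. (?S has_real_derivative y) (at t) \<and> 0 \<le> y" by blast
    qed
    also have "?S 1 = 1" by (simp add: nb_fps_1)
    finally show ?thesis using nb_fps_nonneg[OF assms] Suc by (simp add: lessThan_Suc_atMost)
  qed simp
qed

text \<open>At \<open>s = 0\<close> the logarithmic derivative is r times a geometric series.
  Convolved with the negative binomial weights b it reproduces their recursion (k + 1) b(k + 1) = (r
  + k) q b(k), so both sides solve the same recursion.\<close>

lemma nb_fps_0: "nb_fps r \<theta> 0 = Abs_fps (pmf (negbin_pmf r (1 / (1 + \<theta>))))"
proof (rule fps_ext)
  fix k
  let ?p = "1 / (1 + \<theta>)" and ?q = "nb_ratio \<theta> 1"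
  have p: "0 < ?p" "?p < 1" "1 - ?p = ?q" using \<theta> by (auto simp: nb_ratio_def field_simps)
  let ?b = "\<lambda>k. ((r + real k - 1) gchoose k) * ?p powr r * ?q ^ k"
  have b: "pmf (negbin_pmf r ?p) k = ?b k" for k using pmf_negbin[OF r p(1,2)] p(3) by simp
  have rec: "real (Suc k) * ?b (Suc k) = (r + real k) * ?q * ?b k" for k
  proof -
    have "((r + real (Suc k) - 1) gchoose Suc k) * real (Suc k) = (r + real k) * ((r + real k - 1) gchoose k)"
    proof -
      have eq: "r + real (Suc k) - 1 = r + real k" by simp
      show ?thesis unfolding eq using gbinomial_absorption'[of "Suc k" "r + real k"] by (simp add: field_simps del: of_nat_Suc)
    qed
    then show ?thesis by (simp add: mult_ac del: of_nat_Suc) 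
  qed
  have a: "nb_log_deriv r \<theta> 0 j = r * ?q ^ Suc j" for j by (simp add: nb_log_deriv_def nb_ratio_def)
  have conv: "(\<Sum>j\<le>k. r * ?q ^ Suc j * ?b (k - j)) = real (Suc k) * ?b (Suc k)" for k
  proof (induction k)
    case 0
    then show ?case by simp
  next
    case (Suc k)
    have "(\<Sum>j\<le>Suc k. r * ?q ^ Suc j * ?b (Suc k - j)) = r * ?q * ?b (Suc k) + (\<Sum>j\<le>k. r * ?q ^ Suc (Suc j) * ?b (k - j))"
      by (subst sum.atMost_Suc_shift) simp
    also have "(\<Sum>j\<le>k. r * ?q ^ Suc (Suc j) * ?b (k - j)) = ?q * (\<Sum>j\<le>k. r * ?q ^ Suc j * ?b (k - j))"
      unfolding sum_distrib_left by (intro sum.cong) simp_all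
    also have "\<dots> = ?q * (real (Suc k) * ?b (Suc k))" by (simp only: Suc.IH)
    also have "r * ?q * ?b (Suc k) + ?q * (real (Suc k) * ?b (Suc k)) = (r + real (Suc k)) * ?q * ?b (Suc k)"
    proof -
      have "r * q * B + q * (N * B) = (r + N) * q * B" for q B N by (simp add: algebra_simps)
      then show ?thesis .
    qed
    also have "\<dots> = real (Suc (Suc k)) * ?b (Suc (Suc k))" by (rule rec[symmetric])
    finally show ?case .
  qed
  have "ode_series (nb_log_deriv r \<theta> 0) (?p powr r) k = ?b k"
  proof (induction k rule: less_induct)
    case (less k)
    show ?case
    proof (cases k)
      case (Suc i)
      have "(\<Sum>j\<le>i. nb_log_deriv r \<theta> 0 j * ode_series (nb_log_deriv r \<theta> 0) (?p powr r) (i - j)) = (\<Sum>j\<le>i. r * ?q ^ Suc j * ?b (i - j))"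
        by (intro sum.cong arg_cong2[where f="(*)"] a less) (use Suc in auto)
      then show ?thesis unfolding Suc ode_series.simps conv by (simp del: of_nat_Suc)
    qed simp
  qed
  then show "fps_nth (nb_fps r \<theta> 0) k = fps_nth (Abs_fps (pmf (negbin_pmf r (1 / (1 + \<theta>))))) k"
    using b by (simp add: nb_fps_def)
qed

end

lemma pmf_convolve: "pmf (convolve_pmf A B) k = fps_nth (Abs_fps (pmf A) * Abs_fps (pmf B)) k"
proof -
  have "pmf (convolve_pmf A B) k = measure_pmf.prob (pair_pmf A B) {z. fst z + snd z = k}"
    unfolding convolve_pmf_def pmf_map by (simp add: vimage_def case_prod_beta)
  also have "{z. fst z + snd z = k} = (\<lambda>i. (i, k - i)) ` {0..k}"
    by (force simp: image_iff)
  also have "measure_pmf.prob (pair_pmf A B) ((\<lambda>i. (i, k - i)) ` {0..k}) = (\<Sum>z\<in>(\<lambda>i. (i, k - i)) ` {0..k}. pmf (pair_pmf A B) z)"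
    by (rule measure_measure_pmf_finite) simp
  also have "\<dots> = (\<Sum>i=0..k. pmf A i * pmf B (k - i))"
    by (subst sum.reindex) (auto simp: inj_on_def pmf_pair)
  finally show ?thesis by (simp add: fps_mult_nth)
qed

lemma pois_fps_pmf: "0 < \<kappa> \<Longrightarrow> Abs_fps (pmf (poisson_pmf \<kappa>)) = pois_fps \<kappa>"
  by (rule fps_ext) (simp add: pois_fps_def)

section \<open>Interpolation between the two laws\<close>

definition has_fps_derivative :: "(real \<Rightarrow> real fps) \<Rightarrow> real fps \<Rightarrow> real \<Rightarrow> bool" where
  "has_fps_derivative F F' s \<longleftrightarrow> (\<forall>k. ((\<lambda>s. fps_nth (F s) k) has_real_derivative fps_nth F' k) (at s))"

lemma fps_derivative_mult:
  assumes "has_fps_derivative F F' s" "has_fps_derivative G G' s"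
  shows "has_fps_derivative (\<lambda>s. F s * G s) (F' * G s + F s * G') s"
  unfolding has_fps_derivative_def
proof
  fix k
  have "((\<lambda>s. \<Sum>i=0..k. fps_nth (F s) i * fps_nth (G s) (k - i)) has_real_derivative 
     (\<Sum>i=0..k. fps_nth F' i * fps_nth (G s) (k - i) + fps_nth (F s) i * fps_nth G' (k - i))) (at s)"
  proof (rule DERIV_sum)
    fix i
    have "((\<lambda>s. fps_nth (F s) i) has_real_derivative fps_nth F' i) (at s)"
      "((\<lambda>s. fps_nth (G s) (k - i)) has_real_derivative fps_nth G' (k - i)) (at s)"
      using assms by (auto simp: has_fps_derivative_def)
    from DERIV_mult[OF this] show "((\<lambda>s. fps_nth (F s) i * fps_nth (G s) (k - i)) has_real_derivative 
      (fps_nth F' i * fps_nth (G s) (k - i) + fps_nth (F s) i * fps_nth G' (k - i))) (at s)"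
      by (rule DERIV_cong) (simp add: mult.commute)
  qed
  then show "((\<lambda>s. fps_nth (F s * G s) k) has_real_derivative fps_nth (F' * G s + F s * G') k) (at s)"
    by (simp add: fps_mult_nth sum.distrib)
qed

lemma fps_derivative_lin_fps: "has_fps_derivative lin_fps zx s"
  unfolding has_fps_derivative_def lin_fps_def fps_add_nth fps_mult_left_const_nth
  by (auto intro!: derivative_eq_intros)

lemma fps_derivative_lin_fps_power: "has_fps_derivative (\<lambda>s. lin_fps s ^ w) (of_nat w * (zx * lin_fps s ^ (w - 1))) s"
proof (induction w)
  case 0
  show ?case by (simp add: has_fps_derivative_def)
next
  case (Suc w)
  have "zx * lin_fps s ^ w + lin_fps s * (of_nat w * (zx * lin_fps s ^ (w - 1))) = of_nat (Suc w) * (zx * lin_fps s ^ (Suc w - 1))"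
    by (cases w) (simp_all add: algebra_simps)
  then show ?case using fps_derivative_mult[OF fps_derivative_lin_fps Suc] by simp
qed

lemma fps_derivative_pois_fps: "has_fps_derivative (\<lambda>s. pois_fps (l * (1 - s))) (- fps_const l * (zx * pois_fps (l * (1 - s)))) s"
  unfolding has_fps_derivative_def
proof
  fix k
  let ?\<kappa> = "l * (1 - s)"
  have e: "- fps_const l * (zx * pois_fps ?\<kappa>) = fps_const (- l) * (zx * pois_fps ?\<kappa>)" by (simp flip: fps_const_neg)
  show "((\<lambda>s. fps_nth (pois_fps (l * (1 - s))) k) has_real_derivative fps_nth (- fps_const l * (zx * pois_fps ?\<kappa>)) k) (at s)"
  proof (cases k)
    case 0
    show ?thesis unfolding e fps_mult_left_const_nth nth_x_mult 0
      by (auto simp: pois_fps_def intro!: derivative_eq_intros)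
  next
    case (Suc j)
    have f: "fact (Suc j) = real (Suc j) * fact j" by simp
    have "((\<lambda>s. exp (- (l * (1 - s))) * (l * (1 - s)) ^ Suc j / fact (Suc j)) has_real_derivative
      (exp (- ?\<kappa>) * l * ?\<kappa> ^ Suc j + exp (- ?\<kappa>) * (real (Suc j) * ?\<kappa> ^ j * (- l))) / fact (Suc j)) (at s)"
      by (auto intro!: derivative_eq_intros simp del: fact_Suc of_nat_Suc power_Suc)
    also have "(exp (- ?\<kappa>) * l * ?\<kappa> ^ Suc j + exp (- ?\<kappa>) * (real (Suc j) * ?\<kappa> ^ j * (- l))) / fact (Suc j) = 
       - l * (exp (- ?\<kappa>) * ?\<kappa> ^ j / fact j - exp (- ?\<kappa>) * ?\<kappa> ^ Suc j / fact (Suc j))"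
      unfolding f by (simp add: field_simps del: of_nat_Suc)
    finally show ?thesis unfolding e fps_mult_left_const_nth nth_x_mult Suc by (simp add: pois_fps_def del: fact_Suc)
  qed
qed

text \<open>As a function of the count \<open>w\<close>: the mass of \<open>A\<close> under thinned
  \<open>w\<close> plus an independent part with generating function \<open>V\<close>, after one
  multiplication by z - 1. This is the test function fed to the size-bias expansion.\<close>

definition fps_test :: "nat set \<Rightarrow> real \<Rightarrow> real fps \<Rightarrow> nat \<Rightarrow> real" where
  "fps_test A s V w = (\<Sum>k\<in>A. fps_nth (zx * lin_fps s ^ w * V) k)"

lemma fps_test_add: "fps_test A s (V + V') w = fps_test A s V w + fps_test A s V' w"
  unfolding fps_test_def by (simp only: distrib_left sum.distrib[symmetric] fps_add_nth[symmetric])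

lemma fps_test_const: "fps_test A s (fps_const c * V) w = c * fps_test A s V w"
proof -
  have "zx * lin_fps s ^ w * (fps_const c * V) = fps_const c * (zx * lin_fps s ^ w * V)" by (simp only: mult_ac)
  then show ?thesis unfolding fps_test_def sum_distrib_left fps_mult_left_const_nth[symmetric] by (simp only:)
qed

text \<open>Raising \<open>w\<close> by one multiplies by 1 + s (z - 1), so differencing in
  \<open>w\<close> multiplies by s (z - 1).\<close>

lemma fwd_diff_fps_test: "fwd_diff (fps_test A s V) = fps_test A s (fps_const s * (zx * V))"
proof
  fix w
  have "zx * lin_fps s ^ Suc w * V - zx * lin_fps s ^ w * V = zx * lin_fps s ^ w * (fps_const s * (zx * V))"
    by (simp add: lin_fps_def algebra_simps)
  then have "fps_nth (zx * lin_fps s ^ Suc w * V) k - fps_nth (zx * lin_fps s ^ w * V) k = fps_nth (zx * lin_fps s ^ w * (fps_const s * (zx * V))) k" for k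
    by (metis fps_sub_nth)
  then show "fwd_diff (fps_test A s V) w = fps_test A s (fps_const s * (zx * V)) w"
    unfolding fwd_diff_def fps_test_def sum_subtractf[symmetric] by (intro sum.cong refl)
qed

lemma fwd_diff3_fps_test: "fwd_diff (fwd_diff (fwd_diff (fps_test A s V))) w = s ^ 3 * (\<Sum>k\<in>A. fps_nth (zx ^ 4 * lin_fps s ^ w * V) k)"
proof -
  have "fps_const s * (zx * (fps_const s * (zx * (fps_const s * (zx * V))))) = fps_const (s ^ 3) * (zx ^ 3 * V)"
    by (simp add: power3_eq_cube mult_ac fps_const_mult[symmetric] del: fps_const_mult)
  moreover have "zx * lin_fps s ^ w * (zx ^ 3 * V) = zx ^ 4 * lin_fps s ^ w * V"
    by (simp add: power3_eq_cube power4_eq_xxxx mult_ac)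
  ultimately show ?thesis unfolding fwd_diff_fps_test by (simp only: fps_test_const) (simp only: fps_test_def)
qed

text \<open>Thinning twice: an \<open>s\<close>-thinned count averaged over a
  \<open>t\<close>-sample is a \<open>t * s\<close>-thinned count. With t = 1/8 each isolated
  triangle contributes a factor \<open>lin_fps (s / 8)\<close>.\<close>

lemma bern_lin_fps:
  assumes "finite I"
  shows "bern I t (\<lambda>J. fps_nth (F * lin_fps s ^ card J) k) = fps_nth (F * lin_fps (t * s) ^ card I) k"
  using assms
proof (induction I arbitrary: F rule: finite_induct)
  case (insert i I)
  have "bern I t (\<lambda>J. fps_nth (F * lin_fps s ^ card (insert i J)) k) = bern I t (\<lambda>J. fps_nth (F * lin_fps s * lin_fps s ^ card J) k)"
  proof (rule bern_cong)
    fix J assume "J \<subseteq> I"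
    then have "card (insert i J) = Suc (card J)" using insert finite_subset by (subst card_insert_disjoint) auto
    then show "fps_nth (F * lin_fps s ^ card (insert i J)) k = fps_nth (F * lin_fps s * lin_fps s ^ card J) k" by (simp add: mult.assoc)
  qed
  then have "bern (insert i I) t (\<lambda>J. fps_nth (F * lin_fps s ^ card J) k) = 
    t * fps_nth (F * lin_fps s * lin_fps (t * s) ^ card I) k + (1 - t) * fps_nth (F * lin_fps (t * s) ^ card I) k"
    using insert by (simp add: bern_insert)
  also have "\<dots> = fps_nth (fps_const t * (F * lin_fps s * lin_fps (t * s) ^ card I) + fps_const (1 - t) * (F * lin_fps (t * s) ^ card I)) k"
    by (simp only: fps_add_nth fps_mult_left_const_nth)
  also have "fps_const t * (F * lin_fps s * lin_fps (t * s) ^ card I) + fps_const (1 - t) * (F * lin_fps (t * s) ^ card I) = 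
    F * lin_fps (t * s) ^ card I * (fps_const t * lin_fps s + fps_const (1 - t))" by (simp only: distrib_left mult_ac)
  also have "fps_const t * lin_fps s + fps_const (1 - t) = lin_fps (t * s)"
    by (simp add: lin_fps_def algebra_simps fps_const_sub[symmetric] fps_const_mult[symmetric] del: fps_const_sub fps_const_mult)
  finally show ?case using insert by (simp add: mult_ac)
qed simp

lemma forced_mean_fwd_diff3_fps_test_le:
  assumes q: "0 \<le> p" "2 * p \<le> 1" "12 * p\<^sup>2 \<le> 1" and v: "valid_state n U H \<S>" "card U \<le> 6"
    and L: "0 < L" "L \<le> real ((n - 6) choose 3) * (2 * p) ^ 3 * (1 - 12 * p\<^sup>2) ^ n"
    and s: "0 < s" "s < 1" and \<kappa>: "0 \<le> \<kappa>" and Z: "l1_bound Z 1" and A: "finite A"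
  shows "\<bar>forced_mean n p H \<S> (fwd_diff (fwd_diff (fwd_diff (fps_test A s (pois_fps \<kappa> * Z)))))\<bar> \<le> 
     6000 / L\<^sup>2 + 64 / (1 + \<kappa>)\<^sup>2 * (128 * real n ^ 3 * p ^ 3 * (1 + 4 * real n * p\<^sup>2) / L\<^sup>2)"
proof (rule forced_mean_smooth[OF q v L])
  let ?f = "fwd_diff (fwd_diff (fwd_diff (fps_test A s (pois_fps \<kappa> * Z))))"
  have e: "bern I (1/8) (\<lambda>J. ?f (r + card J)) = s ^ 3 * (\<Sum>k\<in>A. fps_nth (zx ^ 4 * lin_fps s ^ r * lin_fps (s / 8) ^ card I * (pois_fps \<kappa> * Z)) k)"
    if "finite I" for I :: "nat set set" and r
  proof -
    have "bern I (1/8) (\<lambda>J. ?f (r + card J)) = 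
       s ^ 3 * (\<Sum>k\<in>A. bern I (1/8) (\<lambda>J. fps_nth ((zx ^ 4 * lin_fps s ^ r * (pois_fps \<kappa> * Z)) * lin_fps s ^ card J) k))"
      unfolding fwd_diff3_fps_test bern_cmult bern_sum by (simp only: power_add mult_ac)
    then show ?thesis unfolding bern_lin_fps[OF that] by (simp add: mult_ac)
  qed
  have s3: "0 \<le> s ^ 3" "s ^ 3 \<le> 1" using s by (auto intro: power_le_one)
  have s8: "0 < s / 8" "s / 8 < 1" using s by auto
  fix r :: nat and I :: "nat set set" assume I: "finite I"
  have "l1_bound (zx ^ 4 * pois_fps \<kappa> * (lin_fps s ^ r * lin_fps (s / 8) ^ card I * Z)) (64 / (1 + \<kappa>)\<^sup>2)"
    using s s8 by (intro l1_bound_mult1 l1_bound_x4_pois_fps \<kappa> Z l1_bound_lin_fps_power) auto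
  from l1_bound_sum_set[OF this A] 
  have "\<bar>\<Sum>k\<in>A. fps_nth (zx ^ 4 * lin_fps s ^ r * lin_fps (s / 8) ^ card I * (pois_fps \<kappa> * Z)) k\<bar> \<le> 64 / (1 + \<kappa>)\<^sup>2"
    by (simp only: mult_ac)
  then have "\<bar>bern I (1/8) (\<lambda>J. ?f (r + card J))\<bar> \<le> 1 * (64 / (1 + \<kappa>)\<^sup>2)"
    unfolding e[OF I] abs_mult using s3 by (intro mult_mono) auto
  then show "\<bar>bern I (1/8) (\<lambda>J. ?f (r + card J))\<bar> \<le> 64 / (1 + \<kappa>)\<^sup>2" by simp
  assume m: "L / 2 \<le> card I"
  then have m0: "0 < card I" using L by linarith
  have "l1_bound (zx ^ 4 * lin_fps (s / 8) ^ card I * (lin_fps s ^ r * (pois_fps \<kappa> * Z))) (16 / (real (card I) * (s / 8) * (1 - s / 8))\<^sup>2)"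
    using s s8 m0 by (intro l1_bound_mult1 l1_bound_x4_lin_fps_power l1_bound_pois_fps \<kappa> Z l1_bound_lin_fps_power) auto
  from l1_bound_sum_set[OF this A] 
  have "\<bar>\<Sum>k\<in>A. fps_nth (zx ^ 4 * lin_fps s ^ r * lin_fps (s / 8) ^ card I * (pois_fps \<kappa> * Z)) k\<bar> \<le> 16 / (real (card I) * (s / 8) * (1 - s / 8))\<^sup>2"
    by (simp only: mult_ac)
  also have "\<dots> \<le> 16 / (L / 2 * (s / 8) * (7 / 8))\<^sup>2"
    using m m0 s s8 L by (intro divide_left_mono power_mono mult_mono mult_pos_pos zero_less_power) auto
  finally have "\<bar>bern I (1/8) (\<lambda>J. ?f (r + card J))\<bar> \<le> s ^ 3 * (16 / (L / 2 * (s / 8) * (7 / 8))\<^sup>2)"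
    unfolding e[OF I] abs_mult using s3 by (intro mult_mono) auto
  \<comment> \<open>The s^3 of the three differences outweighs the s^-2 of the binomial bound. The
    number is 16 (128/7)^2, below 6000; the 7 comes from 1 - s/8 >= 7/8.\<close>
  also have "\<dots> = s * (16 * 16384 / 49) / L\<^sup>2" using s by (simp add: power2_eq_square power3_eq_cube field_simps)
  also have "\<dots> \<le> 6000 / L\<^sup>2" using s by (intro divide_right_mono) auto
  finally show "\<bar>bern I (1/8) (\<lambda>J. ?f (r + card J))\<bar> \<le> 6000 / L\<^sup>2" .
qed auto

lemma wmean_has_derivative:
  assumes "\<And>w. ((\<lambda>s. f s w) has_real_derivative f' w) (at s)"
  shows "((\<lambda>s. wmean n p (f s)) has_real_derivative wmean n p f') (at s)"
  unfolding wmean_def bern_def by (intro DERIV_sum DERIV_cmult assms)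

context
  fixes n :: nat and p l r \<theta> L :: real and A :: "nat set"
  assumes q: "0 \<le> p" "2 * p \<le> 1" "12 * p\<^sup>2 \<le> 1" 
    and L: "0 < L" "L \<le> real ((n - 6) choose 3) * (2 * p) ^ 3 * (1 - 12 * p\<^sup>2) ^ n"
    and par: "0 < l" "0 < r" "0 < \<theta>"
    and match: "real (n choose 3) * p ^ 3 = l + r * \<theta>" "coeff1 n p = r * \<theta>\<^sup>2" "coeff2 n p = r * \<theta> ^ 3"
    and A: "finite A"
begin

text \<open>\<open>g 0\<close> is the probability of \<open>A\<close> under \<open>M\<^sub>2\<close>, and \<open>g 1\<close> the one under the law of the triangle
  count; \<open>lin_fps s ^ w\<close> is the generating function of \<open>w\<close> thinned with probability \<open>s\<close>.\<close>
private definition "V s = pois_fps (l * (1 - s)) * nb_fps r \<theta> s"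
private definition "g s = wmean n p (\<lambda>w. \<Sum>k\<in>A. fps_nth (lin_fps s ^ w * V s) k)"
text \<open>\<open>K\<close> collects the coefficients of the third differences that survive the
  matching: the remainder of the size-bias expansion and the tail of the geometric series.
  \<open>\<Xi>\<close> is the bound of \<open>forced_mean_smooth\<close> for the probability of too
  few isolated triangles.\<close>

private definition "K = real (n choose 3) * p ^ 3 * (excess n p * (20 * (n * p\<^sup>2 + 1))) + r * \<theta> ^ 4"
private definition "\<Xi> = 128 * real n ^ 3 * p ^ 3 * (1 + 4 * real n * p\<^sup>2) / L\<^sup>2"

text \<open>Iterate G = 1 + \<theta> s (z - 1) G three times, where s (z - 1) acts as the forward
  difference; the last term is an exact remainder.\<close>

lemma geo_fps_fps_test_expansion:
  assumes s: "0 \<le> s"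
  defines "h \<equiv> fps_test A s (V s)" and "hg \<equiv> fps_test A s (pois_fps (l * (1 - s)) * (geo_fps \<theta> s * nb_fps r \<theta> s))"
  shows "hg w = h w + \<theta> * fwd_diff h w + \<theta>\<^sup>2 * fwd_diff (fwd_diff h) w + \<theta> ^ 3 * fwd_diff (fwd_diff (fwd_diff hg)) w"
proof -
  let ?GV = "pois_fps (l * (1 - s)) * (geo_fps \<theta> s * nb_fps r \<theta> s)"
  have "?GV - fps_const (\<theta> * s) * (zx * ?GV) = ((1 - fps_const (\<theta> * s) * zx) * geo_fps \<theta> s) * V s"
    unfolding V_def by (simp only: left_diff_distrib right_diff_distrib mult_1_left mult_ac)
  also have "\<dots> = V s" using geo_fps_inverse[OF par(2,3) s] by simp
  finally have "?GV = V s + fps_const (\<theta> * s) * (zx * ?GV)" by (simp add: algebra_simps)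
  moreover have "fps_const (\<theta> * s) * (zx * ?GV) = fps_const \<theta> * (fps_const s * (zx * ?GV))" by simp
  ultimately have GV: "?GV = V s + fps_const \<theta> * (fps_const s * (zx * ?GV))" by metis
  have 1: "hg = (\<lambda>w. h w + \<theta> * fwd_diff hg w)"
  proof
    fix w
    have "hg w = fps_test A s (V s + fps_const \<theta> * (fps_const s * (zx * ?GV))) w" unfolding hg_def by (subst GV) (rule refl)
    then show "hg w = h w + \<theta> * fwd_diff hg w" by (simp only: fps_test_add fps_test_const h_def hg_def fwd_diff_fps_test)
  qed
  have 2: "fwd_diff hg = (\<lambda>w. fwd_diff h w + \<theta> * fwd_diff (fwd_diff hg) w)"
    by (subst 1) (simp add: fwd_diff_def fun_eq_iff algebra_simps)
  have 3: "fwd_diff (fwd_diff hg) = (\<lambda>w. fwd_diff (fwd_diff h) w + \<theta> * fwd_diff (fwd_diff (fwd_diff hg)) w)"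
    by (subst 2) (simp add: fwd_diff_def fun_eq_iff algebra_simps)
  show ?thesis using fun_cong[OF 1, of w] fun_cong[OF 2, of w] fun_cong[OF 3, of w]
    by (simp add: power2_eq_square power3_eq_cube algebra_simps)
qed

lemma V_derivative:
  assumes s: "0 \<le> s"
  shows "((\<lambda>s. \<Sum>k\<in>A. fps_nth (lin_fps s ^ w * V s) k) has_real_derivative 
     real w * fps_test A s (V s) (w - 1) - l * fps_test A s (V s) w - r * \<theta> * fps_test A s (pois_fps (l * (1 - s)) * (geo_fps \<theta> s * nb_fps r \<theta> s)) w) (at s)"
proof -
  let ?P = "pois_fps (l * (1 - s))" and ?N = "nb_fps r \<theta> s"
  have N: "has_fps_derivative (nb_fps r \<theta>) (- fps_const (r * \<theta>) * (zx * geo_fps \<theta> s) * ?N) s"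
    unfolding has_fps_derivative_def using nb_fps_has_deriv[OF par(2,3) s] by blast
  let ?D = "of_nat w * (zx * lin_fps s ^ (w - 1)) * V s + lin_fps s ^ w * 
     (- fps_const l * (zx * ?P) * ?N + ?P * (- fps_const (r * \<theta>) * (zx * geo_fps \<theta> s) * ?N))"
  have "has_fps_derivative (\<lambda>s. lin_fps s ^ w * V s) ?D s"
    unfolding V_def by (intro fps_derivative_mult fps_derivative_lin_fps_power fps_derivative_pois_fps N)
  then have "((\<lambda>s. \<Sum>k\<in>A. fps_nth (lin_fps s ^ w * V s) k) has_real_derivative (\<Sum>k\<in>A. fps_nth ?D k)) (at s)"
    by (intro DERIV_sum) (auto simp: has_fps_derivative_def)
  moreover have D: "?D = fps_const (real w) * (zx * lin_fps s ^ (w - 1) * V s) - fps_const l * (zx * lin_fps s ^ w * V s)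
     - fps_const (r * \<theta>) * (zx * lin_fps s ^ w * (?P * (geo_fps \<theta> s * ?N)))"
  proof -
    have "w * (Z * M') * (P * N) + M * (- a * (Z * P) * N + P * (- b * (Z * G) * N)) =
      w * (Z * M' * (P * N)) - a * (Z * M * (P * N)) - b * (Z * M * (P * (G * N)))" for w Z M M' P N G a b :: "real fps"
      by (simp add: algebra_simps)
    then show ?thesis unfolding V_def fps_of_nat .
  qed
  have "(\<Sum>k\<in>A. fps_nth ?D k) = real w * fps_test A s (V s) (w - 1) - l * fps_test A s (V s) w - r * \<theta> * fps_test A s (?P * (geo_fps \<theta> s * ?N)) w"
    unfolding D fps_test_def by (simp only: fps_sub_nth fps_mult_left_const_nth sum_subtractf sum_distrib_left)
  ultimately show ?thesis by metis
qed

text \<open>Expanding \<open>hg\<close> in powers of \<theta> turns the subtracted terms into h and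
  its differences with coefficients l + r \<theta>, r \<theta>^2 and r \<theta>^3. By
  \<open>match\<close> these are the coefficients of the size-bias expansion, so only third
  differences remain.\<close>

lemma g_derivative_bound:
  assumes s: "0 < s" "s < 1"
  shows "\<exists>g'. (g has_real_derivative g') (at s) \<and> \<bar>g'\<bar> \<le> K * (6000 / L\<^sup>2 + 64 / (1 + l * (1 - s))\<^sup>2 * \<Xi>)"
proof -
  let ?h = "fps_test A s (V s)" and ?hg = "fps_test A s (pois_fps (l * (1 - s)) * (geo_fps \<theta> s * nb_fps r \<theta> s))"
  let ?B = "6000 / L\<^sup>2 + 64 / (1 + l * (1 - s))\<^sup>2 * \<Xi>"
  let ?\<mu> = "real (n choose 3) * p ^ 3"
  have p: "0 \<le> p" "p \<le> 1" using q by auto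
  have s0: "0 \<le> s" "s \<le> 1" using s by auto
  have \<kappa>: "0 \<le> l * (1 - s)" using s par by auto
  have Bh: "\<bar>forced_mean n p H \<S> (fwd_diff (fwd_diff (fwd_diff ?h)))\<bar> \<le> ?B" if "valid_state n U H \<S>" "card U \<le> 6" for U H \<S>
    unfolding V_def \<Xi>_def by (rule forced_mean_fwd_diff3_fps_test_le[OF q that L s \<kappa> l1_bound_nb_fps[OF par(2,3) s0] A])
  have Bg: "\<bar>wmean n p (fwd_diff (fwd_diff (fwd_diff ?hg)))\<bar> \<le> ?B"
    unfolding wmean_eq_forced_mean \<Xi>_def 
    by (rule forced_mean_fwd_diff3_fps_test_le[OF q valid_state_triples[of "{}"] _ L s \<kappa> l1_bound_mult1[OF l1_bound_geo_fps[OF par(2,3) s0(1)] l1_bound_nb_fps[OF par(2,3) s0]] A]) auto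
  let ?g' = "wmean n p (\<lambda>w. real w * ?h (w - 1) - l * ?h w - r * \<theta> * ?hg w)"
  have "(g has_real_derivative ?g') (at s)"
    unfolding g_def by (intro wmean_has_derivative V_derivative s0)
  moreover have "?g' = wmean n p (\<lambda>w. real w * ?h (w - 1)) - l * wmean n p ?h - r * \<theta> * wmean n p ?hg"
    unfolding wmean_diff wmean_cmult ..
  moreover have "wmean n p ?hg = wmean n p (\<lambda>w. ?h w + \<theta> * fwd_diff ?h w + \<theta>\<^sup>2 * fwd_diff (fwd_diff ?h) w + \<theta> ^ 3 * fwd_diff (fwd_diff (fwd_diff ?hg)) w)"
    using geo_fps_fps_test_expansion[OF s0(1)] by (intro arg_cong[where f="wmean n p"]) (rule ext)
  then have "wmean n p ?hg = wmean n p ?h + \<theta> * wmean n p (fwd_diff ?h) + \<theta>\<^sup>2 * wmean n p (fwd_diff (fwd_diff ?h)) + \<theta> ^ 3 * wmean n p (fwd_diff (fwd_diff (fwd_diff ?hg)))"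
    by (simp only: wmean_add wmean_cmult)
  then have hg: "r * \<theta> * wmean n p ?hg = r * \<theta> * wmean n p ?h + r * \<theta>\<^sup>2 * wmean n p (fwd_diff ?h) + r * \<theta> ^ 3 * wmean n p (fwd_diff (fwd_diff ?h)) 
      + r * \<theta> ^ 4 * wmean n p (fwd_diff (fwd_diff (fwd_diff ?hg)))"
    by (simp add: power2_eq_square power3_eq_cube power4_eq_xxxx algebra_simps)
  ultimately have g': "(g has_real_derivative ?g') (at s)" "?g' = (wmean n p (\<lambda>w. real w * ?h (w - 1)) - ?\<mu> * wmean n p ?h
     - coeff1 n p * wmean n p (fwd_diff ?h) - coeff2 n p * wmean n p (fwd_diff (fwd_diff ?h))) - r * \<theta> ^ 4 * wmean n p (fwd_diff (fwd_diff (fwd_diff ?hg)))"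
    unfolding match by (auto simp: algebra_simps)
  have "\<bar>?g'\<bar> \<le> \<bar>wmean n p (\<lambda>w. real w * ?h (w - 1)) - ?\<mu> * wmean n p ?h
     - coeff1 n p * wmean n p (fwd_diff ?h) - coeff2 n p * wmean n p (fwd_diff (fwd_diff ?h))\<bar> + \<bar>r * \<theta> ^ 4 * wmean n p (fwd_diff (fwd_diff (fwd_diff ?hg)))\<bar>"
    unfolding g'(2) by (rule abs_triangle_ineq4)
  also have "\<dots> \<le> ?\<mu> * (excess n p * (20 * (n * p\<^sup>2 + 1) * ?B)) + r * \<theta> ^ 4 * ?B"
  proof (rule add_mono)
    show "\<bar>r * \<theta> ^ 4 * wmean n p (fwd_diff (fwd_diff (fwd_diff ?hg)))\<bar> \<le> r * \<theta> ^ 4 * ?B"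
      unfolding abs_mult using par Bg by (intro mult_mono) auto
  qed (rule wmean_expansion[OF p Bh])
  also have "\<dots> = K * ?B" unfolding K_def by (simp only: distrib_right mult.assoc)
  finally show ?thesis using g'(1) by blast
qed

lemma interpolation:
  "\<bar>wmean n p (indicator A) - (\<Sum>k\<in>A. fps_nth (pois_fps l * nb_fps r \<theta> 0) k)\<bar> \<le> K * (6000 / L\<^sup>2 + 64 * \<Xi> / l)"
proof -
  have K: "0 \<le> K" unfolding K_def excess_def using q par by (intro add_nonneg_nonneg mult_nonneg_nonneg) auto
  have X: "0 \<le> \<Xi>" unfolding \<Xi>_def using q by (intro divide_nonneg_nonneg mult_nonneg_nonneg add_nonneg_nonneg) auto
  \<comment> \<open>An antiderivative of the bound on the derivative of \<open>g\<close>, whose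
    Poisson term integrates to at most 64 \<Xi> / l. Both \<open>?G - g\<close> and
    \<open>?G + g\<close> are nondecreasing; the derivative bound is known on the open interval, and
    continuity covers the endpoints.\<close>
  let ?G = "\<lambda>s. K * (6000 / L\<^sup>2 * s + 64 * \<Xi> / l / (1 + l * (1 - s)))"
  have pos: "0 < 1 + l * (1 - s)" if "0 \<le> s" "s \<le> 1" for s using that par by (simp add: add_pos_nonneg)
  have G: "(?G has_real_derivative K * (6000 / L\<^sup>2 + 64 / (1 + l * (1 - s))\<^sup>2 * \<Xi>)) (at s)" if "0 \<le> s" "s \<le> 1" for s
  proof -
    have "((\<lambda>s. 64 * \<Xi> / l / (1 + l * (1 - s))) has_real_derivative 64 / (1 + l * (1 - s))\<^sup>2 * \<Xi>) (at s)"
      using pos[OF that] par(1) by (auto intro!: derivative_eq_intros simp: power2_eq_square)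
    moreover have "((\<lambda>s. 6000 / L\<^sup>2 * s) has_real_derivative 6000 / L\<^sup>2) (at s)"
      using DERIV_cmult_Id .
    ultimately show ?thesis by (intro DERIV_cmult DERIV_add)
  qed
  have gcont: "continuous_on {0..1} g"
    unfolding g_def by (rule DERIV_continuous_on, rule has_field_derivative_at_within, rule wmean_has_derivative, rule V_derivative) simp
  have Gcont: "continuous_on {0..1} ?G"
    by (rule DERIV_continuous_on, rule has_field_derivative_at_within, rule G) auto
  have "?G 0 - g 0 \<le> ?G 1 - g 1"
  proof (rule DERIV_nonneg_imp_increasing_open[where f = "\<lambda>s. ?G s - g s"])
    fix s :: real assume s: "0 < s" "s < 1"
    obtain g' where g': "(g has_real_derivative g') (at s)" "\<bar>g'\<bar> \<le> K * (6000 / L\<^sup>2 + 64 / (1 + l * (1 - s))\<^sup>2 * \<Xi>)"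
      using g_derivative_bound[OF s] by blast
    have "((\<lambda>s. ?G s - g s) has_real_derivative K * (6000 / L\<^sup>2 + 64 / (1 + l * (1 - s))\<^sup>2 * \<Xi>) - g') (at s)"
      by (rule DERIV_diff[OF G g'(1)]) (use s in auto)
    then show "\<exists>y. ((\<lambda>s. ?G s - g s) has_real_derivative y) (at s) \<and> 0 \<le> y" using g'(2) abs_le_D1 by fastforce
  qed (use gcont Gcont in \<open>auto intro!: continuous_on_diff\<close>)
  moreover have "?G 0 + g 0 \<le> ?G 1 + g 1"
  proof (rule DERIV_nonneg_imp_increasing_open[where f = "\<lambda>s. ?G s + g s"])
    fix s :: real assume s: "0 < s" "s < 1"
    obtain g' where g': "(g has_real_derivative g') (at s)" "\<bar>g'\<bar> \<le> K * (6000 / L\<^sup>2 + 64 / (1 + l * (1 - s))\<^sup>2 * \<Xi>)"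
      using g_derivative_bound[OF s] by blast
    have "((\<lambda>s. ?G s + g s) has_real_derivative K * (6000 / L\<^sup>2 + 64 / (1 + l * (1 - s))\<^sup>2 * \<Xi>) + g') (at s)"
      by (rule DERIV_add[OF G g'(1)]) (use s in auto)
    then show "\<exists>y. ((\<lambda>s. ?G s + g s) has_real_derivative y) (at s) \<and> 0 \<le> y" using g'(2) abs_le_D2 by fastforce
  qed (use gcont Gcont in \<open>auto intro!: continuous_on_add\<close>)
  moreover have "?G 1 - ?G 0 \<le> K * (6000 / L\<^sup>2 + 64 * \<Xi> / l)"
  proof -
    have "0 \<le> 64 * \<Xi> / l / (1 + l)" using X par by simp
    then have "0 \<le> K * (64 * \<Xi> / l / (1 + l))" using K by (rule mult_nonneg_nonneg[rotated])
    then show ?thesis by (simp add: distrib_left)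
  qed
  moreover have "g 1 = wmean n p (indicator A)"
  proof -
    have "(\<Sum>k\<in>A. fps_nth (lin_fps 1 ^ w * V 1) k) = indicator A w" for w
    proof -
      have "(\<Sum>k\<in>A. fps_nth (lin_fps 1 ^ w * V 1) k) = (\<Sum>k\<in>A. if k = w then 1 else 0)"
        by (intro sum.cong refl) (simp add: V_def lin_fps_1 pois_fps_0 nb_fps_1[OF par(2,3)])
      then show ?thesis using A by (simp add: indicator_def)
    qed
    then show ?thesis unfolding g_def by simp
  qed
  moreover have "g 0 = (\<Sum>k\<in>A. fps_nth (pois_fps l * nb_fps r \<theta> 0) k)"
    unfolding g_def by (simp add: lin_0 V_def wmean_const)
  ultimately show ?thesis by linarith
qed

lemmas interpolation' = interpolation[unfolded K_def \<Xi>_def]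

end

section \<open>Characteristic function of the convolution\<close>

definition chf_den :: "real \<Rightarrow> complex \<Rightarrow> complex" where
  "chf_den \<theta> w = 1 - of_real \<theta> * (exp (\<i> * w) - 1)"

definition chf_ratio :: "real \<Rightarrow> complex \<Rightarrow> complex" where
  "chf_ratio \<theta> w = exp (\<i> * w) / chf_den \<theta> w"

text \<open>\<open>chf_log\<close> is the logarithm of the centred characteristic function of the convolution of the
  negative binomial and Poisson laws; \<open>chf_log1\<close>, \<open>chf_log2\<close>, \<open>chf_log3\<close> are its derivatives.\<close>
definition chf_log :: "real \<Rightarrow> real \<Rightarrow> real \<Rightarrow> complex \<Rightarrow> complex" where
  "chf_log l r \<theta> w = of_real l * (exp (\<i> * w) - 1) - of_real r * Ln (chf_den \<theta> w) - \<i> * w * of_real (l + r * \<theta>)"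

definition chf_log1 :: "real \<Rightarrow> real \<Rightarrow> real \<Rightarrow> complex \<Rightarrow> complex" where
  "chf_log1 l r \<theta> w = \<i> * of_real l * exp (\<i> * w) + \<i> * of_real (r * \<theta>) * chf_ratio \<theta> w - \<i> * of_real (l + r * \<theta>)"

definition chf_log2 :: "real \<Rightarrow> real \<Rightarrow> real \<Rightarrow> complex \<Rightarrow> complex" where
  "chf_log2 l r \<theta> w = - of_real l * exp (\<i> * w) - of_real (r * \<theta>) * (chf_ratio \<theta> w + of_real \<theta> * (chf_ratio \<theta> w)\<^sup>2)"

definition chf_log3 :: "real \<Rightarrow> real \<Rightarrow> real \<Rightarrow> complex \<Rightarrow> complex" where
  "chf_log3 l r \<theta> w = - \<i> * of_real l * exp (\<i> * w) - of_real (r * \<theta>) * ((1 + 2 * of_real \<theta> * chf_ratio \<theta> w) * (\<i> * (chf_ratio \<theta> w + of_real \<theta> * (chf_ratio \<theta> w)\<^sup>2)))"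

lemma norm_exp_i [simp]: "norm (exp (\<i> * complex_of_real t)) = 1"
  by (rule norm_exp_i_times)

text \<open>Mean value inequality on the segment from 0. Applied three times, it passes from a bound
  on the third derivative of the logarithm to its Taylor estimates.\<close>

lemma growth_from_derivative:
  fixes f f' :: "complex \<Rightarrow> complex"
  assumes f: "\<And>s::real. (f has_field_derivative f' (of_real s)) (at (of_real s))"
    and f': "\<And>s::real. norm (f' (of_real s)) \<le> B * \<bar>s\<bar> ^ m" and "f 0 = 0"
  shows "norm (f (of_real t)) \<le> B * \<bar>t\<bar> ^ Suc m"
proof -
  have B: "0 \<le> B" using order_trans[OF norm_ge_zero f'[of 1]] by simp
  let ?S = "closed_segment (0::complex) (of_real t)"
  have S: "\<exists>s::real. z = of_real s \<and> \<bar>s\<bar> \<le> \<bar>t\<bar>" if z: "z \<in> ?S" for z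
  proof -
    obtain u where u: "0 \<le> u" "u \<le> 1" "z = of_real (u * t)"
      using z by (auto simp: in_segment scaleR_conv_of_real)
    then have "\<bar>u * t\<bar> \<le> 1 * \<bar>t\<bar>" unfolding abs_mult by (intro mult_right_mono) auto
    then show ?thesis using u(3) by (intro exI[of _ "u * t"]) simp
  qed
  have "norm (f (of_real t) - f 0) \<le> (B * \<bar>t\<bar> ^ m) * norm (of_real t - (0::complex))"
  proof (rule field_differentiable_bound[of ?S])
    fix z assume "z \<in> ?S"
    then obtain s where s: "z = of_real s" "\<bar>s\<bar> \<le> \<bar>t\<bar>" using S by blast
    show "(f has_field_derivative f' z) (at z within ?S)" unfolding s by (rule has_field_derivative_at_within[OF f])
    have "norm (f' z) \<le> B * \<bar>s\<bar> ^ m" unfolding s by (rule f')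
    also have "\<dots> \<le> B * \<bar>t\<bar> ^ m" using B s by (intro mult_left_mono power_mono) auto
    finally show "norm (f' z) \<le> B * \<bar>t\<bar> ^ m" .
  qed (auto simp: convex_closed_segment)
  then show ?thesis using assms(3) by (simp add: mult_ac)
qed

lemma exp_diff_bound:
  fixes a b :: complex
  assumes "Re a \<le> m" "Re b \<le> m"
  shows "norm (exp a - exp b) \<le> exp m * norm (a - b)"
proof (rule field_differentiable_bound[of "{z. Re z \<le> m}" exp exp])
  show "convex {z. Re z \<le> m}" by (rule convex_halfspace_Re_le)
qed (use assms in \<open>auto intro!: derivative_eq_intros\<close>)

text \<open>Taylor expansion to fourth order with t^2 <= 10 on this range: 1/2 - 10/24 =
  1/12.\<close>

lemma one_minus_cos_ge:
  assumes "\<bar>t\<bar> \<le> pi" shows "t\<^sup>2 / 12 \<le> 1 - cos t"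
proof -
  obtain s where s: "cos t = (\<Sum>m<4. cos_coeff m * t ^ m) + (cos (s + 1/2 * real 4 * pi) / fact 4) * t ^ 4"
    using Maclaurin_cos_expansion[of t 4] by blast
  have "cos t = 1 - t\<^sup>2 / 2 + cos (s + 2 * pi) / 24 * t ^ 4"
  proof -
    have "(\<Sum>m<4. g m) = g 0 + g 1 + g 2 + g 3" for g :: "nat \<Rightarrow> real" by (simp add: eval_nat_numeral)
    moreover have "cos_coeff 0 = 1" "cos_coeff 1 = 0" "cos_coeff 2 = - 1 / 2" "cos_coeff 3 = 0"
      by (simp_all add: cos_coeff_def)
    ultimately show ?thesis using s by (simp add: fact_numeral)
  qed
  also have "\<dots> \<le> 1 - t\<^sup>2 / 2 + 1 / 24 * t ^ 4" by (intro add_mono mult_right_mono) auto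
  finally have c: "cos t \<le> 1 - t\<^sup>2 / 2 + t ^ 4 / 24" by simp
  have "t\<^sup>2 \<le> 10"
  proof -
    have "t\<^sup>2 \<le> pi\<^sup>2" using assms by (metis abs_le_square_iff abs_of_pos pi_gt_zero)
    also have "\<dots> \<le> (3.15)\<^sup>2" using pi_approx by (intro power_mono) auto
    finally show ?thesis by (simp add: power2_eq_square)
  qed
  then have "t\<^sup>2 * t\<^sup>2 \<le> 10 * t\<^sup>2" by (intro mult_right_mono) auto
  then have "t ^ 4 \<le> 10 * t\<^sup>2" by (simp add: power2_eq_square power4_eq_xxxx)
  then show ?thesis using c by simp
qed

section \<open>Taylor estimates for the logarithm of the characteristic function\<close>

context
  fixes l r \<theta> S :: real
  assumes par: "0 < l" "0 < r" "0 < \<theta>" and S: "S = l + r * \<theta> + r * \<theta>\<^sup>2"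
begin

text \<open>Keeps the denominator away from the branch cut of \<open>Ln\<close> on the whole real
  line, with modulus at least 1.\<close>

lemma Re_chf_den: "1 \<le> Re (chf_den \<theta> (of_real t))"
  using par cos_le_one[of t] by (simp add: chf_den_def Re_exp mult_le_0_iff)

lemma chf_den_facts: "1 \<le> norm (chf_den \<theta> (of_real t))" "chf_den \<theta> (of_real t) \<noteq> 0" "chf_den \<theta> (of_real t) \<notin> \<real>\<^sub>\<le>\<^sub>0"
  using Re_chf_den[of t] complex_Re_le_cmod[of "chf_den \<theta> (of_real t)"] by (auto simp: complex_nonpos_Reals_iff)

lemma norm_chf_ratio: "norm (chf_ratio \<theta> (of_real t)) \<le> 1"
  using chf_den_facts[of t] by (simp add: chf_ratio_def norm_divide divide_le_eq)

lemma chf_den_deriv: "(chf_den \<theta> has_field_derivative - of_real \<theta> * (\<i> * exp (\<i> * w))) (at w)"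
  unfolding chf_den_def by (auto intro!: derivative_eq_intros)

lemma chf_ratio_deriv: "(chf_ratio \<theta> has_field_derivative \<i> * (chf_ratio \<theta> (of_real t) + of_real \<theta> * (chf_ratio \<theta> (of_real t))\<^sup>2)) (at (of_real t))"
proof -
  have "(chf_ratio \<theta> has_field_derivative (\<i> * exp (\<i> * of_real t) * chf_den \<theta> (of_real t) - exp (\<i> * of_real t) * (- of_real \<theta> * (\<i> * exp (\<i> * of_real t)))) / (chf_den \<theta> (of_real t) * chf_den \<theta> (of_real t))) (at (of_real t))"
    unfolding chf_ratio_def using chf_den_facts(2)[of t] by (auto intro!: derivative_eq_intros chf_den_deriv)
  also have "(\<i> * exp (\<i> * of_real t) * chf_den \<theta> (of_real t) - exp (\<i> * of_real t) * (- of_real \<theta> * (\<i> * exp (\<i> * of_real t)))) / (chf_den \<theta> (of_real t) * chf_den \<theta> (of_real t)) = 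
     \<i> * (chf_ratio \<theta> (of_real t) + of_real \<theta> * (chf_ratio \<theta> (of_real t))\<^sup>2)"
    unfolding chf_ratio_def using chf_den_facts(2)[of t] by (simp add: field_simps power2_eq_square)
  finally show ?thesis .
qed

lemma chf_log_deriv: "(chf_log l r \<theta> has_field_derivative chf_log1 l r \<theta> (of_real t)) (at (of_real t))"
  unfolding chf_log_def using chf_den_facts[of t]
  by (auto intro!: derivative_eq_intros chf_den_deriv simp: chf_log1_def chf_ratio_def divide_inverse algebra_simps)

lemma chf_log1_deriv: "(chf_log1 l r \<theta> has_field_derivative chf_log2 l r \<theta> (of_real t)) (at (of_real t))"
  unfolding chf_log1_def by (auto intro!: derivative_eq_intros chf_ratio_deriv simp: chf_log2_def algebra_simps)

lemma chf_log2_deriv: "(chf_log2 l r \<theta> has_field_derivative chf_log3 l r \<theta> (of_real t)) (at (of_real t))"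
proof -
  let ?u = "chf_ratio \<theta> (of_real t)" let ?u' = "\<i> * (?u + of_real \<theta> * ?u\<^sup>2)"
  have "((\<lambda>w. - of_real l * exp (\<i> * w) - of_real (r * \<theta>) * (chf_ratio \<theta> w + of_real \<theta> * (chf_ratio \<theta> w * chf_ratio \<theta> w))) has_field_derivative
    - of_real l * (\<i> * exp (\<i> * of_real t)) - of_real (r * \<theta>) * (?u' + of_real \<theta> * (?u' * ?u + ?u' * ?u))) (at (of_real t))"
    by (auto intro!: derivative_eq_intros chf_ratio_deriv)
  also have "- of_real l * (\<i> * exp (\<i> * of_real t)) - of_real (r * \<theta>) * (?u' + of_real \<theta> * (?u' * ?u + ?u' * ?u)) = chf_log3 l r \<theta> (of_real t)"
    unfolding chf_log3_def by (simp add: algebra_simps)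
  finally show ?thesis unfolding chf_log2_def power2_eq_square .
qed

text \<open>As the ratio has modulus at most 1, the bound is l + r \<theta> (1 + 2 \<theta>) (1 +
  \<theta>), and r \<theta> (1 + \<theta>) is the negative binomial share of
  \<open>S\<close>.\<close>

lemma chf_log3_le: "norm (chf_log3 l r \<theta> (of_real t)) \<le> S * (1 + 2 * \<theta>)"
proof -
  let ?u = "chf_ratio \<theta> (of_real t)"
  have 1: "norm (?u + of_real \<theta> * ?u\<^sup>2) \<le> 1 + \<theta>"
  proof -
    have "norm (?u + of_real \<theta> * ?u\<^sup>2) \<le> norm ?u + \<theta> * norm ?u ^ 2"
      using norm_triangle_ineq[of ?u "of_real \<theta> * ?u\<^sup>2"] par by (simp add: norm_mult norm_power)
    also have "\<dots> \<le> 1 + \<theta> * 1" using norm_chf_ratio[of t] par by (intro add_mono mult_left_mono power_le_one) auto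
    finally show ?thesis by simp
  qed
  have 2: "norm (1 + 2 * of_real \<theta> * ?u) \<le> 1 + 2 * \<theta>"
  proof -
    have "norm (1 + 2 * of_real \<theta> * ?u) \<le> norm (1::complex) + norm (2 * of_real \<theta> * ?u)" by (rule norm_triangle_ineq)
    also have "\<dots> = 1 + 2 * \<theta> * norm ?u" using par by (simp add: norm_mult)
    also have "\<dots> \<le> 1 + 2 * \<theta> * 1" using norm_chf_ratio[of t] par by (intro add_mono mult_left_mono) auto
    finally show ?thesis by simp
  qed
  have "norm (chf_log3 l r \<theta> (of_real t)) \<le> norm (- \<i> * of_real l * exp (\<i> * of_real t)) + 
    norm (of_real (r * \<theta>) * ((1 + 2 * of_real \<theta> * ?u) * (\<i> * (?u + of_real \<theta> * ?u\<^sup>2))))"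
    unfolding chf_log3_def by (rule norm_triangle_ineq4)
  also have "\<dots> = l + r * \<theta> * (norm (1 + 2 * of_real \<theta> * ?u) * norm (?u + of_real \<theta> * ?u\<^sup>2))"
    using par by (simp add: norm_mult)
  also have "\<dots> \<le> l + r * \<theta> * ((1 + 2 * \<theta>) * (1 + \<theta>))"
    using 1 2 par by (intro add_left_mono mult_left_mono mult_mono) auto
  also have "\<dots> \<le> S * (1 + 2 * \<theta>)" unfolding S using par by (simp add: algebra_simps power2_eq_square)
  finally show ?thesis .
qed

lemma at_zero: "chf_log l r \<theta> 0 = 0" "chf_log1 l r \<theta> 0 = 0" "chf_log2 l r \<theta> 0 = - of_real S"
  by (simp_all add: chf_log_def chf_log1_def chf_log2_def chf_den_def chf_ratio_def S algebra_simps power2_eq_square)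

lemma chf_log2_le: "norm (chf_log2 l r \<theta> (of_real t) + of_real S) \<le> S * (1 + 2 * \<theta>) * \<bar>t\<bar>"
proof -
  have "((\<lambda>w. chf_log2 l r \<theta> w + of_real S) has_field_derivative chf_log3 l r \<theta> (of_real t)) (at (of_real t))" for t
    by (auto intro!: derivative_eq_intros chf_log2_deriv)
  moreover have "norm (chf_log3 l r \<theta> (of_real t)) \<le> S * (1 + 2 * \<theta>) * \<bar>t\<bar> ^ 0" for t
    using chf_log3_le by simp
  ultimately have "norm (chf_log2 l r \<theta> (of_real t) + of_real S) \<le> S * (1 + 2 * \<theta>) * \<bar>t\<bar> ^ Suc 0"
    by (rule growth_from_derivative) (simp add: at_zero)
  then show ?thesis by simp
qed

lemma chf_log1_le: "norm (chf_log1 l r \<theta> (of_real t) + of_real S * of_real t) \<le> S * (1 + 2 * \<theta>) * \<bar>t\<bar>\<^sup>2"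
proof -
  have "((\<lambda>w. chf_log1 l r \<theta> w + of_real S * w) has_field_derivative chf_log2 l r \<theta> (of_real t) + of_real S) (at (of_real t))" for t
    by (auto intro!: derivative_eq_intros chf_log1_deriv)
  moreover have "norm (chf_log2 l r \<theta> (of_real t) + of_real S) \<le> S * (1 + 2 * \<theta>) * \<bar>t\<bar> ^ 1" for t
    using chf_log2_le by simp
  ultimately have "norm (chf_log1 l r \<theta> (of_real t) + of_real S * of_real t) \<le> S * (1 + 2 * \<theta>) * \<bar>t\<bar> ^ Suc 1"
    by (rule growth_from_derivative) (simp add: at_zero)
  then show ?thesis by (simp add: numeral_2_eq_2)
qed

lemma chf_log_le: "norm (chf_log l r \<theta> (of_real t) + of_real (S * t\<^sup>2 / 2)) \<le> S * (1 + 2 * \<theta>) * \<bar>t\<bar> ^ 3"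
proof -
  have "((\<lambda>w. chf_log l r \<theta> w + of_real S * w\<^sup>2 / 2) has_field_derivative chf_log1 l r \<theta> (of_real t) + of_real S * of_real t) (at (of_real t))" for t
    by (auto intro!: derivative_eq_intros chf_log_deriv)
  moreover have "norm (chf_log1 l r \<theta> (of_real t) + of_real S * of_real t) \<le> S * (1 + 2 * \<theta>) * \<bar>t\<bar> ^ 2" for t
    by (rule chf_log1_le)
  ultimately have "norm (chf_log l r \<theta> (of_real t) + of_real S * (of_real t)\<^sup>2 / 2) \<le> S * (1 + 2 * \<theta>) * \<bar>t\<bar> ^ Suc 2"
    using growth_from_derivative[of "\<lambda>w. chf_log l r \<theta> w + of_real S * w\<^sup>2 / 2" "\<lambda>w. chf_log1 l r \<theta> w + of_real S * w" "S * (1 + 2 * \<theta>)" 2 t]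
    by (simp add: at_zero)
  then show ?thesis by (simp add: numeral_3_eq_3)
qed

text \<open>The decay is that of the Poisson factor alone, the negative binomial one having modulus
  at most 1. This is where \<open>l\<close> has to be comparable with the variance.\<close>

lemma Re_chf_log: "\<bar>t\<bar> \<le> pi \<Longrightarrow> Re (chf_log l r \<theta> (of_real t)) \<le> - l * t\<^sup>2 / 12"
proof -
  assume t: "\<bar>t\<bar> \<le> pi"
  have "0 \<le> Re (Ln (chf_den \<theta> (of_real t)))" using chf_den_facts[of t] by simp
  then have "Re (chf_log l r \<theta> (of_real t)) \<le> l * (cos t - 1)" using par by (simp add: chf_log_def Re_exp)
  also have "\<dots> \<le> l * (- (t\<^sup>2 / 12))" using one_minus_cos_ge[OF t] par by (intro mult_left_mono) auto
  finally show ?thesis by simp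
qed

end

section \<open>Gaussian integrals and Fourier inversion\<close>

lemma gauss_eq_normal_density:
  fixes S :: real
  assumes "0 < S"
  shows "exp (- (S * t\<^sup>2 / 2)) = sqrt (2 * pi / S) * normal_density 0 (1 / sqrt S) t"
proof -
  have "(1 / sqrt S)\<^sup>2 = 1 / S" using assms by (simp add: power_divide)
  then show ?thesis using assms unfolding normal_density_def by (simp add: mult.commute)
qed

lemma integrable_gauss_power:
  fixes S :: real
  assumes "0 < S"
  shows "integrable lborel (\<lambda>t. t ^ k * exp (- (S * t\<^sup>2 / 2)))"
proof -
  have "integrable lborel (\<lambda>t. sqrt (2 * pi / S) * (normal_density 0 (1 / sqrt S) t * (t - 0) ^ k))"
    using assms by (intro integrable_mult_right integrable_normal_moment) auto
  then show ?thesis unfolding gauss_eq_normal_density[OF assms] by (simp add: mult_ac)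
qed

lemma integral_abs_gauss:
  fixes a :: real
  assumes "0 < a"
  shows "has_bochner_integral lborel (\<lambda>t. \<bar>t\<bar> * exp (- (a * t\<^sup>2))) (1 / a)"
proof -
  have a2: "0 < 2 * a" using assms by simp
  have "has_bochner_integral lborel (\<lambda>t. sqrt (2 * pi / (2 * a)) * (normal_density 0 (1 / sqrt (2 * a)) t * \<bar>t - 0\<bar> ^ (2 * 0 + 1)))
     (sqrt (2 * pi / (2 * a)) * (2 ^ 0 * (1 / sqrt (2 * a)) ^ (2 * 0 + 1) * fact 0 * sqrt (2 / pi)))"
    by (intro has_bochner_integral_mult_right normal_moment_abs_odd) (use assms in auto)
  moreover have "(\<lambda>t. sqrt (2 * pi / (2 * a)) * (normal_density 0 (1 / sqrt (2 * a)) t * \<bar>t - 0\<bar> ^ (2 * 0 + 1))) = (\<lambda>t. \<bar>t\<bar> * exp (- (a * t\<^sup>2)))"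
    using gauss_eq_normal_density[OF a2] by (auto simp: fun_eq_iff mult_ac)
  moreover have "sqrt (2 * pi / (2 * a)) * (2 ^ 0 * (1 / sqrt (2 * a)) ^ (2 * 0 + 1) * fact 0 * sqrt (2 / pi)) = 1 / a"
  proof -
    have "sqrt (2 * pi / (2 * a)) * (1 / sqrt (2 * a)) * sqrt (2 / pi) = sqrt ((2 * pi / (2 * a)) * (1 / (2 * a)) * (2 / pi))"
      by (simp only: real_sqrt_mult real_sqrt_divide real_sqrt_one)
    also have "(2 * pi / (2 * a)) * (1 / (2 * a)) * (2 / pi) = (1 / a)\<^sup>2"
      using assms by (simp add: field_simps power2_eq_square)
    finally show ?thesis using assms by simp
  qed
  ultimately show ?thesis by simp
qed

definition gauss :: "real \<Rightarrow> real \<Rightarrow> complex" where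
  "gauss S t = of_real (exp (- (S * t\<^sup>2 / 2)))"

definition wave :: "real \<Rightarrow> real \<Rightarrow> complex" where
  "wave y t = exp (- (\<i> * of_real (t * y)))"

lemma norm_wave [simp]: "norm (wave y t) = 1"
proof -
  have "- (\<i> * of_real (t * y)) = \<i> * of_real (- (t * y))" by simp
  then show ?thesis unfolding wave_def by (simp only: norm_exp_i)
qed

lemma wave_measurable [measurable]: "wave y \<in> borel_measurable borel"
  unfolding wave_def by (intro borel_measurable_continuous_onI continuous_intros)

lemma gauss_measurable [measurable]: "gauss S \<in> borel_measurable borel"
  unfolding gauss_def by measurable

lemma integrable_gauss_wave:
  assumes "0 < S"
  shows "integrable lborel (\<lambda>t. of_real (t ^ k) * gauss S t * wave y t)"
proof (rule Bochner_Integration.integrable_bound)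
  show "integrable lborel (\<lambda>t. t ^ k * exp (- (S * t\<^sup>2 / 2)))" by (rule integrable_gauss_power[OF assms])
  show "AE t in lborel. norm (of_real (t ^ k) * gauss S t * wave y t) \<le> norm (t ^ k * exp (- (S * t\<^sup>2 / 2)))"
    by (simp add: norm_mult gauss_def abs_mult norm_power power_abs)
qed measurable

lemma integral_gauss_wave:
  assumes "0 < S"
  shows "(\<integral>t. gauss S t * wave y t \<partial>lborel) = of_real (sqrt (2 * pi / S) * exp (- (y\<^sup>2 / (2 * S))))"
proof -
  let ?s = "sqrt S" let ?\<tau> = "- y / sqrt S"
  have s: "0 < ?s" "?s * ?s = S" using assms by auto
  have "char std_normal_distribution ?\<tau> = (\<integral>x. std_normal_density x *\<^sub>R iexp (?\<tau> * x) \<partial>lborel)"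
    unfolding char_def by (rule integral_density) auto
  also have "\<dots> = \<bar>?s\<bar> *\<^sub>R (\<integral>t. std_normal_density (0 + ?s * t) *\<^sub>R iexp (?\<tau> * (0 + ?s * t)) \<partial>lborel)"
    by (rule lborel_integral_real_affine) (use s in auto)
  also have "(\<lambda>t. std_normal_density (0 + ?s * t) *\<^sub>R iexp (?\<tau> * (0 + ?s * t))) = (\<lambda>t. of_real (1 / sqrt (2 * pi)) * (gauss S t * wave y t))"
  proof
    fix t
    have "?\<tau> * (0 + ?s * t) = - (t * y)" using s by simp
    moreover have "(?s * t)\<^sup>2 = S * t\<^sup>2" using assms by (simp add: power_mult_distrib)
    ultimately show "std_normal_density (0 + ?s * t) *\<^sub>R iexp (?\<tau> * (0 + ?s * t)) = of_real (1 / sqrt (2 * pi)) * (gauss S t * wave y t)"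
      unfolding std_normal_density_def gauss_def wave_def scaleR_conv_of_real by simp
  qed
  also have "\<bar>?s\<bar> *\<^sub>R (\<integral>t. of_real (1 / sqrt (2 * pi)) * (gauss S t * wave y t) \<partial>lborel) = 
     of_real (?s / sqrt (2 * pi)) * (\<integral>t. gauss S t * wave y t \<partial>lborel)"
    using s by (simp add: scaleR_conv_of_real)
  finally have "of_real (?s / sqrt (2 * pi)) * (\<integral>t. gauss S t * wave y t \<partial>lborel) = of_real (exp (- (?\<tau>\<^sup>2 / 2)))"
    unfolding char_std_normal_distribution by simp
  moreover have "?\<tau>\<^sup>2 / 2 = y\<^sup>2 / (2 * S)" using assms by (simp add: power_divide)
  ultimately have "of_real (sqrt (2 * pi) / ?s) * (of_real (?s / sqrt (2 * pi)) * (\<integral>t. gauss S t * wave y t \<partial>lborel)) = 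
     of_real (sqrt (2 * pi) / ?s) * complex_of_real (exp (- (y\<^sup>2 / (2 * S))))" by simp
  moreover have "of_real (sqrt (2 * pi) / ?s) * (of_real (?s / sqrt (2 * pi)) * z) = z" for z :: complex
  proof -
    have "sqrt (2 * pi) / ?s * (?s / sqrt (2 * pi)) = 1" using s(1) by simp
    then show ?thesis unfolding mult.assoc[symmetric] of_real_mult[symmetric] by simp
  qed
  ultimately show ?thesis by (simp add: real_sqrt_divide)
qed

text \<open>The Gaussian counterpart of the two integrations by parts: the integrand is the
  derivative of (- S t + i y) exp(- S t^2 / 2 - i t y), which vanishes at both ends of the
  line.\<close>

lemma integral_gauss_wave2:
  assumes "0 < S"
  shows "(\<integral>t. of_real (S\<^sup>2 * t\<^sup>2 - S + y\<^sup>2) * gauss S t * wave y t \<partial>lborel) = 0"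
proof -
  let ?F = "\<lambda>w. (- of_real S * w + \<i> * of_real y) * exp (- (of_real S * w\<^sup>2 / 2) - \<i> * w * of_real y)"
  let ?f = "\<lambda>t. of_real (S\<^sup>2 * t\<^sup>2 - S + y\<^sup>2) * gauss S t * wave y t"
  have gw: "exp (- (of_real S * (of_real t)\<^sup>2 / 2) - \<i> * of_real t * of_real y) = gauss S t * wave y t" for t
    unfolding gauss_def wave_def exp_of_real[symmetric] mult_exp_exp by (simp add: mult.assoc)
  have deriv: "((\<lambda>t. ?F (of_real t)) has_vector_derivative ?f t) (at t)" for t
  proof (rule has_vector_derivative_real_field)
    have "(?F has_field_derivative (- of_real S * exp (- (of_real S * (of_real t)\<^sup>2 / 2) - \<i> * of_real t * of_real y) + 
      (- of_real S * of_real t + \<i> * of_real y) * ((- (of_real S * of_real t) - \<i> * of_real y) * 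
       exp (- (of_real S * (of_real t)\<^sup>2 / 2) - \<i> * of_real t * of_real y)))) (at (of_real t))"
      by (auto intro!: derivative_eq_intros simp: algebra_simps)
    moreover have "- of_real S * X + (- of_real S * of_real t + \<i> * of_real y) * ((- (of_real S * of_real t) - \<i> * of_real y) * X) = 
       of_real (S\<^sup>2 * t\<^sup>2 - S + y\<^sup>2) * X" for X :: complex
      by (simp add: algebra_simps power2_eq_square)
    ultimately show "(?F has_field_derivative ?f t) (at (of_real t))" unfolding gw by (simp add: mult.assoc)
  qed
  have cont: "isCont ?f t" for t
    unfolding gauss_def wave_def by (intro continuous_intros) auto
  have f_eq: "?f t = of_real (S\<^sup>2) * (of_real (t ^ 2) * gauss S t * wave y t) + of_real (y\<^sup>2 - S) * (of_real (t ^ 0) * gauss S t * wave y t)" for t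
    by (simp add: algebra_simps)
  have int: "integrable lborel ?f"
    unfolding f_eq by (intro Bochner_Integration.integrable_add integrable_mult_right integrable_gauss_wave assms)
  have bound: "norm (?F (of_real t)) \<le> 2 * inverse \<bar>t\<bar> + 2 * \<bar>y\<bar> / S * (inverse \<bar>t\<bar>)\<^sup>2" if "t \<noteq> 0" for t :: real
  proof -
    have z: "0 < S * t\<^sup>2 / 2" using that assms by simp
    have "exp (- (S * t\<^sup>2 / 2)) \<le> 1 / (S * t\<^sup>2 / 2)"
    proof -
      have "z \<le> exp z" for z :: real using exp_ge_add_one_self[of z] by linarith
      from le_imp_inverse_le[OF this z] show ?thesis by (simp only: exp_minus inverse_eq_divide)
    qed
    moreover have "norm (- of_real S * of_real t + \<i> * complex_of_real y) \<le> S * \<bar>t\<bar> + \<bar>y\<bar>"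
      using norm_triangle_ineq[of "- of_real S * of_real t" "\<i> * complex_of_real y"] assms by (simp add: norm_mult)
    ultimately have "norm (- of_real S * of_real t + \<i> * complex_of_real y) * exp (- (S * t\<^sup>2 / 2)) \<le> 
      (S * \<bar>t\<bar> + \<bar>y\<bar>) * (1 / (S * t\<^sup>2 / 2))"
      using assms by (intro mult_mono) auto
    moreover have "norm (gauss S t) = exp (- (S * t\<^sup>2 / 2))" by (simp add: gauss_def)
    ultimately have "norm (?F (of_real t)) \<le> (S * \<bar>t\<bar> + \<bar>y\<bar>) * (1 / (S * t\<^sup>2 / 2))"
      unfolding gw norm_mult norm_wave mult_1_right by (simp only:)
    also have "\<dots> = 2 * inverse \<bar>t\<bar> + 2 * \<bar>y\<bar> / S * (inverse \<bar>t\<bar>)\<^sup>2"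
    proof -
      have "t\<^sup>2 = \<bar>t\<bar> * \<bar>t\<bar>" by (simp add: power2_eq_square)
      then show ?thesis using that assms by (simp add: field_simps power2_eq_square)
    qed
    finally show ?thesis .
  qed
  have lim: "((\<lambda>t. ?F (of_real t)) \<longlongrightarrow> 0) G" if G: "filterlim (\<lambda>t. t) at_infinity G" for G :: "real filter"
  proof (rule Lim_null_comparison)
    have ne: "eventually (\<lambda>t. t \<noteq> 0) G" 
      using filterlim_at_infinity_imp_eventually_ne[OF G, of 0] .
    then show "eventually (\<lambda>t. norm (?F (of_real t)) \<le> 2 * inverse \<bar>t\<bar> + 2 * \<bar>y\<bar> / S * (inverse \<bar>t\<bar>)\<^sup>2) G"
      by eventually_elim (rule bound)
    have "((\<lambda>t. inverse t) \<longlongrightarrow> 0) G" by (rule tendsto_inverse_0[THEN filterlim_compose, OF G])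
    then have "((\<lambda>t. \<bar>inverse t\<bar>) \<longlongrightarrow> 0) G" by (rule tendsto_rabs_zero)
    then have i: "((\<lambda>t. inverse \<bar>t\<bar>) \<longlongrightarrow> 0) G" by simp
    have "((\<lambda>t. 2 * inverse \<bar>t\<bar> + 2 * \<bar>y\<bar> / S * (inverse \<bar>t\<bar>)\<^sup>2) \<longlongrightarrow> 2 * 0 + 2 * \<bar>y\<bar> / S * 0\<^sup>2) G"
      by (intro tendsto_intros i)
    then show "((\<lambda>t. 2 * inverse \<bar>t\<bar> + 2 * \<bar>y\<bar> / S * (inverse \<bar>t\<bar>)\<^sup>2) \<longlongrightarrow> 0) G" by simp
  qed
  have "(LBINT t=-\<infinity>..\<infinity>. ?f t) = 0 - 0"
  proof (rule interval_integral_FTC_integrable[where F = "\<lambda>t. ?F (of_real t)"])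
    show "set_integrable lborel (einterval (-\<infinity>) \<infinity>) ?f" using int by (simp add: set_integrable_def)
    show "(((\<lambda>t. ?F (of_real t)) \<circ> real_of_ereal) \<longlongrightarrow> 0) (at_right (- \<infinity>))"
      unfolding ereal_tendsto_simps by (rule lim) (simp add: at_bot_le_at_infinity filterlim_def)
    show "(((\<lambda>t. ?F (of_real t)) \<circ> real_of_ereal) \<longlongrightarrow> 0) (at_left \<infinity>)"
      unfolding ereal_tendsto_simps by (rule lim) (simp add: at_top_le_at_infinity filterlim_def)
  qed (use deriv cont in auto)
  then show ?thesis by (simp add: interval_lebesgue_integral_def set_lebesgue_integral_def)
qed

lemma integral_unit_wave:
  fixes m :: int
  shows "has_bochner_integral lborel (\<lambda>t. indicator {-pi..pi} t *\<^sub>R exp (\<i> * of_real (of_int m * t))) (if m = 0 then 2 * pi else 0)"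
proof (cases "m = 0")
  case True
  have "has_bochner_integral lborel (\<lambda>t. indicator {-pi..pi} t *\<^sub>R (1::complex)) (of_real pi - of_real (- pi))"
    by (rule has_bochner_integral_FTC_Icc[where F = of_real])
       (auto intro!: derivative_eq_intros has_vector_derivative_of_real continuous_intros)
  then show ?thesis using True by simp
next
  case False
  let ?F = "\<lambda>t::real. exp (\<i> * of_real (of_int m * t)) / (\<i> * of_int m)"
  have "has_bochner_integral lborel (\<lambda>t. indicator {-pi..pi} t *\<^sub>R exp (\<i> * of_real (of_int m * t))) (?F pi - ?F (- pi))"
  proof (rule has_bochner_integral_FTC_Icc)
    fix t :: real
    have "((\<lambda>w. exp (\<i> * (of_int m * w)) / (\<i> * of_int m)) has_field_derivative exp (\<i> * (of_int m * of_real t))) (at (of_real t))"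
      using False by (auto intro!: derivative_eq_intros simp: algebra_simps)
    from has_vector_derivative_real_field[OF this, of "{-pi..pi}"]
    show "(?F has_vector_derivative exp (\<i> * of_real (of_int m * t))) (at t within {-pi..pi})" by simp
  qed (auto intro!: continuous_intros)
  moreover have "exp (\<i> * of_real (of_int m * pi)) = exp (\<i> * of_real (of_int m * - pi))"
    unfolding exp_eq by (intro exI[of _ m]) (simp add: algebra_simps)
  ultimately show ?thesis using False by simp
qed

lemma l1_bound_summable: "l1_bound F B \<Longrightarrow> summable (\<lambda>k. \<bar>fps_nth F k\<bar>)"
proof (rule bounded_imp_summable[where B = B])
  fix n assume "l1_bound F B"
  then show "(\<Sum>k\<le>n. \<bar>fps_nth F k\<bar>) \<le> B" using l1_boundD[of F B "Suc n"] by (simp only: lessThan_Suc_atMost)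
qed auto

lemma pois_fps_char_sums:
  fixes z :: complex
  shows "(\<lambda>k. of_real (fps_nth (pois_fps l) k) * z ^ k) sums exp (of_real l * (z - 1))"
proof -
  have "(\<lambda>k. exp (- of_real l) * ((of_real l * z) ^ k /\<^sub>R fact k)) sums (exp (- of_real l) * exp (of_real l * z))"
    by (intro sums_mult exp_converges)
  moreover have "exp (- of_real l) * exp (of_real l * z) = exp (of_real l * (z - 1))"
    by (simp add: mult_exp_exp algebra_simps)
  moreover have "exp (- of_real l) * ((of_real l * z) ^ k /\<^sub>R fact k) = of_real (fps_nth (pois_fps l) k) * z ^ k" for k
    by (simp add: pois_fps_def scaleR_conv_of_real power_mult_distrib exp_of_real[symmetric] field_simps)
  ultimately show ?thesis by simp
qed

lemma of_real_gbinomial: "of_real (a gchoose k) = (of_real a gchoose k :: complex)"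
  by (simp add: gbinomial_prod_rev)

context
  fixes l r \<theta> S :: real
  assumes par: "0 < l" "0 < r" "0 < \<theta>" and S: "S = l + r * \<theta> + r * \<theta>\<^sup>2"
begin

text \<open>Binomial series of (1 - q z)^-r with q = \<theta> / (1 + \<theta>). The factorization 1
  - \<theta> (z - 1) = (1 + \<theta>) (1 - q z) passes to principal logarithms because 1 + \<theta>
  is a positive real.\<close>

lemma negbin_char_sums:
  "(\<lambda>k. of_real (fps_nth (nb_fps r \<theta> 0) k) * exp (\<i> * of_real t) ^ k) sums exp (- of_real r * Ln (chf_den \<theta> (of_real t)))"
proof -
  let ?p = "1 / (1 + \<theta>)" and ?q = "\<theta> / (1 + \<theta>)" and ?z = "exp (\<i> * complex_of_real t)"
  have pq: "0 < ?p" "?p < 1" "0 < ?q" "?q < 1" "1 - ?p = ?q" using par by (auto simp: field_simps)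
  have nz: "norm (- (of_real ?q * ?z)) < 1" using pq par by (simp add: norm_mult norm_divide del: of_real_divide)
  have ne: "1 + - (of_real ?q * ?z) \<noteq> 0" using nz by (metis add.inverse_inverse add_eq_0_iff norm_minus_cancel norm_one order_less_irrefl)
  have "(\<lambda>k. of_real (?p powr r) * ((- of_real r gchoose k) * (- (of_real ?q * ?z)) ^ k)) sums 
     (of_real (?p powr r) * (1 + - (of_real ?q * ?z)) powr (- of_real r))"
    by (intro sums_mult gen_binomial_complex nz)
  moreover have "of_real (?p powr r) * ((- of_real r gchoose k) * (- (of_real ?q * ?z)) ^ k) = of_real (fps_nth (nb_fps r \<theta> 0) k) * ?z ^ k" for k
  proof -
    have m: "(-1 :: complex) ^ k * (-1) ^ k = 1" unfolding power_mult_distrib[symmetric] by simp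
    have "fps_nth (nb_fps r \<theta> 0) k = ((r + real k - 1) gchoose k) * ?p powr r * ?q ^ k"
      using nb_fps_0[OF par(2,3)] pmf_negbin[OF par(2) pq(1,2), of k] pq(5) by simp
    moreover have "(- of_real r gchoose k) * (- (of_real ?q * ?z)) ^ k = of_real ((r + real k - 1) gchoose k) * (of_real ?q ^ k * ?z ^ k)"
    proof -
      have "(- of_real r gchoose k) * (- (of_real ?q * ?z)) ^ k = ((-1) ^ k * (-1) ^ k) * ((of_real r + of_nat k - 1 gchoose k) * (of_real ?q * ?z) ^ k)"
        unfolding gbinomial_minus power_minus[of "of_real ?q * ?z"] by (simp only: mult_ac)
      then show ?thesis unfolding m power_mult_distrib of_real_gbinomial by (simp del: of_real_divide)
    qed
    ultimately show ?thesis by simp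
  qed
  moreover have "of_real (?p powr r) * (1 + - (of_real ?q * ?z)) powr (- of_real r) = exp (- of_real r * Ln (chf_den \<theta> (of_real t)))"
  proof -
    have "chf_den \<theta> (of_real t) = of_real (1 + \<theta>) * (1 + - (of_real ?q * ?z))"
      using par unfolding chf_den_def by (simp add: field_simps del: of_real_add) (simp add: algebra_simps)
    then have "Ln (chf_den \<theta> (of_real t)) = Ln (of_real (1 + \<theta>) * (1 + - (of_real ?q * ?z)))" by (simp only:)
    also have "\<dots> = of_real (ln (1 + \<theta>)) + Ln (1 + - (of_real ?q * ?z))"
    proof -
      have "Ln (of_real (1 + \<theta>)) = complex_of_real (ln (1 + \<theta>))" using par by (intro Ln_of_real) auto
      moreover have "Ln (of_real (1 + \<theta>) * (1 + - (of_real ?q * ?z))) = Ln (of_real (1 + \<theta>)) + Ln (1 + - (of_real ?q * ?z))"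
        using ne par by (intro Ln_times_of_real) auto
      ultimately show ?thesis by (simp only:)
    qed
    finally have "Ln (chf_den \<theta> (of_real t)) = of_real (ln (1 + \<theta>)) + Ln (1 + - (of_real ?q * ?z))" .
    moreover have "?p powr r = exp (- r * ln (1 + \<theta>))" using par by (simp add: powr_def ln_div)
    then have "complex_of_real (?p powr r) = exp (- of_real r * of_real (ln (1 + \<theta>)))" by (simp flip: exp_of_real)
    ultimately show ?thesis using ne by (simp add: powr_def mult_exp_exp algebra_simps)
  qed
  ultimately show ?thesis by (simp only:)
qed

private abbreviation (input) "M \<equiv> pois_fps l * nb_fps r \<theta> 0"

lemma l1_bound_M: "l1_bound M 1"
  using l1_bound_mult1[OF l1_bound_pois_fps l1_bound_nb_fps[OF par(2,3)]] par by simp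

lemma M_char_sums:
  "(\<lambda>k. of_real (fps_nth M k) * exp (\<i> * of_real t) ^ k) sums 
     exp (of_real l * (exp (\<i> * of_real t) - 1) - of_real r * Ln (chf_den \<theta> (of_real t)))"
proof -
  let ?z = "exp (\<i> * complex_of_real t)"
  let ?a = "\<lambda>k. of_real (fps_nth (pois_fps l) k) * ?z ^ k" and ?b = "\<lambda>k. of_real (fps_nth (nb_fps r \<theta> 0) k) * ?z ^ k"
  have sm: "summable (\<lambda>k. norm (complex_of_real (fps_nth F k) * ?z ^ k))" if "l1_bound F 1" for F
    using l1_bound_summable[OF that] by (simp add: norm_mult norm_power)
  have "(\<lambda>k. \<Sum>i\<le>k. ?a i * ?b (k - i)) sums ((\<Sum>k. ?a k) * (\<Sum>k. ?b k))"
    by (intro Cauchy_product_sums sm l1_bound_pois_fps l1_bound_nb_fps) (use par in auto)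
  moreover have "(\<Sum>i\<le>k. ?a i * ?b (k - i)) = of_real (fps_nth M k) * ?z ^ k" for k
  proof -
    have "(\<Sum>i\<le>k. ?a i * ?b (k - i)) = (\<Sum>i\<le>k. of_real (fps_nth (pois_fps l) i * fps_nth (nb_fps r \<theta> 0) (k - i)) * ?z ^ k)"
    proof (rule sum.cong[OF refl])
      fix i assume "i \<in> {..k}"
      then have "?z ^ k = ?z ^ i * ?z ^ (k - i)" by (simp flip: power_add)
      then show "?a i * ?b (k - i) = of_real (fps_nth (pois_fps l) i * fps_nth (nb_fps r \<theta> 0) (k - i)) * ?z ^ k"
        by (simp only: of_real_mult mult_ac)
    qed
    then show ?thesis by (simp add: fps_mult_nth sum_distrib_right atLeast0AtMost)
  qed
  moreover have "(\<Sum>k. ?a k) * (\<Sum>k. ?b k) = exp (of_real l * (?z - 1) - of_real r * Ln (chf_den \<theta> (of_real t)))"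
    unfolding sums_unique[OF pois_fps_char_sums[of l ?z], symmetric] sums_unique[OF negbin_char_sums[of t], symmetric] mult_exp_exp by simp
  ultimately show ?thesis by simp
qed

definition centred_chf :: "real \<Rightarrow> complex" where "centred_chf t = exp (chf_log l r \<theta> (of_real t))"

private abbreviation (input) "I \<equiv> indicator {-pi..pi} :: real \<Rightarrow> real"

lemma centred_chf_continuous: "isCont centred_chf t" "isCont (\<lambda>t. chf_log1 l r \<theta> (of_real t)) t" "isCont (\<lambda>t. chf_log2 l r \<theta> (of_real t)) t"
proof -
  have c: "isCont (\<lambda>t. f (complex_of_real t)) t" if "(f has_field_derivative D) (at (of_real t))" for f D
    using DERIV_isCont[OF that] by (intro isCont_o2[OF isCont_of_real]) auto
  show "isCont (\<lambda>t. chf_log1 l r \<theta> (of_real t)) t" by (rule c, rule chf_log1_deriv[OF par S])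
  show "isCont (\<lambda>t. chf_log2 l r \<theta> (of_real t)) t" by (rule c, rule chf_log2_deriv[OF par S])
  have "isCont (\<lambda>t. chf_log l r \<theta> (of_real t)) t" by (rule c, rule chf_log_deriv[OF par S])
  then show "isCont centred_chf t" unfolding centred_chf_def by (intro continuous_intros)
qed

lemma centred_chf_wave: "centred_chf t * wave (of_int k - (l + r * \<theta>)) t = 
  exp (of_real l * (exp (\<i> * of_real t) - 1) - of_real r * Ln (chf_den \<theta> (of_real t))) * exp (- (\<i> * of_real t * of_int k))"
  unfolding centred_chf_def wave_def chf_log_def mult_exp_exp by (simp add: algebra_simps)

text \<open>Orthogonality of the functions exp(i m t) on [-pi, pi], term by term; absolute
  summability of the coefficients justifies the interchange. A negative \<open>k\<close> selects no
  term, hence the case distinction.\<close>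

lemma inversion:
  fixes k :: int
  defines "y \<equiv> of_int k - (l + r * \<theta>)"
  shows "has_bochner_integral lborel (\<lambda>t. I t *\<^sub>R (centred_chf t * wave y t)) (of_real (2 * pi * (if 0 \<le> k then fps_nth M (nat k) else 0)))"
proof -
  let ?f = "\<lambda>j t. of_real (fps_nth M j) * (I t *\<^sub>R exp (\<i> * of_real (of_int (int j - k) * t)))"
  have int: "has_bochner_integral lborel (?f j) (of_real (fps_nth M j) * complex_of_real (if int j - k = 0 then 2 * pi else 0))" for j
    by (rule has_bochner_integral_mult_right[OF integral_unit_wave])
  have s: "(\<lambda>j. ?f j t) sums (I t *\<^sub>R (centred_chf t * wave y t))" for t
  proof -
    have "(\<lambda>j. (of_real (fps_nth M j) * exp (\<i> * of_real t) ^ j) * exp (- (\<i> * of_real t * of_int k))) sums (centred_chf t * wave y t)"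
      unfolding y_def centred_chf_wave by (intro sums_mult2 M_char_sums)
    then have "(\<lambda>j. of_real (I t) * ((of_real (fps_nth M j) * exp (\<i> * of_real t) ^ j) * exp (- (\<i> * of_real t * of_int k)))) sums (of_real (I t) * (centred_chf t * wave y t))"
      by (rule sums_mult)
    moreover have "exp (\<i> * complex_of_real t) ^ j * exp (- (\<i> * of_real t * of_int k)) = exp (\<i> * of_real (of_int (int j - k) * t))" for j
      by (simp add: exp_of_nat_mult[symmetric] mult_exp_exp algebra_simps)
    moreover have "of_real (I t) * ((of_real c * A) * B) = of_real c * (I t *\<^sub>R (A * B))" for c and A B :: complex
      by (simp add: scaleR_conv_of_real)
    ultimately show ?thesis by (simp only: scaleR_conv_of_real)
  qed
  have nrm: "norm (?f j t) = \<bar>fps_nth M j\<bar> * I t" for j t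
  proof -
    have "norm (exp (\<i> * complex_of_real (of_int (int j - k) * t))) = 1" by (rule norm_exp_i)
    then show ?thesis by (simp only: norm_mult norm_of_real norm_scaleR mult_1_right) (simp add: indicator_def)
  qed
  have sm: "summable (\<lambda>j. \<bar>fps_nth M j\<bar>)" using l1_bound_summable[OF l1_bound_M] .
  have sm1: "AE t in lborel. summable (\<lambda>j. norm (?f j t))"
    unfolding nrm by (intro AE_I2 summable_mult2 sm)
  have sm2: "summable (\<lambda>j. \<integral>t. norm (?f j t) \<partial>lborel)"
    unfolding nrm by (simp add: sm summable_mult2)
  have integrable: "integrable lborel (?f j)" for j using int integrable.intros by blast
  have val: "(\<Sum>j. of_real (fps_nth M j) * complex_of_real (if int j - k = 0 then 2 * pi else 0)) = complex_of_real (2 * pi * (if 0 \<le> k then fps_nth M (nat k) else 0))"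
  proof (cases "0 \<le> k")
    case True
    then have "(\<lambda>j. complex_of_real (fps_nth M j) * complex_of_real (if int j - k = 0 then 2 * pi else 0)) = (\<lambda>j. if j = nat k then complex_of_real (fps_nth M j) * complex_of_real (2 * pi) else 0)"
      by (auto simp: fun_eq_iff)
    then show ?thesis using True sums_unique[OF sums_single[of "nat k" "\<lambda>j. complex_of_real (fps_nth M j) * complex_of_real (2 * pi)"]] by (simp add: mult_ac)
  next
    case False
    then have "(\<lambda>j. complex_of_real (fps_nth M j) * complex_of_real (if int j - k = 0 then 2 * pi else 0)) = (\<lambda>j. 0)"
      by (auto simp: fun_eq_iff)
    then show ?thesis using False by simp
  qed
  have "integrable lborel (\<lambda>t. \<Sum>j. ?f j t)" by (rule integrable_suminf[OF integrable sm1 sm2])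
  moreover have "(\<integral>t. (\<Sum>j. ?f j t) \<partial>lborel) = (\<Sum>j. \<integral>t. ?f j t \<partial>lborel)" by (rule integral_suminf[OF integrable sm1 sm2])
  moreover have "(\<lambda>t. \<Sum>j. ?f j t) = (\<lambda>t. I t *\<^sub>R (centred_chf t * wave y t))" using sums_unique[OF s] by (simp add: fun_eq_iff)
  moreover have "(\<integral>t. ?f j t \<partial>lborel) = of_real (fps_nth M j) * complex_of_real (if int j - k = 0 then 2 * pi else 0)" for j
    using int by (rule has_bochner_integral_integral_eq)
  ultimately show ?thesis using val by (simp add: has_bochner_integral_iff)
qed

text \<open>The integrand is the derivative of a function with equal values at \<open>-\<pi>\<close> and \<open>\<pi>\<close>: this replaces
  the two integrations by parts.\<close>
lemma inversion2:
  fixes k :: int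
  defines "y \<equiv> of_int k - (l + r * \<theta>)"
  shows "has_bochner_integral lborel (\<lambda>t. I t *\<^sub>R ((chf_log2 l r \<theta> (of_real t) + (chf_log1 l r \<theta> (of_real t))\<^sup>2 + of_real (y\<^sup>2)) * centred_chf t * wave y t)) 0"
proof -
  \<comment> \<open>The sign of \<open>\<i> * of_real y\<close> is opposite to that in the exponent,
    so the product rule yields (K1 - i y) (K1 + i y) = K1^2 + y^2.\<close>
  let ?F = "\<lambda>w. (chf_log1 l r \<theta> w + \<i> * of_real y) * exp (chf_log l r \<theta> w - \<i> * w * of_real y)"
  let ?f = "\<lambda>t. (chf_log2 l r \<theta> (of_real t) + (chf_log1 l r \<theta> (of_real t))\<^sup>2 + of_real (y\<^sup>2)) * centred_chf t * wave y t"
  have pw: "exp (chf_log l r \<theta> (of_real t) - \<i> * of_real t * of_real y) = centred_chf t * wave y t" for t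
    unfolding centred_chf_def wave_def mult_exp_exp by (simp add: mult.assoc)
  have "has_bochner_integral lborel (\<lambda>t. I t *\<^sub>R ?f t) (?F (of_real pi) - ?F (of_real (- pi)))"
  proof (rule has_bochner_integral_FTC_Icc)
    fix t :: real
    have d: "((\<lambda>w. chf_log l r \<theta> w - \<i> * w * of_real y) has_field_derivative chf_log1 l r \<theta> (of_real t) - \<i> * of_real y) (at (of_real t))"
      by (auto intro!: derivative_eq_intros chf_log_deriv[OF par S])
    have d2: "(?F has_field_derivative (chf_log2 l r \<theta> (of_real t) * exp (chf_log l r \<theta> (of_real t) - \<i> * of_real t * of_real y) + 
       exp (chf_log l r \<theta> (of_real t) - \<i> * of_real t * of_real y) * (chf_log1 l r \<theta> (of_real t) - \<i> * of_real y) * (chf_log1 l r \<theta> (of_real t) + \<i> * of_real y))) (at (of_real t))"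
      by (rule DERIV_mult[OF _ DERIV_fun_exp[OF d]]) (auto intro!: derivative_eq_intros chf_log1_deriv[OF par S])
    have e: "K2 * X + X * (K1 - \<i> * of_real y) * (K1 + \<i> * of_real y) = (K2 + K1\<^sup>2 + of_real (y\<^sup>2)) * X" for X K1 K2 :: complex
      by (simp add: algebra_simps power2_eq_square)
    have "(?F has_field_derivative ?f t) (at (of_real t))" using d2 unfolding e pw by (simp only: mult.assoc)
    then show "((\<lambda>t. ?F (of_real t)) has_vector_derivative ?f t) (at t within {-pi..pi})"
      by (rule has_vector_derivative_real_field)
  next
    have "isCont (wave y) t" for t unfolding wave_def by (intro continuous_intros)
    then have "isCont ?f t" for t
      by (intro continuous_intros centred_chf_continuous)
    then show "continuous_on {-pi..pi} ?f" by (simp add: continuous_at_imp_continuous_on)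
  qed simp
  \<comment> \<open>The non-periodic phases of the centring and of the wave cancel, which leaves
    exp(- i t k) with an integer k.\<close>
  moreover have "?F (of_real pi) = ?F (of_real (- pi))"
  proof -
    have e: "exp (\<i> * complex_of_real pi) = exp (\<i> * complex_of_real (- pi))" unfolding exp_eq by (intro exI[of _ 1]) simp
    have 1: "chf_log1 l r \<theta> (of_real pi) = chf_log1 l r \<theta> (of_real (- pi))" unfolding chf_log1_def chf_ratio_def chf_den_def e ..
    have "exp (- (\<i> * of_real pi * of_int k)) = exp (- (\<i> * of_real (- pi) * of_int k))"
      unfolding exp_eq by (intro exI[of _ "-k"]) (simp add: algebra_simps)
    then have "centred_chf pi * wave y pi = centred_chf (- pi) * wave y (- pi)" unfolding y_def centred_chf_wave chf_den_def e by simp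
    then show ?thesis unfolding pw 1 by simp
  qed
  ultimately show ?thesis by simp
qed

end

section \<open>Local limit bound\<close>

lemma exp_half_bounds:
  fixes y :: real
  assumes "0 \<le> y"
  shows "exp (- y) \<le> exp (- (y / 2))" "y * exp (- y) \<le> 2 * exp (- (y / 2))" "y\<^sup>2 * exp (- y) \<le> 16 * exp (- (y / 2))"
proof -
  show "exp (- y) \<le> exp (- (y / 2))" using assms by simp
  have e: "exp (- y) = exp (- (y / 2)) * exp (- (y / 2))" by (simp add: mult_exp_exp)
  have le: "z \<le> exp z" for z :: real using exp_ge_add_one_self[of z] by linarith
  have "y / 2 * exp (- (y / 2)) \<le> 1" using le[of "y / 2"] by (simp add: exp_minus divide_le_eq field_simps)
  then have "2 * (y / 2 * exp (- (y / 2))) * exp (- (y / 2)) \<le> 2 * 1 * exp (- (y / 2))"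
    by (intro mult_right_mono mult_left_mono) auto
  then show "y * exp (- y) \<le> 2 * exp (- (y / 2))" unfolding e by simp
  have "y / 4 * exp (- (y / 4)) \<le> 1" using le[of "y / 4"] by (simp add: exp_minus field_simps)
  then have "(y / 4 * exp (- (y / 4)))\<^sup>2 \<le> 1\<^sup>2" using assms by (intro power_mono) auto
  moreover have "(exp (- (y / 4)))\<^sup>2 = exp (- (y / 2))" by (simp add: power2_eq_square mult_exp_exp)
  ultimately have "(y / 4)\<^sup>2 * exp (- (y / 2)) \<le> 1" unfolding power_mult_distrib by (simp only: power_one)
  then have "16 * ((y / 4)\<^sup>2 * exp (- (y / 2))) * exp (- (y / 2)) \<le> 16 * 1 * exp (- (y / 2))"
    by (intro mult_right_mono mult_left_mono) auto
  then show "y\<^sup>2 * exp (- y) \<le> 16 * exp (- (y / 2))" unfolding e by (simp add: power_divide mult_ac)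
qed

text \<open>Half of the exponential decay is spent on absorbing the polynomial in
  \<open>envelope_bound\<close>; the factors 2 and 16 are those of
  \<open>exp_half_bounds\<close>.\<close>

definition local_const :: "real \<Rightarrow> real \<Rightarrow> real" where
  "local_const \<kappa> c = \<kappa> + 2 * \<kappa> * (4 * \<kappa> + 3) / c + 16 * \<kappa> / c\<^sup>2"

lemma envelope_bound:
  fixes x c \<kappa> :: real
  assumes "0 \<le> x" "0 < c" "0 \<le> \<kappa>"
  shows "(\<kappa> + \<kappa> * (4 * \<kappa> + 3) * x + \<kappa> * x\<^sup>2) * exp (- (c * x)) \<le> local_const \<kappa> c * exp (- (c * x / 2))"
proof -
  let ?y = "c * x" let ?H = "exp (- (?y / 2))"
  have y: "0 \<le> ?y" using assms by simp
  have x: "x = ?y / c" using assms by simp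
  have "(\<kappa> + \<kappa> * (4 * \<kappa> + 3) * x + \<kappa> * x\<^sup>2) * exp (- ?y) = 
    \<kappa> * exp (- ?y) + \<kappa> * (4 * \<kappa> + 3) / c * (?y * exp (- ?y)) + \<kappa> / c\<^sup>2 * (?y\<^sup>2 * exp (- ?y))"
    using assms(2) by (simp add: field_simps power2_eq_square)
  also have "\<dots> \<le> \<kappa> * ?H + \<kappa> * (4 * \<kappa> + 3) / c * (2 * ?H) + \<kappa> / c\<^sup>2 * (16 * ?H)"
    using exp_half_bounds[OF y] assms by (intro add_mono mult_left_mono) auto
  also have "\<dots> = local_const \<kappa> c * ?H" unfolding local_const_def by (simp add: algebra_simps)
  finally show ?thesis .
qed

context
  fixes l r \<theta> S c :: real
  assumes par: "0 < l" "0 < r" "0 < \<theta>" and S: "S = l + r * \<theta> + r * \<theta>\<^sup>2" and S1: "1 \<le> S"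
    and c: "0 < c" "c \<le> 1/2" "12 * c * S \<le> l"
begin

private abbreviation (input) "\<kappa> \<equiv> 1 + 2 * \<theta>"
private abbreviation (input) "P \<equiv> centred_chf l r \<theta>"
private abbreviation (input) "K1 \<equiv> \<lambda>t. chf_log1 l r \<theta> (of_real t)"
private abbreviation (input) "K2 \<equiv> \<lambda>t. chf_log2 l r \<theta> (of_real t)"
private abbreviation (input) "En \<equiv> \<lambda>t. exp (- (c * (S * t\<^sup>2)))"

lemma norm_gauss_le: "norm (gauss S t) \<le> En t"
proof -
  have "c * (S * t\<^sup>2) \<le> 1/2 * (S * t\<^sup>2)" using c S1 by (intro mult_right_mono) auto
  then show ?thesis by (simp add: gauss_def)
qed

lemma norm_centred_chf_le: "\<bar>t\<bar> \<le> pi \<Longrightarrow> norm (P t) \<le> En t" "\<bar>t\<bar> \<le> pi \<Longrightarrow> Re (chf_log l r \<theta> (of_real t)) \<le> - (c * (S * t\<^sup>2))"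
proof -
  assume t: "\<bar>t\<bar> \<le> pi"
  have "12 * c * S * t\<^sup>2 \<le> l * t\<^sup>2" using c by (intro mult_right_mono) auto
  then show "Re (chf_log l r \<theta> (of_real t)) \<le> - (c * (S * t\<^sup>2))" using Re_chf_log[OF par S t] by simp
  then show "norm (P t) \<le> En t" by (simp add: centred_chf_def[OF par S])
qed

lemma centred_chf_gauss_diff: 
  assumes "\<bar>t\<bar> \<le> pi" shows "norm (P t - gauss S t) \<le> S * \<kappa> * \<bar>t\<bar> ^ 3 * En t"
proof -
  have "c * (S * t\<^sup>2) \<le> 1/2 * (S * t\<^sup>2)" using c S1 by (intro mult_right_mono) auto
  then have "norm (exp (chf_log l r \<theta> (of_real t)) - exp (of_real (- (S * t\<^sup>2 / 2)))) \<le> En t * norm (chf_log l r \<theta> (of_real t) - of_real (- (S * t\<^sup>2 / 2)))"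
    using norm_centred_chf_le(2)[OF assms] by (intro exp_diff_bound) auto
  also have "\<dots> \<le> En t * (S * \<kappa> * \<bar>t\<bar> ^ 3)"
    using chf_log_le[OF par S, of t] by (intro mult_left_mono) auto
  finally show ?thesis unfolding centred_chf_def[OF par S] gauss_def exp_of_real by (simp add: mult_ac)
qed

text \<open>Inside [-pi, pi] this is the cubic Taylor error, with S |t|^3 written as |t| (S t^2).
  Outside, only the Gaussian tail is left, and |t| >= 1 there. The factor |t| makes the integral of
  order 1/S rather than 1 / sqrt S.\<close>

lemma diff1_le:
  "norm (indicator {-pi..pi} t *\<^sub>R P t - gauss S t) \<le> local_const \<kappa> c * (\<bar>t\<bar> * exp (- (c * S / 2 * t\<^sup>2)))"
proof -
  let ?x = "S * t\<^sup>2"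
  have x: "0 \<le> ?x" using S1 by simp
  have k: "1 \<le> \<kappa>" using par by simp
  have env: "\<bar>t\<bar> * ((\<kappa> + \<kappa> * (4 * \<kappa> + 3) * ?x + \<kappa> * ?x\<^sup>2) * En t) \<le> \<bar>t\<bar> * (local_const \<kappa> c * exp (- (c * ?x / 2)))"
    using x c k by (intro mult_left_mono envelope_bound) auto
  have "norm (indicator {-pi..pi} t *\<^sub>R P t - gauss S t) \<le> \<bar>t\<bar> * ((\<kappa> + \<kappa> * (4 * \<kappa> + 3) * ?x + \<kappa> * ?x\<^sup>2) * En t)"
  proof (cases "\<bar>t\<bar> \<le> pi")
    case True
    then have "norm (indicator {-pi..pi} t *\<^sub>R P t - gauss S t) \<le> S * \<kappa> * \<bar>t\<bar> ^ 3 * En t"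
      using centred_chf_gauss_diff[OF True] by (simp add: abs_le_iff)
    also have "\<dots> = \<bar>t\<bar> * ((\<kappa> * 1 * ?x) * En t)" by (simp add: power3_eq_cube power2_eq_square)
    also have "\<dots> \<le> \<bar>t\<bar> * ((\<kappa> + \<kappa> * (4 * \<kappa> + 3) * ?x + \<kappa> * ?x\<^sup>2) * En t)"
    proof (intro mult_left_mono mult_right_mono)
      have "\<kappa> * 1 * ?x \<le> \<kappa> * (4 * \<kappa> + 3) * ?x" using k x by (intro mult_right_mono mult_left_mono) auto
      moreover have "0 \<le> \<kappa> * ?x\<^sup>2" using k by simp
      ultimately show "\<kappa> * 1 * ?x \<le> \<kappa> + \<kappa> * (4 * \<kappa> + 3) * ?x + \<kappa> * ?x\<^sup>2" using k by linarith
    qed auto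
    finally show ?thesis .
  next
    case False
    then have t: "1 \<le> \<bar>t\<bar>" using pi_gt3 by linarith
    have "norm (indicator {-pi..pi} t *\<^sub>R P t - gauss S t) \<le> 1 * (1 * En t)"
      using False norm_gauss_le[of t] by (auto simp: abs_le_iff indicator_def split: if_splits)
    also have "\<dots> \<le> \<bar>t\<bar> * ((\<kappa> + \<kappa> * (4 * \<kappa> + 3) * ?x + \<kappa> * ?x\<^sup>2) * En t)"
    proof (intro mult_mono)
      have "0 \<le> \<kappa> * (4 * \<kappa> + 3) * ?x" "0 \<le> \<kappa> * ?x\<^sup>2" using k x by auto
      then show "1 \<le> \<kappa> + \<kappa> * (4 * \<kappa> + 3) * ?x + \<kappa> * ?x\<^sup>2" using k by linarith
    qed (use t k x par in \<open>auto intro!: add_nonneg_nonneg\<close>)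
    finally show ?thesis .
  qed
  also note env
  finally show ?thesis by (simp add: mult_ac)
qed

text \<open>Uses K1^2 - (S t)^2 = (K1 + S t) (K1 - S t), whose first factor is a Taylor error and
  whose second is of order S |t|. The four terms account for the coefficients \<kappa>, \<kappa> (4
  \<kappa> + 2) + \<kappa> and \<kappa> of the envelope; the 4 bounds |t| <= pi.\<close>

lemma diff2_le:
  "norm (indicator {-pi..pi} t *\<^sub>R ((K2 t + (K1 t)\<^sup>2) * P t) - of_real (S\<^sup>2 * t\<^sup>2 - S) * gauss S t) \<le> 
     S * local_const \<kappa> c * (\<bar>t\<bar> * exp (- (c * S / 2 * t\<^sup>2)))"
proof -
  let ?x = "S * t\<^sup>2" let ?B = "\<kappa> + \<kappa> * (4 * \<kappa> + 3) * ?x + \<kappa> * ?x\<^sup>2"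
  have x: "0 \<le> ?x" using S1 by simp
  have k: "1 \<le> \<kappa>" using par by simp
  have env: "S * \<bar>t\<bar> * (?B * En t) \<le> S * \<bar>t\<bar> * (local_const \<kappa> c * exp (- (c * ?x / 2)))"
    using x c k S1 by (intro mult_left_mono envelope_bound) auto
  have "norm (indicator {-pi..pi} t *\<^sub>R ((K2 t + (K1 t)\<^sup>2) * P t) - of_real (S\<^sup>2 * t\<^sup>2 - S) * gauss S t) \<le> S * \<bar>t\<bar> * (?B * En t)"
  proof (cases "\<bar>t\<bar> \<le> pi")
    case True
    let ?s = "complex_of_real S" let ?t = "complex_of_real t"
    have t4: "\<bar>t\<bar> \<le> 4" using True pi_less_4 by linarith
    have a: "norm (K2 t + ?s) \<le> S * \<kappa> * \<bar>t\<bar>" by (rule chf_log2_le[OF par S])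
    have b: "norm (K1 t + ?s * ?t) \<le> S * \<kappa> * \<bar>t\<bar>\<^sup>2" by (rule chf_log1_le[OF par S])
    have b': "norm (K1 t - ?s * ?t) \<le> S * \<bar>t\<bar> * (4 * \<kappa> + 2)"
    proof -
      have "norm (K1 t - ?s * ?t) = norm ((K1 t + ?s * ?t) - 2 * (?s * ?t))" by (simp add: algebra_simps)
      also have "\<dots> \<le> norm (K1 t + ?s * ?t) + norm (2 * (?s * ?t))" by (rule norm_triangle_ineq4)
      also have "\<dots> \<le> S * \<kappa> * \<bar>t\<bar>\<^sup>2 + 2 * (S * \<bar>t\<bar>)" using b S1 by (simp add: norm_mult)
      also have "\<dots> = S * \<bar>t\<bar> * (\<bar>t\<bar> * \<kappa> + 2)" by (simp add: power2_eq_square algebra_simps)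
      also have "\<dots> \<le> S * \<bar>t\<bar> * (4 * \<kappa> + 2)" using t4 k S1 by (intro mult_left_mono add_right_mono mult_right_mono) auto
      finally show ?thesis .
    qed
    have d: "norm (P t - gauss S t) \<le> S * \<kappa> * \<bar>t\<bar> ^ 3 * En t" by (rule centred_chf_gauss_diff[OF True])
    have n: "norm (P t) \<le> En t" by (rule norm_centred_chf_le[OF True])
    have id: "(K2 t + (K1 t)\<^sup>2) * P t - of_real (S\<^sup>2 * t\<^sup>2 - S) * gauss S t = 
       (K2 t + ?s) * P t + (K1 t + ?s * ?t) * (K1 t - ?s * ?t) * P t + (?s\<^sup>2 * ?t\<^sup>2) * (P t - gauss S t) - ?s * (P t - gauss S t)"
      by (simp add: algebra_simps power2_eq_square)
    have "norm ((K2 t + (K1 t)\<^sup>2) * P t - of_real (S\<^sup>2 * t\<^sup>2 - S) * gauss S t) \<le> 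
       norm ((K2 t + ?s) * P t) + norm ((K1 t + ?s * ?t) * (K1 t - ?s * ?t) * P t) + norm ((?s\<^sup>2 * ?t\<^sup>2) * (P t - gauss S t)) + norm (?s * (P t - gauss S t))"
      unfolding id by (intro order_trans[OF norm_triangle_ineq4] add_right_mono order_trans[OF norm_triangle_ineq] order_refl)
    also have "\<dots> = norm (K2 t + ?s) * norm (P t) + norm (K1 t + ?s * ?t) * norm (K1 t - ?s * ?t) * norm (P t)
       + S\<^sup>2 * t\<^sup>2 * norm (P t - gauss S t) + S * norm (P t - gauss S t)"
      using S1 by (simp add: norm_mult norm_power)
    also have "\<dots> \<le> (S * \<kappa> * \<bar>t\<bar>) * En t + (S * \<kappa> * \<bar>t\<bar>\<^sup>2) * (S * \<bar>t\<bar> * (4 * \<kappa> + 2)) * En t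
       + S\<^sup>2 * t\<^sup>2 * (S * \<kappa> * \<bar>t\<bar> ^ 3 * En t) + S * (S * \<kappa> * \<bar>t\<bar> ^ 3 * En t)"
      using a b b' d n S1 k by (intro add_mono mult_mono mult_nonneg_nonneg) auto
    also have "\<dots> = S * \<bar>t\<bar> * (?B * En t)"
    proof -
      have t2: "t\<^sup>2 = \<bar>t\<bar>\<^sup>2" by simp
      show ?thesis unfolding t2 by (simp only: power2_eq_square power3_eq_cube) (simp add: algebra_simps)
    qed
    finally show ?thesis using True by (simp add: abs_le_iff)
  next
    case False
    then have t: "1 \<le> \<bar>t\<bar>" using pi_gt3 by linarith
    have "norm (indicator {-pi..pi} t *\<^sub>R ((K2 t + (K1 t)\<^sup>2) * P t) - of_real (S\<^sup>2 * t\<^sup>2 - S) * gauss S t) = \<bar>S\<^sup>2 * t\<^sup>2 - S\<bar> * norm (gauss S t)"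
    proof -
      have "indicator {-pi..pi} t = (0::real)" using False by (auto simp: abs_le_iff)
      then show ?thesis by (simp only: scaleR_zero_left diff_0 norm_minus_cancel norm_mult norm_of_real)
    qed
    also have "\<dots> \<le> (S * \<bar>t\<bar> * (?x + 1)) * En t"
    proof (intro mult_mono norm_gauss_le)
      define A where "A = S * \<bar>t\<bar>"
      have "S * 1 \<le> A" unfolding A_def using t S1 by (intro mult_left_mono) auto
      then have A: "S \<le> A" by simp
      have "?x * S \<le> ?x * A" using A x by (rule mult_left_mono)
      moreover have "0 \<le> ?x * S" using x S1 by simp
      moreover have "A * (?x + 1) = ?x * A + A" by (simp add: algebra_simps)
      ultimately have "\<bar>?x * S - S\<bar> \<le> A * (?x + 1)" using A S1 unfolding abs_le_iff by linarith
      moreover have "?x * S = S\<^sup>2 * t\<^sup>2" by (simp add: power2_eq_square)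
      ultimately show "\<bar>S\<^sup>2 * t\<^sup>2 - S\<bar> \<le> S * \<bar>t\<bar> * (?x + 1)" unfolding A_def by simp
    qed (use S1 x in auto)
    also have "\<dots> \<le> (S * \<bar>t\<bar> * ?B) * En t"
    proof (intro mult_right_mono mult_left_mono)
      have "1 * 1 * ?x \<le> \<kappa> * (4 * \<kappa> + 3) * ?x" using k x by (intro mult_right_mono mult_mono) auto
      moreover have "0 \<le> \<kappa> * ?x\<^sup>2" using k by simp
      ultimately show "?x + 1 \<le> ?B" using k by linarith
    qed (use S1 in auto)
    finally show ?thesis by (simp add: mult.assoc)
  qed
  also note env
  finally show ?thesis by (simp add: mult_ac)
qed

lemma norm_integral_le:
  fixes h :: "real \<Rightarrow> complex"
  assumes "integrable lborel h" "\<And>t. norm (h t) \<le> B * (\<bar>t\<bar> * exp (- (c * S / 2 * t\<^sup>2)))"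
  shows "norm (\<integral>t. h t \<partial>lborel) \<le> B * (2 / (c * S))"
proof -
  have "0 < c * S / 2" using c S1 by simp
  from has_bochner_integral_mult_right[OF integral_abs_gauss[OF this], of B]
  have G: "has_bochner_integral lborel (\<lambda>t. B * (\<bar>t\<bar> * exp (- (c * S / 2 * t\<^sup>2)))) (B * (2 / (c * S)))" by simp
  have "norm (\<integral>t. h t \<partial>lborel) \<le> (\<integral>t. norm (h t) \<partial>lborel)" by (rule integral_norm_bound)
  also have "\<dots> \<le> (\<integral>t. B * (\<bar>t\<bar> * exp (- (c * S / 2 * t\<^sup>2))) \<partial>lborel)"
    using assms integrable.intros[OF G] by (intro integral_mono integrable_norm) auto
  also have "\<dots> = B * (2 / (c * S))" using G by (rule has_bochner_integral_integral_eq)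
  finally show ?thesis .
qed

text \<open>The plain inversion formula bounds S times the error, the one integrated by parts bounds
  y^2 times the error, both by the same constant.\<close>

lemma local_limit:
  fixes k :: int
  defines "y \<equiv> of_int k - (l + r * \<theta>)"
  defines "a \<equiv> (if 0 \<le> k then fps_nth (pois_fps l * nb_fps r \<theta> 0) (nat k) else 0)"
  shows "\<bar>a - exp (- (y\<^sup>2 / (2 * S))) / sqrt (2 * pi * S)\<bar> * (S + y\<^sup>2) \<le> local_const \<kappa> c / c"
proof -
  let ?I = "indicator {-pi..pi} :: real \<Rightarrow> real"
  let ?n = "exp (- (y\<^sup>2 / (2 * S))) / sqrt (2 * pi * S)"
  let ?C = "local_const \<kappa> c"
  have S0: "0 < S" using S1 by simp
  have i1: "has_bochner_integral lborel (\<lambda>t. ?I t *\<^sub>R (P t * wave y t)) (of_real (2 * pi * a))"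
    unfolding a_def y_def by (rule inversion[OF par S])
  have i2: "has_bochner_integral lborel (\<lambda>t. ?I t *\<^sub>R ((K2 t + (K1 t)\<^sup>2 + of_real (y\<^sup>2)) * P t * wave y t)) 0"
    unfolding y_def by (rule inversion2[OF par S])
  have n2: "sqrt (2 * pi / S) * exp (- (y\<^sup>2 / (2 * S))) = 2 * pi * ?n"
  proof -
    have "sqrt (2 * pi / S) * sqrt (2 * pi * S) = sqrt ((2 * pi)\<^sup>2)" using S0 by (simp add: real_sqrt_mult[symmetric] power2_eq_square del: real_sqrt_mult)
    then have "sqrt (2 * pi / S) * sqrt (2 * pi * S) = 2 * pi" unfolding real_sqrt_abs by simp
    moreover have "0 < sqrt (2 * pi * S)" using S0 by simp
    ultimately have "sqrt (2 * pi / S) = 2 * pi / sqrt (2 * pi * S)" by (metis nonzero_eq_divide_eq less_irrefl)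
    then show ?thesis by simp
  qed
  have g1: "has_bochner_integral lborel (\<lambda>t. gauss S t * wave y t) (of_real (2 * pi * ?n))"
    using integrable_gauss_wave[OF S0, of 0 y] integral_gauss_wave[OF S0, of y] n2 by (simp add: has_bochner_integral_iff)
  have g2: "has_bochner_integral lborel (\<lambda>t. of_real (S\<^sup>2 * t\<^sup>2 - S + y\<^sup>2) * gauss S t * wave y t) 0"
  proof -
    have "(\<lambda>t. of_real (S\<^sup>2 * t\<^sup>2 - S + y\<^sup>2) * gauss S t * wave y t) = 
       (\<lambda>t. of_real (S\<^sup>2) * (of_real (t ^ 2) * gauss S t * wave y t) + of_real (y\<^sup>2 - S) * (of_real (t ^ 0) * gauss S t * wave y t))"
      by (simp add: fun_eq_iff algebra_simps)
    moreover have "integrable lborel \<dots>"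
      by (intro Bochner_Integration.integrable_add integrable_mult_right integrable_gauss_wave S0)
    ultimately have "integrable lborel (\<lambda>t. of_real (S\<^sup>2 * t\<^sup>2 - S + y\<^sup>2) * gauss S t * wave y t)" by (simp only:)
    then show ?thesis unfolding has_bochner_integral_iff using integral_gauss_wave2[OF S0, of y] by blast
  qed
  let ?h1 = "\<lambda>t. ?I t *\<^sub>R (P t * wave y t) - gauss S t * wave y t"
  have h1: "has_bochner_integral lborel ?h1 (of_real (2 * pi * a) - of_real (2 * pi * ?n))"
    by (rule has_bochner_integral_diff[OF i1 g1])
  have "norm (of_real (2 * pi * a) - complex_of_real (2 * pi * ?n)) \<le> ?C * (2 / (c * S))"
    unfolding has_bochner_integral_integral_eq[OF h1, symmetric]
  proof (rule norm_integral_le)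
    show "integrable lborel ?h1" using h1 by (rule integrable.intros)
    fix t
    have "?h1 t = (?I t *\<^sub>R P t - gauss S t) * wave y t" by (simp add: algebra_simps)
    then show "norm (?h1 t) \<le> ?C * (\<bar>t\<bar> * exp (- (c * S / 2 * t\<^sup>2)))" using diff1_le[of t] by (simp add: norm_mult)
  qed
  moreover have "norm (of_real (2 * pi * a) - complex_of_real (2 * pi * ?n)) = 2 * pi * \<bar>a - ?n\<bar>"
    by (simp only: of_real_diff[symmetric] norm_of_real right_diff_distrib[symmetric] abs_mult) simp
  ultimately have b1: "2 * pi * \<bar>a - ?n\<bar> \<le> ?C * (2 / (c * S))" by simp
  \<comment> \<open>Both weighted integrals are 0. Subtracting y^2 times the first difference
    removes y^2 from the integrand and leaves an integral equal to -y^2 times the error.\<close>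
  let ?h2 = "\<lambda>t. (?I t *\<^sub>R ((K2 t + (K1 t)\<^sup>2 + of_real (y\<^sup>2)) * P t * wave y t) - of_real (S\<^sup>2 * t\<^sup>2 - S + y\<^sup>2) * gauss S t * wave y t) - of_real (y\<^sup>2) * ?h1 t"
  have h2: "has_bochner_integral lborel ?h2 (0 - 0 - of_real (y\<^sup>2) * (of_real (2 * pi * a) - of_real (2 * pi * ?n)))"
    by (intro has_bochner_integral_diff i2 g2 has_bochner_integral_mult_right h1)
  have "norm (0 - 0 - of_real (y\<^sup>2) * (of_real (2 * pi * a) - complex_of_real (2 * pi * ?n))) \<le> S * ?C * (2 / (c * S))"
    unfolding has_bochner_integral_integral_eq[OF h2, symmetric]
  proof (rule norm_integral_le)
    show "integrable lborel ?h2" using h2 by (rule integrable.intros)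
    fix t
    have "?h2 t = (?I t *\<^sub>R ((K2 t + (K1 t)\<^sup>2) * P t) - of_real (S\<^sup>2 * t\<^sup>2 - S) * gauss S t) * wave y t"
      by (simp add: scaleR_conv_of_real algebra_simps)
    then show "norm (?h2 t) \<le> S * ?C * (\<bar>t\<bar> * exp (- (c * S / 2 * t\<^sup>2)))" using diff2_le[of t] by (simp add: norm_mult)
  qed
  moreover have "norm (0 - 0 - of_real (y\<^sup>2) * (of_real (2 * pi * a) - complex_of_real (2 * pi * ?n))) = y\<^sup>2 * (2 * pi * \<bar>a - ?n\<bar>)"
    by (simp only: of_real_diff[symmetric] of_real_mult[symmetric] diff_0 diff_0_right norm_minus_cancel norm_of_real right_diff_distrib[symmetric] abs_mult) simp
  moreover have "S * ?C * (2 / (c * S)) = ?C * 2 / c" using S0 by simp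
  ultimately have b2: "y\<^sup>2 * (2 * pi * \<bar>a - ?n\<bar>) \<le> ?C * 2 / c" by simp
  have "S * (2 * pi * \<bar>a - ?n\<bar>) \<le> S * (?C * (2 / (c * S)))" using b1 S0 by (intro mult_left_mono) auto
  also have "\<dots> = ?C * 2 / c" using S0 by simp
  finally have "(2 * pi) * (\<bar>a - ?n\<bar> * (S + y\<^sup>2)) \<le> 4 * (?C / c)" using b2 by (simp add: algebra_simps)
  moreover have "4 * (\<bar>a - ?n\<bar> * (S + y\<^sup>2)) \<le> (2 * pi) * (\<bar>a - ?n\<bar> * (S + y\<^sup>2))"
    using pi_gt3 S0 by (intro mult_right_mono) auto
  ultimately show ?thesis by linarith
qed

end

section \<open>Distances between laws on the integers\<close>

text \<open>Continuity from below along the intersections with [-n, n] reduces the supremum to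
  finite sets.\<close>

lemma dTV_le:
  assumes "\<And>A. finite A \<Longrightarrow> \<bar>\<Sum>k\<in>A. pmf P k - pmf R k\<bar> \<le> B"
  shows "dTV P R \<le> B"
  unfolding dTV_def
proof (rule cSUP_least)
  fix A :: "int set"
  let ?A = "\<lambda>n::nat. A \<inter> {- int n..int n}"
  have fin: "finite (?A n)" for n by simp
  have U: "(\<Union>n. ?A n) = A"
  proof -
    have "k \<in> ?A (nat \<bar>k\<bar>)" if "k \<in> A" for k using that by auto
    then show ?thesis by blast
  qed
  have inc: "incseq ?A" by (auto simp: incseq_def)
  have "(\<lambda>n. measure_pmf.prob P' (?A n)) \<longlonglongrightarrow> measure_pmf.prob P' A" for P' :: "int pmf"
    using measure_pmf.finite_Lim_measure_incseq[of ?A P', OF _ inc] unfolding U by simp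
  then have "(\<lambda>n. \<bar>measure_pmf.prob P (?A n) - measure_pmf.prob R (?A n)\<bar>) \<longlonglongrightarrow> \<bar>measure_pmf.prob P A - measure_pmf.prob R A\<bar>"
    by (intro tendsto_intros)
  moreover have "\<bar>measure_pmf.prob P (?A n) - measure_pmf.prob R (?A n)\<bar> \<le> B" for n
    using assms[OF fin[of n]] by (simp add: measure_measure_pmf_finite[OF fin] sum_subtractf)
  ultimately show "\<bar>measure_pmf.prob P A - measure_pmf.prob R A\<bar> \<le> B" using LIMSEQ_le_const2 by blast
qed simp

lemma dloc_le:
  assumes "\<And>a. \<bar>pmf P a - pmf R a\<bar> \<le> B"
  shows "dloc P R \<le> B"
  unfolding dloc_def using assms by (intro cSUP_least) auto

lemma dTV_le_1: "dTV P R \<le> 1"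
  unfolding dTV_def
proof (rule cSUP_least)
  fix A
  show "\<bar>measure_pmf.prob P A - measure_pmf.prob R A\<bar> \<le> 1"
    using measure_pmf.prob_le_1[of P A] measure_pmf.prob_le_1[of R A] measure_nonneg[of P A] measure_nonneg[of R A] by linarith
qed simp

lemma dloc_le_1: "dloc P R \<le> 1"
proof (rule dloc_le)
  fix a show "\<bar>pmf P a - pmf R a\<bar> \<le> 1"
    using pmf_le_1[of P a] pmf_le_1[of R a] pmf_nonneg[of P a] pmf_nonneg[of R a] by linarith
qed

lemma pmf_map_int: "pmf (map_pmf int P) k = (if 0 \<le> k then pmf P (nat k) else 0)"
proof (cases "0 \<le> k")
  case True
  then show ?thesis using pmf_map_inj'[of int P "nat k"] by simp
next
  case False
  then have "k \<notin> int ` set_pmf P" by auto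
  then show ?thesis using False by (simp add: pmf_map_outside)
qed

lemma sum_map_int:
  assumes "finite A"
  shows "(\<Sum>k\<in>A. pmf (map_pmf int P) k - pmf (map_pmf int R) k) = (\<Sum>j\<in>nat ` (A \<inter> {0..}). pmf P j - pmf R j)"
proof -
  have "(\<Sum>k\<in>A. pmf (map_pmf int P) k - pmf (map_pmf int R) k) = (\<Sum>k\<in>A \<inter> {0..}. pmf P (nat k) - pmf R (nat k))"
    using assms by (intro sum.mono_neutral_cong_right) (auto simp: pmf_map_int)
  also have "\<dots> = (\<Sum>j\<in>nat ` (A \<inter> {0..}). pmf P j - pmf R j)"
    by (subst sum.reindex) (auto simp: inj_on_def)
  finally show ?thesis .
qed

lemma sum_inverse_square_le:
  assumes "1 \<le> s" shows "(\<Sum>i<N. 1 / (s + real i)\<^sup>2) \<le> 2 / s"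
proof -
  have "(\<Sum>i<N. 1 / (s + real i)\<^sup>2) \<le> 2 / s - 2 / (s + real N)"
  proof (induction N)
    case (Suc N)
    have "1 / a\<^sup>2 \<le> 2 / a - 2 / (a + 1)" if "1 \<le> a" for a :: real
    proof -
      have "2 / (a * (2 * a)) \<le> 2 / (a * (a + 1))" using that by (intro frac_le mult_mono) auto
      also have "\<dots> = 2 / a - 2 / (a + 1)" using that by (simp add: field_simps)
      finally show ?thesis by (simp add: power2_eq_square)
    qed
    from this[of "s + real N"] assms show ?case using Suc by (simp add: add_ac)
  qed simp
  then show ?thesis using assms by (simp add: order_trans)
qed

text \<open>Compare with the inverse square of sqrt S + |k - floor \<mu>|, at the price of a factor
  6. Each distance occurs at most once on either side, and each side sums to at most 2 / sqrt S,
  hence 24.\<close>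

lemma sum_cauchy_le:
  fixes S \<mu> :: real and A :: "int set"
  assumes "1 \<le> S" "finite A"
  shows "(\<Sum>k\<in>A. 1 / (S + (of_int k - \<mu>)\<^sup>2)) \<le> 24 / sqrt S"
proof -
  let ?s = "sqrt S" let ?m = "\<lfloor>\<mu>\<rfloor>"
  let ?g = "\<lambda>i::nat. 1 / (?s + real i)\<^sup>2"
  have s: "1 \<le> ?s" "?s\<^sup>2 = S" using assms by auto
  obtain N where N: "(\<lambda>k. nat \<bar>k - ?m\<bar>) ` A \<subseteq> {..<N}" using finite_nat_bounded[of "(\<lambda>k. nat \<bar>k - ?m\<bar>) ` A"] assms by auto
  have 1: "1 / (S + (of_int k - \<mu>)\<^sup>2) \<le> 6 * ?g (nat \<bar>k - ?m\<bar>)" for k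
  proof -
    let ?j = "real_of_int \<bar>k - ?m\<bar>" let ?d = "of_int k - \<mu>"
    have "?j \<le> \<bar>?d\<bar> + 1" by linarith
    then have "?j\<^sup>2 \<le> (\<bar>?d\<bar> + 1)\<^sup>2" by (intro power_mono) auto
    also have "\<dots> \<le> 2 * ?d\<^sup>2 + 2" using sum_squares_ge_zero[of "\<bar>?d\<bar> - 1" 0] by (simp add: power2_eq_square algebra_simps)
    finally have j: "?j\<^sup>2 \<le> 2 * ?d\<^sup>2 + 2" .
    have "(?s + ?j)\<^sup>2 \<le> 2 * ?s\<^sup>2 + 2 * ?j\<^sup>2" using zero_le_square[of "?s - ?j"] by (simp add: power2_eq_square algebra_simps)
    moreover have aux: "2 * u + 2 * v \<le> 6 * (u + w)" if "v \<le> 2 * w + 2" "1 \<le> u" "0 \<le> w" for u v w :: real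
      using that unfolding distrib_left by linarith
    moreover from aux[OF j assms(1) zero_le_power2] have "2 * ?s\<^sup>2 + 2 * ?j\<^sup>2 \<le> 6 * (S + ?d\<^sup>2)" unfolding s(2) .
    ultimately have "(?s + ?j)\<^sup>2 \<le> 6 * (S + ?d\<^sup>2)" by linarith
    moreover have "0 < (?s + ?j)\<^sup>2" using s(1) by (intro zero_less_power add_pos_nonneg) simp_all
    moreover have "0 < S + ?d\<^sup>2" using assms(1) by (intro add_pos_nonneg) simp_all
    ultimately have "1 / (S + ?d\<^sup>2) \<le> 6 / (?s + ?j)\<^sup>2" by (simp add: field_simps)
    then show ?thesis by simp
  qed
  have 2: "(\<Sum>k\<in>B. ?g (nat \<bar>k - ?m\<bar>)) \<le> 2 / ?s" if "B \<subseteq> A" "inj_on (\<lambda>k. nat \<bar>k - ?m\<bar>) B" for B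
  proof -
    have "(\<Sum>k\<in>B. ?g (nat \<bar>k - ?m\<bar>)) = sum ?g ((\<lambda>k. nat \<bar>k - ?m\<bar>) ` B)" using that(2) by (simp add: sum.reindex)
    also have "\<dots> \<le> sum ?g {..<N}" using that(1) N by (intro sum_mono2) auto
    also have "\<dots> \<le> 2 / ?s" by (rule sum_inverse_square_le[OF s(1)])
    finally show ?thesis .
  qed
  have "(\<Sum>k\<in>A. 1 / (S + (of_int k - \<mu>)\<^sup>2)) \<le> (\<Sum>k\<in>A. 6 * ?g (nat \<bar>k - ?m\<bar>))" by (intro sum_mono 1)
  also have "\<dots> = 6 * (\<Sum>k\<in>A. ?g (nat \<bar>k - ?m\<bar>))" by (simp only: sum_distrib_left)
  also have "(\<Sum>k\<in>A. ?g (nat \<bar>k - ?m\<bar>)) = (\<Sum>k\<in>A \<inter> {?m..}. ?g (nat \<bar>k - ?m\<bar>)) + (\<Sum>k\<in>A \<inter> {..<?m}. ?g (nat \<bar>k - ?m\<bar>))"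
    using assms(2) by (subst sum.union_disjoint[symmetric]) (auto intro!: sum.cong)
  also have "6 * \<dots> \<le> 6 * (2 / ?s + 2 / ?s)"
    by (intro mult_left_mono add_mono 2) (auto simp: inj_on_def)
  finally show ?thesis by simp
qed

text \<open>The derivative times S + x^2 is at most 37. Passing from x to y at distance at most 1/2
  doubles the constant, since S + y^2 <= 2 (S + x^2), and the length 1/2 of the step halves it
  again.\<close>

lemma gauss_lipschitz:
  fixes S u y :: real
  assumes S: "1 \<le> S" and "\<bar>u - y\<bar> \<le> 1/2"
  shows "\<bar>exp (- (u\<^sup>2 / (2 * S))) / sqrt (2 * pi * S) - exp (- (y\<^sup>2 / (2 * S))) / sqrt (2 * pi * S)\<bar> \<le> 37 / (S + y\<^sup>2)"
proof -
  let ?f = "\<lambda>x. exp (- (x\<^sup>2 / (2 * S))) / sqrt (2 * pi * S)"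
  let ?f' = "\<lambda>x. - x / S * ?f x"
  have y0: "0 < S + y\<^sup>2" using S by (simp add: add_pos_nonneg)
  have deriv: "(?f has_real_derivative ?f' x) (at x)" for x
    using S by (auto intro!: derivative_eq_intros simp: field_simps)
  have f': "\<bar>?f' x\<bar> \<le> 74 / (S + y\<^sup>2)" if x: "\<bar>x - y\<bar> \<le> 1/2" for x
  proof -
    have "y\<^sup>2 \<le> 2 * x\<^sup>2 + 2 * (x - y)\<^sup>2" using zero_le_square[of "2 * x - y"] by (simp add: power2_eq_square algebra_simps)
    moreover have "(x - y)\<^sup>2 \<le> (1/2)\<^sup>2" using x by (metis abs_le_square_iff abs_of_pos half_gt_zero_iff zero_less_one)
    ultimately have Sy: "S + y\<^sup>2 \<le> 2 * (S + x\<^sup>2)" using S by (simp add: power2_eq_square)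
    let ?q = "x\<^sup>2 / S" let ?z = "x\<^sup>2 / (2 * S)"
    have z: "0 \<le> ?z" using S by simp
    have E: "exp (- ?z) \<le> 1" "?z * exp (- ?z) \<le> 2" "?z\<^sup>2 * exp (- ?z) \<le> 16"
      using exp_half_bounds[OF z] z by (auto intro: order_trans)
    have s: "0 < sqrt S" "sqrt S * sqrt S = S" using S by auto
    have a1: "2 * (\<bar>x\<bar> / sqrt S) \<le> 1 + ?q"
    proof -
      have "0 \<le> (\<bar>x\<bar> / sqrt S - 1)\<^sup>2" by simp
      moreover have "(\<bar>x\<bar> / sqrt S)\<^sup>2 = ?q" using S by (simp add: power_divide)
      ultimately show ?thesis by (simp add: power2_diff)
    qed
    have pi1: "1 \<le> sqrt (2 * pi)" using pi_gt3 by simp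
    have "\<bar>?f' x\<bar> * (S + x\<^sup>2) = \<bar>x\<bar> / sqrt S * (1 + ?q) * exp (- ?z) / sqrt (2 * pi)"
      using S s by (simp add: abs_mult real_sqrt_mult field_simps)
    also have "\<dots> \<le> \<bar>x\<bar> / sqrt S * (1 + ?q) * exp (- ?z)"
    proof -
      have "0 \<le> \<bar>x\<bar> / sqrt S * (1 + ?q) * exp (- ?z)" using S by simp
      moreover have "0 < sqrt (2 * pi) * 1" by simp
      ultimately show ?thesis using divide_left_mono[OF pi1] by (metis div_by_1)
    qed
    also have "\<dots> \<le> (1 + ?q) / 2 * (1 + ?q) * exp (- ?z)"
    proof (intro mult_right_mono)
      show "\<bar>x\<bar> / sqrt S \<le> (1 + ?q) / 2" using a1 by (subst pos_le_divide_eq) (simp_all only: mult.commute zero_less_numeral)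
    qed (use S in auto)
    also have "\<dots> = (exp (- ?z) + 4 * (?z * exp (- ?z)) + 4 * (?z\<^sup>2 * exp (- ?z))) / 2"
      using S by (simp add: field_simps power2_eq_square)
    also have "\<dots> \<le> (1 + 4 * 2 + 4 * 16) / 2" using E by (intro divide_right_mono add_mono mult_left_mono) auto
    also have "\<dots> \<le> 37" by simp
    finally have "\<bar>?f' x\<bar> * (S + x\<^sup>2) \<le> 37" .
    then have "2 * (\<bar>?f' x\<bar> * (S + x\<^sup>2)) \<le> 2 * 37" by (rule mult_left_mono) simp
    moreover have "\<bar>?f' x\<bar> * (S + y\<^sup>2) \<le> \<bar>?f' x\<bar> * (2 * (S + x\<^sup>2))" using Sy by (intro mult_left_mono) auto
    ultimately have "\<bar>?f' x\<bar> * (S + y\<^sup>2) \<le> 2 * 37" unfolding mult.left_commute[of _ 2] by (rule order_trans[rotated])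
    then have "\<bar>?f' x\<bar> * (S + y\<^sup>2) \<le> 74" by (simp only: mult_numeral_1 numeral_times_numeral num.simps mult_num_simps arith_simps)
    then show ?thesis using y0 by (simp only: pos_le_divide_eq)
  qed
  have "\<bar>?f u - ?f y\<bar> \<le> 74 / (S + y\<^sup>2) * \<bar>u - y\<bar>"
  proof -
    have "norm (?f u - ?f y) \<le> 74 / (S + y\<^sup>2) * norm (u - y)"
    proof (rule field_differentiable_bound[of "{y - 1/2..y + 1/2}"])
      fix z assume "z \<in> {y - 1/2..y + 1/2}"
      then have "\<bar>z - y\<bar> \<le> 1/2" unfolding atLeastAtMost_iff by linarith
      then show "norm (?f' z) \<le> 74 / (S + y\<^sup>2)" using f' by simp
      show "(?f has_real_derivative ?f' z) (at z within {y - 1/2..y + 1/2})" by (rule has_field_derivative_at_within[OF deriv])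
    next
      have "u \<in> {y - 1/2..y + 1/2}" "y \<in> {y - 1/2..y + 1/2}" using assms(2) unfolding atLeastAtMost_iff by linarith+
      then show "u \<in> {y - 1/2..y + 1/2}" "y \<in> {y - 1/2..y + 1/2}" .
    qed simp
    then show ?thesis by simp
  qed
  also have "\<dots> \<le> 74 / (S + y\<^sup>2) * (1/2)" using assms(2) y0 by (intro mult_left_mono) auto
  also have "74 / v * (1/2) = 37 / v" for v :: real by simp
  finally show ?thesis .
qed

lemma discretized_normal_approx:
  fixes S \<mu> :: real and k :: int
  assumes S: "1 \<le> S"
  defines "y \<equiv> of_int k - \<mu>"
  shows "\<bar>pmf (discretized_normal_pmf \<mu> S) k - exp (- (y\<^sup>2 / (2 * S))) / sqrt (2 * pi * S)\<bar> \<le> 37 / (S + y\<^sup>2)"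
proof -
  let ?f = "\<lambda>x. exp (- (x\<^sup>2 / (2 * S))) / sqrt (2 * pi * S)"
  let ?I = "{of_int k - 1/2..of_int k + 1/2::real}"
  let ?B = "37 / (S + y\<^sup>2)"
  have "0 < S" using S by simp
  then have "pmf (discretized_normal_pmf \<mu> S) k = (LBINT x:?I. ?f (x - \<mu>))"
    by (simp add: pmf_discretized_normal)
  moreover have int: "set_integrable lborel ?I (\<lambda>x. ?f (x - \<mu>))"
    unfolding set_integrable_def using S by (intro borel_integrable_compact continuous_intros) auto
  have c: "set_integrable lborel ?I (\<lambda>x. a)" "(LBINT x:?I. a) = a" for a :: real
    by (auto simp: set_integrable_def set_lebesgue_integral_def)
  have d: "\<bar>?f (x - \<mu>) - ?f y\<bar> \<le> ?B" if "x \<in> ?I" for x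
    
  proof (intro gauss_lipschitz S)
    show "\<bar>x - \<mu> - y\<bar> \<le> 1/2" using that unfolding y_def atLeastAtMost_iff by linarith
  qed
  have "(LBINT x:?I. ?f (x - \<mu>)) \<le> (LBINT x:?I. ?f y + ?B)"
  proof (intro set_integral_mono int c)
    fix x assume "x \<in> ?I"
    from d[OF this] show "?f (x - \<mu>) \<le> ?f y + ?B" by linarith
  qed
  moreover have "(LBINT x:?I. ?f y - ?B) \<le> (LBINT x:?I. ?f (x - \<mu>))"
  proof (intro set_integral_mono int c)
    fix x assume "x \<in> ?I"
    from d[OF this] show "?f y - ?B \<le> ?f (x - \<mu>)" by linarith
  qed
  ultimately show ?thesis unfolding c by linarith
qed

section \<open>Explicit bounds for the triangle count\<close>

lemma choose_3_bounds:
  assumes "2 \<le> m"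
  shows "real (m choose 3) \<le> real m ^ 3 / 6" "(real m - 2) ^ 3 / 6 \<le> real (m choose 3)"
proof -
  have eq: "real (m choose 3) = real m * (real m - 1) * (real m - 2) / 6"
    by (simp add: binomial_gbinomial gbinomial_prod_rev numeral_3_eq_3 atLeast0_lessThan_Suc)
  have "real m * (real m - 1) * (real m - 2) \<le> real m * real m * real m"
    using assms by (intro mult_mono) auto
  then show "real (m choose 3) \<le> real m ^ 3 / 6" unfolding eq by (simp add: power3_eq_cube)
  have "(real m - 2) * (real m - 2) * (real m - 2) \<le> real m * (real m - 1) * (real m - 2)"
    using assms by (intro mult_mono) auto
  then show "(real m - 2) ^ 3 / 6 \<le> real (m choose 3)" unfolding eq by (simp add: power3_eq_cube)
qed

text \<open>60 + 60 + 80 (K + 1), the factor of x^2 in the bound \<open>excess_le\<close>.\<close>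

definition cumulant_const :: "real \<Rightarrow> real" where
  "cumulant_const K = 200 + 80 * K"

text \<open>The first factor bounds the coefficients of the third differences, the second the
  smoothing. Here 983040 = 64 * 128 * 120, the 120 stemming from X / 120 <= l, and
  \<open>exp (- (24 * K)) / 2\<close> is a lower bound, in units of X, for the mean number of
  isolated triangles.\<close>

definition negbin_tv_const :: "real \<Rightarrow> real" where
  "negbin_tv_const K = (20 * cumulant_const K * (K + 1) + (cumulant_const K)\<^sup>2 * K) *
     ((6000 + 983040 * (1 + 4 * K)) / (exp (- (24 * K)) / 2)\<^sup>2)"

text \<open>The decay rate c = 1 / (120 (1 + 3 K)) satisfies 12 c S <= l because S <= \<mu> (1 + 3
  K) and \<mu> / 10 <= l. The 37 is the cost of discretization.\<close>

definition normal_const :: "real \<Rightarrow> real" where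
  "normal_const K = local_const (1 + 2 * (cumulant_const K * K)) (1 / (120 * (1 + 3 * K))) * (120 * (1 + 3 * K)) + 37"

lemma local_const_mono:
  assumes "0 \<le> \<kappa>" "\<kappa> \<le> \<kappa>'" "0 < c"
  shows "local_const \<kappa> c \<le> local_const \<kappa>' c"
  unfolding local_const_def using assms
  by (intro add_mono divide_right_mono mult_mono) auto

context
  fixes n :: nat and p K :: real and W :: "nat pmf"
  assumes n: "1000 \<le> n" and p: "0 < p" "p \<le> 1/600"
    and K: "0 \<le> K" "real n * p\<^sup>2 \<le> K" and np: "800 * (K + 1) \<le> real n * p"
    and W: "W = triangle_count_pmf n p"
begin

text \<open>\<open>b\<close> and \<open>d\<close> are \<open>\<Gamma>\<^sub>2 / \<mu>\<close> and \<open>\<Gamma>\<^sub>3 / (2 \<mu>)\<close>, and \<open>\<theta> = (1 - q) / q\<close> for the success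
  probability \<open>q\<close> of the negative binomial part.\<close>
private abbreviation (input) "x \<equiv> real n * p\<^sup>2"
private abbreviation (input) "X \<equiv> (real n * p) ^ 3"
private abbreviation (input) "KX \<equiv> cumulant_const K"
private abbreviation (input) "\<mu> \<equiv> mean W"
private abbreviation (input) "b \<equiv> coeff1 n p / mean W"
private abbreviation (input) "d \<equiv> coeff2 n p / mean W"
private abbreviation (input) "\<theta> \<equiv> coeff2 n p / coeff1 n p"
private abbreviation (input) "r \<equiv> (coeff1 n p) ^ 3 / (coeff2 n p)\<^sup>2"
private abbreviation (input) "l \<equiv> mean W - r * \<theta>"
private abbreviation (input) "S \<equiv> var W"

lemma p01: "0 \<le> p" "p \<le> 1" using p by auto

lemma mean_eq: "mean W = real (n choose 3) * p ^ 3"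
  using mean_W(1)[OF p01] W by simp

text \<open>The last estimate is what the lower bound on n p is for: terms with an extra factor p
  are negligible against x^2.\<close>

lemma size_bounds: "0 < x" "p \<le> x" "1 \<le> X" "(real n * p)\<^sup>2 * (real n * p) = X" "x * p * (K + 1) \<le> x\<^sup>2 / 800"
proof -
  have np1: "1 \<le> real n * p" using K(1) by (intro order_trans[OF _ np]) simp
  show "0 < x" using n p by simp
  have "1 * p \<le> (real n * p) * p" using np1 p by (intro mult_right_mono) auto
  then show "p \<le> x" by (simp add: power2_eq_square)
  show "1 \<le> X" using np1 by simp
  show "(real n * p)\<^sup>2 * (real n * p) = X" by (simp add: power2_eq_square power3_eq_cube)
  have "x * p * (800 * (K + 1)) \<le> x * p * (real n * p)" using np p by (intro mult_left_mono) auto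
  also have "\<dots> = x\<^sup>2" by (simp add: power2_eq_square)
  finally show "x * p * (K + 1) \<le> x\<^sup>2 / 800" by (simp add: algebra_simps)
qed

lemma mean_bounds: "X / 12 \<le> \<mu>" "\<mu> \<le> X / 6" "0 < \<mu>"
proof -
  have X: "X = real n ^ 3 * p ^ 3" by (simp add: power_mult_distrib)
  have p3: "0 \<le> p ^ 3" using p by simp
  have "(9/10 * real n) ^ 3 \<le> (real n - 2) ^ 3" using n by (intro power_mono) auto
  then have "real n ^ 3 / 12 \<le> real (n choose 3)"
    using choose_3_bounds(2)[of n] n by (simp add: power_mult_distrib power3_eq_cube)
  from mult_right_mono[OF this p3] show 1: "X / 12 \<le> \<mu>" unfolding X mean_eq by simp
  have "real (n choose 3) \<le> real n ^ 3 / 6" using choose_3_bounds(1)[of n] n by simp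
  from mult_right_mono[OF this p3] show "\<mu> \<le> X / 6" unfolding X mean_eq by simp
  show "0 < \<mu>" using 1 size_bounds(3) by linarith
qed

lemma coeff1_bounds: "x \<le> b" "b \<le> 3 * x"
proof -
  have "coeff1 n p = \<mu> * (3 * (real n - 3) * (p\<^sup>2 - p ^ 3) - p ^ 3)"
    using Gamma2_W[OF p01, of n] Gamma2_W_eq[OF p01, of n] n W by simp
  then have b: "b = 3 * (real n - 3) * (p\<^sup>2 - p ^ 3) - p ^ 3" using mean_bounds(3) by simp
  have p3: "0 \<le> p ^ 3" "p ^ 3 \<le> p\<^sup>2 / 600"
    using p mult_right_mono[of p "1/600" "p\<^sup>2"] by (auto simp: power2_eq_square power3_eq_cube)
  have p32: "p ^ 3 \<le> p\<^sup>2" using p by (intro power_decreasing) auto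
  have "3 * (real n - 3) * (p\<^sup>2 - p ^ 3) \<le> 3 * real n * p\<^sup>2"
    using n p3 by (intro mult_mono) (use p32 in auto)
  then show "b \<le> 3 * x" unfolding b using p3 by linarith
  have "(2 * real n) * (9/10 * p\<^sup>2) \<le> (3 * (real n - 3)) * (p\<^sup>2 - p ^ 3)"
  proof (rule mult_mono)
    have "1000 \<le> real n" using n by simp
    then show "2 * real n \<le> 3 * (real n - 3)" "0 \<le> 3 * (real n - 3)" unfolding right_diff_distrib by linarith+
    show "9/10 * p\<^sup>2 \<le> p\<^sup>2 - p ^ 3" using p3 by linarith
  qed simp
  moreover have "1000 * p\<^sup>2 \<le> x" using n by (intro mult_right_mono) auto
  moreover have "0 \<le> p\<^sup>2" by simp
  ultimately show "x \<le> b" unfolding b using p3 by linarith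
qed

lemma excess_le: "excess n p \<le> KX * x\<^sup>2"
proof -
  have "excess n p = 60 * x\<^sup>2 + 60 * (x * p) + 80 * (x * p * (x + 1))"
    unfolding excess_def by (simp add: power2_eq_square power3_eq_cube algebra_simps)
  also have "\<dots> \<le> 60 * x\<^sup>2 + 60 * (x * x) + 80 * (x * x * (K + 1))"
    using size_bounds(1,2) K p by (intro add_mono mult_mono mult_left_mono) auto
  finally show ?thesis unfolding cumulant_const_def by (simp add: power2_eq_square algebra_simps)
qed

lemma excess_nonneg: "0 \<le> excess n p"
  unfolding excess_def using p by simp

text \<open>The leading constant 10.5 is lowered to 10.3 for finite n and then by 0.1 for each of
  two error terms. It has to stay above 9 for \<open>l_ge\<close>.\<close>

lemma coeff2_bounds: "10 * x\<^sup>2 \<le> d" "d \<le> KX * x\<^sup>2"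
proof -
  have G: "Gamma3 W = 2 * coeff2 n p" using Gamma3_W[OF p01] W by simp
  have "2 * coeff2 n p \<le> 2 * \<mu> * excess n p" using Gamma3_W_le[OF p01, of n] G W by simp
  then have "d \<le> excess n p" using mean_bounds(3) by (simp add: divide_le_eq mult.commute)
  then show "d \<le> KX * x\<^sup>2" using excess_le by linarith
  let ?m = "3 * (real n - 3) * (3 * (real n - 3) - 1) / 2 + 6 * (real n - 3) * (real n - 4)"
  let ?b = "p ^ 4 * ?m - 3 * n * p\<^sup>2 * ((10 * n + 10) * p ^ 3) - 80 * n * p ^ 3 * (n * p\<^sup>2 + 1)"
  have "2 * \<mu> * ?b \<le> 2 * coeff2 n p" using Gamma3_W_ge[OF p01, of n] G W by simp
  then have b: "?b \<le> d" using mean_bounds(3) by (simp add: le_divide_eq mult.commute)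
  have x4: "x\<^sup>2 = p ^ 4 * (real n)\<^sup>2" by (simp add: power_mult_distrib flip: power_mult)
  have "103/10 * (real n)\<^sup>2 \<le> ?m"
  proof -
    have "1000 * real n \<le> real n * real n" using n by (intro mult_right_mono) auto
    then show ?thesis by (simp add: field_simps power2_eq_square)
  qed
  then have "p ^ 4 * (103/10 * (real n)\<^sup>2) \<le> p ^ 4 * ?m" by (intro mult_left_mono) auto
  then have 1: "103/10 * x\<^sup>2 \<le> p ^ 4 * ?m" unfolding x4 by simp
  have "3 * n * p\<^sup>2 * ((10 * n + 10) * p ^ 3) = 30 * (p ^ 4 * (real n * real n)) * p + 30 * (p ^ 4 * real n) * p"
    by (simp add: eval_nat_numeral algebra_simps)
  also have "\<dots> \<le> 30 * (p ^ 4 * (real n * real n)) * (1/600) + 30 * (p ^ 4 * (real n * real n)) * (1/600)"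
    using n p by (intro add_mono mult_mono mult_left_mono) auto
  also have "\<dots> = x\<^sup>2 / 10" unfolding x4 by (simp add: power2_eq_square)
  finally have 2: "3 * n * p\<^sup>2 * ((10 * n + 10) * p ^ 3) \<le> x\<^sup>2 / 10" .
  have "80 * n * p ^ 3 * (n * p\<^sup>2 + 1) = 80 * (x * p * (x + 1))"
    by (simp add: power2_eq_square power3_eq_cube algebra_simps)
  also have "\<dots> \<le> 80 * (x * p * (K + 1))" using K p by (intro mult_left_mono) auto
  also have "\<dots> \<le> x\<^sup>2 / 10" using size_bounds(5) by simp
  finally have 3: "80 * n * p ^ 3 * (n * p\<^sup>2 + 1) \<le> x\<^sup>2 / 10" .
  have "0 \<le> x\<^sup>2" by simp
  then show "10 * x\<^sup>2 \<le> d" using b 1 2 3 by linarith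
qed

lemma coeff_pos: "0 < coeff1 n p" "0 < coeff2 n p" "0 < b" "0 < d"
proof -
  show b: "0 < b" using coeff1_bounds(1) size_bounds(1) by linarith
  have "0 < 10 * x\<^sup>2" using n p by simp
  then show d: "0 < d" using coeff2_bounds(1) by linarith
  show "0 < coeff1 n p" "0 < coeff2 n p" using b d mean_bounds(3) by (simp_all add: zero_less_divide_iff)
qed

lemma params: "0 < r" "0 < \<theta>" "r * \<theta>\<^sup>2 = coeff1 n p" "r * \<theta> ^ 3 = coeff2 n p"
  "r * \<theta> = \<mu> * (b\<^sup>2 / d)" "r * \<theta> ^ 4 = \<mu> * (d\<^sup>2 / b)" "\<theta> = d / b"
  using coeff_pos(1,2) mean_bounds(3) by (simp_all add: field_simps eval_nat_numeral)

lemma \<theta>_le: "\<theta> \<le> KX * K"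
proof -
  have KX: "0 \<le> KX" using K by (simp add: cumulant_const_def)
  have "d / b \<le> KX * x\<^sup>2 / x" using coeff1_bounds(1) coeff2_bounds(2) size_bounds(1) coeff_pos(4) by (intro frac_le) auto
  also have "\<dots> = KX * x" using n p by (simp add: power2_eq_square)
  also have "\<dots> \<le> KX * K" using K KX by (intro mult_left_mono) auto
  finally show ?thesis unfolding params(7) .
qed

text \<open>The negative binomial part has mean r \<theta> = \<mu> b^2 / d, and b <= 3 x with d >=
  10 x^2 makes this at most 9/10 of \<mu>.\<close>

lemma l_ge: "\<mu> / 10 \<le> l"
proof -
  have "b\<^sup>2 / d \<le> (3 * x)\<^sup>2 / (10 * x\<^sup>2)"
    using coeff1_bounds(2) coeff2_bounds(1) coeff_pos(3) n p by (intro frac_le power_mono) auto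
  also have "\<dots> = 9/10" using n p by (simp add: power_mult_distrib)
  finally have "\<mu> * (b\<^sup>2 / d) \<le> \<mu> * (9/10)" using mean_bounds(3) by (intro mult_left_mono) auto
  then show ?thesis unfolding params(5) by simp
qed

lemma l_pos: "0 < l" using l_ge mean_bounds(3) by linarith

lemma M2_params: "M2_r W = r" "M2_p W = 1 / (1 + \<theta>)" "M2_lambda W = l"
proof -
  have G: "Gamma2 W = coeff1 n p" "Gamma3 W = 2 * coeff2 n p" using Gamma2_W[OF p01] Gamma3_W[OF p01] W by simp_all
  show r: "M2_r W = r" unfolding M2_r_def G by (simp add: power_mult_distrib)
  show q: "M2_p W = 1 / (1 + \<theta>)" unfolding M2_p_def G using coeff_pos(1,2) by (simp add: field_simps)
  have "(1 - 1 / (1 + t)) / (1 / (1 + t)) = t" if "0 < t" for t :: real using that by (simp add: field_simps)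
  from this[OF params(2)]
  show "M2_lambda W = l" unfolding M2_lambda_def r q by (simp only: times_divide_eq_right[symmetric])
qed

lemma admissible: "M2_admissible W"
  unfolding M2_admissible_def M2_params using params(1,2) l_pos by simp

lemma pmf_M2: "pmf (M2_pmf W) k = fps_nth (pois_fps l * nb_fps r \<theta> 0) k"
  unfolding M2_pmf_def pmf_convolve M2_params pois_fps_pmf[OF l_pos] nb_fps_0[OF params(1,2)] by (simp add: mult.commute)

lemma var_eq: "S = \<mu> * (1 + b)" "S = l + r * \<theta> + r * \<theta>\<^sup>2"
proof -
  have S: "S = \<mu> + coeff1 n p" using var_W[OF p01, of n] Gamma2_W[OF p01, of n] W by simp
  show "S = \<mu> * (1 + b)" unfolding S using mean_bounds(3) by (simp add: field_simps)
  show "S = l + r * \<theta> + r * \<theta>\<^sup>2" unfolding S params(3) by simp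
qed

lemma var_ge: "X / 12 \<le> S" "1 \<le> S"
proof -
  show 1: "X / 12 \<le> S"
    using mean_bounds mult_left_mono[of 1 "1 + b" \<mu>] coeff_pos(3) unfolding var_eq(1) by linarith
  have "800 \<le> real n * p" using np K unfolding distrib_left by linarith
  then have "800 ^ 3 \<le> X" by (intro power_mono) auto
  then show "1 \<le> S" using 1 by simp
qed

lemma prob_triangle_count: "measure_pmf.prob W A = wmean n p (indicator A)"
  using expectation_triangle_count[OF p01, of n "indicator A"] W by simp

text \<open>From 1 - u >= exp(- 2 u) for u <= 1/2, with u = 12 p^2 and n p^2 <= K.\<close>

lemma one_minus_power_ge: "exp (- (24 * K)) \<le> (1 - 12 * p\<^sup>2) ^ n"
proof -
  let ?u = "12 * p\<^sup>2"
  have "p\<^sup>2 \<le> (1/600)\<^sup>2" using p by (intro power_mono) auto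
  then have u: "0 \<le> ?u" "?u \<le> 1/2" by (auto simp: power2_eq_square)
  have "1 \<le> (1 - ?u) * (1 + 2 * ?u)"
    using u mult_left_mono[of "?u" "1/2" "?u"] by (simp add: algebra_simps)
  also have "\<dots> \<le> (1 - ?u) * exp (2 * ?u)" using u exp_ge_add_one_self[of "2 * ?u"] by (intro mult_left_mono) auto
  finally have "exp (- (2 * ?u)) \<le> 1 - ?u" by (simp add: exp_minus divide_le_eq field_simps)
  then have "exp (- (2 * ?u)) ^ n \<le> (1 - ?u) ^ n" by (intro power_mono) auto
  moreover have "exp (- (24 * K)) \<le> exp (- (2 * ?u)) ^ n"
    using K by (simp add: exp_of_nat_mult[symmetric] mult_ac)
  ultimately show ?thesis by linarith
qed

lemma sum_diff_M2_le:
  assumes "finite A"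
  shows "\<bar>\<Sum>k\<in>A. pmf W k - pmf (M2_pmf W) k\<bar> \<le> negbin_tv_const K * (p / real n)"
proof -
  let ?e = "exp (- (24 * K)) / 2"
  let ?L = "?e * X"
  let ?E = "20 * KX * (K + 1) + KX\<^sup>2 * K"
  let ?F = "(6000 + 983040 * (1 + 4 * K)) / ?e\<^sup>2"
  have e: "0 < ?e" by simp
  have KX: "0 \<le> KX" using K by (simp add: cumulant_const_def)
  have X: "X = real n ^ 3 * p ^ 3" by (simp add: power_mult_distrib)
  have X0: "0 < X" using size_bounds(3) by linarith
  have L: "0 < ?L" using X0 by simp
  have Lle: "?L \<le> real ((n - 6) choose 3) * (2 * p) ^ 3 * (1 - 12 * p\<^sup>2) ^ n"
  proof -
    have n6: "2 \<le> n - 6" using n by simp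
    have "(9/10 * real n) ^ 3 \<le> (real n - 8) ^ 3" using n by (intro power_mono) auto
    then have "real n ^ 3 / 12 \<le> real ((n - 6) choose 3)"
      using choose_3_bounds(2)[OF n6] n by (simp add: power_mult_distrib power3_eq_cube of_nat_diff)
    then have "real n ^ 3 / 12 * (2 * p) ^ 3 * exp (- (24 * K)) \<le> real ((n - 6) choose 3) * (2 * p) ^ 3 * (1 - 12 * p\<^sup>2) ^ n"
      using p one_minus_power_ge by (intro mult_mono) auto
    \<comment> \<open>The cube of 2 against the 12 leaves 2/3, more than the 1/2 in
      \<open>?L\<close>.\<close>
    moreover have "?L \<le> real n ^ 3 / 12 * (2 * p) ^ 3 * exp (- (24 * K))"
      unfolding X using p by (simp add: power_mult_distrib)
    ultimately show ?thesis by linarith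
  qed
  have q: "0 \<le> p" "2 * p \<le> 1" "12 * p\<^sup>2 \<le> 1"
  proof -
    have "p\<^sup>2 \<le> (1/600)\<^sup>2" using p by (intro power_mono) auto
    then show "12 * p\<^sup>2 \<le> 1" by (simp add: power2_eq_square)
  qed (use p in auto)
  have R: "\<mu> * (excess n p * (20 * (x + 1))) + r * \<theta> ^ 4 \<le> X / 6 * (x\<^sup>2 * ?E)"
  proof -
    have "excess n p * (20 * (x + 1)) \<le> KX * x\<^sup>2 * (20 * (K + 1))"
      using excess_le excess_nonneg K size_bounds(1) KX by (intro mult_mono) auto
    moreover have "d\<^sup>2 / b \<le> KX\<^sup>2 * K * x\<^sup>2"
    proof -
      have "d\<^sup>2 / b \<le> (KX * x\<^sup>2)\<^sup>2 / x"
        using coeff1_bounds(1) coeff2_bounds(2) size_bounds(1) coeff_pos(4) by (intro frac_le power_mono) auto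
      also have "\<dots> = KX\<^sup>2 * x\<^sup>2 * x" using size_bounds(1) by (simp add: power2_eq_square)
      also have "\<dots> \<le> KX\<^sup>2 * x\<^sup>2 * K" using K by (intro mult_left_mono) auto
      finally show ?thesis by (simp add: mult_ac)
    qed
    ultimately have le: "excess n p * (20 * (x + 1)) + d\<^sup>2 / b \<le> x\<^sup>2 * ?E" by (simp add: algebra_simps)
    have "\<mu> * (excess n p * (20 * (x + 1))) + r * \<theta> ^ 4 = \<mu> * (excess n p * (20 * (x + 1)) + d\<^sup>2 / b)"
      unfolding params(6) by (simp only: distrib_left)
    also have "\<dots> \<le> \<mu> * (x\<^sup>2 * ?E)" using le mean_bounds(3) by (intro mult_left_mono) auto
    also have "\<dots> \<le> X / 6 * (x\<^sup>2 * ?E)" using mean_bounds(2) KX K by (intro mult_right_mono) auto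
    finally show ?thesis .
  qed
  have V: "6000 / ?L\<^sup>2 + 64 * (128 * real n ^ 3 * p ^ 3 * (1 + 4 * real n * p\<^sup>2) / ?L\<^sup>2) / l \<le> ?F / X\<^sup>2"
  proof -
    have "128 * real n ^ 3 * p ^ 3 * (1 + 4 * real n * p\<^sup>2) / ?L\<^sup>2 \<le> 128 * X * (1 + 4 * K) / ?L\<^sup>2"
    proof (rule divide_right_mono)
      have eq: "128 * real n ^ 3 * p ^ 3 = 128 * X" unfolding X by simp
      show "128 * real n ^ 3 * p ^ 3 * (1 + 4 * real n * p\<^sup>2) \<le> 128 * X * (1 + 4 * K)"
        unfolding eq by (rule mult_left_mono) (use K X0 in \<open>auto simp: mult.assoc\<close>)
    qed simp
    then have "64 * (128 * real n ^ 3 * p ^ 3 * (1 + 4 * real n * p\<^sup>2) / ?L\<^sup>2) \<le> 64 * (128 * X * (1 + 4 * K) / ?L\<^sup>2)"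
      by (intro mult_left_mono) auto
    moreover have "X / 120 \<le> l" using l_ge mean_bounds(1) by linarith
    ultimately have "64 * (128 * real n ^ 3 * p ^ 3 * (1 + 4 * real n * p\<^sup>2) / ?L\<^sup>2) / l
      \<le> 64 * (128 * X * (1 + 4 * K) / ?L\<^sup>2) / (X / 120)"
      using X0 K by (intro frac_le) auto
    also have "\<dots> = 983040 * (1 + 4 * K) / ?L\<^sup>2" using X0 by simp
    finally have "6000 / ?L\<^sup>2 + 64 * (128 * real n ^ 3 * p ^ 3 * (1 + 4 * real n * p\<^sup>2) / ?L\<^sup>2) / l \<le> 
       6000 / ?L\<^sup>2 + 983040 * (1 + 4 * K) / ?L\<^sup>2" by simp
    also have "\<dots> = ?F / X\<^sup>2"
      by (simp only: power_mult_distrib[of ?e X] add_divide_distrib divide_divide_eq_left)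
    finally show ?thesis .
  qed
  have "\<bar>wmean n p (indicator A) - (\<Sum>k\<in>A. fps_nth (pois_fps l * nb_fps r \<theta> 0) k)\<bar> \<le>
     (real (n choose 3) * p ^ 3 * (excess n p * (20 * (n * p\<^sup>2 + 1))) + r * \<theta> ^ 4) *
     (6000 / ?L\<^sup>2 + 64 * (128 * real n ^ 3 * p ^ 3 * (1 + 4 * real n * p\<^sup>2) / ?L\<^sup>2) / l)"
    by (rule interpolation'[OF q L Lle l_pos params(1,2) _ params(3)[symmetric] params(4)[symmetric] assms])
       (simp add: mean_eq)
  also have "\<dots> \<le> X / 6 * (x\<^sup>2 * ?E) * (?F / X\<^sup>2)"
    using R V X0 K KX l_pos p size_bounds(1) unfolding mean_eq[symmetric] by (intro mult_mono) auto
  also have "X / 6 * (x\<^sup>2 * ?E) * (?F / X\<^sup>2) = ?E * ?F * (x\<^sup>2 / X) / 6"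
  proof -
    have "u / 6 * (v * e) * (f / u\<^sup>2) = e * f * (v / u) / 6" if "0 < u" for u v e f :: real
      using that by (simp add: power2_eq_square mult_ac)
    from this[OF X0] show ?thesis .
  qed
  also have "x\<^sup>2 / X = p / real n"
    using p n by (simp add: X power2_eq_square power3_eq_cube field_simps)
  also have "?E * ?F * (p / real n) / 6 \<le> ?E * ?F * (p / real n)"
  proof -
    have "u / 6 \<le> u" if "0 \<le> u" for u :: real using that by simp
    moreover have "0 \<le> ?E * ?F * (p / real n)" using K KX p by simp
    ultimately show ?thesis by blast
  qed
  finally have "\<bar>wmean n p (indicator A) - (\<Sum>k\<in>A. pmf (M2_pmf W) k)\<bar> \<le> negbin_tv_const K * (p / real n)"
    unfolding pmf_M2 negbin_tv_const_def .
  then show ?thesis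
    using assms by (simp add: sum_subtractf measure_measure_pmf_finite[symmetric] prob_triangle_count)
qed

lemma dist_W_M2:
  "dTV (map_pmf int W) (map_pmf int (M2_pmf W)) \<le> negbin_tv_const K * (p / real n)"
  "dloc (map_pmf int W) (map_pmf int (M2_pmf W)) \<le> negbin_tv_const K * (p / real n)"
proof -
  have *: "\<bar>\<Sum>k\<in>A. pmf (map_pmf int W) k - pmf (map_pmf int (M2_pmf W)) k\<bar> \<le> negbin_tv_const K * (p / real n)" if "finite A" for A
    unfolding sum_map_int[OF that] using that by (intro sum_diff_M2_le) auto
  show "dTV (map_pmf int W) (map_pmf int (M2_pmf W)) \<le> negbin_tv_const K * (p / real n)"
    by (intro dTV_le *)
  show "dloc (map_pmf int W) (map_pmf int (M2_pmf W)) \<le> negbin_tv_const K * (p / real n)"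
  proof (rule dloc_le)
    fix a
    show "\<bar>pmf (map_pmf int W) a - pmf (map_pmf int (M2_pmf W)) a\<bar> \<le> negbin_tv_const K * (p / real n)"
      using *[of "{a}"] by simp
  qed
qed

lemma M2_normal:
  "\<bar>pmf (map_pmf int (M2_pmf W)) k - pmf (discretized_normal_pmf \<mu> S) k\<bar> \<le> normal_const K * (1 / (S + (of_int k - \<mu>)\<^sup>2))"
proof -
  let ?c = "1 / (120 * (1 + 3 * K))"
  let ?y = "of_int k - \<mu>"
  let ?a = "if 0 \<le> k then fps_nth (pois_fps l * nb_fps r \<theta> 0) (nat k) else 0"
  let ?g = "exp (- (?y\<^sup>2 / (2 * S))) / sqrt (2 * pi * S)"
  let ?Y = "pmf (discretized_normal_pmf \<mu> S) k"
  have S1: "1 \<le> S" by (rule var_ge)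
  have y0: "0 < S + ?y\<^sup>2" using S1 by (simp add: add_pos_nonneg)
  have c0: "0 < ?c" "?c \<le> 1/2" using K(1) by (auto simp: field_simps)
  have "b \<le> 3 * K" using coeff1_bounds(2) K(2) by linarith
  then have "S \<le> \<mu> * (1 + 3 * K)" unfolding var_eq(1) using mean_bounds(3) by (intro mult_left_mono) auto
  then have "12 * ?c * S \<le> 12 * ?c * (\<mu> * (1 + 3 * K))" using c0(1) by (intro mult_left_mono) auto
  also have "\<dots> = \<mu> / 10" using K(1) by (simp add: field_simps)
  finally have cS: "12 * ?c * S \<le> l" using l_ge by linarith
  have "\<bar>?a - ?g\<bar> * (S + ?y\<^sup>2) \<le> local_const (1 + 2 * \<theta>) ?c / ?c"
    using local_limit[OF l_pos params(1,2) var_eq(2) S1 c0 cS, of k] by simp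
  also have "\<dots> \<le> local_const (1 + 2 * (KX * K)) ?c / ?c"
    using \<theta>_le params(2) c0(1) by (intro divide_right_mono local_const_mono) auto
  also have "\<dots> = normal_const K - 37" unfolding normal_const_def by simp
  finally have 1: "\<bar>?a - ?g\<bar> * (S + ?y\<^sup>2) \<le> normal_const K - 37" .
  have "\<bar>?Y - ?g\<bar> \<le> 37 / (S + ?y\<^sup>2)" by (rule discretized_normal_approx[OF S1])
  then have 2: "\<bar>?Y - ?g\<bar> * (S + ?y\<^sup>2) \<le> 37" using y0 by (simp only: pos_le_divide_eq)
  have "\<bar>?a - ?Y\<bar> * (S + ?y\<^sup>2) \<le> (\<bar>?a - ?g\<bar> + \<bar>?Y - ?g\<bar>) * (S + ?y\<^sup>2)"
    using y0 by (intro mult_right_mono) auto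
  then have "\<bar>?a - ?Y\<bar> * (S + ?y\<^sup>2) \<le> normal_const K" using 1 2 unfolding distrib_right by linarith
  then have "\<bar>?a - ?Y\<bar> \<le> normal_const K / (S + ?y\<^sup>2)" using y0 by (simp only: pos_le_divide_eq)
  then show ?thesis unfolding pmf_map_int pmf_M2 by simp
qed

lemma normal_const_nonneg: "0 \<le> normal_const K"
  unfolding normal_const_def local_const_def cumulant_const_def using K(1)
  by (intro add_nonneg_nonneg mult_nonneg_nonneg divide_nonneg_nonneg) auto

lemma negbin_tv_const_nonneg: "0 \<le> negbin_tv_const K"
  unfolding negbin_tv_const_def cumulant_const_def using K(1)
  by (intro add_nonneg_nonneg mult_nonneg_nonneg divide_nonneg_nonneg) auto

text \<open>Lets the distance to \<open>M2_pmf W\<close> be absorbed into the normal error, which is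
  of order 1/X locally and 1 / sqrt X in total variation.\<close>

lemma edge_density_le: "p / real n \<le> K\<^sup>2 / X"
proof -
  have "x\<^sup>2 \<le> K\<^sup>2" using K(2) size_bounds(1) by (intro power_mono) auto
  then have "x\<^sup>2 / X \<le> K\<^sup>2 / X" using p by (intro divide_right_mono) auto
  moreover have "x\<^sup>2 / X = p / real n"
    using p n by (simp add: power_mult_distrib power2_eq_square power3_eq_cube field_simps)
  ultimately show ?thesis by simp
qed

lemma dloc_W_normal:
  "dloc (map_pmf int W) (discretized_normal_pmf \<mu> S) \<le> (negbin_tv_const K * K\<^sup>2 + 12 * normal_const K) * (1 / X)"
proof (rule dloc_le)
  fix a
  let ?W = "pmf (map_pmf int W) a" and ?M = "pmf (map_pmf int (M2_pmf W)) a" and ?Y = "pmf (discretized_normal_pmf \<mu> S) a"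
  have X0: "0 < X" using size_bounds(3) by linarith
  have "\<bar>?W - ?M\<bar> = \<bar>\<Sum>k\<in>{a}. pmf (map_pmf int W) k - pmf (map_pmf int (M2_pmf W)) k\<bar>" by simp
  also have "\<dots> \<le> negbin_tv_const K * (p / real n)"
    by (subst sum_map_int, simp, rule sum_diff_M2_le) simp
  also have "\<dots> \<le> negbin_tv_const K * (K\<^sup>2 / X)"
    by (intro mult_left_mono edge_density_le negbin_tv_const_nonneg)
  finally have 1: "\<bar>?W - ?M\<bar> \<le> negbin_tv_const K * (K\<^sup>2 / X)" .
  have "1 / (S + (of_int a - \<mu>)\<^sup>2) \<le> 1 / (X / 12)"
    using var_ge X0 by (intro divide_left_mono mult_pos_pos add_pos_nonneg add_increasing2) simp_all
  then have "normal_const K * (1 / (S + (of_int a - \<mu>)\<^sup>2)) \<le> normal_const K * (12 / X)"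
    using normal_const_nonneg by (intro mult_left_mono) auto
  with M2_normal[of a] have 2: "\<bar>?M - ?Y\<bar> \<le> normal_const K * (12 / X)" by linarith
  have "\<bar>?W - ?Y\<bar> \<le> negbin_tv_const K * (K\<^sup>2 / X) + normal_const K * (12 / X)" using 1 2 by linarith
  also have "\<dots> = (negbin_tv_const K * K\<^sup>2 + 12 * normal_const K) * (1 / X)"
  proof -
    have "t * (k / u) + d * (12 / u) = (t * k + 12 * d) * (1 / u)" for t k d u :: real
      by (simp add: add_divide_distrib)
    then show ?thesis .
  qed
  finally show "\<bar>?W - ?Y\<bar> \<le> \<dots>" .
qed

lemma dTV_W_normal:
  "dTV (map_pmf int W) (discretized_normal_pmf \<mu> S) \<le> (negbin_tv_const K * K\<^sup>2 + 96 * normal_const K) * (1 / sqrt X)"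
proof (rule dTV_le)
  fix A :: "int set" assume A: "finite A"
  let ?W = "pmf (map_pmf int W)" and ?M = "pmf (map_pmf int (M2_pmf W))" and ?Y = "pmf (discretized_normal_pmf \<mu> S)"
  have X1: "1 \<le> X" by (rule size_bounds)
  have sX: "0 < sqrt X" using X1 by (intro real_sqrt_gt_zero) linarith
  have "sqrt X * 1 \<le> sqrt X * sqrt X" using X1 p by (intro mult_left_mono) auto
  then have "1 / X \<le> 1 / sqrt X" using X1 sX by (intro frac_le) simp_all
  then have "K\<^sup>2 * (1 / X) \<le> K\<^sup>2 * (1 / sqrt X)" by (intro mult_left_mono) auto
  then have pn: "p / real n \<le> K\<^sup>2 * (1 / sqrt X)" using edge_density_le by simp
  have "\<bar>\<Sum>k\<in>A. ?W k - ?M k\<bar> \<le> negbin_tv_const K * (p / real n)"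
    unfolding sum_map_int[OF A] using A by (intro sum_diff_M2_le) auto
  also have "\<dots> \<le> negbin_tv_const K * (K\<^sup>2 * (1 / sqrt X))"
    by (intro mult_left_mono pn negbin_tv_const_nonneg)
  finally have 1: "\<bar>\<Sum>k\<in>A. ?W k - ?M k\<bar> \<le> negbin_tv_const K * (K\<^sup>2 * (1 / sqrt X))" .
  \<comment> \<open>16 instead of 12 puts a perfect square under the root, and 24 / sqrt S becomes
    96 / sqrt X.\<close>
  have "X \<le> 4\<^sup>2 * S" using var_ge X1 by simp
  then have "sqrt X \<le> 4 * sqrt S" using real_sqrt_le_mono[of X "4\<^sup>2 * S"] by (simp add: real_sqrt_mult)
  then have "24 / sqrt S \<le> 24 / (sqrt X / 4)" using sX by (intro frac_le) simp_all
  then have s: "24 / sqrt S \<le> 96 * (1 / sqrt X)" by simp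
  have "\<bar>\<Sum>k\<in>A. ?M k - ?Y k\<bar> \<le> (\<Sum>k\<in>A. normal_const K * (1 / (S + (of_int k - \<mu>)\<^sup>2)))"
    by (rule order_trans[OF sum_abs sum_mono[OF M2_normal]])
  also have "\<dots> = normal_const K * (\<Sum>k\<in>A. 1 / (S + (of_int k - \<mu>)\<^sup>2))" by (simp only: sum_distrib_left)
  also have "\<dots> \<le> normal_const K * (96 * (1 / sqrt X))"
    by (intro mult_left_mono order_trans[OF sum_cauchy_le s] var_ge A normal_const_nonneg)
  finally have 2: "\<bar>\<Sum>k\<in>A. ?M k - ?Y k\<bar> \<le> normal_const K * (96 * (1 / sqrt X))" .
  have "(\<Sum>k\<in>A. ?W k - ?Y k) = (\<Sum>k\<in>A. ?W k - ?M k) + (\<Sum>k\<in>A. ?M k - ?Y k)" by (simp add: sum_subtractf)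
  then have "\<bar>\<Sum>k\<in>A. ?W k - ?Y k\<bar> \<le> negbin_tv_const K * (K\<^sup>2 * (1 / sqrt X)) + normal_const K * (96 * (1 / sqrt X))"
    using 1 2 by linarith
  also have "\<dots> = (negbin_tv_const K * K\<^sup>2 + 96 * normal_const K) * (1 / sqrt X)"
  proof -
    have "t * (k * u) + d * (96 * u) = (t * k + 96 * d) * u" for t k d u :: real
      by (simp add: algebra_simps)
    then show ?thesis .
  qed
  finally show "\<bar>\<Sum>k\<in>A. ?W k - ?Y k\<bar> \<le> \<dots>" .
qed

lemma var_pos: "0 < S" using var_ge(2) by linarith

end

section \<open>From explicit bounds to the asymptotic statement\<close>

lemma one_le_power_mult_powr:
  assumes "1 \<le> n" "n \<le> N" "-3 \<le> e"
  shows "1 \<le> real N ^ 3 * real n powr e"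
proof -
  have n: "1 \<le> real n" "real n \<le> real N" using assms by auto
  have "1 = real n ^ 3 * real n powr (-3)"
    using n(1) by (simp add: powr_minus powr_numeral field_simps)
  also have "\<dots> \<le> real N ^ 3 * real n powr e"
    using n assms(3) by (intro mult_mono power_mono powr_mono) auto
  finally show ?thesis .
qed

lemma triples_0: "triples 0 = {}"
  by (auto simp: triples_def)

text \<open>At n = 0 the powers \<open>0 powr e\<close> are 0, so the claimed bounds are saved by
  the failure of both premises.\<close>

lemma triangle_count_degenerate:
  assumes "0 \<le> p" "p \<le> 1" "W = triangle_count_pmf 0 p"
  shows "\<not> M2_admissible W" "var W = 0"
proof -
  have "coeff1 0 p = 0" by (simp add: coeff1_def triples_0)
  then have G: "Gamma2 W = 0" using Gamma2_W[OF assms(1,2), of 0] assms(3) by simp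
  then show "\<not> M2_admissible W" by (simp add: M2_admissible_def M2_r_def)
  show "var W = 0" using var_W[OF assms(1,2), of 0] mean_W(1)[OF assms(1,2), of 0] G assms(3) by simp
qed

text \<open>n p^2 is about c^2 n^(1 - 2 \<alpha>), bounded because \<alpha> >= 1/2, and n p grows
  like n^(1 - \<alpha>) because \<alpha> < 1. A factor 2 of slack around c accounts for 4 c^2 and c
  / 2.\<close>

lemma eventually_triangle_regime:
  fixes p :: "nat \<Rightarrow> real" and \<alpha> c :: real
  assumes \<alpha>: "1/2 \<le> \<alpha>" "\<alpha> < 1" and c: "0 < c"
    and lim: "(\<lambda>n. real n powr \<alpha> * p n) \<longlonglongrightarrow> c"
  shows "\<forall>\<^sub>F n in sequentially. 1000 \<le> n \<and> 0 < p n \<and> p n \<le> 1/600 \<and> real n * (p n)\<^sup>2 \<le> 4 * c\<^sup>2 \<and>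
    800 * (4 * c\<^sup>2 + 1) \<le> real n * p n \<and> p n \<le> 2 * c * real n powr (-\<alpha>) \<and> c / 2 * real n powr (1 - \<alpha>) \<le> real n * p n"
proof -
  have "\<forall>\<^sub>F n in sequentially. c / 2 < real n powr \<alpha> * p n"
    using c by (intro order_tendstoD(1)[OF lim]) auto
  moreover have "\<forall>\<^sub>F n in sequentially. real n powr \<alpha> * p n < 2 * c"
    using c by (intro order_tendstoD(2)[OF lim]) auto
  moreover have "\<forall>\<^sub>F n in sequentially. real n powr (-\<alpha>) < 1 / (1200 * c)"
  proof -
    have "(\<lambda>n. real n powr (-\<alpha>)) \<longlonglongrightarrow> 0"
      using \<alpha> by (intro tendsto_neg_powr filterlim_real_sequentially) auto
    then show ?thesis using c by (intro order_tendstoD(2)) auto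
  qed
  moreover have "\<forall>\<^sub>F n in sequentially. real n powr (-(1 - \<alpha>)) < c / (1600 * (4 * c\<^sup>2 + 1))"
  proof -
    have "(\<lambda>n. real n powr (-(1 - \<alpha>))) \<longlonglongrightarrow> 0"
      using \<alpha> by (intro tendsto_neg_powr filterlim_real_sequentially) auto
    then show ?thesis using c by (intro order_tendstoD(2)) (auto intro!: divide_pos_pos add_nonneg_pos)
  qed
  moreover have "\<forall>\<^sub>F n in sequentially. 1000 \<le> n" by (rule eventually_ge_at_top)
  ultimately show ?thesis
  proof eventually_elim
    case (elim n)
    have n: "1 \<le> real n" using elim(5) by simp
    define u where "u = real n powr \<alpha> * p n"
    have u: "c / 2 < u" "u < 2 * c" using elim(1,2) by (simp_all add: u_def)
    have pu: "p n = u * real n powr (-\<alpha>)" using n by (simp add: u_def powr_minus)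
    have npu: "real n * p n = u * real n powr (1 - \<alpha>)" using n by (simp add: u_def powr_diff)
    have "0 < real n powr (-\<alpha>)" using n by simp
    then have p0: "0 < p n" unfolding pu using u c by (intro mult_pos_pos) auto
    have p2: "p n \<le> 2 * c * real n powr (-\<alpha>)" unfolding pu using u by (intro mult_right_mono) auto
    also have "\<dots> \<le> 2 * c * (1 / (1200 * c))" using elim(3) c by (intro mult_left_mono) auto
    finally have p1: "p n \<le> 1/600" using c by simp
    have np: "c / 2 * real n powr (1 - \<alpha>) \<le> real n * p n" unfolding npu using u by (intro mult_right_mono) auto
    have "1600 * (4 * c\<^sup>2 + 1) / c = 1 / (c / (1600 * (4 * c\<^sup>2 + 1)))" by simp
    also have "\<dots> \<le> 1 / real n powr (-(1 - \<alpha>))" using elim(4) n by (intro frac_le) simp_all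
    also have "\<dots> = real n powr (1 - \<alpha>)" using powr_minus_divide[of "real n" "-(1 - \<alpha>)"] by simp
    finally have el: "1600 * (4 * c\<^sup>2 + 1) / c \<le> real n powr (1 - \<alpha>)" .
    have "c / 2 * (1600 * (4 * c\<^sup>2 + 1) / c) \<le> c / 2 * real n powr (1 - \<alpha>)" using el c by (intro mult_left_mono) auto
    then have np8: "800 * (4 * c\<^sup>2 + 1) \<le> real n * p n" using np c by simp
    have "real n * (p n)\<^sup>2 \<le> real n * (2 * c * real n powr (-\<alpha>))\<^sup>2"
      using p0 p2 by (intro mult_left_mono power_mono) auto
    also have "\<dots> = 4 * c\<^sup>2 * real n powr (1 - 2 * \<alpha>)"
    proof -
      have "(real n powr (-\<alpha>))\<^sup>2 = real n powr (- 2 * \<alpha>)" using n by (simp add: powr_power)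
      moreover have "real n * real n powr (- 2 * \<alpha>) = real n powr (1 - 2 * \<alpha>)"
        using n powr_add[of "real n" 1 "- 2 * \<alpha>"] by simp
      ultimately show ?thesis by (simp add: power_mult_distrib)
    qed
    also have "\<dots> \<le> 4 * c\<^sup>2 * 1"
      using n \<alpha> powr_mono[of "1 - 2 * \<alpha>" 0 "real n"] by (intro mult_left_mono) auto
    finally have "real n * (p n)\<^sup>2 \<le> 4 * c\<^sup>2" by simp
    then show ?case using p0 p1 p2 np np8 elim(5) by blast
  qed
qed

text \<open>Each distance is bounded whenever its comparison law makes sense. That this is so for
  all large n is part of the claim, so the implications are not vacuous.\<close>

theorem theorem3p7:
  fixes p :: "nat \<Rightarrow> real" and \<alpha> c :: real and W :: "nat \<Rightarrow> nat pmf"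
  assumes p_prob: "\<And>n. 0 \<le> p n \<and> p n \<le> 1"
    and \<alpha>: "1/2 \<le> \<alpha>" "\<alpha> < 1"
    and c: "0 < c"
    and p_lim: "(\<lambda>n. real n powr \<alpha> * p n) \<longlonglongrightarrow> c"
    and W_def: "\<And>n. W n = triangle_count_pmf n (p n)"
  shows "(\<forall>\<^sub>F n in sequentially. M2_admissible (W n) \<and> 0 < var (W n)) \<and>
    (\<exists>C. \<forall>n.
      (M2_admissible (W n) \<longrightarrow>
         dTV (map_pmf int (W n)) (map_pmf int (M2_pmf (W n))) \<le> C * real n powr (-1 - \<alpha>) \<and>
         dloc (map_pmf int (W n)) (map_pmf int (M2_pmf (W n))) \<le> C * real n powr (-2 + \<alpha>)) \<and>
      (0 < var (W n) \<longrightarrow>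
         dTV (map_pmf int (W n)) (discretized_normal_pmf (mean (W n)) (var (W n)))
           \<le> C * real n powr (-3/2 + 3 * \<alpha> / 2) \<and>
         dloc (map_pmf int (W n)) (discretized_normal_pmf (mean (W n)) (var (W n)))
           \<le> C * real n powr (-3 + 3 * \<alpha>)))"
proof -
  define K where "K = 4 * c\<^sup>2"
  define u where "u = negbin_tv_const K * (2 * c)"
  define v where "v = (negbin_tv_const K * K\<^sup>2 + 96 * normal_const K) * (1 / sqrt ((c / 2) ^ 3))"
  define w where "w = (negbin_tv_const K * K\<^sup>2 + 12 * normal_const K) * (1 / (c / 2) ^ 3)"
  have K0: "0 \<le> K" by (simp add: K_def)
  obtain N where N: "\<And>n. N \<le> n \<Longrightarrow> 1000 \<le> n \<and> 0 < p n \<and> p n \<le> 1/600 \<and> real n * (p n)\<^sup>2 \<le> K \<and>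
    800 * (K + 1) \<le> real n * p n \<and> p n \<le> 2 * c * real n powr (-\<alpha>) \<and> c / 2 * real n powr (1 - \<alpha>) \<le> real n * p n"
    using eventually_triangle_regime[OF \<alpha> c p_lim] unfolding eventually_sequentially K_def by blast
  note T = N[THEN conjunct1] N[THEN conjunct2, THEN conjunct1] N[THEN conjunct2, THEN conjunct2, THEN conjunct1] K0
    N[THEN conjunct2, THEN conjunct2, THEN conjunct2, THEN conjunct1]
    N[THEN conjunct2, THEN conjunct2, THEN conjunct2, THEN conjunct2, THEN conjunct1]
  \<comment> \<open>u serves both distances to the convolution, v and w the total variation and
    local distances to the normal law, and the cube the finitely many n below
    \<open>N\<close>.\<close>
  let ?C = "\<bar>u\<bar> + \<bar>v\<bar> + \<bar>w\<bar> + real N ^ 3"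
  have C: "u \<le> ?C" "v \<le> ?C" "w \<le> ?C" "real N ^ 3 \<le> ?C" by (auto intro: add_increasing2)
  have large: "M2_admissible (W n) \<and> 0 < var (W n)" if "N \<le> n" for n
    using admissible[OF T W_def] var_pos[OF T W_def] that by simp
  have le_C: "a * s \<le> ?C * s" if "a \<le> ?C" "0 \<le> s" for a s
    using that by (rule mult_right_mono)
  have main: "dTV (map_pmf int (W n)) (map_pmf int (M2_pmf (W n))) \<le> ?C * real n powr (-1 - \<alpha>) \<and>
         dloc (map_pmf int (W n)) (map_pmf int (M2_pmf (W n))) \<le> ?C * real n powr (-2 + \<alpha>) \<and>
         dTV (map_pmf int (W n)) (discretized_normal_pmf (mean (W n)) (var (W n)))
           \<le> ?C * real n powr (-3/2 + 3 * \<alpha> / 2) \<and>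
         dloc (map_pmf int (W n)) (discretized_normal_pmf (mean (W n)) (var (W n)))
           \<le> ?C * real n powr (-3 + 3 * \<alpha>)" if "1 \<le> n" for n
  proof (cases "N \<le> n")
    case True
    note B = T(1)[OF True] T(2)[OF True] T(3)[OF True] K0 T(5)[OF True] T(6)[OF True]
    have n: "1 \<le> real n" using that by simp
    have nn: "0 \<le> negbin_tv_const K" "0 \<le> normal_const K"
      by (rule negbin_tv_const_nonneg[OF B W_def], rule normal_const_nonneg[OF B W_def])
    let ?X = "(real n * p n) ^ 3"
    let ?h = "(c / 2) ^ 3"
    have h: "0 < ?h" using c by simp
    have pn: "p n / real n \<le> 2 * c * real n powr (-1 - \<alpha>)"
    proof -
      have "p n / real n \<le> 2 * c * real n powr (-\<alpha>) / real n"
        using N[OF True] by (intro divide_right_mono) auto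
      also have "\<dots> = 2 * c * real n powr (-1 - \<alpha>)" using n by (simp add: powr_diff powr_minus field_simps)
      finally show ?thesis .
    qed
    have b1: "negbin_tv_const K * (p n / real n) \<le> ?C * real n powr (-1 - \<alpha>)"
    proof -
      have "negbin_tv_const K * (p n / real n) \<le> negbin_tv_const K * (2 * c * real n powr (-1 - \<alpha>))"
        using pn nn by (intro mult_left_mono) auto
      also have "\<dots> = u * real n powr (-1 - \<alpha>)" unfolding u_def by simp
      also have "\<dots> \<le> ?C * real n powr (-1 - \<alpha>)" by (rule le_C[OF C(1)]) simp
      finally show ?thesis .
    qed
    also have "\<dots> \<le> ?C * real n powr (-2 + \<alpha>)"
      using n \<alpha> by (intro mult_left_mono powr_mono) auto
    finally have b2: "negbin_tv_const K * (p n / real n) \<le> ?C * real n powr (-2 + \<alpha>)" .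
    have pw: "(c / 2 * real n powr (1 - \<alpha>)) ^ 3 = ?h * real n powr (3 - 3 * \<alpha>)"
    proof -
      have "(real n powr (1 - \<alpha>)) ^ 3 = real n powr (3 - 3 * \<alpha>)" using n by (simp add: powr_power algebra_simps)
      then show ?thesis by (simp only: power_mult_distrib)
    qed
    have X: "?h * real n powr (3 - 3 * \<alpha>) \<le> ?X"
      unfolding pw[symmetric] using N[OF True] c by (intro power_mono) auto
    have h0: "0 < ?h * real n powr (3 - 3 * \<alpha>)" using h n by (intro mult_pos_pos) auto
    have "1 / ?X \<le> 1 / (?h * real n powr (3 - 3 * \<alpha>))"
      using X h0 by (intro frac_le) auto
    also have "\<dots> = 1 / ?h * real n powr (-3 + 3 * \<alpha>)"
      using n powr_minus_divide[of "real n" "3 - 3 * \<alpha>"] by simp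
    finally have "(negbin_tv_const K * K\<^sup>2 + 12 * normal_const K) * (1 / ?X) \<le> 
       (negbin_tv_const K * K\<^sup>2 + 12 * normal_const K) * (1 / ?h * real n powr (-3 + 3 * \<alpha>))"
      using nn by (intro mult_left_mono) auto
    also have "\<dots> = w * real n powr (-3 + 3 * \<alpha>)" unfolding w_def by (simp only: mult.assoc)
    also have "\<dots> \<le> ?C * real n powr (-3 + 3 * \<alpha>)" by (rule le_C[OF C(3)]) simp
    finally have b3: "(negbin_tv_const K * K\<^sup>2 + 12 * normal_const K) * (1 / ?X) \<le> ?C * real n powr (-3 + 3 * \<alpha>)" .
    have "1 / sqrt ?X \<le> 1 / sqrt (?h * real n powr (3 - 3 * \<alpha>))"
      using X h0 by (intro frac_le real_sqrt_le_mono real_sqrt_gt_zero) simp_all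
    also have "\<dots> = 1 / sqrt ?h * real n powr (-3/2 + 3 * \<alpha> / 2)"
    proof -
      have "sqrt (real n powr (3 - 3 * \<alpha>)) = real n powr ((3 - 3 * \<alpha>) / 2)"
        by (simp add: powr_half_sqrt[symmetric] powr_powr)
      moreover have "-3/2 + 3 * \<alpha> / 2 = - ((3 - 3 * \<alpha>) / 2)" by (simp add: field_simps)
      ultimately show ?thesis by (simp only: real_sqrt_mult powr_minus_divide) simp
    qed
    finally have "(negbin_tv_const K * K\<^sup>2 + 96 * normal_const K) * (1 / sqrt ?X) \<le> 
       (negbin_tv_const K * K\<^sup>2 + 96 * normal_const K) * (1 / sqrt ?h * real n powr (-3/2 + 3 * \<alpha> / 2))"
      using nn by (intro mult_left_mono) auto
    also have "\<dots> = v * real n powr (-3/2 + 3 * \<alpha> / 2)" unfolding v_def by (simp only: mult.assoc)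
    also have "\<dots> \<le> ?C * real n powr (-3/2 + 3 * \<alpha> / 2)" by (rule le_C[OF C(2)]) simp
    finally have b4: "(negbin_tv_const K * K\<^sup>2 + 96 * normal_const K) * (1 / sqrt ?X) \<le> ?C * real n powr (-3/2 + 3 * \<alpha> / 2)" .
    show ?thesis
      using order_trans[OF dist_W_M2(1)[OF B W_def] b1] order_trans[OF dist_W_M2(2)[OF B W_def] b2]
        order_trans[OF dTV_W_normal[OF B W_def] b4] order_trans[OF dloc_W_normal[OF B W_def] b3] by blast
  next
    case False
    \<comment> \<open>Below \<open>N\<close> the trivial bound 1 on both distances is enough, as all
      four exponents are at least -3.\<close>
    have "1 \<le> ?C * real n powr e" if "-3 \<le> e" for e
    proof -
      have "1 \<le> real N ^ 3 * real n powr e" using False \<open>1 \<le> n\<close> that by (intro one_le_power_mult_powr) auto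
      also have "\<dots> \<le> ?C * real n powr e" by (rule le_C[OF C(4)]) simp
      finally show ?thesis .
    qed
    from order_trans[OF dTV_le_1 this] order_trans[OF dloc_le_1 this] show ?thesis using \<alpha> by simp
  qed
  show ?thesis
  proof (intro conjI exI[of _ ?C] allI)
    show "\<forall>\<^sub>F n in sequentially. M2_admissible (W n) \<and> 0 < var (W n)"
      unfolding eventually_sequentially using large by blast
  next
    fix n
    show "M2_admissible (W n) \<longrightarrow>
         dTV (map_pmf int (W n)) (map_pmf int (M2_pmf (W n))) \<le> ?C * real n powr (-1 - \<alpha>) \<and>
         dloc (map_pmf int (W n)) (map_pmf int (M2_pmf (W n))) \<le> ?C * real n powr (-2 + \<alpha>)"
      using main[of n] triangle_count_degenerate(1)[of "p 0" "W 0"] p_prob W_def by (cases "n = 0") auto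
    show "0 < var (W n) \<longrightarrow>
         dTV (map_pmf int (W n)) (discretized_normal_pmf (mean (W n)) (var (W n)))
           \<le> ?C * real n powr (-3/2 + 3 * \<alpha> / 2) \<and>
         dloc (map_pmf int (W n)) (discretized_normal_pmf (mean (W n)) (var (W n)))
           \<le> ?C * real n powr (-3 + 3 * \<alpha>)"
      using main[of n] triangle_count_degenerate(2)[of "p 0" "W 0"] p_prob W_def by (cases "n = 0") auto
  qed
qed

end
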